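(* The limit $p_0$ does not depend on $\mathbf y$. Furthermore, the local problem for $\mathbf u_1$ is the following: (for almost every $\mathbf x\in\Omega$) find $\mathbf u_1=\mathbf u_1(\mathbf x,\cdot)\in\mathbf H^1_p(Y_s)/\mathbb C^3$ such that $$q(\mathbf u_1(\mathbf x,\cdot),\mathbf w)=-\frac{\partial u^k}{\partial x_l}(\mathbf x)\int_{Y_s}a_{ijkl}\overline{\frac{\partial w^i}{\partial y_j}}\,d\mathbf y-p_0(\mathbf x)\int_{Y_s}\overline{\mathrm{div}_{\mathbf y}\mathbf w}\,d\mathbf y\qquad\forall\,\mathbf w\in\mathbf H^1_p(Y_s)/\mathbb C^3,$$ where $$q(\mathbf v,\mathbf w)=\int_{Y_s}a_{ijkl}\frac{\partial v^k}{\partial y_l}\overline{\frac{\partial w^i}{\partial y_j}}\,d\mathbf y=\int_{Y_s}a_{ijkl}\,e_{ij}(\mathbf v)\,e_{kl}(\overline{\mathbf w})\,d\mathbf y.$$ That is, $\mathbf u_1(\mathbf x,\cdot)$ satisfies this problem. This problem is uniquely solvable.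
   Context: All vector spaces are over $\mathbb{C}$; the Einstein summation convention is used. Geometry. $Y=(-\frac12,\frac12)^3=Y_s\cup Y_f\cup\Gamma$ (disjoint union), $Y_s$ (solid) and $Y_f$ (fluid) open, $\Gamma$ the smooth surface separating them. For $I\in\{s,f\}$, $\tilde Y_I=\bigcup_{\mathbf k\in\mathbb Z^3}\big((Y_I\cup(\overline{Y_I}\cap\partial Y))+\mathbf k\big)$, and $\tilde\Gamma$ is the $Y$-periodic extension of $\Gamma$. Assumptions: (i) $Y_s$, $Y_f$ have strictly positive measure; (ii) $\tilde Y_s,\tilde Y_f$ are open sets with $C^1$ boundary, locally on one side of their boundary, and $\tilde Y_s$ is connected (hence $\overline{Y_s}$ meets each face of $\overline Y$ in a set of strictly positive surface measure); (iii) $Y_s$ is open, connected, with locally Lipschitz boundary. $\Omega\subset\mathbb R^3$ is a smooth bounded open set, $0<\epsilon\ll1$, $\Omega_\epsilon^s=\Omega\cap\epsilon\tilde Y_s$ (connected), $\Omega_\epsilon^f=\Omega\cap\epsilon\tilde Y_f$, $\Gamma_\epsilon=\{\mathbf x\in\Omega:\mathbf x/\epsilon\in\tilde\Gamma\}$, with surface measure $d\sigma_\epsilon$. The jump $\llbracket\cdot\rrbracket_s^f$ is the trace on $\Gamma_\epsilon$ from $\Omega_\epsilon^f$ minus the trace from $\Omega_\epsilon^s$. Spaces. $V=\{\mathbf w\in H^1(\Omega_\epsilon^f\cup\Omega_\epsilon^s):\mathbf w|_{\partial\Omega}=\mathbf 0\}$ ($\mathbb C^3$-valued). $L^2_p(Y_o)$,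 $H^1_p(Y_o)$: $Y$-periodic functions that are $L^2$, resp. $H^1$, in $Y_o\subset Y$; $L^2_p=L^2_p(Y)$. Boldface denotes $\mathbb C^3$-valued versions. $\mathbf H^1_p(Y_s)/\mathbb C^3$: elements of $\mathbf H^1_p(Y_s)$ with zero mean over $Y_s$, normed by the $L^2(Y_s)$-norm of the gradient. $\mathscr K(\overline\Omega)$: continuous functions on $\overline\Omega$. For $\psi=\psi(\mathbf y)$, $\psi^\epsilon(\mathbf x)=\psi(\mathbf x/\epsilon)$. $e_{ij}(\mathbf w)=\frac12(\partial w^i/\partial y_j+\partial w^j/\partial y_i)$, $E_{ij}(\mathbf v)=\frac12(\partial v^i/\partial x_j+\partial v^j/\partial x_i)$. Data. $a_{ijkl}$ are constants with $a_{ijkl}=a_{jikl}=a_{ijlk}=a_{klij}$ and $a_{ijkl}\xi_{kl}\xi_{ij}\ge c\,\xi_{ij}\xi_{ij}$ for some $c>0$ and all $\xi_{ij}=\xi_{ji}$; $\mu,\eta\in\mathbb{R}$, $\mu>0$, $\eta/\mu>-\frac23$; $\rho^s,\rho^f>0$; $c_0>0$, $\gamma=c_0^2\rho^f$; $\alpha>0$. $\mathbf f\in L^2_{loc}(0,+\infty;\mathbf L^2(\Omega))$ is independent of $\epsilon$, $\|\mathbf f(t)\|^2_{\mathbf L^2(\Omega)}\le Ke^{mt}$ a.e. $t>0$ ($K>0$, $m\in\mathbb R$); $\hat{\mathbf f}=\hat{\mathbf f}(\lambda)$ is its Laplace transform. Solution. $\lambda\in\mathbb C$ is fixed with $\mathrm{Re}\,\lambda\ge\lambda_0>r>\max\{0,m/2\}$,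 and $\hat{\mathbf u}_\epsilon\in V$ is the unique solution of: for all $\mathbf w\in V$, $$\int_\Omega\hat{\mathbf f}\cdot\overline{\mathbf w}\,d\mathbf x=\lambda^2\int_{\Omega_\epsilon^s}\rho^s\hat{\mathbf u}_\epsilon\cdot\overline{\mathbf w}\,d\mathbf x+\lambda^2\int_{\Omega_\epsilon^f}\rho^f\hat{\mathbf u}_\epsilon\cdot\overline{\mathbf w}\,d\mathbf x+c^\epsilon(\hat{\mathbf u}_\epsilon,\mathbf w)+\lambda\epsilon^2b^\epsilon(\hat{\mathbf u}_\epsilon,\mathbf w)+\lambda\epsilon\int_{\Gamma_\epsilon}\alpha\llbracket\hat{\mathbf u}_\epsilon\rrbracket_s^f\cdot\overline{\llbracket\mathbf w\rrbracket_s^f}\,d\sigma_\epsilon,$$ with $b^\epsilon(\mathbf u,\mathbf v)=\int_{\Omega_\epsilon^f}[\eta(\nabla\cdot\mathbf u)(\overline{\nabla\cdot\mathbf v})+2\mu E_{ij}(\mathbf u)\overline{E_{ij}(\mathbf v)}]d\mathbf x$ and $c^\epsilon(\mathbf u,\mathbf v)=\int_{\Omega_\epsilon^s}a_{ijkl}E_{kl}(\mathbf u)\overline{E_{ij}(\mathbf v)}\,d\mathbf x+\int_{\Omega_\epsilon^f}\gamma(\nabla\cdot\mathbf u)(\overline{\nabla\cdot\mathbf v})\,d\mathbf x$. Derivatives of $\hat{\mathbf u}_\epsilon$ are taken in each phase separately; $\hat p_\epsilon=-\gamma\,\mathrm{div}\,\hat{\mathbf u}_\epsilon$ in $\Omega_\epsilon^f$.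 Two-scale limits. $\epsilon\downarrow0$ along a fixed subsequence for which, for all $\psi\in L^2_p$, $\phi\in\mathscr K(\overline\Omega)$, $1\le k,l\le3$, $$\int_\Omega\hat u^k_\epsilon\psi^\epsilon\phi\,d\mathbf x\to\int_{\Omega\times Y}w_0^k\psi\phi\,d\mathbf xd\mathbf y,\qquad\int_\Omega\epsilon\frac{\partial\hat u^k_\epsilon}{\partial x_l}\psi^\epsilon\phi\,d\mathbf x\to\int_{\Omega\times Y}\frac{\partial w_0^k}{\partial y_l}\psi\phi\,d\mathbf xd\mathbf y,$$ $$\int_{\Omega_\epsilon^s}\frac{\partial\hat u^k_\epsilon}{\partial x_l}\psi^\epsilon\phi\,d\mathbf x\to\int_{\Omega\times Y_s}\Big[\frac{\partial u^k}{\partial x_l}(\mathbf x)+\frac{\partial u_1^k}{\partial y_l}(\mathbf x,\mathbf y)\Big]\psi(\mathbf y)\phi(\mathbf x)\,d\mathbf xd\mathbf y,\qquad\int_{\Omega_\epsilon^f}\hat p_\epsilon\psi^\epsilon\phi\,d\mathbf x\to\int_{\Omega\times Y_f}p_0(\mathbf x,\mathbf y)\psi(\mathbf y)\phi(\mathbf x)\,d\mathbf xd\mathbf y,$$ with $\mathbf w_0\in\mathbf L^2(\Omega;\mathbf H^1_p(Y_s\cup Y_f))$, $\mathbf u\in\mathbf H^1_0(\Omega)$, $\mathbf u_1\in\mathbf L^2(\Omega;\mathbf H^1_p(Y_s)/\mathbb C^3)$, $p_0\in L^2(\Omega;L^2_p(Y_f))$, and $\mathbf w_0(\mathbf x,\mathbf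 y)=\mathbf u(\mathbf x)+\mathbf u_r(\mathbf x,\mathbf y)$ with $\mathbf u_r=0$ for $\mathbf y\in Y_s$ and $\mathrm{div}_{\mathbf y}\mathbf u_r=0$. Such subsequences exist. *)

theory Defs
  imports "HOL-Analysis.Analysis"
begin

type_synonym R3 = "real ^ 3"
type_synonym C3 = "complex ^ 3"

section \<open>Smooth functions, domains and surfaces\<close>

primrec Ck :: "nat \<Rightarrow> ('a::euclidean_space \<Rightarrow> 'b::real_normed_vector) \<Rightarrow> bool" where
  "Ck 0 f \<longleftrightarrow> continuous_on UNIV f"
| "Ck (Suc k) f \<longleftrightarrow> (\<forall>x. f differentiable (at x)) \<and>
     (\<forall>b\<in>Basis. Ck k (\<lambda>x. frechet_derivative f (at x) b))"

definition smooth :: "('a::euclidean_space \<Rightarrow> 'b::real_normed_vector) \<Rightarrow> bool" where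
  "smooth f \<longleftrightarrow> (\<forall>k. Ck k f)"

definition lipschitz :: "(real \<times> real \<Rightarrow> real) \<Rightarrow> bool" where
  "lipschitz g \<longleftrightarrow> (\<exists>L. L-lipschitz_on UNIV g)"

text \<open>Near each boundary point, and in suitable orthonormal coordinates, the set \<open>U\<close> is the
  strict subgraph of a function of the regularity class \<open>R\<close>.  In particular \<open>U\<close> lies locally on
  one side of its boundary.\<close>

definition graph_boundary :: "((real \<times> real \<Rightarrow> real) \<Rightarrow> bool) \<Rightarrow> R3 set \<Rightarrow> bool" where
  "graph_boundary R U \<longleftrightarrow>
     (\<forall>x\<in>frontier U. \<exists>(T :: R3 \<Rightarrow> R3) (g :: real \<times> real \<Rightarrow> real) r.
        orthogonal_transformation T \<and> R g \<and> r > 0 \<and>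
        (\<forall>y\<in>ball x r. y \<in> U \<longleftrightarrow> T (y - x) $ 3 < g (T (y - x) $ 1, T (y - x) $ 2)))"

definition smooth_surface :: "R3 set \<Rightarrow> bool" where
  "smooth_surface S \<longleftrightarrow>
     (\<forall>x\<in>S. \<exists>(T :: R3 \<Rightarrow> R3) (g :: real \<times> real \<Rightarrow> real) r.
        orthogonal_transformation T \<and> smooth g \<and> r > 0 \<and>
        (\<forall>y\<in>ball x r. y \<in> S \<longleftrightarrow> T (y - x) $ 3 = g (T (y - x) $ 1, T (y - x) $ 2)))"

text \<open>Surface measure is the two-dimensional Hausdorff measure on \<open>\<real>\<^sup>3\<close>, normalised so
  that it agrees with area on planes.\<close>

definition hausdorff2_outer :: "R3 set \<Rightarrow> ennreal" where
  "hausdorff2_outer A = (SUP \<delta>\<in>{0<..}.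
     INF C\<in>{C :: nat \<Rightarrow> R3 set. A \<subseteq> (\<Union>i. C i) \<and> (\<forall>i. bounded (C i) \<and> diameter (C i) \<le> \<delta>)}.
       (\<Sum>i. ennreal (pi / 4 * (diameter (C i))\<^sup>2)))"

definition surf :: "R3 measure" where
  "surf = measure_of UNIV (sets borel) hausdorff2_outer"

section \<open>Lebesgue and Sobolev spaces\<close>

text \<open>Elements of function spaces are represented by functions.\<close>

definition L2 :: "'a measure \<Rightarrow> 'a set \<Rightarrow> ('a \<Rightarrow> 'b::{real_normed_vector,second_countable_topology}) \<Rightarrow> bool"
  where "L2 M U f \<longleftrightarrow> set_borel_measurable M U f \<and> set_integrable M U (\<lambda>x. (norm (f x))\<^sup>2)"

definition L1_loc :: "R3 set \<Rightarrow> (R3 \<Rightarrow> complex) \<Rightarrow> bool" where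
  "L1_loc U f \<longleftrightarrow> (\<forall>K. compact K \<and> K \<subseteq> U \<longrightarrow> set_integrable lebesgue K f)"

definition test_fun :: "R3 set \<Rightarrow> (R3 \<Rightarrow> complex) \<Rightarrow> bool" where
  "test_fun U \<phi> \<longleftrightarrow> smooth \<phi> \<and> compact (closure {x. \<phi> x \<noteq> 0}) \<and> closure {x. \<phi> x \<noteq> 0} \<subseteq> U"

definition has_weak_pd :: "R3 set \<Rightarrow> 3 \<Rightarrow> (R3 \<Rightarrow> complex) \<Rightarrow> (R3 \<Rightarrow> complex) \<Rightarrow> bool" where
  "has_weak_pd U l f g \<longleftrightarrow> L1_loc U f \<and> L1_loc U g \<and>
     (\<forall>\<phi>. test_fun U \<phi> \<longrightarrow>
        (LINT x:U|lebesgue. f x * frechet_derivative \<phi> (at x) (axis l 1))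
        = - (LINT x:U|lebesgue. g x * \<phi> x))"

text \<open>The weak derivative is determined up to a null set of \<open>U\<close>; one representative is picked.\<close>

definition weak_pd :: "R3 set \<Rightarrow> 3 \<Rightarrow> (R3 \<Rightarrow> complex) \<Rightarrow> R3 \<Rightarrow> complex" where
  "weak_pd U l f = (SOME g. has_weak_pd U l f g)"

definition H1 :: "R3 set \<Rightarrow> (R3 \<Rightarrow> complex) \<Rightarrow> bool" where
  "H1 U f \<longleftrightarrow> L2 lebesgue U f \<and> (\<forall>l. \<exists>g. has_weak_pd U l f g \<and> L2 lebesgue U g)"

definition L2_tendsto ::
    "'a measure \<Rightarrow> 'a set \<Rightarrow> (nat \<Rightarrow> 'a \<Rightarrow> complex) \<Rightarrow> ('a \<Rightarrow> complex) \<Rightarrow> bool" where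
  "L2_tendsto M U F f \<longleftrightarrow>
     (\<lambda>n. \<integral>\<^sup>+x\<in>U. ennreal ((cmod (F n x - f x))\<^sup>2) \<partial>M) \<longlonglongrightarrow> 0"

definition H1_tendsto :: "R3 set \<Rightarrow> (nat \<Rightarrow> R3 \<Rightarrow> complex) \<Rightarrow> (R3 \<Rightarrow> complex) \<Rightarrow> bool" where
  "H1_tendsto U F f \<longleftrightarrow> (\<forall>n. H1 U (F n)) \<and> H1 U f \<and> L2_tendsto lebesgue U F f \<and>
     (\<forall>l. L2_tendsto lebesgue U (\<lambda>n. weak_pd U l (F n)) (weak_pd U l f))"

definition H10 :: "R3 set \<Rightarrow> (R3 \<Rightarrow> complex) \<Rightarrow> bool" where
  "H10 U f \<longleftrightarrow> (\<exists>F. (\<forall>n. test_fun U (F n)) \<and> H1_tendsto U F f)"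

text \<open>The trace on \<open>S \<subseteq> \<partial>U\<close> of \<open>f \<in> H\<^sup>1(U)\<close>, as extension by continuity of the restriction of
  functions that are smooth up to the boundary: \<open>g\<close> is the \<open>L\<^sup>2(S)\<close>-limit of the restrictions
  to \<open>S\<close> of smooth functions converging to \<open>f\<close> in \<open>H\<^sup>1(U)\<close>.\<close>

definition has_trace :: "R3 set \<Rightarrow> R3 set \<Rightarrow> (R3 \<Rightarrow> complex) \<Rightarrow> (R3 \<Rightarrow> complex) \<Rightarrow> bool" where
  "has_trace U S f g \<longleftrightarrow> L2 surf S g \<and>
     (\<exists>F. (\<forall>n. smooth (F n)) \<and> H1_tendsto U F f \<and> L2_tendsto surf S F g)"

text \<open>Derivatives of vector fields: \<open>pdv U w i j\<close> is the derivative of the \<open>i\<close>-th component in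
  direction \<open>j\<close>.\<close>

definition pdv :: "R3 set \<Rightarrow> (R3 \<Rightarrow> C3) \<Rightarrow> 3 \<Rightarrow> 3 \<Rightarrow> R3 \<Rightarrow> complex" where
  "pdv U w i j = weak_pd U j (\<lambda>x. w x $ i)"

definition dvg :: "R3 set \<Rightarrow> (R3 \<Rightarrow> C3) \<Rightarrow> R3 \<Rightarrow> complex" where
  "dvg U w x = (\<Sum>i\<in>UNIV. pdv U w i i x)"

definition strain :: "R3 set \<Rightarrow> (R3 \<Rightarrow> C3) \<Rightarrow> 3 \<Rightarrow> 3 \<Rightarrow> R3 \<Rightarrow> complex" where
  "strain U w i j x = (pdv U w i j x + pdv U w j i x) / 2"

definition cdot :: "C3 \<Rightarrow> C3 \<Rightarrow> complex" where
  "cdot u w = (\<Sum>i\<in>UNIV. u $ i * cnj (w $ i))"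

definition cnj_field :: "(R3 \<Rightarrow> C3) \<Rightarrow> R3 \<Rightarrow> C3" where
  "cnj_field w y = (\<chi> i. cnj (w y $ i))"

section \<open>The periodic cell\<close>

definition cell :: "R3 set" where
  "cell = box (\<chi> i. - 1 / 2) (\<chi> i. 1 / 2)"

definition lattice3 :: "R3 set" where
  "lattice3 = {k. \<forall>i. k $ i \<in> \<int>}"

definition per_ext :: "R3 set \<Rightarrow> R3 set" where
  "per_ext A = (\<Union>k\<in>lattice3. (\<lambda>y. y + k) ` (A \<union> (closure A \<inter> frontier cell)))"

definition per_surf :: "R3 set \<Rightarrow> R3 set" where
  "per_surf S = (\<Union>k\<in>lattice3. (\<lambda>y. y + k) ` S)"

definition cell_geometry :: "R3 set \<Rightarrow> R3 set \<Rightarrow> R3 set \<Rightarrow> bool" where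
  "cell_geometry Ys Yf Gam \<longleftrightarrow>
     cell = Ys \<union> Yf \<union> Gam \<and> Ys \<inter> Yf = {} \<and> Ys \<inter> Gam = {} \<and> Yf \<inter> Gam = {} \<and>
     open Ys \<and> open Yf \<and>
     smooth_surface Gam \<and> Gam = cell \<inter> frontier Ys \<and> Gam = cell \<inter> frontier Yf \<and>
     emeasure lebesgue Ys > 0 \<and> emeasure lebesgue Yf > 0 \<and>
     open (per_ext Ys) \<and> graph_boundary (Ck 1) (per_ext Ys) \<and>
     open (per_ext Yf) \<and> graph_boundary (Ck 1) (per_ext Yf) \<and>
     connected (per_ext Ys) \<and>
     connected Ys \<and> graph_boundary lipschitz Ys"

definition periodic :: "(R3 \<Rightarrow> 'b) \<Rightarrow> bool" where
  "periodic f \<longleftrightarrow> (\<forall>k\<in>lattice3. \<forall>y. f (y + k) = f y)"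

definition L2p :: "R3 set \<Rightarrow> (R3 \<Rightarrow> complex) \<Rightarrow> bool" where
  "L2p Yo f \<longleftrightarrow> periodic f \<and> L2 lebesgue Yo f"

text \<open>The weak derivatives of elements of \<open>H\<^sup>1\<^sub>p(Yo)\<close> are those on the periodic extension of \<open>Yo\<close>,
  so that there is no jump across the faces of the cell.\<close>

definition H1p :: "R3 set \<Rightarrow> (R3 \<Rightarrow> complex) \<Rightarrow> bool" where
  "H1p Yo f \<longleftrightarrow> L2p Yo f \<and> (\<forall>l. \<exists>g. has_weak_pd (per_ext Yo) l f g \<and> L2 lebesgue Yo g)"

definition H1p_vec :: "R3 set \<Rightarrow> (R3 \<Rightarrow> C3) \<Rightarrow> bool" where
  "H1p_vec Yo w \<longleftrightarrow> (\<forall>i. H1p Yo (\<lambda>y. w y $ i))"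

definition H1p_mod :: "R3 set \<Rightarrow> (R3 \<Rightarrow> C3) \<Rightarrow> bool" where
  "H1p_mod Yo w \<longleftrightarrow> H1p_vec Yo w \<and> (\<forall>i. (LINT y:Yo|lebesgue. w y $ i) = 0)"

definition L2_L2p :: "R3 set \<Rightarrow> R3 set \<Rightarrow> (R3 \<Rightarrow> R3 \<Rightarrow> complex) \<Rightarrow> bool" where
  "L2_L2p \<Omega> Yo f \<longleftrightarrow> L2 lebesgue (\<Omega> \<times> Yo) (\<lambda>(x, y). f x y) \<and>
     (AE x in lebesgue. x \<in> \<Omega> \<longrightarrow> L2p Yo (f x))"

text \<open>\<open>L\<^sup>2(\<Omega>; H\<^sup>1\<^sub>p(Yo))\<close>, the derivatives in \<open>y\<close> having jointly measurable representatives.\<close>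

definition L2_H1p :: "R3 set \<Rightarrow> R3 set \<Rightarrow> (R3 \<Rightarrow> R3 \<Rightarrow> complex) \<Rightarrow> bool" where
  "L2_H1p \<Omega> Yo f \<longleftrightarrow> L2_L2p \<Omega> Yo f \<and>
     (AE x in lebesgue. x \<in> \<Omega> \<longrightarrow> H1p Yo (f x)) \<and>
     (\<forall>l. \<exists>G. L2 lebesgue (\<Omega> \<times> Yo) (\<lambda>(x, y). G x y) \<and>
        (AE x in lebesgue. x \<in> \<Omega> \<longrightarrow> has_weak_pd (per_ext Yo) l (f x) (G x)))"

definition elasticity_tensor :: "(3 \<Rightarrow> 3 \<Rightarrow> 3 \<Rightarrow> 3 \<Rightarrow> real) \<Rightarrow> bool" where
  "elasticity_tensor a \<longleftrightarrow>
     (\<forall>i j k l. a i j k l = a j i k l \<and> a i j k l = a i j l k \<and> a i j k l = a k l i j) \<and>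
     (\<exists>c>0. \<forall>\<xi> :: 3 \<Rightarrow> 3 \<Rightarrow> real. (\<forall>i j. \<xi> i j = \<xi> j i) \<longrightarrow>
        (\<Sum>i\<in>UNIV. \<Sum>j\<in>UNIV. \<Sum>k\<in>UNIV. \<Sum>l\<in>UNIV. a i j k l * \<xi> k l * \<xi> i j)
          \<ge> c * (\<Sum>i\<in>UNIV. \<Sum>j\<in>UNIV. \<xi> i j * \<xi> i j))"

section \<open>The problem at scale \<open>\<epsilon>\<close>\<close>

definition phase :: "R3 set \<Rightarrow> R3 set \<Rightarrow> real \<Rightarrow> R3 set" where
  "phase \<Omega> YI e = \<Omega> \<inter> (\<lambda>y. e *\<^sub>R y) ` per_ext YI"

definition interface :: "R3 set \<Rightarrow> R3 set \<Rightarrow> real \<Rightarrow> R3 set" where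
  "interface \<Omega> Gam e = {x \<in> \<Omega>. (1 / e) *\<^sub>R x \<in> per_surf Gam}"

text \<open>In the following, \<open>Us\<close> and \<open>Uf\<close> are the solid and the fluid part of \<open>\<Omega>\<close>.  The condition on
  \<open>\<partial>\<Omega>\<close> is imposed from each phase on the part of \<open>\<partial>\<Omega>\<close> that the phase touches.\<close>

definition V_space :: "R3 set \<Rightarrow> R3 set \<Rightarrow> R3 set \<Rightarrow> (R3 \<Rightarrow> C3) set" where
  "V_space \<Omega> Us Uf = {w. \<forall>i. H1 (Uf \<union> Us) (\<lambda>x. w x $ i) \<and>
     has_trace Us (frontier \<Omega> \<inter> closure Us) (\<lambda>x. w x $ i) (\<lambda>_. 0) \<and>
     has_trace Uf (frontier \<Omega> \<inter> closure Uf) (\<lambda>x. w x $ i) (\<lambda>_. 0)}"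

definition has_jump :: "R3 set \<Rightarrow> R3 set \<Rightarrow> R3 set \<Rightarrow> (R3 \<Rightarrow> C3) \<Rightarrow> (R3 \<Rightarrow> C3) \<Rightarrow> bool" where
  "has_jump Us Uf S w J \<longleftrightarrow> (\<exists>gf gs :: R3 \<Rightarrow> C3.
     (\<forall>i. has_trace Uf S (\<lambda>x. w x $ i) (\<lambda>x. gf x $ i) \<and>
          has_trace Us S (\<lambda>x. w x $ i) (\<lambda>x. gs x $ i)) \<and>
     (\<forall>x\<in>S. J x = gf x - gs x))"

definition b_form ::
  "R3 set \<Rightarrow> R3 set \<Rightarrow> real \<Rightarrow> real \<Rightarrow> (R3 \<Rightarrow> C3) \<Rightarrow> (R3 \<Rightarrow> C3) \<Rightarrow> complex" where
  "b_form Us Uf \<eta> \<mu> u v =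
     (LINT x:Uf|lebesgue. of_real \<eta> * dvg (Uf \<union> Us) u x * cnj (dvg (Uf \<union> Us) v x) +
        2 * of_real \<mu> * (\<Sum>i\<in>UNIV. \<Sum>j\<in>UNIV.
          strain (Uf \<union> Us) u i j x * cnj (strain (Uf \<union> Us) v i j x)))"

definition c_form ::
  "R3 set \<Rightarrow> R3 set \<Rightarrow> (3 \<Rightarrow> 3 \<Rightarrow> 3 \<Rightarrow> 3 \<Rightarrow> real) \<Rightarrow> real \<Rightarrow> (R3 \<Rightarrow> C3) \<Rightarrow> (R3 \<Rightarrow> C3) \<Rightarrow> complex" where
  "c_form Us Uf a \<gamma> u v =
     (LINT x:Us|lebesgue. (\<Sum>i\<in>UNIV. \<Sum>j\<in>UNIV. \<Sum>k\<in>UNIV. \<Sum>l\<in>UNIV. of_real (a i j k l) *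
        strain (Uf \<union> Us) u k l x * cnj (strain (Uf \<union> Us) v i j x))) +
     (LINT x:Uf|lebesgue. of_real \<gamma> * dvg (Uf \<union> Us) u x * cnj (dvg (Uf \<union> Us) v x))"

text \<open>\<open>u\<close> solves the variational problem with right-hand side \<open>F\<close>.  Jumps are defined up to
  null sets of the interface \<open>S\<close>; all their representatives give the same surface integral.
  By the trace theorem every element of \<open>V_space\<close> has a jump.\<close>

definition eps_solution where
  "eps_solution \<Omega> Us Uf S a \<mu> \<eta> \<rho>s \<rho>f \<gamma> \<alpha> e (lam :: complex) F u \<longleftrightarrow>
     u \<in> V_space \<Omega> Us Uf \<and>
     (\<exists>J. has_jump Us Uf S u J \<and>
       (\<forall>w\<in>V_space \<Omega> Us Uf. \<forall>Jw. has_jump Us Uf S w Jw \<longrightarrow>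
         (LINT x:\<Omega>|lebesgue. cdot (F x) (w x)) =
           lam\<^sup>2 * (LINT x:Us|lebesgue. of_real \<rho>s * cdot (u x) (w x)) +
           lam\<^sup>2 * (LINT x:Uf|lebesgue. of_real \<rho>f * cdot (u x) (w x)) +
           c_form Us Uf a \<gamma> u w +
           lam * of_real (e\<^sup>2) * b_form Us Uf \<eta> \<mu> u w +
           lam * of_real e * (LINT x:S|surf. of_real \<alpha> * cdot (J x) (Jw x))))"

text \<open>The Bochner integral in \<open>L\<^sup>2(\<Omega>)\<close> defining the Laplace transform, evaluated pointwise.\<close>

definition laplace :: "(real \<Rightarrow> R3 \<Rightarrow> C3) \<Rightarrow> complex \<Rightarrow> R3 \<Rightarrow> C3" where
  "laplace f lam x = (LINT t:{0<..}|lebesgue. exp (- lam * of_real t) *s f t x)"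

section \<open>The local problem\<close>

definition q_form :: "R3 set \<Rightarrow> (3 \<Rightarrow> 3 \<Rightarrow> 3 \<Rightarrow> 3 \<Rightarrow> real) \<Rightarrow> (R3 \<Rightarrow> C3) \<Rightarrow> (R3 \<Rightarrow> C3) \<Rightarrow> complex" where
  "q_form Ys a v w = (LINT y:Ys|lebesgue.
     (\<Sum>i\<in>UNIV. \<Sum>j\<in>UNIV. \<Sum>k\<in>UNIV. \<Sum>l\<in>UNIV. of_real (a i j k l) *
        pdv (per_ext Ys) v k l y * cnj (pdv (per_ext Ys) w i j y)))"

text \<open>\<open>D k l\<close> stands for \<open>\<partial>u\<^sup>k/\<partial>x\<^sub>l(x)\<close> and \<open>p\<close> for \<open>p\<^sub>0(x)\<close> at a fixed \<open>x\<close>.\<close>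

definition local_solution ::
  "R3 set \<Rightarrow> (3 \<Rightarrow> 3 \<Rightarrow> 3 \<Rightarrow> 3 \<Rightarrow> real) \<Rightarrow> (3 \<Rightarrow> 3 \<Rightarrow> complex) \<Rightarrow> complex \<Rightarrow> (R3 \<Rightarrow> C3) \<Rightarrow> bool" where
  "local_solution Ys a D p v \<longleftrightarrow> H1p_mod Ys v \<and>
     (\<forall>w. H1p_mod Ys w \<longrightarrow>
        q_form Ys a v w =
          - (\<Sum>k\<in>UNIV. \<Sum>l\<in>UNIV. D k l *
               (LINT y:Ys|lebesgue. (\<Sum>i\<in>UNIV. \<Sum>j\<in>UNIV.
                  of_real (a i j k l) * cnj (pdv (per_ext Ys) w i j y))))
          - p * (LINT y:Ys|lebesgue. cnj (dvg (per_ext Ys) w y)))"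

end

theory Submission imports Defs begin

text \<open>Testing with \<open>\<epsilon> \<phi>(x) \<theta>(x/\<epsilon>)\<close> times a basis vector in one phase and \<open>0\<close> in the other gives, as
\<open>\<epsilon> \<rightarrow> 0\<close>, the weak form of the cell equations. Such a field jumps across the interface; the surface
integral is nevertheless negligible, because the energy identity bounds \<open>\<epsilon> \<integral> |J|\<^sup>2\<close> and the area of
the interface is \<open>O(1/\<epsilon>)\<close>.

In the fluid the result is \<open>\<integral> p\<^sub>0 \<partial>\<^sub>i\<theta> = 0\<close> for all smooth periodic \<open>\<theta>\<close>, including those that do not vanish
on the interface. The extension of \<open>p\<^sub>0(x, \<cdot>)\<close> by \<open>0\<close> to the cell therefore has zero gradient, so it is
constant, and the constant is \<open>0\<close> since the solid has positive measure: \<open>P = 0\<close> is the required limit.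
In the solid the result is the local problem tested with smooth functions. Density in \<open>H\<^sup>1\<^sub>p\<close> follows from the
graph condition on the boundary, by translating into the domain and mollifying; only countably many test
functions are needed, so they can be fixed before the null set of \<open>x\<close>.

Two solutions differ by a periodic field with vanishing strain on a connected domain; such a field is
constant, and its mean is zero.\<close>

text \<open>Density is used in dual form only. If the fields \<open>\<sigma> j\<close> annihilate
  the derivatives of all bumps, Fubini moves the mollification of a Sobolev function onto the
  kernel, where the annihilation applies; what remains is the weak convergence of mollifications
  against square integrable functions. For this reason one explicit family of bumps, symmetric in
  point and centre and stable under translation, serves as test functions, mollifiers and cut-offs,
  and its periodisations serve as test functions on the cell. The factor eps of the test field
  offsets the 1/eps produced by differentiating theta(x/eps): its gradient has order one, while
  force and inertia see a field of order eps. Of the factor eps^2 of the viscous form, one eps turns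
  the gradient of the solution into the convergent quantity eps grad u, and the other tends to 0.
  Weak derivatives are representatives chosen arbitrarily, so every identity between them holds only
  almost everywhere; and the Fubini theorem concerns Borel measures, whereas all integrals here are
  over their completions.\<close>

abbreviation (input) sum_all :: "('i => 'a) => 'a::comm_monoid_add" (binder "\<Sigma>" 10)
 where "sum_all f \<equiv> sum f UNIV"

abbreviation (input) lebesgue_measure :: "'a::euclidean_space measure" ("\<L>") where "\<L> \<equiv> lebesgue"

lemmas integrable_dominated = Bochner_Integration.integrable_bound
lemmas L2_defs = L2_def set_borel_measurable_def set_integrable_def

section \<open>Differentiable functions of finite order\<close>

lemma Ck_continuous: "Ck k f ==> continuous_on UNIV f"
proof (cases k)
 case (Suc n)
 moreover assume "Ck k f"
 ultimately have "f differentiable_on UNIV"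
  by (simp add: differentiable_on_def)
 then show ?thesis by (rule differentiable_imp_continuous_on)
qed simp

lemma Ck_Suc_imp: "Ck (Suc k) f ==> Ck k f"
proof (induction k arbitrary: f)
 case 0
 then show ?case using Ck_continuous[of "Suc 0" f] by (simp only: Ck.simps(1))
next
 case (Suc k)
 then show ?case by auto
qed

text \<open>\<open>Ck\<close> speaks of functions on the whole space. This locality principle is
  what allows functions given by cases, or by locally finite sums, to be recognised as
  smooth.\<close>

lemma Ck_local:
 assumes "\<And>x. \<exists>V g. open V \<and> x \<in> V \<and> Ck k g \<and> (\<forall>y\<in>V. f y = g y)"
 shows "Ck k f"
 using assms
proof (induction k arbitrary: f)
 case 0
 have "isCont f x" for x
 proof -
  obtain V g where V: "open V" "x \<in> V" "continuous_on UNIV g" "\<forall>y\<in>V. f y = g y"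
   using 0[of x] by auto
  then have "isCont g x" by (simp add: continuous_on_eq_continuous_at)
  moreover have "eventually (\<lambda>y. f y = g y) (nhds x)"
   using V eventually_nhds by blast
  ultimately show ?thesis by (simp add: isCont_cong)
 qed
 then show ?case by (simp add: continuous_at_imp_continuous_on)
next
 case (Suc k)
 have *: "(f has_derivative frechet_derivative g (at y)) (at y)"
  if "open V" "Ck (Suc k) g" "\<forall>y\<in>V. f y = g y" "y \<in> V" for V g y
 proof -
  have "(g has_derivative frechet_derivative g (at y)) (at y)"
   using that by (simp add: frechet_derivative_works)
  then show ?thesis
   using has_derivative_transform_within_open[of g _ y UNIV V f] that by auto
 qed
 show ?case
  unfolding Ck.simps
 proof (intro conjI allI ballI)
  fix x
  obtain V g where "open V" "x \<in> V" "Ck (Suc k) g" "\<forall>y\<in>V. f y = g y"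
   using Suc.prems[of x] by blast
  with * show "f differentiable at x" unfolding differentiable_def by blast
 next
  fix b :: 'a assume b: "b \<in> Basis"
  show "Ck k (\<lambda>x. frechet_derivative f (at x) b)"
  proof (rule Suc.IH)
   fix x
   obtain V g where V: "open V" "x \<in> V" "Ck (Suc k) g" "\<forall>y\<in>V. f y = g y"
    using Suc.prems[of x] by blast
   have "\<forall>y\<in>V. frechet_derivative f (at y) b = frechet_derivative g (at y) b"
    using frechet_derivative_at[OF *[OF V(1,3,4)]] by auto
   with V b show "\<exists>V g. open V \<and> x \<in> V \<and> Ck k g \<and> (\<forall>y\<in>V. frechet_derivative f (at y) b = g y)"
    by (intro exI[of _ V] exI[of _ "\<lambda>x. frechet_derivative g (at x) b"]) auto
  qed
 qed
qed

lemma CkI: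
 assumes "\<And>x. (f has_derivative f' x) (at x)" "\<And>b. b \<in> Basis ==> Ck k (\<lambda>x. f' x b)"
 shows "Ck (Suc k) f"
proof -
 have "frechet_derivative f (at x) = f' x" for x
  using frechet_derivative_at[OF assms(1)] by simp
 then show ?thesis using assms by (auto simp: differentiable_def)
qed

lemma Ck_has_derivative:
 "Ck (Suc k) f ==> (f has_derivative frechet_derivative f (at x)) (at x)"
 by (simp add: frechet_derivative_works)

lemma Ck_const: "Ck k (\<lambda>x. c)"
proof (induction k arbitrary: c)
 case (Suc k)
 show ?case by (rule CkI[where f' = "\<lambda>x b. 0"]) (auto intro!: Suc derivative_eq_intros)
qed auto

lemma Ck_linear:
 assumes "bounded_linear L" "Ck k f" shows "Ck k (\<lambda>x. L (f x))"
 using assms(2)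
proof (induction k arbitrary: f)
 case 0
 then show ?case using assms(1) by (auto intro: bounded_linear.continuous_on)
next
 case (Suc k)
 show ?case
  by (rule CkI[where f' = "\<lambda>x b. L (frechet_derivative f (at x) b)"])
   (use Suc in \<open>auto intro!: bounded_linear.has_derivative[OF assms(1)] Ck_has_derivative\<close>)
qed

lemma Ck_add: "Ck k f ==> Ck k g ==> Ck k (\<lambda>x. f x + g x)"
proof (induction k arbitrary: f g)
 case (Suc k)
 show ?case
  by (rule CkI[where f' = "\<lambda>x b. frechet_derivative f (at x) b + frechet_derivative g (at x) b"])
   (use Suc in \<open>auto intro!: has_derivative_add Ck_has_derivative\<close>)
qed (auto intro: continuous_intros)

lemma Ck_mult:
 fixes f g :: "'a::euclidean_space => 'b::real_normed_algebra"
 shows "Ck k f ==> Ck k g ==> Ck k (\<lambda>x. f x * g x)"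
proof (induction k arbitrary: f g)
 case (Suc k)
 have "Ck k f" "Ck k g" using Suc.prems Ck_Suc_imp by blast+
 show ?case
  by (rule CkI[where f' = "\<lambda>x b. f x * frechet_derivative g (at x) b + frechet_derivative f (at x) b * g x"])
   (use Suc \<open>Ck k f\<close> \<open>Ck k g\<close> in \<open>auto intro!: has_derivative_mult Ck_has_derivative Ck_add\<close>)
qed (auto intro: continuous_intros)

lemma Ck_sum: "finite I ==> (\<And>i. i \<in> I ==> Ck k (f i)) ==> Ck k (\<lambda>x. \<Sum>i\<in>I. f i x)"
 by (induction I rule: finite_induct) (auto intro: Ck_const Ck_add)

lemma Ck_bounded_linear: "bounded_linear L ==> Ck k L"
proof (cases k)
 case (Suc n)
 assume "bounded_linear L"
 then show ?thesis unfolding Suc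
  by (intro CkI[where f' = "\<lambda>x. L"]) (auto intro: bounded_linear_imp_has_derivative Ck_const)
qed (auto intro: linear_continuous_on)

lemma Ck_affine:
 assumes "Ck k f" shows "Ck k (\<lambda>x. f (c *\<^sub>R x + d))"
 using assms
proof (induction k arbitrary: f)
 case 0
 then show ?case by (auto intro!: continuous_on_compose2[of UNIV f] continuous_intros)
next
 case (Suc k)
 have "((\<lambda>x. f (c *\<^sub>R x + d)) has_derivative (\<lambda>h. frechet_derivative f (at (c *\<^sub>R x + d)) (c *\<^sub>R h))) (at x)" for x
  by (rule has_derivative_compose[where g = f, rotated])
   (use Suc.prems in \<open>auto intro!: derivative_eq_intros Ck_has_derivative\<close>)
 moreover have "frechet_derivative f (at z) (c *\<^sub>R h) = c *\<^sub>R frechet_derivative f (at z) h" for z h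
  by (rule linear_simps(5)[OF has_derivative_bounded_linear[OF Ck_has_derivative[OF Suc.prems]]])
 moreover have "Ck k (\<lambda>x. c *\<^sub>R frechet_derivative f (at (c *\<^sub>R x + d)) b)" if "b \<in> Basis" for b
  using Suc.IH[of "\<lambda>x. frechet_derivative f (at x) b"] Suc.prems that
  by (intro Ck_linear[of "\<lambda>x. c *\<^sub>R x"] bounded_linear_scaleR_right) auto
 ultimately show ?case
  by (intro CkI[where f' = "\<lambda>x h. c *\<^sub>R frechet_derivative f (at (c *\<^sub>R x + d)) h"]) simp_all
qed

text \<open>Since \<open>h\<close> has a real argument, its derivative is multiplication by its
  value at 1. The chain rule is therefore a product, and the induction closes on products of
  \<open>Ck\<close> functions.\<close>

lemma Ck_compose:
 fixes h :: "real => real"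
 assumes "Ck k h" "Ck k g" shows "Ck k (\<lambda>x. h (g x))"
 using assms
proof (induction k arbitrary: h g)
 case 0
 then show ?case by (auto intro: continuous_on_compose2[of UNIV h])
next
 case (Suc k)
 have "((\<lambda>x. h (g x)) has_derivative (\<lambda>b. frechet_derivative h (at (g x)) (frechet_derivative g (at x) b))) (at x)" for x
  by (rule has_derivative_compose[where g = h, rotated])
   (use Suc.prems in \<open>auto intro!: Ck_has_derivative\<close>)
 moreover have "frechet_derivative h (at z) t = t * frechet_derivative h (at z) 1" for z t
  using linear_simps(5)[OF has_derivative_bounded_linear[OF Ck_has_derivative[OF Suc.prems(1)]], of z t 1] by simp
 ultimately have "((\<lambda>x. h (g x)) has_derivative (\<lambda>b. frechet_derivative g (at x) b * frechet_derivative h (at (g x)) 1)) (at x)" for x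
  by (blast intro: has_derivative_eq_rhs)
 moreover have h': "Ck k (\<lambda>t. frechet_derivative h (at t) 1)" and g: "Ck k g"
  using Suc.prems(1) Ck_Suc_imp[OF Suc.prems(2)] by (simp_all add: Basis_real_def)
 have "Ck k (\<lambda>x. frechet_derivative g (at x) b * frechet_derivative h (at (g x)) 1)" if "b \<in> Basis" for b
  using Suc.prems(2) that by (intro Ck_mult Suc.IH[OF h' g]) auto
 ultimately show ?case by (rule CkI)
qed

lemma Ck_inverse:
 fixes f :: "'a::euclidean_space => real"
 assumes "Ck k f" "\<And>x. f x \<noteq> 0" shows "Ck k (\<lambda>x. inverse (f x))"
 using assms
proof (induction k arbitrary: f)
 case 0
 then show ?case by (auto intro: continuous_intros)
next
 case (Suc k)
 have "Ck k f" using Suc.prems Ck_Suc_imp by blast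
 then have i: "Ck k (\<lambda>x. inverse (f x))" using Suc.prems(2) by (rule Suc.IH)
 have "Ck k (\<lambda>x. (- 1) * (inverse (f x) * frechet_derivative f (at x) b * inverse (f x)))" if "b \<in> Basis" for b
  using Suc.prems that by (intro Ck_mult i Ck_const) auto
 then have 1: "Ck k (\<lambda>x. (\<lambda>b. - (inverse (f x) * frechet_derivative f (at x) b * inverse (f x))) b)" if "b \<in> Basis" for b
  using that by simp
 have 2: "((\<lambda>x. inverse (f x)) has_derivative (\<lambda>b. - (inverse (f x) * frechet_derivative f (at x) b * inverse (f x)))) (at x)" for x
  using Suc.prems by (intro Deriv.has_derivative_inverse Ck_has_derivative)
 from 2 1 show ?case
  by (rule CkI)
qed

lemma smooth_Ck: "smooth f ==> Ck k f"
 by (simp add: smooth_def)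

lemma smooth_const: "smooth (\<lambda>x. c)"
 unfolding smooth_def by (intro allI Ck_const)

lemma smooth_add: "smooth f ==> smooth g ==> smooth (\<lambda>x. f x + g x)"
 unfolding smooth_def by (intro allI Ck_add) simp_all

lemma smooth_affine: "smooth f ==> smooth (\<lambda>x. f (c *\<^sub>R x + d))"
 unfolding smooth_def by (rule allI, rule Ck_affine) simp

lemma smooth_linear: "bounded_linear L ==> smooth f ==> smooth (\<lambda>x. L (f x))"
 unfolding smooth_def by (rule allI, rule Ck_linear) simp_all

lemma smooth_bounded_linear: "bounded_linear L ==> smooth L"
 unfolding smooth_def by (rule allI, rule Ck_bounded_linear)

lemma smooth_continuous: "smooth f ==> continuous_on UNIV f"
 by (rule Ck_continuous[OF smooth_Ck[of f 0]])

lemma smooth_mult: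
 fixes f g :: "'a::euclidean_space => 'b::real_normed_algebra"
 shows "smooth f ==> smooth g ==> smooth (\<lambda>x. f x * g x)"
 unfolding smooth_def by (rule allI, rule Ck_mult) blast+

lemma smooth_inverse:
 fixes f :: "'a::euclidean_space => real"
 shows "smooth f ==> (\<And>x. f x \<noteq> 0) ==> smooth (\<lambda>x. inverse (f x))"
 unfolding smooth_def by (rule allI, rule Ck_inverse) blast+

lemma smooth_compose:
 fixes h :: "real => real"
 shows "smooth h ==> smooth g ==> smooth (\<lambda>x. h (g x))"
 unfolding smooth_def by (rule allI, rule Ck_compose) blast+

lemma smooth_sum: "finite I ==> (\<And>i. i \<in> I ==> smooth (f i)) ==> smooth (\<lambda>x. \<Sum>i\<in>I. f i x)"
 unfolding smooth_def by (rule allI, rule Ck_sum) blast+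

lemma smooth_local:
 assumes "\<And>x. \<exists>V g. open V \<and> x \<in> V \<and> smooth g \<and> (\<forall>y\<in>V. f y = g y)"
 shows "smooth f"
 unfolding smooth_def
proof
 fix k
 show "Ck k f"
 proof (rule Ck_local)
  fix x
  obtain V g where "open V" "x \<in> V" "smooth g" "\<forall>y\<in>V. f y = g y" using assms by blast
  then show "\<exists>V g. open V \<and> x \<in> V \<and> Ck k g \<and> (\<forall>y\<in>V. f y = g y)"
   by (auto simp: smooth_def)
 qed
qed

lemma smooth_has_derivative:
 "smooth f ==> (f has_derivative frechet_derivative f (at x)) (at x)"
 unfolding smooth_def using Ck_has_derivative by blast

lemma smooth_frechet: "smooth f ==> b \<in> Basis ==> smooth (\<lambda>x. frechet_derivative f (at x) b)"
 unfolding smooth_def using Ck.simps(2) by blast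

section \<open>The partial derivatives of smooth functions\<close>

text \<open>The derivative that occurs under the integral in \<open>has_weak_pd\<close>, named so
  that a calculus for it can be stated; the codomain is general because bumps are real and test
  functions complex.\<close>

definition pd :: "3 => (R3 => 'b::real_normed_vector) => R3 => 'b" where
 "pd l f x = frechet_derivative f (at x) (axis l 1)"

lemma pd_eq: "(f has_derivative f') (at x) ==> pd l f x = f' (axis l 1)"
 unfolding pd_def by (drule frechet_derivative_at) simp

lemma smooth_pd: "smooth f ==> smooth (pd l f)"
 unfolding pd_def by (rule smooth_frechet) (simp_all add: axis_in_Basis_iff)

lemma smooth_derivative_sum:
 fixes f :: "R3 => 'b::real_normed_vector"
 assumes "smooth f"
 shows "(f has_derivative (\<lambda>h. \<Sigma> l. h $ l *\<^sub>R pd l f x)) (at x)"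
proof -
 have d: "(f has_derivative frechet_derivative f (at x)) (at x)"
  by (rule smooth_has_derivative[OF assms])
 then interpret bounded_linear "frechet_derivative f (at x)" by (rule has_derivative_bounded_linear)
 have "frechet_derivative f (at x) h = (\<Sigma> l. h $ l *\<^sub>R pd l f x)" for h :: R3
 proof -
  have "h = (\<Sigma> l. h $ l *\<^sub>R axis l 1)"
   using basis_expansion[of h] by (simp add: scalar_mult_eq_scaleR)
  then have "frechet_derivative f (at x) h = frechet_derivative f (at x) (\<Sigma> l. h $ l *\<^sub>R axis l 1)" by simp
  then show ?thesis by (simp add: sum scaleR pd_def)
 qed
 then have "frechet_derivative f (at x) = (\<lambda>h. \<Sigma> l. h $ l *\<^sub>R pd l f x)" by (rule ext)
 with d show ?thesis by simp
qed

lemma pd_mult: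
 fixes f g :: "R3 => 'b::real_normed_algebra"
 shows "smooth f ==> smooth g ==> pd l (\<lambda>x. f x * g x) x = f x * pd l g x + pd l f x * g x"
 by (subst pd_eq[OF has_derivative_mult[OF smooth_has_derivative smooth_has_derivative]]) (auto simp: pd_def)

lemma pd_linear:
 assumes "bounded_linear L" "smooth f" shows "pd l (\<lambda>x. L (f x)) x = L (pd l f x)"
 by (subst pd_eq[OF bounded_linear.has_derivative[OF assms(1) smooth_has_derivative[OF assms(2)]]]) (auto simp: pd_def)

lemma pd_affine:
 assumes "smooth f" shows "pd l (\<lambda>x. f (c *\<^sub>R x + d)) x = c *\<^sub>R pd l f (c *\<^sub>R x + d)"
proof -
 have "((\<lambda>x. f (c *\<^sub>R x + d)) has_derivative (\<lambda>h. frechet_derivative f (at (c *\<^sub>R x + d)) (c *\<^sub>R h))) (at x)"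
  by (rule has_derivative_compose[where g = f, rotated])
   (use assms in \<open>auto intro!: derivative_eq_intros smooth_has_derivative\<close>)
 moreover have "frechet_derivative f (at z) (c *\<^sub>R h) = c *\<^sub>R frechet_derivative f (at z) h" for z h
  by (rule linear_simps(5)[OF has_derivative_bounded_linear[OF smooth_has_derivative[OF assms]]])
 ultimately show ?thesis unfolding pd_def by (subst frechet_derivative_at[symmetric]) simp_all
qed

lemma pd_sum: "finite I ==> (\<And>i. i \<in> I ==> smooth (f i)) ==> pd l (\<lambda>x. \<Sum>i\<in>I. f i x) x = (\<Sum>i\<in>I. pd l (f i) x)"
 by (subst pd_eq[OF has_derivative_sum[OF smooth_has_derivative]]) (auto simp: pd_def)

lemma pd_inverse:
 fixes f :: "R3 => real"
 shows "smooth f ==> f x \<noteq> 0 ==> pd l (\<lambda>x. inverse (f x)) x = - (inverse (f x) * pd l f x * inverse (f x))"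
 by (subst pd_eq[OF Deriv.has_derivative_inverse[OF _ smooth_has_derivative]]) (auto simp: pd_def)

lemma pd_cong_open: "open V ==> x \<in> V ==> (\<And>y. y \<in> V ==> f y = g y) ==> smooth g ==> pd l f x = pd l g x"
 using has_derivative_transform_within_open[OF smooth_has_derivative[of g x], of V f] pd_eq[of f "frechet_derivative g (at x)" x l]
 by (auto simp: pd_def)

section \<open>Bump functions\<close>

text \<open>Indexed by a power of \<open>1 / t\<close> so that the derivative of each member is a linear combination of members.\<close>

definition expinv :: "nat => real => real" where
 "expinv n t = (if t \<le> 0 then 0 else (1 / t) ^ n * exp (- (1 / t)))"

lemma expinv_tendsto_0: "((\<lambda>t. expinv n t) \<longlongrightarrow> 0) (at 0)"
proof -
 have "((\<lambda>x. x ^ n / exp x) \<longlongrightarrow> (0::real)) at_top" by (rule tendsto_power_div_exp_0)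
 then have "((\<lambda>t. inverse t ^ n / exp (inverse t)) \<longlongrightarrow> (0::real)) (at_right 0)"
  by (rule filterlim_compose) (rule filterlim_inverse_at_top_right)
 then have "(expinv n \<longlongrightarrow> 0) (at_right 0)"
  by (rule Lim_transform_eventually)
   (auto simp: eventually_at_filter expinv_def exp_minus field_simps)
 moreover have "(expinv n \<longlongrightarrow> 0) (at_left 0)"
  by (rule tendsto_eventually) (auto simp: eventually_at_filter expinv_def)
 ultimately show ?thesis using filterlim_split_at by blast
qed

lemma expinv_deriv: "(expinv n has_real_derivative (expinv (n + 2) t - real n * expinv (n + 1) t)) (at t)"
proof -
 consider "t < 0" | "t = 0" | "t > 0" by linarith
 then show ?thesis
 proof cases
  case 1
  have "(expinv n has_real_derivative 0) (at t)"
   by (rule has_field_derivative_transform_within_open[where f = "\<lambda>t. 0" and S = "{..<0}"])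
    (use 1 in \<open>auto simp: expinv_def\<close>)
  with 1 show ?thesis by (simp add: expinv_def)
 next
  case 2
  \<comment> \<open>The difference quotient at 0 is again a member of the family,
    \<open>expinv (Suc n)\<close>, whose limit is known.\<close>
  have "((\<lambda>h. (expinv n (0 + h) - expinv n 0) / h) \<longlongrightarrow> 0) (at 0)"
   by (rule Lim_transform_eventually[OF expinv_tendsto_0[of "Suc n"]])
    (auto simp: eventually_at_filter expinv_def field_simps)
  then have "(expinv n has_real_derivative 0) (at 0)" by (simp add: DERIV_def)
  with 2 show ?thesis by (simp add: expinv_def)
 next
  case 3
  have "((\<lambda>t. (1 / t) ^ n * exp (- (1 / t))) has_real_derivative (expinv (n + 2) t - real n * expinv (n + 1) t)) (at t)"
  proof -
   have d: "((\<lambda>t. 1 / t) has_real_derivative (- (1 / t\<^sup>2))) (at t)"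
    using 3 by (auto intro!: derivative_eq_intros simp: power2_eq_square)
   have e: "((\<lambda>t. exp (- (1 / t))) has_real_derivative (exp (- (1 / t)) * (1 / t\<^sup>2))) (at t)"
    using DERIV_fun_exp[OF DERIV_minus[OF d]] by simp
   have "((\<lambda>t. (1 / t) ^ n * exp (- (1 / t))) has_real_derivative
     (real n * (1 / t) ^ (n - 1) * (- (1 / t\<^sup>2))) * exp (- (1 / t)) + (1 / t) ^ n * (exp (- (1 / t)) * (1 / t\<^sup>2))) (at t)"
    by (rule DERIV_cong[OF DERIV_mult[OF DERIV_power[OF d, of n] e]]) (simp add: algebra_simps)
   also have "(real n * (1 / t) ^ (n - 1) * (- (1 / t\<^sup>2))) * exp (- (1 / t)) + (1 / t) ^ n * (exp (- (1 / t)) * (1 / t\<^sup>2))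
    = expinv (n + 2) t - real n * expinv (n + 1) t"
    using 3 by (cases n) (simp_all add: expinv_def power2_eq_square algebra_simps add_divide_distrib)
   finally show ?thesis .
  qed
  then show ?thesis
   by (rule has_field_derivative_transform_within_open[of _ _ _ "{0<..}"]) (use 3 in \<open>auto simp: expinv_def\<close>)
 qed
qed

lemma smooth_expinv: "smooth (expinv n)"
 unfolding smooth_def
proof
 fix k show "Ck k (expinv n)"
 proof (induction k arbitrary: n)
  case 0
  show ?case using DERIV_isCont[OF expinv_deriv] by (simp add: continuous_at_imp_continuous_on)
 next
  case (Suc k)
  have "Ck k (\<lambda>t. (expinv (n + 2) t + (- real n) * expinv (n + 1) t) * b)" for b
   by (intro Ck_mult Ck_add Suc Ck_const)
  moreover have "(expinv n has_derivative (\<lambda>b. (expinv (n + 2) t + (- real n) * expinv (n + 1) t) * b)) (at t)" for t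
   using expinv_deriv[of n] by (simp add: has_field_derivative_def)
  ultimately show ?case by (intro CkI)
 qed
qed

text \<open>Not normalised: the integral is \<open>mass r\<close>. The dependence on the squared
  distance makes it smooth at the centre and symmetric in \<open>y\<close> and \<open>q\<close>, so
  that it can be read as a test function of \<open>y\<close> or as a kernel.\<close>

definition bump :: "real => R3 => R3 => real" where
 "bump r q y = expinv 0 (r\<^sup>2 - (y - q) \<bullet> (y - q))"

lemma bump_nonneg: "bump r q y \<ge> 0" by (simp add: bump_def expinv_def)

lemma bump_pos_iff: "r > 0 ==> bump r q y > 0 \<longleftrightarrow> dist y q < r"
proof -
 assume r: "r > 0"
 have "(y - q) \<bullet> (y - q) < r\<^sup>2 \<longleftrightarrow> dist y q < r"
  using r power2_less_imp_less[of "norm (y - q)" r] power_strict_mono[of "norm (y - q)" r 2]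
  by (auto simp: dot_square_norm dist_norm)
 then show ?thesis by (auto simp: bump_def expinv_def)
qed

lemma bump_0_iff: "r > 0 ==> bump r q y = 0 \<longleftrightarrow> r \<le> dist y q"
 using bump_pos_iff[of r q y] bump_nonneg[of r q y] by linarith

lemma bump_le_1: "bump r q y \<le> 1"
 by (simp add: bump_def expinv_def)

lemma bump_shift: "bump r q (y + v) = bump r (q - v) y" "bump r q (y - v) = bump r (q + v) y"
 "bump r q y = bump r y q"
 by (simp_all add: bump_def algebra_simps inner_commute)

lemma smooth_minus: "smooth f ==> smooth (\<lambda>x. - f x)"
 by (rule smooth_linear[OF bounded_linear_minus[OF bounded_linear_ident]])

lemma smooth_diff: "smooth f ==> smooth g ==> smooth (\<lambda>x. f x - g x)"
 using smooth_add[OF _ smooth_minus, of f g] by simp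

lemma smooth_coordinate: "smooth (\<lambda>y::R3. c * (y - q) $ l)"
proof -
 have "smooth (\<lambda>y::R3. c * (y $ l - q $ l))"
  by (rule smooth_mult[OF smooth_const smooth_diff[OF smooth_bounded_linear[OF bounded_linear_vec_nth] smooth_const]])
 then show ?thesis by simp
qed

lemma smooth_expinv_ball: "smooth (\<lambda>y::R3. expinv n (r\<^sup>2 - (y - q) \<bullet> (y - q)))"
proof -
 have "smooth (\<lambda>y::R3. \<Sigma> i. (1 * (y - q) $ i) * (1 * (y - q) $ i))"
  by (rule smooth_sum[OF finite_class.finite smooth_mult[OF smooth_coordinate smooth_coordinate]])
 then have "smooth (\<lambda>y. (y - q) \<bullet> (y - q))"
  by (simp add: inner_vec_def)
 then show ?thesis
  by (rule smooth_compose[OF smooth_expinv smooth_diff[OF smooth_const]])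
qed

lemma smooth_bump: "smooth (bump r q)"
 unfolding bump_def[abs_def] by (rule smooth_expinv_ball)

lemma pd_expinv_ball:
 "pd l (\<lambda>y. expinv n (r\<^sup>2 - (y - q) \<bullet> (y - q))) y =
  (expinv (n + 2) (r\<^sup>2 - (y - q) \<bullet> (y - q)) - real n * expinv (n + 1) (r\<^sup>2 - (y - q) \<bullet> (y - q))) * (- 2 * (y - q) $ l)"
proof -
 have "((\<lambda>y. r\<^sup>2 - (y - q) \<bullet> (y - q)) has_derivative (\<lambda>h. - 2 * ((y - q) \<bullet> h))) (at y)"
  by (auto intro!: derivative_eq_intros simp: inner_commute)
 from has_derivative_compose[OF this expinv_deriv[of n, unfolded has_field_derivative_def]]
 show ?thesis by (subst pd_eq, assumption) (simp add: inner_axis)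
qed

lemma pd_bump: "pd l (bump r q) y = expinv 2 (r\<^sup>2 - (y - q) \<bullet> (y - q)) * (- 2 * (y - q) $ l)"
 unfolding bump_def[abs_def] using pd_expinv_ball[of l 0 r q y] by (simp only: add_0 of_nat_0 mult_zero_left diff_zero numeral_2_eq_2)

lemma pd_bump_0: "r > 0 ==> r \<le> dist y q ==> pd l (bump r q) y = 0"
 using bump_0_iff[of r q y] unfolding pd_bump by (auto simp: bump_def expinv_def split: if_splits)

lemma pd_bump_shift: "pd l (bump r q) (y + v) = pd l (bump r (q - v)) y"
 unfolding pd_bump by (simp add: algebra_simps)

text \<open>Read off from the explicit formula, which is symmetric in \<open>k\<close> and
  \<open>l\<close>. It supplies the commuting second derivatives of the rigidity argument.\<close>

lemma pd_pd_bump_symmetric: "pd k (pd l (bump r q)) y = pd l (pd k (bump r q)) y"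
proof -
 have 1: "pd k (\<lambda>y. - 2 * (y - q) $ l) y = (if k = l then -2 else 0)" for k l
 proof -
  have "((\<lambda>y. - 2 * (y - q) $ l) has_derivative (\<lambda>h. - 2 * h $ l)) (at y)"
   by (auto intro!: derivative_eq_intros bounded_linear.has_derivative[OF bounded_linear_vec_nth])
  from pd_eq[OF this] show ?thesis by (simp add: axis_def)
 qed
 have "pd k (pd l (bump r q)) y = expinv 2 (r\<^sup>2 - (y - q) \<bullet> (y - q)) * (if k = l then -2 else 0) +
  (expinv 4 (r\<^sup>2 - (y - q) \<bullet> (y - q)) - 2 * expinv 3 (r\<^sup>2 - (y - q) \<bullet> (y - q))) * (- 2 * (y - q) $ k) * (- 2 * (y - q) $ l)" for k l
  unfolding pd_bump[abs_def] pd_mult[OF smooth_expinv_ball smooth_coordinate] pd_expinv_ball 1 by simp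
 then show ?thesis by (simp add: mult_ac)
qed

section \<open>Lebesgue integration\<close>

text \<open>Lebesgue measure is the completion of \<open>lborel\<close>, and product measures are at
  hand for \<open>lborel\<close>. Replacing integrable functions by Borel ones, up to null sets,
  gives access to Fubini.\<close>

lemma borel_representative_real:
 fixes f :: "'a::euclidean_space => real"
 assumes "integrable \<L> f"
 obtains g where "integrable lborel g" "AE x in \<L>. f x = g x"
proof -
 have "f \<in> borel_measurable (completion lborel)" using assms by auto
 from completion_ex_borel_measurable_real[OF this]
 obtain g where g: "g \<in> borel_measurable lborel" "AE x in lborel. f x = g x" by blast
 then have ae: "AE x in \<L>. f x = g x" by (simp add: AE_completion)
 have "integrable \<L> g"
  using assms ae g(1) by (subst integrable_cong_AE[where g = f]) (auto intro: measurable_completion)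
 then have "integrable lborel g"
  using g(1) by (subst integrable_completion[symmetric])
 then show ?thesis using ae that by blast
qed

lemma borel_representative:
 fixes f :: "'a::euclidean_space => complex"
 assumes "integrable \<L> f"
 obtains g where "integrable lborel g" "AE x in \<L>. f x = g x"
proof -
 obtain g1 where g1: "integrable lborel g1" "AE x in \<L>. Re (f x) = g1 x"
  using borel_representative_real[of "\<lambda>x. Re (f x)"] assms integrable_Re by blast
 obtain g2 where g2: "integrable lborel g2" "AE x in \<L>. Im (f x) = g2 x"
  using borel_representative_real[of "\<lambda>x. Im (f x)"] assms integrable_Im by blast
 show ?thesis
 proof
  show "integrable lborel (\<lambda>x. complex_of_real (g1 x) + \<i> * complex_of_real (g2 x))"
   using g1 g2 by auto
  show "AE x in \<L>. f x = complex_of_real (g1 x) + \<i> * complex_of_real (g2 x)"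
   using g1(2) g2(2) by eventually_elim (auto simp: complex_eq_iff)
 qed
qed

lemma integral_lborel_eq:
 fixes f g :: "'a::euclidean_space => 'b::{banach, second_countable_topology}"
 assumes "f \<in> borel_measurable \<L>" "g \<in> borel_measurable borel" "AE x in \<L>. f x = g x"
 shows "integral\<^sup>L \<L> f = integral\<^sup>L lborel g"
proof -
 have "g \<in> borel_measurable \<L>" using assms by (auto intro: measurable_completion)
 then have "integral\<^sup>L \<L> f = integral\<^sup>L \<L> g"
  using assms by (intro integral_cong_AE) auto
 then show ?thesis using assms by (simp add: integral_completion)
qed

lemma integrable_AE:
 fixes f g :: "'a::euclidean_space => 'b::euclidean_space"
 assumes "integrable \<L> f" "AE x in \<L>. g x = f x"
 shows "integrable \<L> g"
proof -
 have f: "f \<in> borel_measurable \<L>" using assms by auto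
 have ae: "AE x in \<L>. f x = g x" using assms(2) by eventually_elim simp
 then have "g \<in> borel_measurable \<L>"
  using borel_measurable_AE[OF f] by blast
 with f ae assms(1) show ?thesis
  using integrable_cong_AE[of f \<L> g] by blast
qed

text \<open>Completeness of the measure carries measurability across null sets, so either both
  functions are measurable, or neither is and both integrals are 0 by convention.\<close>

lemma integral_AE:
 fixes f g :: "'a::euclidean_space => 'b::euclidean_space"
 assumes ae: "AE x in \<L>. f x = g x"
 shows "integral\<^sup>L \<L> f = integral\<^sup>L \<L> g"
proof (cases "f \<in> borel_measurable \<L>")
 case True
 then have "g \<in> borel_measurable \<L>"
  using borel_measurable_AE[OF True ae] by blast
 with True ae show ?thesis
  by (intro integral_cong_AE)
next
 case False
 have "AE x in \<L>. g x = f x" using ae by eventually_elim simp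
 then have "g \<notin> borel_measurable \<L>"
  using False borel_measurable_AE[of g f] by blast
 then have "\<not> integrable \<L> f" "\<not> integrable \<L> g"
  using False by (blast dest: borel_measurable_integrable)+
 then show ?thesis by (simp add: not_integrable_integral_eq)
qed

lemma integrable_mult_bounded:
 fixes f :: "'a => 'b::{real_normed_algebra, banach, second_countable_topology}"
 assumes "integrable M f" "h \<in> borel_measurable M" "\<And>x. norm (h x) \<le> C"
 shows "integrable M (\<lambda>x. f x * h x)"
proof (rule integrable_dominated)
 show "integrable M (\<lambda>x. C * norm (f x))" using assms by auto
 show "(\<lambda>x. f x * h x) \<in> borel_measurable M" using assms by auto
 show "AE x in M. norm (f x * h x) \<le> norm (C * norm (f x))"
 proof (rule AE_I2)
  fix x
  have "norm (f x * h x) \<le> norm (f x) * norm (h x)" by (rule norm_mult_ineq)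
  also have "\<dots> \<le> norm (f x) * C" by (rule mult_left_mono) (use assms in auto)
  finally show "norm (f x * h x) \<le> norm (C * norm (f x))" by (simp add: mult.commute)
 qed
qed

text \<open>A bounded kernel leaves the integrand dominated by a multiple of
  \<open>f y * g z\<close>, which is integrable on the product.\<close>

lemma kernel_Fubini_lborel:
 fixes f g :: "'a::euclidean_space => 'b::{real_normed_field, banach, second_countable_topology}"
 assumes f: "integrable lborel f" and g: "integrable lborel g"
  and k: "(\<lambda>(y, z). k y z) \<in> borel_measurable borel" "\<And>y z. norm (k y z) \<le> C"
 shows "integrable lborel (\<lambda>y. f y * (LINT z|lborel. g z * k y z))"
  "(LINT y|lborel. f y * (LINT z|lborel. g z * k y z)) = (LINT z|lborel. g z * (LINT y|lborel. f y * k y z))"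
proof -
 have k': "(\<lambda>(y, z). k y z) \<in> borel_measurable (lborel \<Otimes>\<^sub>M lborel)"
  using k by (simp add: lborel_prod)
 have [measurable]: "(\<lambda>z. k y z) \<in> borel_measurable borel" "(\<lambda>y. k y z) \<in> borel_measurable borel" for y z
  using measurable_compose[of "\<lambda>z. (y, z)" borel borel, OF _ k(1)]
     measurable_compose[of "\<lambda>y. (y, z)" borel borel, OF _ k(1)] by (auto simp: borel_prod[symmetric])
 have [measurable]: "f \<in> borel_measurable borel" "g \<in> borel_measurable borel" using f g by auto
 have prod: "integrable (lborel \<Otimes>\<^sub>M lborel) (\<lambda>(y, z). f y * g z)"
 proof (rule lborel_pair.Fubini_integrable)
  show "(\<lambda>(y, z). f y * g z) \<in> borel_measurable (lborel \<Otimes>\<^sub>M lborel)" by measurable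
  show "integrable lborel (\<lambda>x. LINT y|lborel. norm (case (x, y) of (y, z) => f y * g z))"
   using f g by (simp add: norm_mult)
  show "AE x in lborel. integrable lborel (\<lambda>y. case (x, y) of (y, z) => f y * g z)"
   using g by simp
 qed
 have H: "integrable (lborel \<Otimes>\<^sub>M lborel) (\<lambda>(y, z). f y * g z * k y z)"
 proof -
  have "norm (case x of (y, z) => k y z) \<le> C" for x using k(2) by (simp add: case_prod_beta)
  from integrable_mult_bounded[OF prod k' this] show ?thesis by (simp add: case_prod_unfold)
 qed
 have "integrable lborel (\<lambda>y. LINT z|lborel. f y * g z * k y z)"
  using lborel_pair.integrable_fst'[OF H] by simp
 then show "integrable lborel (\<lambda>y. f y * (LINT z|lborel. g z * k y z))"
  by (simp add: mult.assoc)
 have "(LINT z|lborel. LINT y|lborel. f y * g z * k y z) = (LINT y|lborel. LINT z|lborel. f y * g z * k y z)"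
  using lborel_pair.Fubini_integral[OF H] by simp
 then have "(LINT z|lborel. LINT y|lborel. g z * (f y * k y z)) = (LINT y|lborel. LINT z|lborel. f y * (g z * k y z))"
  by (simp add: mult_ac)
 then show "(LINT y|lborel. f y * (LINT z|lborel. g z * k y z)) = (LINT z|lborel. g z * (LINT y|lborel. f y * k y z))"
  by simp
qed

text \<open>The Borel representatives are passed as arguments because they are constructed
  separately for real and for complex functions, while this transfer to the completed measure is the
  same for both.\<close>

lemma kernel_Fubini_aux:
 fixes f g :: "'a::euclidean_space => 'b::{real_normed_field, banach, second_countable_topology}"
 assumes f: "integrable \<L> f" and g: "integrable \<L> g"
  and f': "integrable lborel f'" "AE x in \<L>. f x = f' x"
  and g': "integrable lborel g'" "AE x in \<L>. g x = g' x"
  and k: "(\<lambda>(y, z). k y z) \<in> borel_measurable borel" "\<And>y z. norm (k y z) \<le> C"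
 shows "integrable \<L> (\<lambda>y. f y * (LINT z|\<L>. g z * k y z)) \<and>
  (LINT y|\<L>. f y * (LINT z|\<L>. g z * k y z)) = (LINT z|\<L>. g z * (LINT y|\<L>. f y * k y z))"
proof -
 have [measurable]: "(\<lambda>z. k y z) \<in> borel_measurable borel" "(\<lambda>y. k y z) \<in> borel_measurable borel" for y z
  using measurable_compose[of "\<lambda>z. (y, z)" borel borel, OF _ k(1)]
     measurable_compose[of "\<lambda>y. (y, z)" borel borel, OF _ k(1)] by (auto simp: borel_prod[symmetric])
 have [measurable]: "f' \<in> borel_measurable borel" "g' \<in> borel_measurable borel" using f' g' by auto
 have [measurable]: "f \<in> borel_measurable \<L>" "g \<in> borel_measurable \<L>" using f g by auto
 have [measurable]: "(\<lambda>z. k y z) \<in> borel_measurable \<L>" "(\<lambda>y. k y z) \<in> borel_measurable \<L>" for y z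
  by (auto intro: measurable_completion)
 have 1: "(LINT z|\<L>. g z * k y z) = (LINT z|lborel. g' z * k y z)" for y
  by (rule integral_lborel_eq) (use g' in auto)
 have 2: "(LINT y|\<L>. f y * k y z) = (LINT y|lborel. f' y * k y z)" for z
  by (rule integral_lborel_eq) (use f' in auto)
 note K = kernel_Fubini_lborel[OF f'(1) g'(1) k]
 have k2: "(\<lambda>(z, y). k y z) \<in> borel_measurable borel"
  using measurable_compose[OF measurable_pair_swap'[of borel borel] k(1)[unfolded borel_prod[symmetric]]]
  by (simp add: borel_prod case_prod_beta)
 note K' = kernel_Fubini_lborel[OF g'(1) f'(1), of "\<lambda>y z. k z y" C, OF k2 k(2)]
 have m1: "(\<lambda>y. f' y * (LINT z|lborel. g' z * k y z)) \<in> borel_measurable borel" using K(1) by auto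
 have m2: "(\<lambda>y. g' y * (LINT z|lborel. f' z * k z y)) \<in> borel_measurable borel" using K'(1) by auto
 have e1: "AE y in \<L>. f y * (LINT z|lborel. g' z * k y z) = f' y * (LINT z|lborel. g' z * k y z)"
  using f'(2) by eventually_elim simp
 have e2: "AE y in \<L>. g y * (LINT z|lborel. f' z * k z y) = g' y * (LINT z|lborel. f' z * k z y)"
  using g'(2) by eventually_elim simp
 have m3: "(\<lambda>y. f y * (LINT z|lborel. g' z * k y z)) \<in> borel_measurable \<L>"
 proof -
  have "(\<lambda>y. LINT z|lborel. g' z * k y z) \<in> borel_measurable borel"
  proof -
   have "(\<lambda>(y, z). g' z * k y z) \<in> borel_measurable (borel \<Otimes>\<^sub>M lborel)"
    using k(1) by (simp add: borel_prod[symmetric] case_prod_beta cong: measurable_cong_sets) measurable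
   then show ?thesis by (rule lborel.borel_measurable_lebesgue_integral)
  qed
  then have "(\<lambda>y. LINT z|lborel. g' z * k y z) \<in> borel_measurable \<L>"
   by (intro measurable_completion) simp
  then show ?thesis by (intro borel_measurable_times) simp_all
 qed
 have m4: "(\<lambda>y. g y * (LINT z|lborel. f' z * k z y)) \<in> borel_measurable \<L>"
 proof -
  have "(\<lambda>y. LINT z|lborel. f' z * k z y) \<in> borel_measurable borel"
  proof -
   have "(\<lambda>(y, z). f' z * k z y) \<in> borel_measurable (borel \<Otimes>\<^sub>M lborel)"
    using k2 by (simp add: borel_prod[symmetric] case_prod_beta cong: measurable_cong_sets) measurable
   then show ?thesis by (rule lborel.borel_measurable_lebesgue_integral)
  qed
  then have "(\<lambda>y. LINT z|lborel. f' z * k z y) \<in> borel_measurable \<L>"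
   by (intro measurable_completion) simp
  then show ?thesis by (intro borel_measurable_times) simp_all
 qed
 have "integrable \<L> (\<lambda>y. f' y * (LINT z|lborel. g' z * k y z))"
  using K(1) m1 by (simp add: integrable_completion)
 then have "integrable \<L> (\<lambda>y. f y * (LINT z|lborel. g' z * k y z))"
  using e1 m1 m3 by (subst integrable_cong_AE[where g = "\<lambda>y. f' y * (LINT z|lborel. g' z * k y z)"]) (auto intro: measurable_completion)
 moreover have "(LINT y|\<L>. f y * (LINT z|lborel. g' z * k y z)) = (LINT z|\<L>. g z * (LINT y|lborel. f' y * k y z))"
  using K(2) integral_lborel_eq[OF m3 m1 e1] integral_lborel_eq[OF m4 m2 e2] by simp
 ultimately show ?thesis by (simp add: 1 2)
qed

lemma kernel_Fubini:
 fixes f g :: "'a::euclidean_space => complex"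
 assumes f: "integrable \<L> f" and g: "integrable \<L> g"
  and k: "(\<lambda>(y, z). k y z) \<in> borel_measurable borel" "\<And>y z. norm (k y z) \<le> C"
 shows "integrable \<L> (\<lambda>y. f y * (LINT z|\<L>. g z * k y z))"
  "(LINT y|\<L>. f y * (LINT z|\<L>. g z * k y z)) = (LINT z|\<L>. g z * (LINT y|\<L>. f y * k y z))"
proof -
 obtain f' g' where "integrable lborel f'" "AE x in \<L>. f x = f' x" "integrable lborel g'" "AE x in \<L>. g x = g' x"
  using borel_representative f g by metis
 from kernel_Fubini_aux[OF f g this k]
 show "integrable \<L> (\<lambda>y. f y * (LINT z|\<L>. g z * k y z))"
  "(LINT y|\<L>. f y * (LINT z|\<L>. g z * k y z)) = (LINT z|\<L>. g z * (LINT y|\<L>. f y * k y z))"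
  by simp_all
qed

lemma kernel_Fubini_real:
 fixes f g :: "'a::euclidean_space => real"
 assumes f: "integrable \<L> f" and g: "integrable \<L> g"
  and k: "(\<lambda>(y, z). k y z) \<in> borel_measurable borel" "\<And>y z. norm (k y z) \<le> C"
 shows "integrable \<L> (\<lambda>y. f y * (LINT z|\<L>. g z * k y z))"
  "(LINT y|\<L>. f y * (LINT z|\<L>. g z * k y z)) = (LINT z|\<L>. g z * (LINT y|\<L>. f y * k y z))"
proof -
 obtain f' g' where "integrable lborel f'" "AE x in \<L>. f x = f' x" "integrable lborel g'" "AE x in \<L>. g x = g' x"
  using borel_representative_real f g by metis
 from kernel_Fubini_aux[OF f g this k]
 show "integrable \<L> (\<lambda>y. f y * (LINT z|\<L>. g z * k y z))"
  "(LINT y|\<L>. f y * (LINT z|\<L>. g z * k y z)) = (LINT z|\<L>. g z * (LINT y|\<L>. f y * k y z))"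
  by simp_all
qed

text \<open>Lebesgue measure on a product is the completion of the product measure, so sections of
  \<open>F\<close> are measurable only for almost every \<open>x\<close>. The integral over
  \<open>y\<close> is compared with that of a Borel representative, off a null set of
  \<open>x\<close>.\<close>

lemma lebesgue_slices:
 fixes F :: "'a::euclidean_space \<times> 'b::euclidean_space => complex"
 assumes F: "integrable \<L> F"
 shows "AE x in \<L>. integrable \<L> (\<lambda>y. F (x, y))"
  "integrable \<L> (\<lambda>x. LINT y|\<L>. F (x, y))"
  "(LINT x|\<L>. LINT y|\<L>. F (x, y)) = (LINT z|\<L>. F z)"
proof -
 obtain G where G: "integrable lborel G" "AE x in \<L>. F x = G x"
  using borel_representative F by blast
 have G': "integrable (lborel \<Otimes>\<^sub>M lborel) G" using G(1) by (simp add: lborel_prod)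
 have "AE z in lborel \<Otimes>\<^sub>M lborel. F z = G z"
  using G(2) unfolding lborel_prod AE_completion_iff .
 from lborel_pair.AE_pair[OF this]
 have ae: "AE x in \<L>. AE y in \<L>. F (x, y) = G (x, y)"
  by (simp add: AE_completion_iff)
 have int: "AE x in \<L>. integrable lborel (\<lambda>y. G (x, y))"
  using lborel_pair.AE_integrable_fst'[OF G'] by (simp add: AE_completion)
 have m: "(\<lambda>y. G (x, y)) \<in> borel_measurable borel" for x
  using G' by (auto dest!: borel_measurable_integrable)
 have *: "AE x in \<L>. integrable \<L> (\<lambda>y. F (x, y)) \<and> (LINT y|\<L>. F (x, y)) = (LINT y|lborel. G (x, y))"
  using ae int
 proof eventually_elim
  case (elim x)
  have mG: "(\<lambda>y. G (x, y)) \<in> borel_measurable \<L>" using m by (auto intro: measurable_completion)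
  have mF: "(\<lambda>y. F (x, y)) \<in> borel_measurable \<L>"
   by (rule borel_measurable_AE[OF mG]) (use elim in auto)
  have "integrable \<L> (\<lambda>y. G (x, y))" using elim m by (simp add: integrable_completion)
  then have "integrable \<L> (\<lambda>y. F (x, y))"
   using elim mF mG by (subst integrable_cong_AE[where g = "\<lambda>y. G (x, y)"]) auto
  then show ?case using integral_lborel_eq[OF mF m] elim by simp
 qed
 then show "AE x in \<L>. integrable \<L> (\<lambda>y. F (x, y))" by auto
 have "integrable lborel (\<lambda>x. LINT y|lborel. G (x, y))"
  using lborel_pair.integrable_fst'[OF G'] by simp
 then have "integrable \<L> (\<lambda>x. LINT y|lborel. G (x, y))" by (subst integrable_completion) auto
 then show "integrable \<L> (\<lambda>x. LINT y|\<L>. F (x, y))"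
  by (rule integrable_AE) (use * in auto)
 have "(LINT x|\<L>. LINT y|\<L>. F (x, y)) = (LINT x|\<L>. LINT y|lborel. G (x, y))"
  by (rule integral_AE) (use * in auto)
 also have "\<dots> = (LINT x|lborel. LINT y|lborel. G (x, y))"
  using \<open>integrable lborel (\<lambda>x. LINT y|lborel. G (x, y))\<close> by (intro integral_completion) auto
 also have "\<dots> = (LINT z|lborel. G z)"
  using lborel_pair.integral_fst'[OF G'] by (simp add: lborel_prod)
 also have "\<dots> = (LINT z|\<L>. F z)"
  using integral_lborel_eq[of F G] F G by auto
 finally show "(LINT x|\<L>. LINT y|\<L>. F (x, y)) = (LINT z|\<L>. F z)" .
qed

lemma integrable_swap:
 fixes F :: "'a::euclidean_space \<times> 'b::euclidean_space => complex"
 assumes F: "integrable \<L> F"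
 shows "integrable \<L> (\<lambda>z. F (snd z, fst z))"
proof -
 obtain G where G: "integrable lborel G" "AE x in \<L>. F x = G x"
  using borel_representative F by blast
 have G': "integrable (lborel \<Otimes>\<^sub>M lborel) G" using G(1) by (simp add: lborel_prod)
 have "integrable (lborel \<Otimes>\<^sub>M lborel) (\<lambda>(x, y). G (y, x))"
  by (rule lborel_pair.integrable_product_swap[OF G'])
 then have i: "integrable lborel (\<lambda>z. G (snd z, fst z))" by (simp add: lborel_prod case_prod_unfold)
 then have i': "integrable \<L> (\<lambda>z. G (snd z, fst z))"
  by (subst integrable_completion) (auto dest: borel_measurable_integrable)
 have "AE z in lborel \<Otimes>\<^sub>M lborel. F z = G z"
  using G(2) unfolding lborel_prod AE_completion_iff .
 then have "AE z in distr (lborel \<Otimes>\<^sub>M lborel) (lborel \<Otimes>\<^sub>M lborel) (\<lambda>(x, y). (y, x)). F z = G z"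
  using lborel_pair.distr_pair_swap by metis
 then have "AE z in lborel \<Otimes>\<^sub>M lborel. F (snd z, fst z) = G (snd z, fst z)"
  using AE_distrD[OF measurable_pair_swap'[of lborel lborel], where P = "\<lambda>z. F z = G z"] by (simp add: case_prod_unfold)
 then have "AE z in \<L>. F (snd z, fst z) = G (snd z, fst z)"
  unfolding lborel_prod AE_completion_iff .
 then show ?thesis by (rule integrable_AE[OF i'])
qed

text \<open>If \<open>f\<close> is not integrable its integral is 0, so the pointwise bound by an
  integrable \<open>g\<close> always suffices.\<close>

lemma norm_integral_le:
 fixes f :: "'a => 'b::{banach, second_countable_topology}"
 assumes "integrable M g" "\<And>x. norm (f x) \<le> g x"
 shows "norm (integral\<^sup>L M f) \<le> integral\<^sup>L M g"
proof -
 have "norm (integral\<^sup>L M f) \<le> (LINT x|M. norm (f x))" by (rule integral_norm_bound)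
 also have "\<dots> \<le> integral\<^sup>L M g"
  by (rule integral_mono'[OF assms(1)]) (use assms(2) order_trans[OF norm_ge_zero] in blast)+
 finally show ?thesis .
qed

section \<open>Translation invariance of Lebesgue measure\<close>

lemma lebesgue_shift: "distr \<L> \<L> (\<lambda>x. t + x) = (\<L> :: 'a::euclidean_space measure)"
proof -
 have "(\<lambda>x. t + (\<Sum>j\<in>Basis. (1 * (x \<bullet> j)) *\<^sub>R j)) = (\<lambda>x::'a. t + x)"
  by (simp add: euclidean_representation)
 then have "\<L> = density (distr \<L> \<L> (\<lambda>x::'a. t + x)) (\<lambda>_. 1)"
  using lebesgue_affine_euclidean[of "\<lambda>_. 1" t] by simp
 then show ?thesis by (simp only: density_1)
qed

lemma measurable_shift: "(\<lambda>x::'a::euclidean_space. t + x) \<in> \<L> \<rightarrow>\<^sub>M \<L>"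
proof -
 have "(\<lambda>x. t + (\<Sum>j\<in>Basis. (1 * (x \<bullet> j)) *\<^sub>R j)) = (\<lambda>x::'a. t + x)"
  by (simp add: euclidean_representation)
 then show ?thesis
  using lebesgue_affine_measurable[of "\<lambda>_. 1" t] by simp
qed

lemma integral_shift:
 fixes f :: "'a::euclidean_space => 'b::euclidean_space"
 shows "(LINT x|\<L>. f (x + t)) = (LINT x|\<L>. f x)"
proof -
 have *: "(LINT x|\<L>. f (x + t)) = (LINT x|\<L>. f x)" if "f \<in> borel_measurable \<L>" for f :: "'a => 'b" and t
  using integral_distr[OF measurable_shift[of t] that] by (simp add: lebesgue_shift[of t, unfolded add.commute[of t]] add.commute[of t])
 show ?thesis
 proof (cases "f \<in> borel_measurable \<L>")
  case False
  then have "(\<lambda>x. f (x + t)) \<notin> borel_measurable \<L>"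
   using measurable_compose[OF measurable_shift[of "- t"], of "\<lambda>x. f (x + t)" borel] by auto
  with False have "\<not> integrable \<L> f" "\<not> integrable \<L> (\<lambda>x. f (x + t))"
   by (blast dest: borel_measurable_integrable)+
  then show ?thesis by (simp add: not_integrable_integral_eq)
 qed (rule *)
qed

lemma integrable_shift:
 fixes f :: "'a::euclidean_space => 'b::euclidean_space"
 assumes "integrable \<L> f" shows "integrable \<L> (\<lambda>x. f (x + t))"
proof -
 have "integrable (distr \<L> \<L> (\<lambda>x. t + x)) f" using assms by (simp only: lebesgue_shift)
 from integrable_distr[OF measurable_shift this] show ?thesis by (simp only: add.commute[of t])
qed

lemma AE_shift:
 assumes "AE x in (\<L> :: 'a::euclidean_space measure). P x"
 shows "AE x in \<L>. P (x + t)"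
proof -
 have "AE x in distr \<L> \<L> (\<lambda>x. t + x). P x" using assms by (simp only: lebesgue_shift)
 from AE_distrD[OF measurable_shift this] show ?thesis by (simp only: add.commute[of t])
qed

section \<open>Approximation by continuous functions\<close>

lemma continuous_integrable:
 fixes f :: "'a::euclidean_space => 'b::{banach, second_countable_topology}"
 assumes "continuous_on UNIV f" "\<And>x. norm x > R ==> f x = 0"
 shows "integrable \<L> f"
proof -
 have "integrable lborel (\<lambda>x. indicator (cball 0 R) x *\<^sub>R f x)"
  by (rule borel_integrable_compact[OF compact_cball continuous_on_subset[OF assms(1) subset_UNIV]])
 also have "(\<lambda>x. indicator (cball 0 R) x *\<^sub>R f x) = f"
 proof
  fix x show "indicator (cball 0 R) x *\<^sub>R f x = f x"
   using assms(2)[of x] by (cases "norm x > R") auto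
 qed
 finally show ?thesis
  using borel_measurable_continuous_onI[OF assms(1)] by (subst integrable_completion) simp_all
qed

text \<open>For an indicator, a Urysohn function between an inner closed and an outer open set
  differs from it only on two thin layers; sums and dominated limits extend this to all integrable
  functions. The uniform bound on \<open>g\<close> later provides the majorant for
  mollifications.\<close>

lemma L1_approx_continuous:
 fixes f :: "'a::euclidean_space => complex"
 assumes "integrable \<L> f"
 shows "\<And>e. e > 0 ==> \<exists>g B. continuous_on UNIV g \<and> (\<forall>x. norm (g x) \<le> B) \<and> integrable \<L> g \<and> (LINT x|\<L>. norm (f x - g x)) < e"
 using assms
proof (induction rule: integrable_induct)
 case (base A c)
 \<comment> \<open>The two layers contribute at most \<open>2 * norm c * e'\<close>, which this
   choice keeps below \<open>e\<close>; the summand 1 covers \<open>c = 0\<close>.\<close>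
 define e' where "e' = e / (2 * norm c + 1)"
 have n: "2 * norm c + 1 > 0" using norm_ge_zero[of c] by linarith
 have e': "e' > 0" unfolding e'_def using base(3) n by simp
 obtain T where T: "open T" "A \<subseteq> T" "T - A \<in> lmeasurable" "emeasure \<L> (T - A) < ennreal e'"
  using sets_lebesgue_outer_open[OF base(1) e'] by metis
 obtain K where K: "closed K" "K \<subseteq> A" "A - K \<in> lmeasurable" "emeasure \<L> (A - K) < ennreal e'"
  using sets_lebesgue_inner_closed[OF base(1) e'] by metis
 obtain h :: "'a => real" where h: "continuous_on UNIV h" "\<And>x. h x \<in> closed_segment 1 0" "\<And>x. x \<in> K ==> h x = 1" "\<And>x. x \<in> - T ==> h x = 0"
  using Urysohn[of K "- T" 1 "0::real"] T K by (metis Compl_disjoint2 closed_Compl disjoint_eq_subset_Compl double_complement subset_trans)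
 have h01: "0 \<le> h x" "h x \<le> 1" for x using h(2)[of x] by (auto simp: closed_segment_eq_real_ivl)
 have A: "A \<in> lmeasurable" using base by (intro fmeasurableI) auto
 have TA: "T = A \<union> (T - A)" using T(2) by auto
 have Tm: "T \<in> lmeasurable" using A T(3) fmeasurable.Un[OF A T(3)] TA by simp
 define g where "g = (\<lambda>x. h x *\<^sub>R c)"
 have gc: "continuous_on UNIV g" unfolding g_def using h(1) by (intro continuous_intros)
 have "integrable \<L> h"
  by (rule integrable_dominated[of _ "indicator T :: 'a => real"])
   (use Tm h01 h(1) h(4) in \<open>auto simp: integrable_indicator_iff indicator_def fmeasurable_def less_top intro!: measurable_completion borel_measurable_continuous_onI AE_I2\<close>)
 then have gi: "integrable \<L> g" unfolding g_def by simp
 have "(LINT x|\<L>. norm (indicator A x *\<^sub>R c - g x)) \<le> (LINT x|\<L>. norm c * (indicator (T - A) x + indicator (A - K) x))"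
 proof (rule integral_mono)
  show "integrable \<L> (\<lambda>x. norm (indicator A x *\<^sub>R c - g x))"
   using gi A by (intro integrable_norm Bochner_Integration.integrable_diff integrable_scaleR_left) (auto simp: integrable_indicator_iff fmeasurable_def less_top)
  show "integrable \<L> (\<lambda>x. norm c * (indicator (T - A) x + indicator (A - K) x :: real))"
   using T(3) K(3) by (intro integrable_mult_right Bochner_Integration.integrable_add) (auto simp: integrable_indicator_iff fmeasurable_def less_top)
  fix x
  have "norm (indicator A x *\<^sub>R c - g x) = \<bar>indicator A x - h x\<bar> * norm c"
   unfolding g_def by (simp flip: scaleR_diff_left)
  also have "\<bar>indicator A x - h x\<bar> \<le> indicator (T - A) x + indicator (A - K) x"
   using h01[of x] h(3,4)[of x] T(2) K(2) by (auto simp: indicator_def)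
  finally show "norm (indicator A x *\<^sub>R c - g x) \<le> norm c * (indicator (T - A) x + indicator (A - K) x)"
   by (simp add: mult.commute mult_right_mono)
 qed
 also have "\<dots> = norm c * (measure \<L> (T - A) + measure \<L> (A - K))"
  using T(3) K(3) by (subst integral_mult_right_zero, subst Bochner_Integration.integral_add) (auto simp: integrable_indicator_iff fmeasurable_def less_top)
 also have "\<dots> \<le> norm c * (e' + e')"
  using T(3,4) K(3,4) e' by (intro mult_left_mono add_mono) (auto simp: emeasure_eq_measure2 ennreal_less_iff)
 also have "\<dots> = (2 * norm c / (2 * norm c + 1)) * e" unfolding e'_def by simp
 also have "\<dots> < 1 * e" by (rule mult_strict_right_mono) (use n base(3) in auto)
 finally have "(LINT x|\<L>. norm (indicator A x *\<^sub>R c - g x)) < e" by simp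
 moreover have "\<forall>x. norm (g x) \<le> norm c"
  unfolding g_def using h01 by (auto intro: mult_left_le_one_le)
 ultimately show ?case using gc gi by blast
next
 case (add f1 f2)
 have "e / 2 > 0" using add.prems by simp
 from add.IH(1)[OF this] add.IH(2)[OF this]
 obtain g1 B1 g2 B2 where g: "continuous_on UNIV g1" "\<forall>x. norm (g1 x) \<le> B1" "integrable \<L> g1" "(LINT x|\<L>. norm (f1 x - g1 x)) < e / 2"
  "continuous_on UNIV g2" "\<forall>x. norm (g2 x) \<le> B2" "integrable \<L> g2" "(LINT x|\<L>. norm (f2 x - g2 x)) < e / 2"
  by blast
 have "(LINT x|\<L>. norm (f1 x + f2 x - (g1 x + g2 x))) \<le> (LINT x|\<L>. norm (f1 x - g1 x) + norm (f2 x - g2 x))"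
  by (rule integral_mono) (use add.hyps g in \<open>auto simp: add_diff_add intro: norm_triangle_ineq\<close>)
 also have "\<dots> = (LINT x|\<L>. norm (f1 x - g1 x)) + (LINT x|\<L>. norm (f2 x - g2 x))"
  by (rule Bochner_Integration.integral_add) (use add.hyps g in auto)
 also have "\<dots> < e" using g by simp
 finally have "(LINT x|\<L>. norm (f1 x + f2 x - (g1 x + g2 x))) < e" .
 moreover have "\<forall>x. norm (g1 x + g2 x) \<le> B1 + B2" using g norm_triangle_mono by blast
 ultimately show ?case using g by (intro exI[of _ "\<lambda>x. g1 x + g2 x"] exI[of _ "B1 + B2"]) (auto intro: continuous_intros)
next
 case (lim f s)
 have "(\<lambda>i. LINT x|\<L>. norm (f x - s i x)) \<longlonglongrightarrow> (LINT x|\<L>. norm (f x - f x))"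
 proof (rule integral_dominated_convergence)
  show "integrable \<L> (\<lambda>x. 3 * norm (f x))" using lim.hyps(4) by auto
  show "AE x in \<L>. (\<lambda>i. norm (f x - s i x)) \<longlonglongrightarrow> norm (f x - f x)"
   by (intro AE_I2 tendsto_norm tendsto_diff tendsto_const lim.hyps(2)) simp
  show "AE x in \<L>. norm (norm (f x - s i x)) \<le> 3 * norm (f x)" for i
  proof (rule AE_I2)
   fix x
   have "norm (s i x) \<le> 2 * norm (f x)" using lim.hyps(3)[of x i] by simp
   then show "norm (norm (f x - s i x)) \<le> 3 * norm (f x)" using norm_triangle_ineq4[of "f x" "s i x"] by simp
  qed
 qed (use lim.hyps in auto)
 then have "eventually (\<lambda>i. (LINT x|\<L>. norm (f x - s i x)) < e / 2) sequentially"
  using lim.prems by (intro order_tendstoD) auto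
 then obtain i where i: "(LINT x|\<L>. norm (f x - s i x)) < e / 2" by (auto simp: eventually_sequentially)
 have "e / 2 > 0" using lim.prems by simp
 from lim.IH[OF this, of i] obtain g B where g: "continuous_on UNIV g" "\<forall>x. norm (g x) \<le> B" "integrable \<L> g" "(LINT x|\<L>. norm (s i x - g x)) < e / 2" by blast
 have "(LINT x|\<L>. norm (f x - g x)) \<le> (LINT x|\<L>. norm (f x - s i x) + norm (s i x - g x))"
  by (rule integral_mono) (use lim.hyps(1,4) g norm_triangle_sub in \<open>auto intro: norm_diff_triangle_le\<close>)
 also have "\<dots> = (LINT x|\<L>. norm (f x - s i x)) + (LINT x|\<L>. norm (s i x - g x))"
  by (rule Bochner_Integration.integral_add) (use lim.hyps(1,4) g in auto)
 also have "\<dots> < e" using i g by simp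
 finally show ?case using g by blast
qed

section \<open>Mollification\<close>

definition mass :: "real => real" where
 "mass r = (LINT z|\<L>. bump r 0 z)"

text \<open>The convolution before division by \<open>mass r\<close>. The shift \<open>p\<close>
  displaces the averaging ball from \<open>y\<close> to \<open>y - p\<close>, so that it can be kept
  inside a domain even when \<open>y\<close> is close to the boundary.\<close>

definition moll :: "real => R3 => (R3 => complex) => R3 => complex" where
 "moll r p g y = (LINT z|\<L>. g z * of_real (bump r (y - p) z))"

lemma bump_outside: "r > 0 ==> norm z > r + norm q ==> bump r q z = 0"
 using norm_triangle_ineq2[of z q] by (auto simp: bump_0_iff dist_norm)

lemma integrable_bump: "r > 0 ==> integrable \<L> (bump r q)"
 by (rule continuous_integrable[where R = "r + norm q"]) (auto intro: smooth_continuous smooth_bump bump_outside)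

lemma integral_bump: "(LINT z|\<L>. bump r q z) = mass r"
 using integral_shift[of "bump r q" q] by (simp add: bump_shift mass_def)

lemma mass_pos: assumes "r > 0" shows "mass r > 0"
proof (rule ccontr)
 assume "\<not> mass r > 0"
 moreover have "mass r \<ge> 0" unfolding mass_def by (rule Bochner_Integration.integral_nonneg) (simp add: bump_nonneg)
 ultimately have "mass r = 0" by simp
 then have "AE z in \<L>. bump r 0 z = 0"
  unfolding mass_def using integral_nonneg_eq_0_iff_AE[OF integrable_bump[OF assms]] by (simp add: bump_nonneg)
 then have "AE z in \<L>. z \<notin> ball (0::R3) r"
  by eventually_elim (use assms in \<open>simp add: bump_0_iff dist_commute\<close>)
 then have "ball (0::R3) r \<in> null_sets \<L>" by (simp add: AE_iff_null_sets)
 then have "negligible (ball (0::R3) r)" by (simp add: negligible_iff_null_sets)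
 then show False using assms open_not_negligible[of "ball (0::R3) r"] by auto
qed

lemma borel_bump: "(\<lambda>(y, z). complex_of_real (bump r (y - p) z)) \<in> borel_measurable borel"
 "(\<lambda>(y, z). bump r (y - p) z) \<in> borel_measurable borel"
proof -
 have "continuous_on UNIV (expinv 0)" by (rule smooth_continuous[OF smooth_expinv])
 then have "continuous_on UNIV (\<lambda>x. bump r (fst x - p) (snd x))"
  unfolding bump_def by (rule continuous_on_compose2) (auto intro!: continuous_intros)
 then show "(\<lambda>(y, z). bump r (y - p) z) \<in> borel_measurable borel"
  "(\<lambda>(y, z). complex_of_real (bump r (y - p) z)) \<in> borel_measurable borel"
  by (auto simp: case_prod_unfold intro!: borel_measurable_continuous_onI continuous_intros)
qed

lemma moll_Fubini:
 assumes "integrable \<L> s" "integrable \<L> g"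
 shows "integrable \<L> (\<lambda>y. s y * moll r p g y)"
  "(LINT y|\<L>. s y * moll r p g y) = (LINT z|\<L>. g z * (LINT y|\<L>. s y * of_real (bump r (y - p) z)))"
proof -
 have *: "norm (complex_of_real (bump r (y - p) z)) \<le> 1" for y z by (simp add: abs_of_nonneg bump_nonneg bump_le_1)
 show "integrable \<L> (\<lambda>y. s y * moll r p g y)"
  "(LINT y|\<L>. s y * moll r p g y) = (LINT z|\<L>. g z * (LINT y|\<L>. s y * of_real (bump r (y - p) z)))"
  unfolding moll_def using kernel_Fubini[OF assms borel_bump(1) *] by simp_all
qed

lemma integrable_mult_bump:
 fixes g :: "R3 => complex"
 assumes "integrable \<L> g" shows "integrable \<L> (\<lambda>z. g z * of_real (bump r q z))"
proof (rule integrable_mult_bounded[OF assms])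
 have "continuous_on UNIV (bump r q)" by (rule smooth_continuous[OF smooth_bump])
 then show "(\<lambda>z. complex_of_real (bump r q z)) \<in> borel_measurable \<L>"
  by (intro measurable_completion) (auto intro!: borel_measurable_continuous_onI continuous_intros)
 show "norm (complex_of_real (bump r q z)) \<le> 1" for z by (simp add: abs_of_nonneg bump_nonneg bump_le_1)
qed

lemma moll_diff:
 assumes "integrable \<L> f" "integrable \<L> g"
 shows "moll r p (\<lambda>x. f x - g x) y = moll r p f y - moll r p g y"
 unfolding moll_def
 by (simp add: left_diff_distrib Bochner_Integration.integral_diff integrable_mult_bump assms)

text \<open>Applied twice: \<open>c = g y\<close> yields pointwise convergence for continuous
  \<open>g\<close>, and \<open>c = 0\<close> yields a bound that is uniform in \<open>r\<close> and
  \<open>p\<close>.\<close>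

lemma moll_bounded:
 fixes c :: complex
 assumes r: "r > 0" and g: "integrable \<L> g" and b: "\<And>z. dist z (y - p) < r ==> norm (g z - c) \<le> B"
 shows "norm (moll r p g y - mass r * c) \<le> mass r * B"
proof -
 have "mass r * c = (LINT z|\<L>. c * of_real (bump r (y - p) z))"
  by (simp add: integral_bump)
 then have "moll r p g y - mass r * c = (LINT z|\<L>. (g z - c) * of_real (bump r (y - p) z))"
  unfolding moll_def by (simp add: left_diff_distrib integrable_mult_bump[OF g] integrable_bump[OF r])
 also have "norm \<dots> \<le> (LINT z|\<L>. B * bump r (y - p) z)"
 proof (rule norm_integral_le)
  show "integrable \<L> (\<lambda>z. B * bump r (y - p) z)" using integrable_bump[OF r] by simp
  fix z
  show "norm ((g z - c) * of_real (bump r (y - p) z)) \<le> B * bump r (y - p) z"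
  proof (cases "dist z (y - p) < r")
   case True
   then show ?thesis using b[OF True] bump_nonneg[of r "y - p" z] by (simp add: norm_mult mult_right_mono)
  next
   case False
   then have "bump r (y - p) z = 0" using r by (simp add: bump_0_iff)
   then show ?thesis by simp
  qed
 qed
 also have "\<dots> = mass r * B" by (simp add: integral_bump)
 finally show ?thesis .
qed

lemma moll_pointwise:
 assumes r: "\<And>n. r n > 0" "r \<longlonglongrightarrow> 0" "p \<longlonglongrightarrow> 0" and g: "continuous_on UNIV g" "integrable \<L> g"
 shows "(\<lambda>n. moll (r n) (p n) g y / mass (r n)) \<longlonglongrightarrow> g y"
proof (rule LIMSEQ_I)
 fix e :: real assume e: "e > 0"
 have "isCont g y" using g(1) by (simp add: continuous_on_eq_continuous_at)
 then obtain d where d: "d > 0" "\<And>z. dist z y < d ==> dist (g z) (g y) < e / 2"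
  using e by (metis continuous_at_eps_delta dist_norm half_gt_zero)
 have "(\<lambda>n. r n + norm (p n)) \<longlonglongrightarrow> 0" using r by (auto intro: tendsto_eq_intros)
 then have "eventually (\<lambda>n. r n + norm (p n) < d) sequentially" using d(1) by (rule order_tendstoD)
 then obtain N where N: "\<And>n. n \<ge> N ==> r n + norm (p n) < d" by (auto simp: eventually_sequentially)
 have "norm (moll (r n) (p n) g y / mass (r n) - g y) < e" if "n \<ge> N" for n
 proof -
  have "norm (g z - g y) \<le> e / 2" if z: "dist z (y - p n) < r n" for z
  proof -
   have "dist z y \<le> dist z (y - p n) + norm (p n)"
    using norm_triangle_ineq4[of "z - (y - p n)" "p n"] by (simp add: dist_norm)
   then have "dist z y < d" using z N[OF \<open>n \<ge> N\<close>] by linarith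
   then show ?thesis using d(2)[of z] by (simp add: dist_norm)
  qed
  from moll_bounded[OF r(1) g(2) this] have *: "norm (moll (r n) (p n) g y - mass (r n) * g y) \<le> mass (r n) * (e / 2)" by blast
  have m: "mass (r n) > 0" using mass_pos r by blast
  have "moll (r n) (p n) g y / mass (r n) - g y = (moll (r n) (p n) g y - mass (r n) * g y) / mass (r n)"
   using m by (simp add: field_simps)
  then have "norm (moll (r n) (p n) g y / mass (r n) - g y) = norm (moll (r n) (p n) g y - mass (r n) * g y) / mass (r n)"
   using m by (simp add: norm_divide)
  also have "\<dots> \<le> e / 2" using * m by (simp add: divide_le_eq mult.commute)
  finally show ?thesis using e by simp
 qed
 then show "\<exists>N. \<forall>n\<ge>N. norm (moll (r n) (p n) g y / mass (r n) - g y) < e" by blast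
qed

text \<open>The kernel has integral \<open>mass r\<close> in each of its two variables, so
  mollification tested with a bounded \<open>s\<close> is continuous in L1 uniformly in
  \<open>n\<close>. This reduces the limit to continuous bounded \<open>h\<close>, where dominated
  convergence applies.\<close>

lemma moll_L1:
 assumes r: "\<And>n. r n > 0" "r \<longlonglongrightarrow> 0" "p \<longlonglongrightarrow> 0" and g: "integrable \<L> g"
  and s: "integrable \<L> s" "\<And>y. norm (s y) \<le> M"
 shows "(\<lambda>n. (LINT y|\<L>. s y * moll (r n) (p n) g y) / mass (r n)) \<longlonglongrightarrow> (LINT y|\<L>. s y * g y)"
proof (rule LIMSEQ_I)
 fix e :: real assume e: "e > 0"
 have M: "M \<ge> 0" using s(2) norm_ge_zero order_trans by blast
 \<comment> \<open>Makes \<open>M * d\<close> smaller than a third of \<open>e\<close>, once for the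
   mollified error and once for the plain one; the summand 1 covers \<open>M = 0\<close>.\<close>
 define d where "d = e / (3 * (M + 1))"
 have d: "d > 0" "M * d < e / 3" using e M by (auto simp: d_def field_simps)
 obtain h B where h: "continuous_on UNIV h" "\<And>x. norm (h x) \<le> B" "integrable \<L> h" "(LINT x|\<L>. norm (g x - h x)) < d"
  using L1_approx_continuous[OF g d(1)] by blast
 have gh: "integrable \<L> (\<lambda>x. g x - h x)" using g h by simp
 have sm: "s \<in> borel_measurable \<L>" using s by auto
 have bnd: "norm ((LINT y|\<L>. s y * moll (r n) (p n) f y) / mass (r n)) \<le> M * (LINT x|\<L>. norm (f x))"
  if f: "integrable \<L> f" for f n
 proof -
  have rn: "r n > 0" by (rule r)
  have m: "mass (r n) > 0" using mass_pos r by blast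
  have "norm (LINT y|\<L>. s y * of_real (bump (r n) (y - p n) z)) \<le> (LINT y|\<L>. M * bump (r n) (z + p n) y)" for z
  proof -
   have eq: "bump (r n) (y - p n) z = bump (r n) (z + p n) y" for y
    by (simp add: bump_def algebra_simps inner_commute)
   show ?thesis unfolding eq
    by (rule norm_integral_le)
     (use s integrable_bump[OF rn] in \<open>auto simp: norm_mult abs_of_nonneg bump_nonneg mult_right_mono\<close>)
  qed
  then have z: "norm (LINT y|\<L>. s y * of_real (bump (r n) (y - p n) z)) \<le> M * mass (r n)" for z
   by (simp add: integral_bump)
  have M0: "M * mass (r n) \<ge> 0" using M m by simp
  have "norm (LINT y|\<L>. s y * moll (r n) (p n) f y) = norm (LINT z|\<L>. f z * (LINT y|\<L>. s y * of_real (bump (r n) (y - p n) z)))"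
   by (simp add: moll_Fubini(2)[OF s(1) f])
  also have "\<dots> \<le> (LINT z|\<L>. norm (f z) * (M * mass (r n)))"
   by (rule norm_integral_le) (use f z in \<open>auto simp: norm_mult intro: mult_left_mono\<close>)
  also have "\<dots> = M * (LINT x|\<L>. norm (f x)) * mass (r n)" by simp
  finally show ?thesis using m by (simp add: norm_divide divide_le_eq)
 qed
 have "(\<lambda>n. LINT y|\<L>. s y * (moll (r n) (p n) h y / mass (r n))) \<longlonglongrightarrow> (LINT y|\<L>. s y * h y)"
 proof (rule integral_dominated_convergence)
  show "(\<lambda>y. s y * h y) \<in> borel_measurable \<L>" using sm h(3) by auto
  show "(\<lambda>y. s y * (moll (r n) (p n) h y / mass (r n))) \<in> borel_measurable \<L>" for n
   using borel_measurable_divide[OF borel_measurable_integrable[OF moll_Fubini(1)[OF s(1) h(3), of "r n" "p n"]], of "\<lambda>_. of_real (mass (r n))"]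
   by simp
  show "integrable \<L> (\<lambda>x. norm (s x) * B)" using s by simp
  show "AE y in \<L>. (\<lambda>n. s y * (moll (r n) (p n) h y / mass (r n))) \<longlonglongrightarrow> s y * h y"
   by (intro AE_I2 tendsto_mult tendsto_const moll_pointwise[OF r h(1,3)])
  show "AE y in \<L>. norm (s y * (moll (r n) (p n) h y / mass (r n))) \<le> norm (s y) * B" for n
  proof (rule AE_I2)
   fix y
   have "norm (moll (r n) (p n) h y - mass (r n) * (0::complex)) \<le> mass (r n) * B"
    by (rule moll_bounded[OF r(1) h(3)]) (simp add: h(2))
   then show "norm (s y * (moll (r n) (p n) h y / mass (r n))) \<le> norm (s y) * B"
    using mass_pos[OF r(1)[of n]] by (simp add: norm_mult norm_divide divide_le_eq mult_left_mono mult_ac)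
      (use mult_left_mono[of "cmod (moll (r n) (p n) h y)" "B * mass (r n)" "cmod (s y)"] in \<open>simp add: mult_ac\<close>)
  qed
 qed
 then have "(\<lambda>n. (LINT y|\<L>. s y * moll (r n) (p n) h y) / mass (r n)) \<longlonglongrightarrow> (LINT y|\<L>. s y * h y)"
  by simp
 moreover have "e / 3 > 0" using e by simp
 ultimately obtain N where N: "\<And>n. n \<ge> N ==> norm ((LINT y|\<L>. s y * moll (r n) (p n) h y) / mass (r n) - (LINT y|\<L>. s y * h y)) < e / 3"
  using LIMSEQ_D by blast
 have "norm ((LINT y|\<L>. s y * moll (r n) (p n) g y) / mass (r n) - (LINT y|\<L>. s y * g y)) < e" if n: "n \<ge> N" for n
 proof -
  let ?I = "\<lambda>f. (LINT y|\<L>. s y * moll (r n) (p n) f y) / mass (r n)"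
  have 1: "?I g = ?I h + ?I (\<lambda>x. g x - h x)"
   using moll_diff[OF g h(3)] moll_Fubini(1)[OF s(1) g] moll_Fubini(1)[OF s(1) h(3)]
   by (simp add: right_diff_distrib diff_divide_distrib)
  have sg: "integrable \<L> (\<lambda>y. s y * f y)" if "integrable \<L> f" for f
   using integrable_mult_bounded[OF that sm s(2)] by (simp add: mult.commute)
  have 2: "(LINT y|\<L>. s y * g y) = (LINT y|\<L>. s y * h y) + (LINT y|\<L>. s y * (g y - h y))"
   using sg[OF g] sg[OF h(3)] by (simp add: right_diff_distrib)
  have "norm (LINT y|\<L>. s y * (g y - h y)) \<le> (LINT y|\<L>. M * norm (g y - h y))"
   by (rule norm_integral_le) (use gh s in \<open>auto simp: norm_mult intro: mult_right_mono\<close>)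
  also have "\<dots> = M * (LINT y|\<L>. norm (g y - h y))" by simp
  also have "\<dots> < e / 3" using mult_left_mono[OF less_imp_le[OF h(4)] M] d by linarith
  finally have 3: "norm (LINT y|\<L>. s y * (g y - h y)) < e / 3" .
  have 4: "norm (?I (\<lambda>x. g x - h x)) < e / 3"
   using bnd[OF gh, of n] mult_left_mono[OF less_imp_le[OF h(4)] M] d(2) by linarith
  have "?I g - (LINT y|\<L>. s y * g y) = (?I h - (LINT y|\<L>. s y * h y)) + ?I (\<lambda>x. g x - h x) - (LINT y|\<L>. s y * (g y - h y))"
   unfolding 1 2 by simp
  also have "norm \<dots> < e"
   using 3 4 N[OF n] by norm
  finally show ?thesis .
 qed
 then show "\<exists>N. \<forall>n\<ge>N. norm ((LINT y|\<L>. s y * moll (r n) (p n) g y) / mass (r n) - (LINT y|\<L>. s y * g y)) < e" by blast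
qed

text \<open>Young's inequality with weight \<open>t\<close> under the integral replaces the product
  of \<open>f\<close> and \<open>g\<close> by their squares, and the kernel is then integrated out
  in the other variable. The free weight stands in for the Cauchy-Schwarz inequality.\<close>

lemma moll_L2_bound:
 assumes r: "r > 0" and t: "t > 0"
  and f: "f \<in> borel_measurable \<L>" "integrable \<L> (\<lambda>x. (norm (f x))\<^sup>2)" "\<And>x. norm x > R ==> f x = 0"
  and g: "integrable \<L> g" "integrable \<L> (\<lambda>x. (norm (g x))\<^sup>2)"
 shows "norm (LINT y|\<L>. f y * moll r p g y)
  \<le> mass r * (t / 2 * (LINT x|\<L>. (norm (f x))\<^sup>2) + (LINT x|\<L>. (norm (g x))\<^sup>2) / (2 * t))"
proof -
 \<comment> \<open>Fubini needs an integrable factor in \<open>y\<close>. The constant 1 is not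
   integrable, but the indicator of a ball containing the support of \<open>f\<close> does the same
   work.\<close>
 define B where "B = (indicator (cball 0 R) :: R3 => real)"
 define G where "G = (\<lambda>z. (norm (g z))\<^sup>2)"
 have B: "integrable \<L> B" unfolding B_def
  using emeasure_bounded_finite[OF bounded_cball, of "0::R3" R] by (simp add: integrable_indicator_iff less_top)
 have k1: "norm (bump r (y - p) z) \<le> 1" for y z by (simp add: abs_of_nonneg bump_nonneg bump_le_1)
 note K = kernel_Fubini_real[OF B g(2) borel_bump(2) k1]
 have mb: "bump r q \<in> borel_measurable \<L>" for q
  using integrable_bump[OF r] by blast
 have iG: "integrable \<L> (\<lambda>z. G z * bump r (y - p) z)" for y
  unfolding G_def by (rule integrable_mult_bounded[OF g(2) mb k1])
 have "norm (f y * moll r p g y) \<le> t / 2 * mass r * (norm (f y))\<^sup>2 + 1 / (2 * t) * (B y * (LINT z|\<L>. G z * bump r (y - p) z))" for y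
 proof (cases "norm y > R")
  case True
  then have "B y = 0" "f y = 0" using f(3) by (auto simp: B_def)
  then show ?thesis by simp
 next
  case False
  have "norm (f y * moll r p g y) = norm (LINT z|\<L>. f y * (g z * of_real (bump r (y - p) z)))"
   unfolding moll_def by (simp del: mult.assoc)
  also have "\<dots> \<le> (LINT z|\<L>. t / 2 * (norm (f y))\<^sup>2 * bump r (y - p) z + 1 / (2 * t) * (G z * bump r (y - p) z))"
  proof (rule norm_integral_le)
   show "integrable \<L> (\<lambda>z. t / 2 * (norm (f y))\<^sup>2 * bump r (y - p) z + 1 / (2 * t) * (G z * bump r (y - p) z))"
    by (intro Bochner_Integration.integrable_add integrable_mult_right iG integrable_bump r)
   fix z
   have "norm (f y) * norm (g z) \<le> t / 2 * (norm (f y))\<^sup>2 + 1 / (2 * t) * (norm (g z))\<^sup>2"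
   proof -
    have "0 \<le> (t * norm (f y) - norm (g z))\<^sup>2" by simp
    then have "2 * t * (norm (f y) * norm (g z)) \<le> t * t * (norm (f y))\<^sup>2 + (norm (g z))\<^sup>2"
     by (simp add: power2_eq_square algebra_simps)
    then show ?thesis using t by (simp add: field_simps power2_eq_square)
   qed
   from mult_right_mono[OF this bump_nonneg]
   show "norm (f y * (g z * of_real (bump r (y - p) z))) \<le> t / 2 * (norm (f y))\<^sup>2 * bump r (y - p) z + 1 / (2 * t) * (G z * bump r (y - p) z)"
    by (simp add: norm_mult abs_of_nonneg bump_nonneg G_def algebra_simps)
  qed
  also have "\<dots> = t / 2 * (norm (f y))\<^sup>2 * mass r + 1 / (2 * t) * (LINT z|\<L>. G z * bump r (y - p) z)"
   by (subst Bochner_Integration.integral_add) (auto intro!: iG integrable_bump r simp: integral_bump)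
  also have "\<dots> = t / 2 * mass r * (norm (f y))\<^sup>2 + 1 / (2 * t) * (B y * (LINT z|\<L>. G z * bump r (y - p) z))"
   using False by (simp add: B_def)
  finally show ?thesis .
 qed
 then have "norm (LINT y|\<L>. f y * moll r p g y) \<le> (LINT y|\<L>. t / 2 * mass r * (norm (f y))\<^sup>2 + 1 / (2 * t) * (B y * (LINT z|\<L>. G z * bump r (y - p) z)))"
  by (rule norm_integral_le[rotated]) (use K(1) f(2) in \<open>auto simp: G_def\<close>)
 also have "\<dots> = t / 2 * mass r * (LINT y|\<L>. (norm (f y))\<^sup>2) + 1 / (2 * t) * (LINT y|\<L>. B y * (LINT z|\<L>. G z * bump r (y - p) z))"
  by (subst Bochner_Integration.integral_add) (use K(1) f(2) in \<open>auto simp: G_def\<close>)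
 also have "(LINT y|\<L>. B y * (LINT z|\<L>. G z * bump r (y - p) z)) = (LINT z|\<L>. G z * (LINT y|\<L>. B y * bump r (y - p) z))"
  unfolding G_def by (rule K(2))
 also have "t / 2 * mass r * (LINT y|\<L>. (norm (f y))\<^sup>2) + 1 / (2 * t) * (LINT z|\<L>. G z * (LINT y|\<L>. B y * bump r (y - p) z))
  \<le> t / 2 * mass r * (LINT y|\<L>. (norm (f y))\<^sup>2) + 1 / (2 * t) * (LINT z|\<L>. G z * mass r)"
 proof (intro add_left_mono mult_left_mono)
  show "0 \<le> 1 / (2 * t)" using t by simp
  show "(LINT z|\<L>. G z * (LINT y|\<L>. B y * bump r (y - p) z)) \<le> (LINT z|\<L>. G z * mass r)"
 proof (rule integral_mono')
  show "integrable \<L> (\<lambda>z. G z * mass r)" using g(2) by (simp add: G_def)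
  fix z
  show "0 \<le> G z * mass r" using mass_pos[OF r] by (simp add: G_def)
  have e: "bump r (y - p) z = bump r (z + p) y" for y by (simp add: bump_def algebra_simps inner_commute)
  have "(LINT y|\<L>. B y * bump r (y - p) z) \<le> (LINT y|\<L>. bump r (z + p) y)"
   unfolding e by (rule integral_mono') (auto simp: integrable_bump[OF r] bump_nonneg B_def indicator_def)
  then show "G z * (LINT y|\<L>. B y * bump r (y - p) z) \<le> G z * mass r"
   by (intro mult_left_mono) (auto simp: integral_bump G_def)
 qed
 qed
 finally show ?thesis by (simp add: G_def algebra_simps)
qed

text \<open>Truncate \<open>s\<close> at height \<open>M\<close>: the bounded part is covered by
  \<open>moll_L1\<close>, and the remainder is small in L2, hence small in the pairing by
  \<open>moll_L2_bound\<close>.\<close>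

lemma moll_L2:
 assumes r: "\<And>n. r n > 0" "r \<longlonglongrightarrow> 0" "p \<longlonglongrightarrow> 0"
  and s: "integrable \<L> s" "integrable \<L> (\<lambda>x. (norm (s x))\<^sup>2)" "\<And>x. norm x > R ==> s x = 0"
  and g: "integrable \<L> g" "integrable \<L> (\<lambda>x. (norm (g x))\<^sup>2)"
 shows "(\<lambda>n. (LINT y|\<L>. s y * moll (r n) (p n) g y) / mass (r n)) \<longlonglongrightarrow> (LINT y|\<L>. s y * g y)"
proof (rule LIMSEQ_I)
 fix e :: real assume e: "e > 0"
 define G where "G = (LINT x|\<L>. (norm (g x))\<^sup>2)"
 have G: "G \<ge> 0" unfolding G_def by simp
 \<comment> \<open>Gives \<open>G / (2 * t) \<le> e / 8\<close>. The truncation height is fixed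
   afterwards so that the other summand of the bound is below \<open>e / 8\<close> too.\<close>
 define t where "t = 4 * (G + 1) / e"
 have t: "t > 0" "G / (2 * t) \<le> e / 8"
 proof -
  show "t > 0" using e G by (simp add: t_def)
  have "G / (2 * t) = e / 8 * (G / (G + 1))" using e G by (simp add: t_def field_simps)
  also have "\<dots> \<le> e / 8 * 1" by (rule mult_left_mono) (use e G in auto)
  finally show "G / (2 * t) \<le> e / 8" by simp
 qed
 define b where "b = (\<lambda>M y. if norm (s y) \<le> real M then s y else 0)"
 define d where "d = (\<lambda>M y. s y - b M y)"
 have [measurable]: "s \<in> borel_measurable \<L>" using s by auto
 have bm [measurable]: "b M \<in> borel_measurable \<L>" for M unfolding b_def by measurable
 have dn: "norm (d M y) \<le> norm (s y)" and bn: "norm (b M y) \<le> norm (s y)" for M y by (auto simp: d_def b_def)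
 have dm [measurable]: "d M \<in> borel_measurable \<L>" for M unfolding d_def by measurable
 have bi: "integrable \<L> (b M)" and di: "integrable \<L> (d M)" for M
  by (rule integrable_dominated[OF s(1)]; use bn dn in auto)+
 have d2: "integrable \<L> (\<lambda>y. (norm (d M y))\<^sup>2)" for M
  by (rule integrable_dominated[OF s(2)]) (use dn in \<open>auto intro!: power_mono\<close>)
 have "(\<lambda>M. LINT y|\<L>. (norm (d M y))\<^sup>2) \<longlonglongrightarrow> (LINT y|(\<L>::R3 measure). 0)"
 proof (rule integral_dominated_convergence[OF _ _ s(2)])
  show "AE y in \<L>. (\<lambda>M. (norm (d M y))\<^sup>2) \<longlonglongrightarrow> 0"
  proof (rule AE_I2)
   fix y
   obtain M0 where "norm (s y) \<le> real M0" using real_arch_simple by blast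
   then have "d M y = 0" if "M \<ge> M0" for M using that by (auto simp: d_def b_def)
   then show "(\<lambda>M. (norm (d M y))\<^sup>2) \<longlonglongrightarrow> 0"
    by (intro tendsto_eventually) (auto simp: eventually_sequentially)
  qed
 qed (use dn in \<open>auto intro!: AE_I2 power_mono\<close>)
 then have "(\<lambda>M. LINT y|\<L>. (norm (d M y))\<^sup>2) \<longlonglongrightarrow> 0" by simp
 moreover have "e / (4 * t) > 0" using e t by simp
 ultimately have "eventually (\<lambda>M. (LINT y|\<L>. (norm (d M y))\<^sup>2) < e / (4 * t)) sequentially"
  by (rule order_tendstoD)
 then obtain M where M: "(LINT y|\<L>. (norm (d M y))\<^sup>2) < e / (4 * t)" by (auto simp: eventually_sequentially)
 have tb: "t / 2 * (LINT y|\<L>. (norm (d M y))\<^sup>2) + G / (2 * t) < e / 4"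
 proof -
  have "t / 2 * (LINT y|\<L>. (norm (d M y))\<^sup>2) < t / 2 * (e / (4 * t))"
   by (rule mult_strict_left_mono[OF M]) (use t in simp)
  also have "\<dots> = e / 8" using t by simp
  finally show ?thesis using t(2) by linarith
 qed
 have 1: "norm ((LINT y|\<L>. d M y * moll (r n) (p n) g y) / mass (r n)) < e / 4" for n
 proof -
  have m: "mass (r n) > 0" using mass_pos r by blast
  have "norm (LINT y|\<L>. d M y * moll (r n) (p n) g y) \<le> mass (r n) * (t / 2 * (LINT y|\<L>. (norm (d M y))\<^sup>2) + G / (2 * t))"
   unfolding G_def by (rule moll_L2_bound[OF r(1) t(1) dm d2 _ g]) (use s(3) in \<open>auto simp: d_def b_def\<close>)
  also have "\<dots> < mass (r n) * (e / 4)" by (rule mult_strict_left_mono[OF tb m])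
  finally show ?thesis using m by (simp add: norm_divide divide_less_eq mult.commute)
 qed
 have amgm: "norm (d M y) * norm (g y) \<le> t / 2 * (norm (d M y))\<^sup>2 + 1 / (2 * t) * (norm (g y))\<^sup>2" for y
 proof -
  have "0 \<le> (t * norm (d M y) - norm (g y))\<^sup>2" by simp
  then have "2 * t * (norm (d M y) * norm (g y)) \<le> t * t * (norm (d M y))\<^sup>2 + (norm (g y))\<^sup>2"
   by (simp add: power2_eq_square algebra_simps)
  then show ?thesis using t by (simp add: field_simps power2_eq_square)
 qed
 have "norm (LINT y|\<L>. d M y * g y) \<le> (LINT y|\<L>. t / 2 * (norm (d M y))\<^sup>2 + 1 / (2 * t) * (norm (g y))\<^sup>2)"
  by (rule norm_integral_le) (use d2 g amgm in \<open>auto simp: norm_mult\<close>)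
 also have "\<dots> = t / 2 * (LINT y|\<L>. (norm (d M y))\<^sup>2) + G / (2 * t)"
  unfolding G_def by (subst Bochner_Integration.integral_add) (use d2 g in auto)
 finally have 2: "norm (LINT y|\<L>. d M y * g y) < e / 4" using tb by simp
 have "(\<lambda>n. (LINT y|\<L>. b M y * moll (r n) (p n) g y) / mass (r n)) \<longlonglongrightarrow> (LINT y|\<L>. b M y * g y)"
  by (rule moll_L1[OF r g(1) bi, where M = "real M"]) (auto simp: b_def)
 moreover have "e / 2 > 0" using e by simp
 ultimately obtain N where N: "\<And>n. n \<ge> N ==> norm ((LINT y|\<L>. b M y * moll (r n) (p n) g y) / mass (r n) - (LINT y|\<L>. b M y * g y)) < e / 2"
  using LIMSEQ_D by blast
 have sd: "s y = d M y + b M y" for y by (simp add: d_def)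
 have dg: "integrable \<L> (\<lambda>y. d M y * g y)"
  by (rule integrable_dominated[of _ "\<lambda>y. t / 2 * (norm (d M y))\<^sup>2 + 1 / (2 * t) * (norm (g y))\<^sup>2"])
   (use d2 g amgm in \<open>auto simp: norm_mult intro!: AE_I2 order_trans[OF _ abs_ge_self]\<close>)
 have bg: "integrable \<L> (\<lambda>y. b M y * g y)"
  using integrable_mult_bounded[OF g(1) bm, of M "real M"] by (simp add: mult.commute b_def)
 have "norm ((LINT y|\<L>. s y * moll (r n) (p n) g y) / mass (r n) - (LINT y|\<L>. s y * g y)) < e" if n: "n \<ge> N" for n
 proof -
  let ?I = "\<lambda>f. (LINT y|\<L>. f y * moll (r n) (p n) g y) / mass (r n)"
  have 3: "?I s = ?I (d M) + ?I (b M)"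
   unfolding sd distrib_right by (simp add: add_divide_distrib moll_Fubini(1)[OF di g(1)] moll_Fubini(1)[OF bi g(1)])
  have 4: "(LINT y|\<L>. s y * g y) = (LINT y|\<L>. d M y * g y) + (LINT y|\<L>. b M y * g y)"
   unfolding sd distrib_right by (simp add: dg bg)
  have "?I s - (LINT y|\<L>. s y * g y) = ?I (d M) + (?I (b M) - (LINT y|\<L>. b M y * g y)) - (LINT y|\<L>. d M y * g y)"
   unfolding 3 4 by simp
  also have "norm \<dots> < e" using 1[of n] 2 N[OF n] by norm
  finally show ?thesis .
 qed
 then show "\<exists>N. \<forall>n\<ge>N. norm ((LINT y|\<L>. s y * moll (r n) (p n) g y) / mass (r n) - (LINT y|\<L>. s y * g y)) < e" by blast
qed

text \<open>Multiplication by the conjugate phase turns \<open>f\<close> into its modulus, so this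
  single bounded multiplier detects whether \<open>f\<close> vanishes.\<close>

lemma integral_norm_0_AE:
 fixes f :: "'a::euclidean_space => complex"
 assumes f: "integrable \<L> f" and "(LINT y|\<L>. sgn (cnj (f y)) * f y) = 0"
 shows "AE y in \<L>. f y = 0"
proof -
 have "sgn (cnj z) * z = of_real (norm z)" for z :: complex
 proof (cases "z = 0")
  case False
  have "cnj z * z = of_real ((norm z)\<^sup>2)" by (simp only: mult.commute[of "cnj z"] complex_norm_square)
  then show ?thesis using False by (simp add: sgn_div_norm scaleR_conv_of_real field_simps power2_eq_square)
 qed simp
 then have "complex_of_real (LINT y|\<L>. norm (f y)) = 0" using assms(2) by simp
 then have "(LINT y|\<L>. norm (f y)) = 0" by (simp only: of_real_eq_0_iff)
 then have "AE y in \<L>. norm (f y) = 0"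
  using integral_nonneg_eq_0_iff_AE[OF integrable_norm[OF f]] by simp
 then show ?thesis by simp
qed

text \<open>Lindelof's theorem: a null set in each member of an arbitrary open cover is harmless
  because countably many members have the same union.\<close>

lemma AE_open_cover:
 fixes U :: "'a::euclidean_space set"
 assumes "\<And>x. x \<in> U ==> \<exists>V. open V \<and> x \<in> V \<and> (AE y\<in>V in \<L>. P y)"
 shows "AE y\<in>U in \<L>. P y"
proof -
 define F where "F = {V :: 'a set. open V \<and> (AE y\<in>V in \<L>. P y)}"
 obtain F' where F': "F' \<subseteq> F" "countable F'" "\<Union>F' = \<Union>F"
  using Lindelof[of F] by (auto simp: F_def)
 have "AE y in \<L>. \<forall>V\<in>F'. y \<in> V --> P y"
  using F' by (subst AE_ball_countable) (auto simp: F_def)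
 then show ?thesis
 proof eventually_elim
  case (elim y)
  have "U \<subseteq> \<Union>F" using assms by (auto simp: F_def) 
  with elim F'(3) show ?case by auto
 qed
qed

text \<open>On \<open>ball c \<rho>\<close> every mollification of \<open>f - k\<close> with radius
  at most \<open>\<rho>\<close> uses a bump inside the double ball, hence vanishes. Its weak limit,
  paired with the conjugate phase of \<open>f - k\<close>, is the integral of the modulus. The
  doubled radius is what gives the bumps room.\<close>

lemma fundamental_lemma_local:
 fixes f :: "R3 => complex"
 assumes rho: "\<rho> > 0" and f: "integrable \<L> f"
  and z: "\<And>r q. r > 0 ==> cball q r \<subseteq> cball c (2 * \<rho>) ==> (LINT z|\<L>. f z * of_real (bump r q z)) = (LINT z|\<L>. k * of_real (bump r q z))"
 shows "AE y\<in>ball c \<rho> in \<L>. f y = k"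
proof -
 define I where "I = (indicator (ball c \<rho>) :: R3 => real)"
 define K where "K = (indicator (cball c (2 * \<rho>)) :: R3 => real)"
 define h where "h = (\<lambda>y. I y *\<^sub>R (f y - k))"
 \<comment> \<open>\<open>k\<close> is cut off outside the double ball, which makes it integrable
   without changing any of the mollifications used.\<close>
 define g where "g = (\<lambda>y. f y - K y *\<^sub>R k)"
 have Ii: "integrable \<L> I" and Ki: "integrable \<L> K"
  using emeasure_bounded_finite[OF bounded_cball, of c "2 * \<rho>"] emeasure_bounded_finite[OF bounded_ball, of c \<rho>]
  by (simp_all add: I_def K_def integrable_indicator_iff less_top)
 have fm: "f \<in> borel_measurable \<L>" using f by auto
 have Im: "I \<in> borel_measurable \<L>" using Ii by auto
 have h: "integrable \<L> h"
 proof -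
  have "integrable \<L> (\<lambda>y. I y *\<^sub>R f y - I y *\<^sub>R k)"
  proof (intro Bochner_Integration.integrable_diff integrable_scaleR_left Ii)
   show "integrable \<L> (\<lambda>y. I y *\<^sub>R f y)"
   proof (rule integrable_dominated[OF f])
    show "(\<lambda>y. I y *\<^sub>R f y) \<in> borel_measurable \<L>" using fm Im by (rule borel_measurable_scaleR[rotated])
   qed (auto simp: I_def indicator_def)
  qed
  then show ?thesis by (simp add: h_def scaleR_diff_right)
 qed
 have g: "integrable \<L> g" unfolding g_def using f Ki by auto
 define s where "s = (\<lambda>y. sgn (cnj (h y)))"
 have "h \<in> borel_measurable \<L>" using h by auto
 then have "(\<lambda>y. cnj (h y)) \<in> borel_measurable \<L>"
  by (rule borel_measurable_continuous_on[OF continuous_on_cnj[OF continuous_on_id]])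
 then have "(\<lambda>y. cnj (h y) /\<^sub>R norm (cnj (h y))) \<in> borel_measurable \<L>" by measurable
 then have sm: "s \<in> borel_measurable \<L>" unfolding s_def sgn_div_norm .
 have s1: "norm (s y) \<le> 1" for y by (simp add: s_def norm_sgn)
 have s0: "s y = 0" if "y \<notin> ball c \<rho>" for y using that by (simp add: s_def h_def I_def)
 have si: "integrable \<L> s"
  by (rule integrable_dominated[OF Ii sm]) (use s1 s0 in \<open>auto simp: I_def indicator_def\<close>)
 define r where "r = (\<lambda>n. \<rho> * inverse (real (Suc n)))"
 have r: "r n > 0" "r n \<le> \<rho>" for n using rho by (auto simp: r_def field_simps)
 have r0: "r \<longlonglongrightarrow> 0" unfolding r_def using tendsto_mult_left[OF LIMSEQ_inverse_real_of_nat, of \<rho>] by simp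
 have zero: "s y * moll (r n) 0 g y = 0" for n y
 proof (cases "y \<in> ball c \<rho>")
  case True
  have sub: "cball y (r n) \<subseteq> cball c (2 * \<rho>)"
  proof
   fix x assume "x \<in> cball y (r n)"
   then show "x \<in> cball c (2 * \<rho>)" using True r(2)[of n] dist_triangle[of c x y] by auto
  qed
  have "moll (r n) 0 g y = (LINT z|\<L>. f z * of_real (bump (r n) y z) - k * of_real (bump (r n) y z))"
   unfolding moll_def
  proof (rule Bochner_Integration.integral_cong[OF refl])
   fix z
   show "g z * of_real (bump (r n) (y - 0) z) = f z * of_real (bump (r n) y z) - k * of_real (bump (r n) y z)"
   proof (cases "z \<in> cball c (2 * \<rho>)")
    case False
    then have "z \<notin> cball y (r n)" using sub by blast
    then have "bump (r n) y z = 0" using bump_0_iff[OF r(1)[of n], of y z] by (simp add: dist_commute)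
    then show ?thesis by simp
   qed (simp add: g_def K_def left_diff_distrib)
  qed
  also have "\<dots> = 0"
   using integrable_mult_bump[OF f] integrable_bump[OF r(1)] z[OF r(1) sub] by (subst Bochner_Integration.integral_diff) auto
  finally show ?thesis by simp
 qed (simp add: s0)
 have z0: "(LINT y|\<L>. s y * moll (r n) 0 g y) / mass (r n) = 0" for n by (simp only: zero integral_zero div_0)
 have "(\<lambda>n. (LINT y|\<L>. s y * moll (r n) 0 g y) / mass (r n)) \<longlonglongrightarrow> (LINT y|\<L>. s y * g y)"
  by (rule moll_L1[OF r(1) r0 tendsto_const g si s1])
 then have "(LINT y|\<L>. s y * g y) = 0" unfolding z0 by (simp add: LIMSEQ_const_iff)
 moreover have "s y * g y = sgn (cnj (h y)) * h y" for y
 proof (cases "y \<in> ball c \<rho>")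
  case True
  then have "y \<in> cball c (2 * \<rho>)" using rho by auto
  with True show ?thesis by (simp add: s_def g_def h_def I_def K_def)
 qed (simp add: s0 h_def I_def)
 ultimately have "AE y in \<L>. h y = 0" by (intro integral_norm_0_AE[OF h]) simp
 then show ?thesis by eventually_elim (auto simp: h_def I_def)
qed

section \<open>Weak derivatives\<close>

lemma L1_loc_restrict:
 assumes "L1_loc U f" "compact K" "K \<subseteq> U"
 shows "integrable \<L> (\<lambda>x. indicator K x *\<^sub>R f x)"
 using assms unfolding L1_loc_def set_integrable_def by blast

lemma set_integral_restrict:
 fixes f :: "R3 => complex"
 assumes "K \<subseteq> U" "\<And>z. z \<notin> K ==> g z = 0"
 shows "(LINT z:U|\<L>. f z * g z) = (LINT z|\<L>. (indicator K z *\<^sub>R f z) * g z)"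
proof -
 have "indicator U z *\<^sub>R (f z * g z) = (indicator K z *\<^sub>R f z) * g z" for z
  using assms by (cases "z \<in> K") auto
 then show ?thesis by (simp only: set_lebesgue_integral_def)
qed

lemma continuous_lebesgue_measurable:
 fixes f :: "'a::euclidean_space => 'b::topological_space"
 assumes "continuous_on UNIV f" shows "f \<in> borel_measurable \<L>"
 using borel_measurable_continuous_onI[OF assms] by (intro measurable_completion) simp

lemma open_cball_double:
 fixes U :: "R3 set"
 assumes "open U" "x \<in> U" obtains \<rho> where "\<rho> > 0" "cball x (2 * \<rho>) \<subseteq> U"
proof -
 obtain e where "e > 0" "cball x e \<subseteq> U" using assms open_contains_cball by blast
 then show ?thesis using that[of "e / 2"] by auto
qed

lemma bump_zero: "r > 0 ==> cball q r \<subseteq> U ==> x \<notin> U ==> bump r q x = 0"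
 using bump_0_iff[of r q x] by (metis dist_commute linear mem_cball subsetD)

lemma pd_bump_zero: "r > 0 ==> cball q r \<subseteq> U ==> x \<notin> U ==> pd l (bump r q) x = 0"
 using pd_bump_0[of r x q l] by (metis dist_commute linear mem_cball subsetD)

text \<open>Real, nonnegative bumps suffice as test functions, which later leaves only this concrete
  family to be inserted in the limit equations.\<close>

lemma fundamental_lemma:
 assumes U: "open U" and f: "L1_loc U f"
  and z: "\<And>r q. r > 0 ==> cball q r \<subseteq> U ==> (LINT z:U|\<L>. f z * of_real (bump r q z)) = 0"
 shows "AE y\<in>U in \<L>. f y = 0"
proof (rule AE_open_cover)
 fix x assume "x \<in> U"
 then obtain \<rho> where \<rho>: "\<rho> > 0" "cball x (2 * \<rho>) \<subseteq> U" using open_cball_double[OF U] by metis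
 have "AE y\<in>ball x \<rho> in \<L>. indicator (cball x (2 * \<rho>)) y *\<^sub>R f y = 0"
 proof (rule fundamental_lemma_local[OF \<rho>(1) L1_loc_restrict[OF f compact_cball \<rho>(2)]])
  fix r q assume r: "r > 0" "cball q r \<subseteq> cball x (2 * \<rho>)"
  have "bump r q z = 0" if "z \<notin> cball x (2 * \<rho>)" for z
   by (rule bump_zero[OF r that])
  then have "(LINT z|\<L>. indicator (cball x (2 * \<rho>)) z *\<^sub>R f z * of_real (bump r q z)) = (LINT z:U|\<L>. f z * of_real (bump r q z))"
   using set_integral_restrict[OF \<rho>(2), of "\<lambda>z. of_real (bump r q z)" f] by simp
  also have "\<dots> = 0" by (rule z) (use r \<rho> in auto)
  finally show "(LINT z|\<L>. indicator (cball x (2 * \<rho>)) z *\<^sub>R f z * of_real (bump r q z)) = (LINT z|\<L>. 0 * of_real (bump r q z))"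
   by simp
 qed
 then have "AE y\<in>ball x \<rho> in \<L>. f y = 0"
  by eventually_elim (use \<rho> in \<open>auto simp: indicator_def split: if_splits\<close>)
 then show "\<exists>V. open V \<and> x \<in> V \<and> (AE y\<in>V in \<L>. f y = 0)"
  using \<rho> by (intro exI[of _ "ball x \<rho>"]) auto
qed

lemma test_funI:
 assumes "smooth \<phi>" "compact K" "K \<subseteq> U" "\<And>x. x \<notin> K ==> \<phi> x = 0"
 shows "test_fun U \<phi>"
proof -
 have "{x. \<phi> x \<noteq> 0} \<subseteq> K" using assms(4) by blast
 then have "closure {x. \<phi> x \<noteq> 0} \<subseteq> K" using assms(2) by (simp add: closure_minimal compact_imp_closed)
 moreover from this have "compact (closure {x. \<phi> x \<noteq> 0})"
  using assms(2) by (metis closed_closure closed_Int_compact inf.absorb_iff2 inf_commute)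
 ultimately show ?thesis using assms(1,3) by (auto simp: test_fun_def)
qed

lemma smooth_of_real:
 fixes f :: "'a::euclidean_space => real"
 assumes "smooth f" shows "smooth (\<lambda>x. complex_of_real (f x))"
 by (rule smooth_linear[OF bounded_linear_of_real assms])

lemma pd_of_real:
 assumes "smooth f" shows "pd l (\<lambda>x. complex_of_real (f x)) x = of_real (pd l f x)"
 by (rule pd_linear[OF bounded_linear_of_real assms])

lemma test_fun_bump: "r > 0 ==> cball q r \<subseteq> U ==> test_fun U (\<lambda>x. of_real (bump r q x))"
 by (rule test_funI[where K = "cball q r"]) (auto intro: smooth_of_real smooth_bump bump_zero[of r q "cball q r"])

lemma test_fun_pd_bump: "r > 0 ==> cball q r \<subseteq> U ==> test_fun U (\<lambda>x. of_real (pd l (bump r q) x))"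
 by (rule test_funI[where K = "cball q r"]) (auto intro: smooth_of_real smooth_pd smooth_bump pd_bump_zero[of r q "cball q r"])

lemma has_weak_pdD:
 assumes "has_weak_pd U l f g" "test_fun U \<phi>"
 shows "(LINT x:U|\<L>. f x * pd l \<phi> x) = - (LINT x:U|\<L>. g x * \<phi> x)"
 using assms unfolding has_weak_pd_def pd_def by blast

lemma test_fun_integrable:
 assumes "L1_loc U f" "test_fun U \<phi>"
 shows "set_integrable \<L> U (\<lambda>x. f x * \<phi> x)"
proof -
 let ?K = "closure {x. \<phi> x \<noteq> 0}"
 have K: "compact ?K" "?K \<subseteq> U" "smooth \<phi>" using assms(2) by (auto simp: test_fun_def)
 have z: "\<phi> x = 0" if "x \<notin> ?K" for x using that closure_subset by force
 have c: "continuous_on UNIV \<phi>" by (rule smooth_continuous[OF K(3)])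
 obtain B where B: "\<And>x. x \<in> ?K ==> norm (\<phi> x) \<le> B"
  using compact_imp_bounded[OF compact_continuous_image[OF continuous_on_subset[OF c subset_UNIV] K(1)]]
  unfolding bounded_iff by blast
 have "norm (\<phi> x) \<le> max B 0" for x using B[of x] z[of x] by (cases "x \<in> ?K") auto
 from integrable_mult_bounded[OF L1_loc_restrict[OF assms(1) K(1,2)] continuous_lebesgue_measurable[OF c] this]
 have "integrable \<L> (\<lambda>x. indicator ?K x *\<^sub>R f x * \<phi> x)" .
 also have "(\<lambda>x. indicator ?K x *\<^sub>R f x * \<phi> x) = (\<lambda>x. indicator U x *\<^sub>R (f x * \<phi> x))"
 proof
  fix x show "indicator ?K x *\<^sub>R f x * \<phi> x = indicator U x *\<^sub>R (f x * \<phi> x)"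
   using K(2) z[of x] by (cases "x \<in> ?K") auto
 qed
 finally show ?thesis by (simp add: set_integrable_def)
qed

lemma L1_loc_diff: "L1_loc U f ==> L1_loc U g ==> L1_loc U (\<lambda>x. f x - g x)"
 unfolding L1_loc_def by (auto intro: set_integral_diff)

lemma weak_pd_unique:
 assumes U: "open U" and g: "has_weak_pd U l f g" "has_weak_pd U l f h"
 shows "AE y\<in>U in \<L>. g y = h y"
proof -
 have L: "L1_loc U g" "L1_loc U h" using g by (auto simp: has_weak_pd_def)
 have "AE y\<in>U in \<L>. g y - h y = 0"
 proof (rule fundamental_lemma[OF U L1_loc_diff[OF L]])
  fix r q assume r: "r > (0::real)" "cball q r \<subseteq> U"
  note t = test_fun_bump[OF r]
  have "(LINT x:U|\<L>. g x * of_real (bump r q x)) = (LINT x:U|\<L>. h x * of_real (bump r q x))"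
   using has_weak_pdD[OF g(1) t] has_weak_pdD[OF g(2) t] by simp
  then show "(LINT z:U|\<L>. (g z - h z) * of_real (bump r q z)) = 0"
   using test_fun_integrable[OF L(1) t] test_fun_integrable[OF L(2) t]
   by (simp add: left_diff_distrib set_integral_diff)
 qed
 then show ?thesis by simp
qed

lemma weak_pd_works: "has_weak_pd U l f g ==> has_weak_pd U l f (weak_pd U l f)"
 unfolding weak_pd_def by (rule someI[of "has_weak_pd U l f"])

lemma weak_pd_AE: "open U ==> has_weak_pd U l f g ==> AE y\<in>U in \<L>. weak_pd U l f y = g y"
 using weak_pd_unique weak_pd_works by blast

lemma L1_loc_cong: "(\<And>x. x \<in> U ==> f x = f' x) ==> L1_loc U f \<longleftrightarrow> L1_loc U f'"
 unfolding L1_loc_def set_integrable_def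
 by (intro all_cong imp_cong arg_cong2[where f = integrable] refl ext) (auto simp: indicator_def)

lemma has_weak_pd_cong:
 assumes "\<And>x. x \<in> U ==> f x = f' x"
 shows "has_weak_pd U l f = has_weak_pd U l f'"
proof
 fix g
 have "(LINT x:U|\<L>. f x * h x) = (LINT x:U|\<L>. f' x * h x)" for h
  unfolding set_lebesgue_integral_def using assms by (intro Bochner_Integration.integral_cong) (auto simp: indicator_def)
 then show "has_weak_pd U l f g = has_weak_pd U l f' g"
  unfolding has_weak_pd_def using L1_loc_cong[OF assms] by simp
qed

lemma weak_pd_cong:
 assumes "\<And>x. x \<in> U ==> f x = f' x"
 shows "weak_pd U l f = weak_pd U l f'"
 unfolding weak_pd_def using has_weak_pd_cong[OF assms] by simp

lemma set_integral_AE_eq: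
 fixes f g :: "'a::euclidean_space => complex"
 assumes "AE x\<in>U in \<L>. f x = g x"
 shows "(LINT x:U|\<L>. f x) = (LINT x:U|\<L>. g x)"
 unfolding set_lebesgue_integral_def
 by (rule integral_AE) (use assms in \<open>eventually_elim, auto simp: indicator_def\<close>)

lemma set_integrable_AE_eq:
 fixes f g :: "'a::euclidean_space => 'b::euclidean_space"
 assumes "set_integrable \<L> U g" "AE x\<in>U in \<L>. f x = g x"
 shows "set_integrable \<L> U f"
 using assms(1) unfolding set_integrable_def
 by (rule integrable_AE) (use assms(2) in \<open>eventually_elim, auto simp: indicator_def\<close>)

lemma L1_loc_AE_eq:
 assumes "L1_loc U g" "AE x\<in>U in \<L>. f x = g x"
 shows "L1_loc U f"
 unfolding L1_loc_def
proof (intro allI impI)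
 fix K assume K: "compact K \<and> K \<subseteq> U"
 then have "set_integrable \<L> K g" using assms(1) by (simp add: L1_loc_def)
 moreover have "AE x\<in>K in \<L>. f x = g x" using assms(2) by eventually_elim (use K in blast)
 ultimately show "set_integrable \<L> K f" by (rule set_integrable_AE_eq)
qed

lemma has_weak_pd_AE_eq:
 assumes "has_weak_pd U l f g" "AE x\<in>U in \<L>. f' x = f x" "AE x\<in>U in \<L>. g' x = g x"
 shows "has_weak_pd U l f' g'"
proof -
 have "(LINT x:U|\<L>. f' x * h x) = (LINT x:U|\<L>. f x * h x)"
  "(LINT x:U|\<L>. g' x * h x) = (LINT x:U|\<L>. g x * h x)" for h
  by (rule set_integral_AE_eq; use assms(2,3) in \<open>eventually_elim, simp\<close>)+
 then show ?thesis using assms L1_loc_AE_eq[OF _ assms(2)] L1_loc_AE_eq[OF _ assms(3)] unfolding has_weak_pd_def by simp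
qed

section \<open>Differentiation under the integral and functions with zero gradient\<close>

lemma smooth_compact_Lipschitz:
 fixes k :: "R3 => complex"
 assumes k: "smooth k" "\<And>x. norm x > R ==> k x = 0"
 obtains L where "L \<ge> 0" "\<And>x y. norm (k x - k y) \<le> L * norm (x - y)"
proof -
 have "\<exists>B. \<forall>x. norm (pd l k x) \<le> B" for l
 proof -
  have c: "continuous_on UNIV (pd l k)" by (intro smooth_continuous smooth_pd k)
  obtain B where B: "\<And>x. x \<in> cball 0 R ==> norm (pd l k x) \<le> B"
   using compact_imp_bounded[OF compact_continuous_image[OF continuous_on_subset[OF c subset_UNIV] compact_cball[of 0 R]]]
   unfolding bounded_iff by blast
  have "pd l k x = 0" if "x \<notin> cball 0 R" for x
  proof -
   have "pd l k x = pd l (\<lambda>_. 0 :: complex) x"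
    by (rule pd_cong_open[of "- cball 0 R"]) (use that k in \<open>auto simp: smooth_const not_le\<close>)
   also have "\<dots> = 0" using pd_eq[OF has_derivative_const] by blast
   finally show ?thesis .
  qed
  then have "norm (pd l k x) \<le> max B 0" for x using B[of x] by (cases "x \<in> cball 0 R") auto
  then show ?thesis by blast
 qed
 then obtain B where B: "\<And>l x. norm (pd l k x) \<le> B l" by metis
 have "B l \<ge> 0" for l using B[of l 0] norm_ge_zero order_trans by blast
 then have B0: "(\<Sigma> l. B l) \<ge> 0" by (simp add: sum_nonneg)
 have "norm (k x - k y) \<le> (\<Sigma> l. B l) * norm (x - y)" for x y
 proof (rule differentiable_bound[OF convex_UNIV])
  fix x
  show "(k has_derivative (\<lambda>h. \<Sigma> l. h $ l *\<^sub>R pd l k x)) (at x within UNIV)"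
   using smooth_derivative_sum[OF k(1)] by simp
  show "onorm (\<lambda>h. \<Sigma> l. h $ l *\<^sub>R pd l k x) \<le> (\<Sigma> l. B l)"
  proof (rule onorm_le)
   fix h :: R3
   have "norm (\<Sigma> l. h $ l *\<^sub>R pd l k x) \<le> (\<Sigma> l. norm (h $ l *\<^sub>R pd l k x))" by (rule norm_sum)
   also have "\<dots> \<le> (\<Sigma> l. norm h * B l)"
    by (intro sum_mono) (auto intro!: mult_mono B component_le_norm_cart)
   finally show "norm (\<Sigma> l. h $ l *\<^sub>R pd l k x) \<le> (\<Sigma> l. B l) * norm h"
    by (simp add: sum_distrib_left mult.commute)
  qed
 qed auto
 with B0 show ?thesis by (rule that)
qed

lemma smooth_bounded:
 fixes k :: "R3 => complex"
 assumes "continuous_on UNIV k" "\<And>x. norm x > R ==> k x = 0"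
 obtains B where "\<And>x. norm (k x) \<le> B"
proof -
 obtain B where B: "\<And>x. x \<in> cball 0 R ==> norm (k x) \<le> B"
  using compact_imp_bounded[OF compact_continuous_image[OF continuous_on_subset[OF assms(1) subset_UNIV] compact_cball[of 0 R]]]
  unfolding bounded_iff by blast
 then have "norm (k x) \<le> max B 0" for x using B[of x] assms(2)[of x] by (cases "norm x \<le> R") (auto simp: le_max_iff_disj)
 then show ?thesis by (rule that)
qed

lemma has_vector_derivative_iff_quotient:
 "(f has_vector_derivative D) (at t) \<longleftrightarrow> ((\<lambda>h. (f (t + h) - f t) /\<^sub>R h) \<longlongrightarrow> D) (at 0)"
proof -
 have "norm (f (t + h) - f t - h *\<^sub>R D) / norm h = norm ((f (t + h) - f t) /\<^sub>R h - D)" if "h \<noteq> 0" for h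
 proof -
  have "(f (t + h) - f t) /\<^sub>R h - D = (f (t + h) - f t - h *\<^sub>R D) /\<^sub>R h"
   using that by (simp add: scaleR_diff_right)
  then show ?thesis by (simp add: divide_inverse mult.commute)
 qed
 then have "((\<lambda>h. norm (f (t + h) - f t - h *\<^sub>R D) / norm h) \<longlongrightarrow> 0) (at 0)
  \<longleftrightarrow> ((\<lambda>h. norm ((f (t + h) - f t) /\<^sub>R h - D)) \<longlongrightarrow> 0) (at 0)"
  by (intro tendsto_cong) (simp add: eventually_at_filter)
 then show ?thesis
  unfolding has_vector_derivative_def has_derivative_at
  by (simp add: tendsto_norm_zero_iff LIM_zero_iff bounded_linear_scaleR_left)
qed

text \<open>The Lipschitz constant of \<open>k\<close> bounds all difference quotients, so dominated
  convergence applies along any sequence of increments.\<close>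

lemma convolution_has_vector_derivative:
 fixes k :: "R3 => complex"
 assumes f: "integrable \<L> f" and k: "smooth k" "\<And>x. norm x > R ==> k x = 0"
 shows "((\<lambda>t. LINT z|\<L>. f z * k (z - t *\<^sub>R v)) has_vector_derivative
  (LINT z|\<L>. f z * - (\<Sigma> l. v $ l *\<^sub>R pd l k (z - t *\<^sub>R v)))) (at t)"
proof -
 obtain L where L: "L \<ge> 0" "\<And>x y. norm (k x - k y) \<le> L * norm (x - y)" using smooth_compact_Lipschitz[OF k] by metis
 have kc: "continuous_on UNIV k" by (rule smooth_continuous[OF k(1)])
 obtain B where B: "\<And>x. norm (k x) \<le> B" using smooth_bounded[OF kc k(2)] by metis
 define D where "D = (\<lambda>z. - (\<Sigma> l. v $ l *\<^sub>R pd l k (z - t *\<^sub>R v)))"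
 have km: "(\<lambda>z. k (z - w)) \<in> borel_measurable \<L>" for w
  by (intro measurable_completion) (auto intro!: borel_measurable_continuous_onI continuous_on_compose2[OF kc] continuous_intros)
 have fk: "integrable \<L> (\<lambda>z. f z * k (z - w))" for w
  by (rule integrable_mult_bounded[OF f km B])
 have der: "((\<lambda>s. k (z - s *\<^sub>R v)) has_vector_derivative D z) (at t)" for z
 proof -
  have "((\<lambda>s. z - s *\<^sub>R v) has_derivative (\<lambda>h. - (h *\<^sub>R v))) (at t)"
   by (auto intro!: derivative_eq_intros)
  from has_derivative_compose[OF this smooth_derivative_sum[OF k(1)]]
  have "((\<lambda>s. k (z - s *\<^sub>R v)) has_derivative (\<lambda>h. \<Sigma> l. (- (h *\<^sub>R v)) $ l *\<^sub>R pd l k (z - t *\<^sub>R v))) (at t)" .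
  moreover have "(\<lambda>h. \<Sigma> l. (- (h *\<^sub>R v)) $ l *\<^sub>R pd l k (z - t *\<^sub>R v)) = (\<lambda>h. h *\<^sub>R D z)"
   by (auto simp: D_def scaleR_sum_right sum_negf)
  ultimately show ?thesis by (simp add: has_vector_derivative_def)
 qed
 have Dc: "continuous_on UNIV D"
  unfolding D_def by (intro continuous_intros continuous_on_compose2[OF smooth_continuous[OF smooth_pd[OF k(1)]]]) auto
 have quot: "((\<lambda>h. (k (z - (t + h) *\<^sub>R v) - k (z - t *\<^sub>R v)) /\<^sub>R h) \<longlongrightarrow> D z) (at 0)" for z
  using der[of z] by (simp only: has_vector_derivative_iff_quotient)
 have "((\<lambda>h. ((LINT z|\<L>. f z * k (z - (t + h) *\<^sub>R v)) - (LINT z|\<L>. f z * k (z - t *\<^sub>R v))) /\<^sub>R h) \<longlongrightarrow> (LINT z|\<L>. f z * D z)) (at 0)"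
  unfolding tendsto_at_iff_sequentially
 proof (intro allI impI)
  fix X :: "nat => real" assume X: "\<forall>i. X i \<in> UNIV - {0}" "X \<longlonglongrightarrow> 0"
  have Xf: "filterlim X (at 0) sequentially"
   using X by (auto simp: filterlim_at)
  have "(\<lambda>n. LINT z|\<L>. f z * ((k (z - (t + X n) *\<^sub>R v) - k (z - t *\<^sub>R v)) /\<^sub>R X n)) \<longlonglongrightarrow> (LINT z|\<L>. f z * D z)"
  proof (rule integral_dominated_convergence)
   show "integrable \<L> (\<lambda>z. norm (f z) * (L * norm v))" using f by simp
   show "AE z in \<L>. (\<lambda>n. f z * ((k (z - (t + X n) *\<^sub>R v) - k (z - t *\<^sub>R v)) /\<^sub>R X n)) \<longlonglongrightarrow> f z * D z"
    by (intro AE_I2 tendsto_mult tendsto_const filterlim_compose[OF quot Xf])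
   show "(\<lambda>z. f z * D z) \<in> borel_measurable \<L>"
    using f continuous_lebesgue_measurable[OF Dc] by (intro borel_measurable_times) auto
   show "(\<lambda>z. f z * ((k (z - (t + X n) *\<^sub>R v) - k (z - t *\<^sub>R v)) /\<^sub>R X n)) \<in> borel_measurable \<L>" for n
    using f by (intro borel_measurable_times borel_measurable_scaleR borel_measurable_diff km) auto
   show "AE z in \<L>. norm (f z * ((k (z - (t + X n) *\<^sub>R v) - k (z - t *\<^sub>R v)) /\<^sub>R X n)) \<le> norm (f z) * (L * norm v)" for n
   proof (rule AE_I2)
    fix z
    have "norm (k (z - (t + X n) *\<^sub>R v) - k (z - t *\<^sub>R v)) \<le> L * norm ((z - (t + X n) *\<^sub>R v) - (z - t *\<^sub>R v))" by (rule L)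
    also have "(z - (t + X n) *\<^sub>R v) - (z - t *\<^sub>R v) = - (X n *\<^sub>R v)" by (simp add: algebra_simps)
    finally have "norm ((k (z - (t + X n) *\<^sub>R v) - k (z - t *\<^sub>R v)) /\<^sub>R X n) \<le> L * norm v"
     using X(1) by (simp add: divide_simps mult_ac)
    then show "norm (f z * ((k (z - (t + X n) *\<^sub>R v) - k (z - t *\<^sub>R v)) /\<^sub>R X n)) \<le> norm (f z) * (L * norm v)"
     unfolding norm_mult by (rule mult_left_mono) simp
   qed
  qed
  moreover have "(LINT z|\<L>. f z * ((k (z - (t + X n) *\<^sub>R v) - k (z - t *\<^sub>R v)) /\<^sub>R X n))
   = ((LINT z|\<L>. f z * k (z - (t + X n) *\<^sub>R v)) - (LINT z|\<L>. f z * k (z - t *\<^sub>R v))) /\<^sub>R X n" for n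
   using fk[of "(t + X n) *\<^sub>R v"] fk[of "t *\<^sub>R v"]
   by (simp only: mult_scaleR_right integral_scaleR_right right_diff_distrib Bochner_Integration.integral_diff)
  ultimately show "((\<lambda>h. ((LINT z|\<L>. f z * k (z - (t + h) *\<^sub>R v)) - (LINT z|\<L>. f z * k (z - t *\<^sub>R v))) /\<^sub>R h) \<circ> X) \<longlonglongrightarrow> (LINT z|\<L>. f z * D z)"
   by (simp only: o_def)
 qed
 then show ?thesis unfolding has_vector_derivative_iff_quotient D_def .
qed


text \<open>The integral of a translate does not depend on the translation; its derivative in the
  translation parameter is minus the integral of the partial derivative.\<close>

lemma integral_pd_zero:
 fixes k :: "R3 => complex"
 assumes k: "smooth k" "\<And>x. norm x > R ==> k x = 0"
 shows "(LINT z|\<L>. pd l k z) = 0"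
proof -
 \<comment> \<open>Replaces the non-integrable constant 1. The margin 1 in the radius keeps it equal
   to 1 on the support of every translate by less than a unit.\<close>
 define f where "f = (\<lambda>z::R3. indicator (cball 0 (R + 1)) z *\<^sub>R (1::complex))"
 let ?e = "axis l 1 :: R3"
 have f: "integrable \<L> f"
  using emeasure_bounded_finite[OF bounded_cball, of "0::R3" "R + 1"]
  unfolding f_def by (intro integrable_scaleR_left) (simp add: integrable_indicator_iff less_top)
 have "f z * k (z - t *\<^sub>R ?e) = k (z + (- t *\<^sub>R ?e))" if "t \<in> ball 0 1" for t z
 proof (cases "norm z \<le> R + 1")
  case False
  have "norm (t *\<^sub>R ?e) < 1" using that by simp
  with False have "norm (z - t *\<^sub>R ?e) > R" using norm_triangle_ineq2[of z "t *\<^sub>R ?e"] by linarith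
  then show ?thesis using k(2) by simp
 qed (simp add: f_def)
 then have "(LINT z|\<L>. f z * k (z - t *\<^sub>R ?e)) = (LINT z|\<L>. k z)" if "t \<in> ball 0 1" for t
  using that integral_shift[of k "- t *\<^sub>R ?e"] by (simp only:)
 then have "((\<lambda>t. LINT z|\<L>. f z * k (z - t *\<^sub>R ?e)) has_vector_derivative 0) (at 0)"
  by (intro has_vector_derivative_transform_within_open[OF has_vector_derivative_const[of "LINT z|\<L>. k z"], of "ball 0 1"]) simp_all
 with convolution_has_vector_derivative[OF f k, where v = ?e and t = 0]
 have "(LINT z|\<L>. f z * - (\<Sigma> j. ?e $ j *\<^sub>R pd j k (z - 0 *\<^sub>R ?e))) = 0"
  by (rule vector_derivative_unique_at)
 moreover have "f z * - (\<Sigma> j. ?e $ j *\<^sub>R pd j k (z - 0 *\<^sub>R ?e)) = - pd l k z" for z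
 proof -
  have "(\<Sigma> j. ?e $ j *\<^sub>R pd j k z) = (\<Sigma> j. if j = l then pd j k z else 0)"
   by (rule sum.cong) (auto simp: axis_def)
  then have 1: "(\<Sigma> j. ?e $ j *\<^sub>R pd j k z) = pd l k z" by simp
  have 2: "pd l k z = 0" if "norm z > R"
  proof -
   have "pd l k z = pd l (\<lambda>_. 0 :: complex) z"
    by (rule pd_cong_open[of "- cball 0 R"]) (use that k in \<open>auto simp: smooth_const not_le\<close>)
   also have "\<dots> = 0" using pd_eq[OF has_derivative_const] by blast
   finally show ?thesis .
  qed
  show ?thesis
  proof (cases "norm z \<le> R + 1")
   case False
   then show ?thesis using 2 by (simp add: f_def)
  qed (simp add: f_def 1)
 qed
 ultimately show ?thesis by simp
qed

text \<open>Along a segment from \<open>c\<close> the derivative of a mollification is a combination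
  of integrals of \<open>f\<close> against derivatives of bumps in the double ball, hence 0.
  Mollifications are thus constant on \<open>ball c \<rho>\<close>, and their weak limit inherits
  this.\<close>

lemma zero_gradient_local:
 fixes f :: "R3 => complex"
 assumes rho: "\<rho> > 0" and f: "integrable \<L> f"
  and z: "\<And>r q l. r > 0 ==> cball q r \<subseteq> cball c (2 * \<rho>) ==> (LINT z|\<L>. f z * of_real (pd l (bump r q) z)) = 0"
 shows "\<exists>k. AE y\<in>ball c \<rho> in \<L>. f y = k"
proof -
 have sub: "cball y r \<subseteq> cball c (2 * \<rho>)" if "y \<in> ball c \<rho>" "r \<le> \<rho>" for y r
 proof
  fix x assume "x \<in> cball y r"
  then show "x \<in> cball c (2 * \<rho>)" using that dist_triangle[of c x y] by auto
 qed
 have gen: "w * - (\<Sigma> l. v $ l *\<^sub>R b l) = (\<Sigma> l. (- v $ l) *\<^sub>R (w * b l))" for w :: complex and v :: R3 and b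
  by (simp add: sum_distrib_left sum_negf)
 have const: "moll r 0 f y = moll r 0 f c" if y: "y \<in> ball c \<rho>" and r: "0 < r" "r \<le> \<rho>" for y r
 proof -
  let ?k = "\<lambda>z. complex_of_real (bump r c z)"
  have k: "smooth ?k" "\<And>x. norm x > r + norm c ==> ?k x = 0"
   using smooth_of_real[OF smooth_bump] bump_outside[OF r(1)] by auto
  define \<Phi> where "\<Phi> = (\<lambda>t. LINT z|\<L>. f z * ?k (z - t *\<^sub>R (y - c)))"
  have "(\<Phi> has_vector_derivative 0) (at t within {0..1})" if t: "t \<in> {0..1}" for t
  proof -
   let ?q = "c + t *\<^sub>R (y - c)"
   have "dist c ?q \<le> dist c y" using t by (simp add: dist_norm mult_left_le_one_le norm_minus_commute)
   then have q: "?q \<in> ball c \<rho>" using y by simp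
   have p: "pd l ?k (z - t *\<^sub>R (y - c)) = of_real (pd l (bump r ?q) z)" for l z
    using pd_bump_shift[of l r c z "- t *\<^sub>R (y - c)"] by (simp add: pd_of_real smooth_bump)
   have int: "integrable \<L> (\<lambda>z. f z * complex_of_real (pd l (bump r ?q) z))" for l
   proof -
    have c: "continuous_on UNIV (\<lambda>z. complex_of_real (pd l (bump r ?q) z))"
     by (intro smooth_continuous smooth_of_real smooth_pd smooth_bump)
    have "complex_of_real (pd l (bump r ?q) x) = 0" if "norm x > r + norm ?q" for x
    proof -
     have "r \<le> dist x ?q" using norm_triangle_ineq2[of x ?q] that by (simp add: dist_norm)
     then show ?thesis using pd_bump_0[OF r(1)] by simp
    qed
    from smooth_bounded[OF c this] obtain B where "\<And>z. norm (complex_of_real (pd l (bump r ?q) z)) \<le> B"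
     by metis
    from integrable_mult_bounded[OF f continuous_lebesgue_measurable[OF c] this] show ?thesis .
   qed
   have "(LINT z|\<L>. f z * - (\<Sigma> l. (y - c) $ l *\<^sub>R pd l ?k (z - t *\<^sub>R (y - c))))
    = (LINT z|\<L>. (\<Sigma> l. (- (y - c) $ l) *\<^sub>R (f z * of_real (pd l (bump r ?q) z))))"
    unfolding p gen ..
   also have "\<dots> = (\<Sigma> l. (- (y - c) $ l) *\<^sub>R (LINT z|\<L>. f z * of_real (pd l (bump r ?q) z)))"
    by (subst Bochner_Integration.integral_sum) (auto intro: int integrable_scaleR_right)
   also have "\<dots> = 0" using z[OF r(1) sub[OF q r(2)]] by simp
   finally show ?thesis
    using convolution_has_vector_derivative[OF f k, where v = "y - c" and t = t] unfolding \<Phi>_def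
    by (simp only: has_vector_derivative_at_within)
  qed
  then obtain C where "\<And>t. t \<in> {0..1} ==> \<Phi> t = C"
   using has_vector_derivative_zero_constant[of "{0..1::real}" \<Phi>] by auto
  then have "\<Phi> 1 = \<Phi> 0" by simp
  then show ?thesis
   unfolding \<Phi>_def moll_def using bump_shift(2)[of r c _ "y - c"] by simp
 qed
 define r where "r = (\<lambda>n. \<rho> * inverse (real (Suc n)))"
 have r: "r n > 0" "r n \<le> \<rho>" for n using rho by (auto simp: r_def field_simps)
 have r0: "r \<longlonglongrightarrow> 0" unfolding r_def using tendsto_mult_left[OF LIMSEQ_inverse_real_of_nat, of \<rho>] by simp
 have lim: "(\<lambda>n. (moll (r n) 0 f c / mass (r n)) * (LINT y|\<L>. s y)) \<longlonglongrightarrow> (LINT y|\<L>. s y * f y)"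
  if s: "integrable \<L> s" "\<And>y. norm (s y) \<le> M" "\<And>y. y \<notin> ball c \<rho> ==> s y = 0" for s M
 proof -
  have "s y * moll (r n) 0 f y = s y * moll (r n) 0 f c" for n y
   using const[OF _ r] s(3) by (cases "y \<in> ball c \<rho>") auto
  then have e: "(LINT y|\<L>. s y * moll (r n) 0 f y) / mass (r n) = (moll (r n) 0 f c / mass (r n)) * (LINT y|\<L>. s y)" for n
   by (simp only:) simp
  show ?thesis
   using moll_L1[OF r(1) r0 tendsto_const f s(1,2)] unfolding e .
 qed
 let ?I = "\<lambda>y. indicator (ball c \<rho>) y *\<^sub>R (1::complex)"
 have fin: "emeasure lborel (ball c \<rho>) < \<infinity>" by (rule emeasure_bounded_finite[OF bounded_ball])
 have Ii: "integrable \<L> ?I"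
  using fin by (intro integrable_scaleR_left) (simp add: integrable_indicator_iff less_top)
 have Iint: "(LINT y|\<L>. ?I y) = of_real (measure \<L> (ball c \<rho>))"
  by (simp add: scaleR_conv_of_real)
 have pos: "measure \<L> (ball c \<rho>) > 0" using rho by (simp add: content_ball_pos)
 \<comment> \<open>The mean of \<open>f\<close> over the ball. Testing the weak limit with the
   indicator of the ball shows that the constants \<open>moll (r n) 0 f c / mass (r n)\<close>
   converge, and to this value.\<close>
 define k where "k = (LINT y|\<L>. ?I y * f y) / of_real (measure \<L> (ball c \<rho>))"
 have limk: "(\<lambda>n. moll (r n) 0 f c / mass (r n)) \<longlonglongrightarrow> k"
  using tendsto_divide[OF lim[OF Ii, of 1] tendsto_const, of "of_real (measure \<L> (ball c \<rho>))"] pos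
  unfolding k_def Iint by (simp add: indicator_def)
 have eq: "(LINT y|\<L>. s y * f y) = k * (LINT y|\<L>. s y)"
  if s: "integrable \<L> s" "\<And>y. norm (s y) \<le> M" "\<And>y. y \<notin> ball c \<rho> ==> s y = 0" for s M
  using LIMSEQ_unique[OF lim[OF s] tendsto_mult[OF limk tendsto_const]] by simp
 define h where "h = (\<lambda>y. ?I y * f y - k * ?I y)"
 have If: "integrable \<L> (\<lambda>y. ?I y * f y)"
  using integrable_mult_bounded[OF f, of ?I 1] Ii by (simp add: mult.commute indicator_def)
 have h: "integrable \<L> h" unfolding h_def using If Ii by (intro Bochner_Integration.integrable_diff integrable_mult_right)
 define s where "s = (\<lambda>y. sgn (cnj (h y)))"
 have "h \<in> borel_measurable \<L>" using h by auto
 then have "(\<lambda>y. cnj (h y)) \<in> borel_measurable \<L>"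
  by (rule borel_measurable_continuous_on[OF continuous_on_cnj[OF continuous_on_id]])
 then have "(\<lambda>y. cnj (h y) /\<^sub>R norm (cnj (h y))) \<in> borel_measurable \<L>" by measurable
 then have sm: "s \<in> borel_measurable \<L>" unfolding s_def sgn_div_norm .
 have s1: "norm (s y) \<le> 1" for y by (simp add: s_def norm_sgn)
 have s0: "s y = 0" if "y \<notin> ball c \<rho>" for y using that by (simp add: s_def h_def)
 have si: "integrable \<L> s"
  by (rule integrable_dominated[OF Ii sm]) (use s1 s0 in \<open>auto simp: indicator_def\<close>)
 have "(LINT y|\<L>. s y * h y) = (LINT y|\<L>. s y * f y - k * s y)"
  using s0 by (intro Bochner_Integration.integral_cong) (auto simp: h_def indicator_def algebra_simps)
 also have "\<dots> = 0"
  using eq[OF si s1 s0] integrable_mult_bounded[OF f sm s1] si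
  by (subst Bochner_Integration.integral_diff) (auto simp: mult.commute)
 finally have "(LINT y|\<L>. sgn (cnj (h y)) * h y) = 0" by (simp add: s_def)
 from integral_norm_0_AE[OF h this]
 have "AE y\<in>ball c \<rho> in \<L>. f y = k"
  by eventually_elim (auto simp: h_def)
 then show ?thesis by blast
qed

lemma AE_ball_nonempty:
 fixes P :: "R3 => bool"
 assumes "AE y\<in>V in \<L>. P y" "open V" "V \<noteq> {}"
 shows "\<exists>y\<in>V. P y"
proof (rule ccontr)
 assume "\<not> (\<exists>y\<in>V. P y)"
 then have "AE y in \<L>. y \<notin> V" using assms(1) by (auto elim: eventually_mono)
 then have "V \<in> null_sets \<L>" using assms(2) by (simp add: AE_iff_null_sets)
 then show False using open_not_negligible[OF assms(2,3)] by (simp add: negligible_iff_null_sets)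
qed

text \<open>Open sets on which \<open>f\<close> equals the constant \<open>k\<close> of one ball and
  open sets on which it equals another constant cannot meet, since a nonempty open set is not null.
  Connectedness then excludes the second kind.\<close>

lemma zero_gradient_constant:
 assumes U: "open U" "connected U" and f: "L1_loc U f"
  and z: "\<And>r q l. r > 0 ==> cball q r \<subseteq> U ==> (LINT z:U|\<L>. f z * of_real (pd l (bump r q) z)) = 0"
 shows "\<exists>k. AE y\<in>U in \<L>. f y = k"
proof -
 have loc: "\<exists>\<rho> k. \<rho> > 0 \<and> ball x \<rho> \<subseteq> U \<and> (AE y\<in>ball x \<rho> in \<L>. f y = k)" if x: "x \<in> U" for x
 proof -
  obtain \<rho> where \<rho>: "\<rho> > 0" "cball x (2 * \<rho>) \<subseteq> U" using open_cball_double[OF U(1) x] by metis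
  have "\<exists>k. AE y\<in>ball x \<rho> in \<L>. indicator (cball x (2 * \<rho>)) y *\<^sub>R f y = k"
  proof (rule zero_gradient_local[OF \<rho>(1) L1_loc_restrict[OF f compact_cball \<rho>(2)]])
   fix r q l assume r: "r > 0" "cball q r \<subseteq> cball x (2 * \<rho>)"
   have "pd l (bump r q) z = 0" if "z \<notin> cball x (2 * \<rho>)" for z
    by (rule pd_bump_zero[OF r that])
   then have "(LINT z|\<L>. indicator (cball x (2 * \<rho>)) z *\<^sub>R f z * of_real (pd l (bump r q) z)) = (LINT z:U|\<L>. f z * of_real (pd l (bump r q) z))"
    using set_integral_restrict[OF \<rho>(2), of "\<lambda>z. of_real (pd l (bump r q) z)" f] by simp
   also have "\<dots> = 0" by (rule z) (use r \<rho> in auto)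
   finally show "(LINT z|\<L>. indicator (cball x (2 * \<rho>)) z *\<^sub>R f z * of_real (pd l (bump r q) z)) = 0" .
  qed
  then obtain k where "AE y\<in>ball x \<rho> in \<L>. indicator (cball x (2 * \<rho>)) y *\<^sub>R f y = k" by blast
  then have "AE y\<in>ball x \<rho> in \<L>. f y = k"
   by eventually_elim (use \<rho> in \<open>auto simp: indicator_def split: if_splits\<close>)
  then show ?thesis using \<rho> ball_subset_cball[of x \<rho>] cball_subset_cball_iff[of x \<rho> x "2 * \<rho>"]
   by (intro exI[of _ \<rho>] exI[of _ k]) auto
 qed
 show ?thesis
 proof (cases "U = {}")
  case False
  then obtain x0 where "x0 \<in> U" by blast
  then obtain \<rho>0 k where k: "\<rho>0 > 0" "ball x0 \<rho>0 \<subseteq> U" "AE y\<in>ball x0 \<rho>0 in \<L>. f y = k" using loc by blast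
  define A where "A = {V. open V \<and> V \<noteq> {} \<and> (AE y\<in>V in \<L>. f y = k)}"
  define B where "B = {V. open V \<and> V \<noteq> {} \<and> (\<exists>j. j \<noteq> k \<and> (AE y\<in>V in \<L>. f y = j))}"
  have disj: "V \<inter> W = {}" if V: "V \<in> A" and W: "W \<in> B" for V W
  proof (rule ccontr)
   assume n: "V \<inter> W \<noteq> {}"
   obtain j where j: "j \<noteq> k" "AE y\<in>W in \<L>. f y = j" using W unfolding B_def by blast
   have v: "AE y\<in>V in \<L>. f y = k" using V by (auto simp: A_def)
   have "AE y in \<L>. y \<in> V \<inter> W --> False"
    using v j(2) by eventually_elim (use j(1) in auto)
   moreover have "open (V \<inter> W)" using V W by (intro open_Int) (simp_all add: A_def B_def)
   ultimately have "\<exists>y\<in>V \<inter> W. False" using n by (rule AE_ball_nonempty)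
   then show False by simp
  qed
  have cover: "x \<in> \<Union>A \<or> x \<in> \<Union>B" if "x \<in> U" for x
  proof -
   obtain \<rho> j where j: "\<rho> > 0" "AE y\<in>ball x \<rho> in \<L>. f y = j" using loc[OF \<open>x \<in> U\<close>] by blast
   then show ?thesis unfolding A_def B_def using centre_in_ball[of x \<rho>] by (cases "j = k") blast+
  qed
  have "\<Union>A \<inter> U = {} \<or> \<Union>B \<inter> U = {}"
  proof (rule connectedD[OF U(2)])
   show "open (\<Union>A)" "open (\<Union>B)" by (auto simp: A_def B_def)
   show "\<Union>A \<inter> \<Union>B \<inter> U = {}" using disj by blast
   show "U \<subseteq> \<Union>A \<union> \<Union>B" using cover by blast
  qed
  moreover have "x0 \<in> \<Union>A" using k by (auto simp: A_def intro!: exI[of _ "ball x0 \<rho>0"])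
  ultimately have BU: "\<Union>B \<inter> U = {}" using \<open>x0 \<in> U\<close> by blast
  have "AE y\<in>U in \<L>. f y = k"
  proof (rule AE_open_cover)
   fix x assume "x \<in> U"
   then have "x \<in> \<Union>A" using cover BU by blast
   then show "\<exists>V. open V \<and> x \<in> V \<and> (AE y\<in>V in \<L>. f y = k)" unfolding A_def by blast
  qed
  then show ?thesis by blast
 qed auto
qed

section \<open>The lattice and the periodic cell\<close>

lemma lattice_0: "0 \<in> lattice3"
 and lattice_add: "k \<in> lattice3 ==> l \<in> lattice3 ==> k + l \<in> lattice3"
 and lattice_minus: "k \<in> lattice3 ==> - k \<in> lattice3"
 and lattice_diff: "k \<in> lattice3 ==> l \<in> lattice3 ==> k - l \<in> lattice3"
 and lattice_axis: "axis i 1 \<in> lattice3"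
 by (auto simp: lattice3_def axis_def)

lemma mem_cell: "y \<in> cell \<longleftrightarrow> (\<forall>i. - 1 / 2 < y $ i \<and> y $ i < 1 / 2)"
 by (auto simp: cell_def mem_box_cart)

lemma mem_closure_cell: "y \<in> closure cell \<longleftrightarrow> (\<forall>i. - 1 / 2 \<le> y $ i \<and> y $ i \<le> 1 / 2)"
proof -
 have "closure cell = cbox (\<chi> i. - 1 / 2) (\<chi> i. 1 / 2)"
  unfolding cell_def by (rule closure_box) (auto simp: interval_ne_empty_cart)
 then show ?thesis by (auto simp: mem_box_cart)
qed

lemma open_cell: "open cell" unfolding cell_def by (rule open_box)

lemma convex_cell: "convex cell" unfolding cell_def by (rule convex_box)

lemma bounded_cell: "bounded cell" unfolding cell_def by (rule bounded_box)

lemma frontier_cell: "frontier cell = closure cell - cell"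
 by (simp add: frontier_def interior_open open_cell)

lemma norm_closure_cell: "y \<in> closure cell ==> norm y < 1"
proof -
 assume y: "y \<in> closure cell"
 have "(norm y)\<^sup>2 = (\<Sigma> i. (y $ i)\<^sup>2)" by (simp add: norm_vec_def L2_set_def sum_nonneg)
 also have "\<dots> \<le> (\<Sum>i\<in>(UNIV::3 set). 1 / 4)"
 proof (rule sum_mono)
  fix i :: 3
  have "- 1 / 2 \<le> y $ i" "y $ i \<le> 1 / 2" using y mem_closure_cell by blast+
  then have "\<bar>y $ i\<bar> \<le> 1 / 2" by linarith
  then have "\<bar>y $ i\<bar>\<^sup>2 \<le> (1 / 2)\<^sup>2" by (rule power_mono) simp
  then show "(y $ i)\<^sup>2 \<le> 1 / 4" by (simp add: power2_eq_square)
 qed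
 also have "\<dots> < 1\<^sup>2" by simp
 finally show ?thesis using power_less_imp_less_base[of "norm y" 2 1] by simp
qed

lemma lattice_small: "k \<in> lattice3 ==> (\<And>i. \<bar>k $ i\<bar> < 1) ==> k = 0"
proof -
 assume k: "k \<in> lattice3" "\<And>i. \<bar>k $ i\<bar> < 1"
 have "k $ i = 0" for i
 proof -
  obtain n where "k $ i = of_int n" using k(1) by (auto simp: lattice3_def elim: Ints_cases)
  then show ?thesis using k(2)[of i] by simp
 qed
 then show ?thesis by (simp add: vec_eq_iff)
qed

lemma cell_translate: "y \<in> cell ==> y - k \<in> closure cell ==> k \<in> lattice3 ==> k = 0"
proof (rule lattice_small)
 fix i assume "y \<in> cell" "y - k \<in> closure cell"
 then have "- 1 / 2 < y $ i" "y $ i < 1 / 2" "- 1 / 2 \<le> y $ i - k $ i" "y $ i - k $ i \<le> 1 / 2"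
  by (auto simp: mem_cell mem_closure_cell)
 then show "\<bar>k $ i\<bar> < 1" by linarith
qed

definition nearest :: "R3 => R3" where
 "nearest y = (\<chi> i. of_int (round (y $ i)))"

lemma nearest_lattice: "nearest y \<in> lattice3" by (simp add: nearest_def lattice3_def)

lemma nearest_closure_cell: "y - nearest y \<in> closure cell"
proof -
 have "- 1 / 2 \<le> y $ i - of_int (round (y $ i)) \<and> y $ i - of_int (round (y $ i)) \<le> 1 / 2" for i
  using of_int_round_abs_le[of "y $ i"] by linarith
 then show ?thesis by (simp add: mem_closure_cell nearest_def)
qed

lemma countable_lattice: "countable lattice3"
proof -
 have "lattice3 \<subseteq> range (\<lambda>v :: int ^ 3. \<chi> i. of_int (v $ i))"
 proof
  fix k :: R3 assume "k \<in> lattice3"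
  then have "\<forall>i. \<exists>n. k $ i = of_int n" unfolding lattice3_def by (metis (mono_tags, lifting) Ints_cases mem_Collect_eq)
  then obtain f where "\<forall>i. k $ i = of_int (f i)" by metis
  then have "k = (\<chi> i. of_int ((\<chi> i. f i) $ i))" by (simp add: vec_eq_iff)
  then show "k \<in> range (\<lambda>v :: int ^ 3. \<chi> i. of_int (v $ i))" by blast
 qed
 moreover have "countable (UNIV :: (int ^ 3) set)"
 proof -
  have "(UNIV :: (int ^ 3) set) = vec_lambda ` (\<Pi>\<^sub>E i\<in>UNIV. UNIV)"
   by (auto simp: image_iff) (metis UNIV_I vec_lambda_eta)
  then show ?thesis by (simp add: countable_PiE del: PiE_UNIV_domain)
 qed
 ultimately show ?thesis by (meson countable_image countable_subset)
qed

text \<open>The cubic count of cells. Against an area of order \<open>e\<^sup>2\<close> per cell it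
  produces the order 1/e of the interface area.\<close>

lemma lattice_box:
 "finite {k \<in> lattice3. \<forall>i. \<bar>k $ i\<bar> \<le> real M}" "card {k \<in> lattice3. \<forall>i. \<bar>k $ i\<bar> \<le> real M} \<le> (2 * M + 1) ^ 3"
proof -
 let ?A = "{- int M..int M}"
 let ?S = "(\<lambda>f. \<chi> i::3. real_of_int (f i)) ` (\<Pi>\<^sub>E i\<in>(UNIV::3 set). ?A)"
 have sub: "{k \<in> lattice3. \<forall>i. \<bar>k $ i\<bar> \<le> real M} \<subseteq> ?S"
 proof
  fix k :: R3 assume k: "k \<in> {k \<in> lattice3. \<forall>i. \<bar>k $ i\<bar> \<le> real M}"
  then have "\<forall>i. \<exists>n. k $ i = of_int n" unfolding lattice3_def by (metis (mono_tags, lifting) Ints_cases mem_Collect_eq)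
  then obtain f where f: "\<forall>i. k $ i = of_int (f i)" by metis
  have "f i \<in> ?A" for i
  proof -
   have "\<bar>k $ i\<bar> \<le> real M" using k by blast
   then have "\<bar>f i\<bar> \<le> int M" using f by (metis of_int_abs of_int_le_iff of_int_of_nat_eq)
   then show ?thesis by auto
  qed
  moreover have "k = (\<chi> i. real_of_int (f i))" using f by (simp add: vec_eq_iff)
  ultimately show "k \<in> ?S" by auto
 qed
 have fin: "finite (\<Pi>\<^sub>E i\<in>(UNIV::3 set). ?A)" by (intro finite_PiE) auto
 then show "finite {k \<in> lattice3. \<forall>i. \<bar>k $ i\<bar> \<le> real M}" using sub finite_subset by blast
 have "card {k \<in> lattice3. \<forall>i. \<bar>k $ i\<bar> \<le> real M} \<le> card ?S" using sub fin by (intro card_mono) auto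
 also have "\<dots> \<le> card (\<Pi>\<^sub>E i\<in>(UNIV::3 set). ?A)" by (rule card_image_le[OF fin])
 also have "\<dots> = (2 * M + 1) ^ 3" by (subst card_PiE) (auto simp: nat_add_distrib nat_mult_distrib)
 finally show "card {k \<in> lattice3. \<forall>i. \<bar>k $ i\<bar> \<le> real M} \<le> (2 * M + 1) ^ 3" .
qed

definition lat :: "real => R3 set" where
 "lat R = {k \<in> lattice3. norm k \<le> R}"

lemma finite_lat: "finite (lat R)"
proof -
 obtain M where "R \<le> real M" using real_arch_simple by blast
 have "lat R \<subseteq> {k \<in> lattice3. \<forall>i. \<bar>k $ i\<bar> \<le> real M}"
 proof
  fix k assume k: "k \<in> lat R"
  have "\<bar>k $ i\<bar> \<le> real M" for i
   using component_le_norm_cart[of k i] k \<open>R \<le> real M\<close> by (simp add: lat_def)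
  then show "k \<in> {k \<in> lattice3. \<forall>i. \<bar>k $ i\<bar> \<le> real M}" using k by (simp add: lat_def)
 qed
 then show ?thesis using lattice_box(1) finite_subset by blast
qed

text \<open>The exceptional points lie on the countably many hyperplanes where some coordinate is an
  integer plus one half.\<close>

lemma AE_in_cells: "AE y in \<L>. \<exists>k\<in>lattice3. y - k \<in> cell"
proof -
 have "negligible {y :: R3. y $ i = c}" for i c
  using negligible_standard_hyperplane[of "axis i 1 :: R3" c] by (simp add: inner_axis axis_in_Basis_iff)
 then have "{y :: R3. y $ i = of_int n + 1 / 2} \<in> null_sets \<L>" for i n
  by (simp add: negligible_iff_null_sets)
 then have "AE y in \<L>. y \<notin> {y :: R3. y $ i = of_int n + 1 / 2}" for i n
  by (rule AE_not_in)
 then have "AE y in \<L>. \<forall>i n. y \<notin> {y :: R3. y $ i = of_int n + 1 / 2}"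
  unfolding AE_all_countable by blast
 then show ?thesis
 proof eventually_elim
  case (elim y)
  have "y - nearest y \<in> cell" unfolding mem_cell
  proof
   fix i
   have 1: "- 1 / 2 \<le> y $ i - nearest y $ i \<and> y $ i - nearest y $ i \<le> 1 / 2"
    using nearest_closure_cell[of y] by (auto simp: mem_closure_cell)
   have "y $ i \<noteq> of_int (round (y $ i)) + 1 / 2" "y $ i \<noteq> of_int (round (y $ i) - 1) + 1 / 2"
    using elim[rule_format, of i "round (y $ i)"] elim[rule_format, of i "round (y $ i) - 1"] by blast+
   with 1 show "- 1 / 2 < (y - nearest y) $ i \<and> (y - nearest y) $ i < 1 / 2"
    by (auto simp: nearest_def less_le)
  qed
  then show ?case using nearest_lattice by blast
 qed
qed

lemma per_ext_shift: "k \<in> lattice3 ==> y + k \<in> per_ext A \<longleftrightarrow> y \<in> per_ext A"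
proof -
 have *: "y + k \<in> per_ext A" if "y \<in> per_ext A" "k \<in> lattice3" for y k
 proof -
  obtain j z where jz: "j \<in> lattice3" "z \<in> A \<union> (closure A \<inter> frontier cell)" "y = z + j"
   using \<open>y \<in> per_ext A\<close> unfolding per_ext_def by blast
  then have "y + k = z + (j + k)" "j + k \<in> lattice3" using that lattice_add by (auto simp: algebra_simps)
  then show ?thesis unfolding per_ext_def using jz(2) by blast
 qed
 assume k: "k \<in> lattice3"
 show ?thesis using *[of y k] *[of "y + k" "- k"] k lattice_minus by auto
qed

lemma per_ext_subset: "A \<subseteq> per_ext A"
 unfolding per_ext_def using lattice_0 by force

lemma per_ext_cell: "A \<subseteq> cell ==> y \<in> cell ==> y \<in> per_ext A \<longleftrightarrow> y \<in> A"
proof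
 assume A: "A \<subseteq> cell" and y: "y \<in> cell" "y \<in> per_ext A"
 then obtain k z where kz: "k \<in> lattice3" "z \<in> A \<union> (closure A \<inter> frontier cell)" "y = z + k"
  unfolding per_ext_def by blast
 have "y - k \<in> closure cell" using kz A closure_subset[of cell] by (auto simp: frontier_cell)
 then have "k = 0" using cell_translate kz(1) y(1) by blast
 then show "y \<in> A" using kz y(1) by (auto simp: frontier_cell)
qed (use per_ext_subset in blast)

text \<open>Almost every point lies in exactly one translate of the open cell. Points of the cell
  have norm below 1, so translates by lattice vectors of norm at most \<open>R + 1\<close> reach the
  whole support.\<close>

lemma integral_cells:
 fixes F :: "R3 => complex"
 assumes F: "integrable \<L> F" "\<And>y. norm y > R ==> F y = 0"
 shows "(LINT y|\<L>. F y) = (LINT y:cell|\<L>. (\<Sum>k\<in>lat (R + 1). F (y + k)))"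
  "k \<in> lattice3 ==> set_integrable \<L> cell (\<lambda>y. F (y + k))"
proof -
 have cm: "cell \<in> sets \<L>" using open_cell by auto
 have Fk: "integrable \<L> (\<lambda>y. indicator cell (y - k) *\<^sub>R F y)" for k
 proof -
  have "integrable \<L> (\<lambda>y. indicator cell y *\<^sub>R F (y + k))"
   by (rule integrable_mult_indicator[OF cm integrable_shift[OF F(1)]])
  from integrable_shift[OF this, of "- k"] show ?thesis by simp
 qed
 have sh: "(LINT y|\<L>. indicator cell (y - k) *\<^sub>R F y) = (LINT y|\<L>. indicator cell y *\<^sub>R F (y + k))" for k
  using integral_shift[of "\<lambda>y. indicator cell (y - k) *\<^sub>R F y" k] by simp
 have Fi: "integrable \<L> (\<lambda>y. indicator cell y *\<^sub>R F (y + k))" for k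
  by (rule integrable_mult_indicator[OF cm integrable_shift[OF F(1)]])
 then show "k \<in> lattice3 ==> set_integrable \<L> cell (\<lambda>y. F (y + k))"
  by (simp add: set_integrable_def)
 have "AE y in \<L>. F y = (\<Sum>k\<in>lat (R + 1). indicator cell (y - k) *\<^sub>R F y)"
  using AE_in_cells
 proof eventually_elim
  case (elim y)
  then obtain k where k: "k \<in> lattice3" "y - k \<in> cell" by blast
  show ?case
  proof (cases "F y = 0")
   case False
   then have "norm y \<le> R" using F(2) by force
   moreover have "norm (y - k) < 1" using k(2) norm_closure_cell closure_subset by blast
   ultimately have "norm k \<le> R + 1" using norm_triangle_ineq4[of y "y - k"] by simp
   then have kl: "k \<in> lat (R + 1)" using k by (simp add: lat_def)
   have "indicator cell (y - j) *\<^sub>R F y = (if j = k then F y else 0)" if "j \<in> lat (R + 1)" for j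
   proof (cases "y - j \<in> cell")
    case True
    then have "(y - j) - (k - j) \<in> closure cell" using k(2) closure_subset[of cell] by auto
    moreover have "k - j \<in> lattice3" using k(1) that by (simp add: lattice_diff lat_def)
    ultimately have "k - j = 0" using cell_translate[OF True] by blast
    then show ?thesis using True by simp
   qed (use k in auto)
   then have "(\<Sum>j\<in>lat (R + 1). indicator cell (y - j) *\<^sub>R F y) = (\<Sum>j\<in>lat (R + 1). if j = k then F y else 0)"
    by (rule sum.cong[OF refl])
   also have "\<dots> = F y" using kl finite_lat by simp
   finally show ?thesis by simp
  qed simp
 qed
 then have "(LINT y|\<L>. F y) = (LINT y|\<L>. (\<Sum>k\<in>lat (R + 1). indicator cell (y - k) *\<^sub>R F y))"
  by (rule integral_AE)
 also have "\<dots> = (\<Sum>k\<in>lat (R + 1). LINT y|\<L>. indicator cell y *\<^sub>R F (y + k))"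
  by (subst Bochner_Integration.integral_sum) (auto intro: Fk simp: sh)
 also have "\<dots> = (LINT y|\<L>. (\<Sum>k\<in>lat (R + 1). indicator cell y *\<^sub>R F (y + k)))"
  by (subst Bochner_Integration.integral_sum) (auto intro: Fi)
 finally show "(LINT y|\<L>. F y) = (LINT y:cell|\<L>. (\<Sum>k\<in>lat (R + 1). F (y + k)))"
  by (simp add: set_lebesgue_integral_def scaleR_sum_right)
qed

section \<open>Periodisation\<close>

text \<open>Summing over the nonzero terms only makes the index set finite for compactly supported
  \<open>f\<close> and frees the definition from any choice of a radius.\<close>

definition periodize :: "(R3 => real) => R3 => real" where
 "periodize f y = (\<Sum>k | k \<in> lattice3 \<and> f (y + k) \<noteq> 0. f (y + k))"

lemma periodize_eq:
 assumes "\<And>y. norm y > R ==> f y = 0" "norm y \<le> M" "R + M \<le> N"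
 shows "periodize f y = (\<Sum>k\<in>lat N. f (y + k))"
 unfolding periodize_def
proof (rule sum.mono_neutral_left[OF finite_lat])
 show "{k. k \<in> lattice3 \<and> f (y + k) \<noteq> 0} \<subseteq> lat N"
 proof
  fix k assume k: "k \<in> {k. k \<in> lattice3 \<and> f (y + k) \<noteq> 0}"
  then have "norm (y + k) \<le> R" using assms(1) by force
  then have "norm k \<le> R + M" using norm_triangle_ineq4[of "y + k" y] assms(2) by simp
  then show "k \<in> lat N" using k assms(3) by (simp add: lat_def)
 qed
qed (auto simp: lat_def)

lemma periodic_periodize: "periodic (periodize f)"
 unfolding periodic_def
proof (intro ballI allI)
 fix k y assume k: "k \<in> lattice3"
 show "periodize f (y + k) = periodize f y"
  unfolding periodize_def
  by (rule sum.reindex_bij_witness[of _ "\<lambda>j. j - k" "\<lambda>j. j + k"])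
   (use k in \<open>auto simp: algebra_simps lattice_add lattice_diff\<close>)
qed

lemma smooth_periodize:
 assumes f: "smooth f" and R: "\<And>y. norm y > R ==> f y = 0"
 shows "smooth (periodize f)"
  "norm y < M ==> R + M \<le> N ==> pd l (periodize f) y = (\<Sum>k\<in>lat N. pd l f (y + k))"
proof -
 have g: "smooth (\<lambda>y. \<Sum>k\<in>lat N. f (y + k))" for N
  using smooth_affine[OF f, of 1] by (intro smooth_sum finite_lat) simp
 show "smooth (periodize f)"
 proof (rule smooth_local)
  fix x :: R3
  show "\<exists>V g. open V \<and> x \<in> V \<and> smooth g \<and> (\<forall>y\<in>V. periodize f y = g y)"
   by (rule exI[of _ "ball 0 (norm x + 1)"], rule exI[of _ "\<lambda>y. \<Sum>k\<in>lat (R + (norm x + 1)). f (y + k)"])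
    (auto intro!: g periodize_eq[OF R])
 qed
 assume y: "norm y < M" "R + M \<le> N"
 have "pd l (periodize f) y = pd l (\<lambda>y. \<Sum>k\<in>lat N. f (y + k)) y"
  by (rule pd_cong_open[of "ball 0 M"]) (use y in \<open>auto intro!: g periodize_eq[OF R]\<close>)
 also have "\<dots> = (\<Sum>k\<in>lat N. pd l (\<lambda>y. f (y + k)) y)"
  using smooth_affine[OF f, of 1] by (intro pd_sum finite_lat) simp
 also have "\<dots> = (\<Sum>k\<in>lat N. pd l f (y + k))"
  using pd_affine[OF f, of l 1] by simp
 finally show "pd l (periodize f) y = (\<Sum>k\<in>lat N. pd l f (y + k))" .
qed

lemma periodic_pd:
 assumes "smooth f" "periodic f" shows "periodic (pd l f)"
 unfolding periodic_def
proof (intro ballI allI)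
 fix k y assume "k \<in> lattice3"
 then have "(\<lambda>y. f (1 *\<^sub>R y + k)) = f" using assms(2) by (auto simp: periodic_def)
 then show "pd l f (y + k) = pd l f y" using pd_affine[OF assms(1), of l 1 k y] by simp
qed

lemma periodize_cell:
 assumes "\<And>y. y \<notin> cell ==> f y = 0" "y \<in> cell"
 shows "periodize f y = f y"
proof -
 have "k = 0" if "k \<in> lattice3" "f (y + k) \<noteq> 0" for k
 proof -
  have "y - (- k) \<in> closure cell" using that(2) assms(1)[of "y + k"] closure_subset[of cell] by auto
  then have "- k = 0" using cell_translate[OF assms(2)] lattice_minus[OF that(1)] by blast
  then show ?thesis by simp
 qed
 then have "{k. k \<in> lattice3 \<and> f (y + k) \<noteq> 0} = (if f y = 0 then {} else {0})"
  using lattice_0 by force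
 then show ?thesis by (simp add: periodize_def)
qed

lemma integral_periodic_mult:
 fixes s :: "R3 => complex"
 assumes s: "\<And>k. k \<in> lattice3 ==> AE y in \<L>. s (y + k) = s y"
  and f: "\<And>y. norm y > R ==> f y = 0" and i: "integrable \<L> (\<lambda>y. s y * f y)"
 shows "(LINT y|\<L>. s y * f y) = (LINT y:cell|\<L>. s y * (\<Sum>k\<in>lat (R + 1). f (y + k)))"
proof -
 have ae: "AE y in \<L>. \<forall>k\<in>lat (R + 1). s (y + k) = s y"
  using s by (intro AE_finite_allI finite_lat) (auto simp: lat_def)
 have "(LINT y|\<L>. s y * f y) = (LINT y:cell|\<L>. (\<Sum>k\<in>lat (R + 1). s (y + k) * f (y + k)))"
  by (rule integral_cells(1)[OF i]) (simp add: f)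
 also have "\<dots> = (LINT y:cell|\<L>. s y * (\<Sum>k\<in>lat (R + 1). f (y + k)))"
  by (rule set_integral_AE_eq) (use ae in \<open>eventually_elim, simp add: sum_distrib_left\<close>)
 finally show ?thesis .
qed

section \<open>The geometry of the phases\<close>

locale cell_geom =
 fixes Ys Yf Gam :: "R3 set"
 assumes geometry: "cell_geometry Ys Yf Gam"
begin

lemma cell_eq: "cell = Ys \<union> Yf \<union> Gam" and disj: "Ys \<inter> Yf = {}" "Ys \<inter> Gam = {}" "Yf \<inter> Gam = {}"
 and open_Y: "open Ys" "open Yf" and open_per: "open (per_ext Ys)" "open (per_ext Yf)"
 and Gam_s: "Gam = cell \<inter> frontier Ys" and Gam_f: "Gam = cell \<inter> frontier Yf"
 using geometry unfolding cell_geometry_def by blast+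

lemma sub_cell: "Ys \<subseteq> cell" "Yf \<subseteq> cell" "Gam \<subseteq> cell" using cell_eq by blast+

text \<open>A nonempty open intersection would contain points interior to translated cells, and
  there the extensions reduce to \<open>Ys\<close> and \<open>Yf\<close>. This avoids any discussion
  of the points on the faces that \<open>per_ext\<close> adds.\<close>

lemma per_disjoint: "per_ext Ys \<inter> per_ext Yf = {}"
proof (rule ccontr)
 assume n: "per_ext Ys \<inter> per_ext Yf \<noteq> {}"
 have "AE y in \<L>. y \<in> per_ext Ys \<inter> per_ext Yf --> (\<exists>k\<in>lattice3. y - k \<in> cell)"
  using AE_in_cells by eventually_elim simp
 from AE_ball_nonempty[OF this _ n] open_per obtain y k where y: "y \<in> per_ext Ys" "y \<in> per_ext Yf" "k \<in> lattice3" "y - k \<in> cell"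
  by blast
 then have "y - k \<in> per_ext Ys" "y - k \<in> per_ext Yf"
  using per_ext_shift[OF lattice_minus[OF y(3)], of y] by auto
 then have "y - k \<in> Ys" "y - k \<in> Yf" using per_ext_cell sub_cell y(4) by blast+
 then show False using disj by blast
qed

text \<open>For points on the faces: since \<open>Gam\<close> lies in the frontier of
  \<open>Ys\<close>, the closure of the cell is the union of the closures of \<open>Ys\<close> and
  \<open>Yf\<close>, and \<open>per_ext\<close> includes those closures on the faces.\<close>

lemma per_cover: "y \<in> per_ext Ys \<or> y \<in> per_ext Yf \<or> y \<in> per_surf Gam"
proof -
 define z where "z = y - nearest y"
 have yz: "y = z + nearest y" by (simp add: z_def)
 have "z \<in> closure cell" unfolding z_def by (rule nearest_closure_cell)
 then consider "z \<in> Ys" | "z \<in> Yf" | "z \<in> Gam" | "z \<in> frontier cell"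
  using cell_eq by (auto simp: frontier_cell)
 then show ?thesis
 proof cases
  case 3
  then show ?thesis unfolding per_surf_def using nearest_lattice[of y] yz by blast
 next
  case 4
  have "closure cell = closure Ys \<union> closure Yf \<union> closure Gam" by (simp add: cell_eq closure_Un)
  moreover have "closure Gam \<subseteq> closure Ys"
   using Gam_s closure_mono[of Gam "closure Ys"] by (auto simp: frontier_def)
  ultimately have "z \<in> closure Ys \<or> z \<in> closure Yf" using \<open>z \<in> closure cell\<close> by blast
  then show ?thesis unfolding per_ext_def using 4 nearest_lattice[of y] yz by blast
 next
  case 1
  then show ?thesis using per_ext_shift[OF nearest_lattice, of z y Ys] per_ext_subset yz by auto
 next
  case 2
  then show ?thesis using per_ext_shift[OF nearest_lattice, of z y Yf] per_ext_subset yz by auto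
 qed
qed

text \<open>A limit point of \<open>Gam\<close> on a face of the cell would lie in the closures of
  both phases, hence in both periodic extensions, which are disjoint. The interface therefore stays
  away from the faces.\<close>

lemma compact_Gam: "compact Gam"
proof -
 have "closure Gam \<subseteq> Gam"
 proof
  fix x assume x: "x \<in> closure Gam"
  have "closure Gam \<subseteq> closure Ys" using Gam_s closure_mono[of Gam "closure Ys"] by (auto simp: frontier_def)
  moreover have "closure Gam \<subseteq> closure Yf" using Gam_f closure_mono[of Gam "closure Yf"] by (auto simp: frontier_def)
  moreover have "closure Gam \<subseteq> frontier Ys" using Gam_s closure_minimal[of Gam "frontier Ys"] by (simp add: frontier_closed)
  moreover have "closure Gam \<subseteq> closure cell" using sub_cell(3) by (rule closure_mono)
  ultimately have xc: "x \<in> closure Ys" "x \<in> closure Yf" "x \<in> frontier Ys" "x \<in> closure cell" using x by blast+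
  show "x \<in> Gam"
  proof (cases "x \<in> cell")
   case True
   then show ?thesis using xc Gam_s by blast
  next
   case False
   then have f: "x \<in> frontier cell" using xc by (simp add: frontier_cell)
   have "x \<in> per_ext Ys" "x \<in> per_ext Yf"
    unfolding per_ext_def using xc f lattice_0 by force+
   then show ?thesis using per_disjoint by blast
  qed
 qed
 then have "closed Gam" by (simp add: closure_subset_eq)
 moreover have "bounded Gam" using bounded_cell sub_cell(3) bounded_subset by blast
 ultimately show ?thesis by (simp add: compact_eq_bounded_closed)
qed

end

section \<open>The surface measure of the interface\<close>

text \<open>Keeps the covers of the Hausdorff construction explicit, so that bounds can be
  transported cover by cover under scaling and translation.\<close>

definition area_le :: "R3 set => real => bool" where
 "area_le A H \<longleftrightarrow> (\<forall>\<delta>>0. \<exists>C :: nat => R3 set. A \<subseteq> (\<Union>i. C i) \<and> (\<forall>i. bounded (C i) \<and> diameter (C i) \<le> \<delta>) \<and>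
  (\<Sum>i. ennreal (pi / 4 * (diameter (C i))\<^sup>2)) \<le> ennreal H)"

text \<open>Were \<open>hausdorff2_outer\<close> not countably additive on Borel sets, \<open>measure_of\<close> would yield the zero
measure; an upper bound holds in either case, and no lower bound is needed.\<close>

lemma emeasure_surf_le:
 assumes "area_le A H" shows "emeasure surf A \<le> ennreal H"
proof -
 have "hausdorff2_outer A \<le> ennreal H"
  unfolding hausdorff2_outer_def
 proof (rule SUP_least)
  fix \<delta> :: real assume "\<delta> \<in> {0<..}"
  then obtain C :: "nat => R3 set" where C: "A \<subseteq> (\<Union>i. C i) \<and> (\<forall>i. bounded (C i) \<and> diameter (C i) \<le> \<delta>)"
   "(\<Sum>i. ennreal (pi / 4 * (diameter (C i))\<^sup>2)) \<le> ennreal H"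
   using assms unfolding area_le_def by auto
  show "(INF C\<in>{C :: nat => R3 set. A \<subseteq> (\<Union>i. C i) \<and> (\<forall>i. bounded (C i) \<and> diameter (C i) \<le> \<delta>)}.
   (\<Sum>i. ennreal (pi / 4 * (diameter (C i))\<^sup>2))) \<le> ennreal H"
   by (rule INF_lower2[of C]) (use C in auto)
 qed
 then show ?thesis
  unfolding surf_def emeasure_measure_of_conv by auto
qed

lemma sets_surf: "sets surf = sets borel"
 unfolding surf_def using sets.sigma_sets_eq[of borel] by (simp add: sets_measure_of_conv)

lemma area_le_scale:
 assumes "area_le A H" "e > 0"
 shows "area_le ((\<lambda>y. e *\<^sub>R y + c) ` A) (e\<^sup>2 * H)"
 unfolding area_le_def
proof (intro allI impI)
 fix \<delta> :: real assume \<delta>: "\<delta> > 0"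
 obtain C :: "nat => R3 set" where C: "A \<subseteq> (\<Union>i. C i)" "\<And>i. bounded (C i)" "\<And>i. diameter (C i) \<le> \<delta> / e"
   "(\<Sum>i. ennreal (pi / 4 * (diameter (C i))\<^sup>2)) \<le> ennreal H"
  using assms \<delta> unfolding area_le_def by (metis divide_pos_pos)
 let ?f = "\<lambda>y. e *\<^sub>R y + c"
 have b: "bounded (?f ` C i)" for i
  using bounded_translation[OF bounded_scaling[OF C(2)[of i], of e], of c] by (simp add: image_image add.commute)
 have d: "diameter (?f ` C i) \<le> e * diameter (C i)" for i
 proof (rule diameter_le)
  show "?f ` C i \<noteq> {} \<or> 0 \<le> e * diameter (C i)" using diameter_ge_0[OF C(2)[of i]] assms(2) by simp
  fix x y assume "x \<in> ?f ` C i" "y \<in> ?f ` C i"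
  then obtain x' y' where xy: "x' \<in> C i" "y' \<in> C i" "x = ?f x'" "y = ?f y'" by blast
  have "norm (x' - y') \<le> diameter (C i)" using diameter_bounded_bound[OF C(2) xy(1,2)] by (simp add: dist_norm)
  moreover have "norm (x - y) = e * norm (x' - y')"
   using assms(2) by (simp add: xy flip: scaleR_diff_right)
  ultimately show "norm (x - y) \<le> e * diameter (C i)" using assms(2) by simp
 qed
 have "(\<Sum>i. ennreal (pi / 4 * (diameter (?f ` C i))\<^sup>2)) \<le> (\<Sum>i. ennreal (e\<^sup>2) * ennreal (pi / 4 * (diameter (C i))\<^sup>2))"
 proof (rule suminf_le)
  fix i
  have "(diameter (?f ` C i))\<^sup>2 \<le> (e * diameter (C i))\<^sup>2"
   by (rule power_mono[OF d diameter_ge_0[OF b]])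
  then have "pi / 4 * (diameter (?f ` C i))\<^sup>2 \<le> e\<^sup>2 * (pi / 4 * (diameter (C i))\<^sup>2)"
   by (simp add: power_mult_distrib mult_left_mono)
  then show "ennreal (pi / 4 * (diameter (?f ` C i))\<^sup>2) \<le> ennreal (e\<^sup>2) * ennreal (pi / 4 * (diameter (C i))\<^sup>2)"
   by (simp add: ennreal_leI flip: ennreal_mult)
 qed auto
 also have "\<dots> = ennreal (e\<^sup>2) * (\<Sum>i. ennreal (pi / 4 * (diameter (C i))\<^sup>2))" by simp
 also have "\<dots> \<le> ennreal (e\<^sup>2) * ennreal H" by (rule mult_left_mono[OF C(4)]) simp
 also have "\<dots> = ennreal (e\<^sup>2 * H)" by (simp add: ennreal_mult')
 finally have "(\<Sum>i. ennreal (pi / 4 * (diameter (?f ` C i))\<^sup>2)) \<le> ennreal (e\<^sup>2 * H)" .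
 moreover have "diameter (?f ` C i) \<le> \<delta>" for i
  using d[of i] C(3)[of i] assms(2) by (simp add: field_simps)
 moreover have "?f ` A \<subseteq> (\<Union>i. ?f ` C i)" using C(1) by blast
 ultimately show "\<exists>C. ?f ` A \<subseteq> (\<Union>i. C i) \<and> (\<forall>i. bounded (C i) \<and> diameter (C i) \<le> \<delta>) \<and>
  (\<Sum>i. ennreal (pi / 4 * (diameter (C i))\<^sup>2)) \<le> ennreal (e\<^sup>2 * H)"
  using b by (intro exI[of _ "\<lambda>i. ?f ` C i"]) blast
qed

lemma C1_Lipschitz_square:
 fixes g :: "real \<times> real => real"
 assumes "Ck 1 g"
 obtains L where "L \<ge> 0" "\<And>p q. p \<in> cbox (- r, - r) (r, r) ==> q \<in> cbox (- r, - r) (r, r) ==> \<bar>g p - g q\<bar> \<le> L * norm (p - q)"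
proof -
 let ?S = "cbox (- r, - r) (r, r) :: (real \<times> real) set"
 have d: "(g has_derivative frechet_derivative g (at x)) (at x)" for x
  using assms by (intro Ck_has_derivative[of 0]) simp
 have "\<exists>B. \<forall>x\<in>?S. norm (frechet_derivative g (at x) b) \<le> B" if "b \<in> Basis" for b
 proof -
  have "continuous_on UNIV (\<lambda>x. frechet_derivative g (at x) b)" using assms that by simp
  then have "continuous_on ?S (\<lambda>x. frechet_derivative g (at x) b)" by (rule continuous_on_subset) simp
  from compact_imp_bounded[OF compact_continuous_image[OF this compact_cbox]]
  show ?thesis unfolding bounded_iff by auto
 qed
 then obtain B where B: "\<And>b x. b \<in> Basis ==> x \<in> ?S ==> norm (frechet_derivative g (at x) b) \<le> B b" by metis
 define L where "L = (\<Sum>b\<in>(Basis :: (real \<times> real) set). \<bar>B b\<bar>)"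
 have "norm (g p - g q) \<le> L * norm (p - q)" if "p \<in> ?S" "q \<in> ?S" for p q
 proof (rule differentiable_bound[OF convex_box(1) _ _ that])
  fix x assume x: "x \<in> ?S"
  show "(g has_derivative frechet_derivative g (at x)) (at x within ?S)"
   using d has_derivative_at_withinI by blast
  interpret bounded_linear "frechet_derivative g (at x)" using d by (rule has_derivative_bounded_linear)
  show "onorm (frechet_derivative g (at x)) \<le> L"
  proof (rule onorm_le)
   fix h :: "real \<times> real"
   have "frechet_derivative g (at x) h = frechet_derivative g (at x) (\<Sum>b\<in>Basis. (h \<bullet> b) *\<^sub>R b)"
    by (simp add: euclidean_representation)
   also have "\<dots> = (\<Sum>b\<in>Basis. (h \<bullet> b) *\<^sub>R frechet_derivative g (at x) b)" by (simp only: sum scaleR)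
   also have "norm \<dots> \<le> (\<Sum>b\<in>Basis. norm ((h \<bullet> b) *\<^sub>R frechet_derivative g (at x) b))" by (rule norm_sum)
   also have "\<dots> \<le> (\<Sum>b\<in>(Basis :: (real \<times> real) set). norm h * \<bar>B b\<bar>)"
   proof (rule sum_mono)
    fix b :: "real \<times> real" assume b: "b \<in> Basis"
    have "norm (frechet_derivative g (at x) b) \<le> \<bar>B b\<bar>" using B[OF b x] by simp
    then show "norm ((h \<bullet> b) *\<^sub>R frechet_derivative g (at x) b) \<le> norm h * \<bar>B b\<bar>"
     using Basis_le_norm[OF b, of h] by (simp add: abs_mult mult_mono)
   qed
   finally show "norm (frechet_derivative g (at x) h) \<le> L * norm h"
    by (simp add: L_def sum_distrib_left mult.commute)
  qed
 qed
 moreover have "L \<ge> 0" unfolding L_def by (rule sum_nonneg) simp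
 ultimately show ?thesis using that by auto
qed

text \<open>Over a grid of \<open>M * M\<close> squares of side \<open>s = 2 * r / M\<close> each
  patch of the graph has diameter at most \<open>K * s\<close>. The sum of the squared diameters is
  then bounded by \<open>(2 * K * r)\<^sup>2\<close>, whatever \<open>M\<close> is.\<close>

lemma graph_area_le:
 fixes T :: "R3 => R3"
 assumes T: "orthogonal_transformation T" and g: "Ck 1 g" and r: "r > 0"
  and A: "\<And>y. y \<in> A ==> norm (y - x) \<le> r \<and> T (y - x) $ 3 = g (T (y - x) $ 1, T (y - x) $ 2)"
 shows "\<exists>H\<ge>0. area_le A H"
proof -
 obtain L where L: "L \<ge> 0" "\<And>p q. p \<in> cbox (- r, - r) (r, r) ==> q \<in> cbox (- r, - r) (r, r) ==> \<bar>g p - g q\<bar> \<le> L * norm (p - q)"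
  using C1_Lipschitz_square[OF g] by metis
 have lin: "linear T" and iso: "norm (T v) = norm v" for v using T by (auto simp: orthogonal_transformation)
 define a where "a = (\<lambda>y. T (y - x) $ 1)"
 define b where "b = (\<lambda>y. T (y - x) $ 2)"
 have ab: "\<bar>a y\<bar> \<le> r" "\<bar>b y\<bar> \<le> r" if "y \<in> A" for y
  using component_le_norm_cart[of "T (y - x)"] iso[of "y - x"] A[OF that] by (auto simp: a_def b_def intro: order_trans)
 \<comment> \<open>The three rotated coordinates of a difference contribute \<open>s\<close>,
   \<open>s\<close> and \<open>L * (2 * s)\<close> to its sum norm.\<close>
 define K where "K = 2 + 2 * L"
 have K: "K \<ge> 0" using L by (simp add: K_def)
 have dist: "norm (y - z) \<le> K * s" if yz: "y \<in> A" "z \<in> A" "\<bar>a y - a z\<bar> \<le> s" "\<bar>b y - b z\<bar> \<le> s" for y z s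
 proof -
  have in_sq: "(a w, b w) \<in> cbox (- r, - r) (r, r)" if "w \<in> A" for w
   using ab[OF that] by (auto simp: cbox_Pair_eq)
  have n: "norm ((a y, b y) - (a z, b z)) \<le> 2 * s"
   using norm_Pair_le[of "a y - a z" "b y - b z"] yz by simp
  have "T (y - z) = T (y - x) - T (z - x)" using linear_diff[OF lin, of "y - x" "z - x"] by simp
  then have c: "T (y - z) $ 1 = a y - a z" "T (y - z) $ 2 = b y - b z" "T (y - z) $ 3 = g (a y, b y) - g (a z, b z)"
   using A yz by (auto simp: a_def b_def)
  have "norm (y - z) = norm (T (y - z))" using iso by simp
  also have "\<dots> \<le> (\<Sigma> i. \<bar>T (y - z) $ i\<bar>)" by (rule norm_le_l1_cart)
  also have "\<dots> = \<bar>a y - a z\<bar> + \<bar>b y - b z\<bar> + \<bar>g (a y, b y) - g (a z, b z)\<bar>" by (simp add: sum_3 c)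
  also have "\<dots> \<le> s + s + L * (2 * s)"
   using yz L(2)[OF in_sq in_sq, OF yz(1,2)] mult_left_mono[OF n L(1)] by linarith
  finally show ?thesis by (simp add: K_def algebra_simps)
 qed
 define H where "H = pi / 4 * (2 * K * r)\<^sup>2"
 have "area_le A H" unfolding area_le_def
 proof (intro allI impI)
  fix \<delta> :: real assume \<delta>: "\<delta> > 0"
  obtain M :: nat where M: "M > 0" "2 * K * r / \<delta> < real M"
   using reals_Archimedean2[of "max 1 (2 * K * r / \<delta>)"] by (metis max_less_iff_conj of_nat_0_less_iff less_trans zero_less_one)
  define s where "s = 2 * r / real M"
  have s: "s > 0" "K * s \<le> \<delta>" using r M \<delta> by (auto simp: s_def field_simps)
  \<comment> \<open>The minimum with \<open>M - 1\<close> assigns the right end point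
    \<open>t = r\<close> to the last interval.\<close>
  define cellno where "cellno = (\<lambda>t. min (M - 1) (nat \<lfloor>(t + r) / s\<rfloor>))"
  have close: "\<bar>t - t'\<bar> \<le> s" if "\<bar>t\<bar> \<le> r" "\<bar>t'\<bar> \<le> r" "cellno t = cellno t'" for t t'
  proof -
   have rng: "real (cellno t) * s \<le> t + r \<and> t + r \<le> (real (cellno t) + 1) * s" if t: "\<bar>t\<bar> \<le> r" for t
   proof -
    have q0: "0 \<le> (t + r) / s" using t s by (auto simp: abs_le_iff)
    have qM: "(t + r) / s \<le> real M" using t s M r by (simp add: s_def field_simps abs_le_iff)
    let ?n = "nat \<lfloor>(t + r) / s\<rfloor>"
    have n: "real ?n \<le> (t + r) / s" "(t + r) / s < real ?n + 1" using q0 by linarith+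
    have "real (cellno t) \<le> (t + r) / s" using n(1) by (simp add: cellno_def min_def of_nat_diff)
    moreover have "(t + r) / s \<le> real (cellno t) + 1"
    proof (cases "?n \<le> M - 1")
     case True
     then show ?thesis using n(2) by (simp add: cellno_def min_def)
    next
     case False
     then have "cellno t = M - 1" by (simp add: cellno_def min_def)
     then show ?thesis using qM M(1) by (simp add: of_nat_diff)
    qed
    ultimately show ?thesis using s by (simp add: field_simps)
   qed
   show ?thesis using rng[OF that(1)] rng[OF that(2)] that(3) by (simp add: algebra_simps abs_le_iff)
  qed
  define C where "C = (\<lambda>n. if n < M * M then {y \<in> A. cellno (a y) = n div M \<and> cellno (b y) = n mod M} else {})"
  have bA: "bounded A"
   unfolding bounded_iff using A norm_triangle_sub[of _ x] by (intro exI[of _ "norm x + r"]) (metis add_left_mono order_trans)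
  have Cb: "bounded (C n)" for n unfolding C_def by (auto intro: bounded_subset[OF bA])
  have Cd: "diameter (C n) \<le> K * s" for n
  proof (rule diameter_le)
   show "C n \<noteq> {} \<or> 0 \<le> K * s" using K s by simp
   fix y z assume "y \<in> C n" "z \<in> C n"
   then have "y \<in> A" "z \<in> A" "cellno (a y) = cellno (a z)" "cellno (b y) = cellno (b z)"
    by (auto simp: C_def split: if_splits)
   then show "norm (y - z) \<le> K * s" using ab by (intro dist close) auto
  qed
  have cover: "A \<subseteq> (\<Union>n. C n)"
  proof
   fix y assume y: "y \<in> A"
   define n where "n = cellno (a y) * M + cellno (b y)"
   have lt: "cellno t < M" for t using M(1) by (simp add: cellno_def)
   have "n < (cellno (a y) + 1) * M" using lt[of "b y"] by (simp add: n_def algebra_simps)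
   also have "\<dots> \<le> M * M" using lt[of "a y"] by (intro mult_le_mono1) simp
   finally have "n < M * M" .
   moreover have "n div M = cellno (a y)" "n mod M = cellno (b y)"
    using lt[of "b y"] M(1) by (simp_all add: n_def)
   ultimately have "y \<in> C n" using y by (simp add: C_def)
   then show "y \<in> (\<Union>n. C n)" by blast
  qed
  have "(\<Sum>n. ennreal (pi / 4 * (diameter (C n))\<^sup>2)) = (\<Sum>n<M * M. ennreal (pi / 4 * (diameter (C n))\<^sup>2))"
   by (rule suminf_finite) (auto simp: C_def)
  also have "\<dots> \<le> (\<Sum>n<M * M. ennreal (pi / 4 * (K * s)\<^sup>2))"
   by (intro sum_mono ennreal_leI mult_left_mono power_mono Cd diameter_ge_0 Cb) simp_all
  also have "\<dots> = ennreal (real (M * M) * (pi / 4 * (K * s)\<^sup>2))"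
   by (simp add: ennreal_of_nat_eq_real_of_nat flip: ennreal_mult)
  also have "real (M * M) * (pi / 4 * (K * s)\<^sup>2) = H"
   using M(1) by (simp add: H_def s_def power2_eq_square field_simps)
  finally have "(\<Sum>n. ennreal (pi / 4 * (diameter (C n))\<^sup>2)) \<le> ennreal H" .
  then show "\<exists>C :: nat => R3 set. A \<subseteq> (\<Union>i. C i) \<and> (\<forall>i. bounded (C i) \<and> diameter (C i) \<le> \<delta>) \<and>
  (\<Sum>i. ennreal (pi / 4 * (diameter (C i))\<^sup>2)) \<le> ennreal H"
   using cover Cb order_trans[OF Cd s(2)] by blast
 qed
 moreover have "H \<ge> 0" by (simp add: H_def)
 ultimately show ?thesis by blast
qed

text \<open>The graph is contained in the image of a plane under a differentiable map into three
  dimensions.\<close>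

lemma graph_negligible:
 fixes T :: "R3 => R3" and g :: "real \<times> real => real"
 assumes T: "orthogonal_transformation T" and g: "\<And>p. g differentiable (at p)"
  and A: "\<And>y. y \<in> A ==> T (y - x) $ 3 = g (T (y - x) $ 1, T (y - x) $ 2)"
 shows "negligible A"
proof -
 define S where "S = inv T"
 have S: "linear S" "S (T v) = v" for v
 proof -
  have "bij T" by (rule orthogonal_transformation_bij[OF T])
  then show "S (T v) = v" unfolding S_def by (simp add: bij_is_inj)
  show "linear S" unfolding S_def using orthogonal_transformation_inv[OF T] by (simp add: orthogonal_transformation)
 qed
 define \<Psi> where "\<Psi> = (\<lambda>p :: real \<times> real. x + S (fst p *\<^sub>R axis 1 1 + snd p *\<^sub>R axis 2 1 + g p *\<^sub>R axis 3 1))"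
 have "A \<subseteq> range \<Psi>"
 proof
  fix y assume y: "y \<in> A"
  let ?v = "T (y - x)"
  have "?v = ?v $ 1 *\<^sub>R axis 1 1 + ?v $ 2 *\<^sub>R axis 2 1 + ?v $ 3 *\<^sub>R axis 3 1"
   using basis_expansion[of ?v] by (simp add: sum_3 scalar_mult_eq_scaleR)
  then have "S ?v = S (?v $ 1 *\<^sub>R axis 1 1 + ?v $ 2 *\<^sub>R axis 2 1 + g (?v $ 1, ?v $ 2) *\<^sub>R axis 3 1)"
   using A[OF y] by simp
  then have "y = \<Psi> (?v $ 1, ?v $ 2)" by (simp add: S(2) \<Psi>_def algebra_simps)
  then show "y \<in> range \<Psi>" by blast
 qed
 moreover have "negligible (range \<Psi>)"
 proof (rule negligible_differentiable_image_lowdim)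
  show "DIM(real \<times> real) < DIM(R3)" by simp
  have "bounded_linear S" using S(1) by (simp add: linear_linear)
  show "\<Psi> differentiable_on UNIV"
   unfolding differentiable_on_def
  proof
   fix p
   have "(g has_derivative frechet_derivative g (at p)) (at p)" using g by (simp add: frechet_derivative_works)
   then have "((\<lambda>p. fst p *\<^sub>R axis 1 1 + snd p *\<^sub>R axis 2 1 + g p *\<^sub>R axis 3 1) has_derivative
    (\<lambda>h. fst h *\<^sub>R axis 1 1 + snd h *\<^sub>R axis 2 1 + frechet_derivative g (at p) h *\<^sub>R (axis 3 1 :: R3))) (at p)"
    by (auto intro!: derivative_eq_intros)
   from has_derivative_add[OF has_derivative_const bounded_linear.has_derivative[OF \<open>bounded_linear S\<close> this], of x]
   show "\<Psi> differentiable at p" unfolding \<Psi>_def differentiable_def by blast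
  qed
 qed
 ultimately show ?thesis using negligible_subset by blast
qed

context cell_geom
begin

text \<open>Compactness of \<open>Gam\<close> reduces its charts to finitely many. The pieces are
  compact so that their affine images are Borel, hence measurable for \<open>surf\<close>.\<close>

lemma Gam_pieces:
 "\<exists>\<F> H. finite \<F> \<and> Gam = \<Union>\<F> \<and> (\<forall>A\<in>\<F>. compact A \<and> negligible A \<and> area_le A H) \<and> H \<ge> 0"
proof -
 have ss: "smooth_surface Gam" using geometry unfolding cell_geometry_def by blast
 have "\<exists>r H. r > 0 \<and> H \<ge> 0 \<and> negligible (Gam \<inter> cball x r) \<and> area_le (Gam \<inter> cball x r) H" if x: "x \<in> Gam" for x
 proof -
  obtain T :: "R3 => R3" and g :: "real \<times> real => real" and r where
   T: "orthogonal_transformation T" and g: "smooth g" and r: "r > 0"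
   and gr: "\<forall>y\<in>ball x r. y \<in> Gam \<longleftrightarrow> T (y - x) $ 3 = g (T (y - x) $ 1, T (y - x) $ 2)"
   using ss x unfolding smooth_surface_def by blast
  have A: "norm (y - x) \<le> r / 2 \<and> T (y - x) $ 3 = g (T (y - x) $ 1, T (y - x) $ 2)" if "y \<in> Gam \<inter> cball x (r / 2)" for y
  proof -
   have "y \<in> ball x r" using that r by auto
   then show ?thesis using gr that by (auto simp: dist_norm norm_minus_commute)
  qed
  have "g differentiable (at p)" for p using smooth_has_derivative[OF g] unfolding differentiable_def by blast
  then have "negligible (Gam \<inter> cball x (r / 2))" using graph_negligible[OF T] A by blast
  moreover have "\<exists>H\<ge>0. area_le (Gam \<inter> cball x (r / 2)) H"
   by (rule graph_area_le[OF T smooth_Ck[OF g] _ A]) (use r in simp)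
  ultimately show ?thesis using r by (metis half_gt_zero)
 qed
 then obtain r H where rH: "\<And>x. x \<in> Gam ==> r x > 0" "\<And>x. x \<in> Gam ==> H x \<ge> (0::real)"
  "\<And>x. x \<in> Gam ==> negligible (Gam \<inter> cball x (r x))" "\<And>x. x \<in> Gam ==> area_le (Gam \<inter> cball x (r x)) (H x)"
  by metis
 have "Gam \<subseteq> (\<Union>x\<in>Gam. ball x (r x))" using rH(1) by force
 then obtain D where D: "D \<subseteq> Gam" "finite D" "Gam \<subseteq> (\<Union>x\<in>D. ball x (r x))"
  using compactE_image[OF compact_Gam, of Gam "\<lambda>x. ball x (r x)"] by (metis open_ball)
 define H' where "H' = (\<Sum>x\<in>D. H x)"
 have H': "H x \<le> H'" if "x \<in> D" for x
  unfolding H'_def using D rH(2) that by (intro member_le_sum) auto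
 have "area_le (Gam \<inter> cball x (r x)) H'" if "x \<in> D" for x
 proof -
  have "area_le (Gam \<inter> cball x (r x)) (H x)" using rH(4) D(1) that by (simp add: subset_iff)
  then show ?thesis
   unfolding area_le_def by (meson order_trans ennreal_leI H'[OF that])
 qed
 moreover have "Gam = \<Union>((\<lambda>x. Gam \<inter> cball x (r x)) ` D)" using D(3) ball_subset_cball by blast
 moreover have "H' \<ge> 0" unfolding H'_def using D(1) rH(2) by (intro sum_nonneg) auto
 moreover have "compact (Gam \<inter> cball x (r x))" for x by (intro compact_Int compact_Gam compact_cball)
 ultimately show ?thesis
 proof (intro exI[of _ "(\<lambda>x. Gam \<inter> cball x (r x)) ` D"] exI[of _ H'] conjI ballI)
  fix A assume "A \<in> (\<lambda>x. Gam \<inter> cball x (r x)) ` D"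
  then obtain x where x: "x \<in> D" "A = Gam \<inter> cball x (r x)" by blast
  show "compact A" unfolding x(2) by fact
  have "x \<in> Gam" using x(1) D(1) by (rule subsetD[rotated])
  then show "negligible A" unfolding x(2) by (rule rH(3))
  show "area_le A H'" unfolding x(2) using x(1) by fact
 qed (use D(2) in simp)
qed

lemma negligible_Gam: "negligible Gam"
proof -
 obtain \<F> H where F: "finite \<F>" "Gam = \<Union>\<F>" "\<And>A. A \<in> \<F> ==> compact A \<and> negligible A \<and> area_le A H" "H \<ge> 0"
  using Gam_pieces by blast
 have "negligible (\<Union>\<F>)" by (rule negligible_Union[OF F(1)]) (use F(3) in blast)
 then show ?thesis using F(2) by simp
qed

lemma interface_eq:
 assumes "e > 0"
 shows "interface \<Omega> Gam e = \<Omega> \<inter> (\<Union>k\<in>lattice3. (\<lambda>y. e *\<^sub>R y + e *\<^sub>R k) ` Gam)"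
proof -
 have "(1 / e) *\<^sub>R x \<in> per_surf Gam \<longleftrightarrow> x \<in> (\<Union>k\<in>lattice3. (\<lambda>y. e *\<^sub>R y + e *\<^sub>R k) ` Gam)" for x
 proof -
  have "(1 / e) *\<^sub>R x = y + k \<longleftrightarrow> x = e *\<^sub>R y + e *\<^sub>R k" for y k
  proof
   assume "(1 / e) *\<^sub>R x = y + k"
   then have "e *\<^sub>R ((1 / e) *\<^sub>R x) = e *\<^sub>R (y + k)" by simp
   then show "x = e *\<^sub>R y + e *\<^sub>R k" using assms by (simp add: scaleR_add_right)
  qed (use assms in \<open>simp add: scaleR_add_right\<close>)
  then show ?thesis unfolding per_surf_def UN_iff image_iff by simp
 qed
 then show ?thesis unfolding interface_def by blast
qed

lemma compact_affine_image: "compact A ==> compact ((\<lambda>y :: R3. e *\<^sub>R y + c) ` A)"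
 by (intro compact_continuous_image continuous_intros)

lemma interface_sets:
 assumes "e > 0" "open \<Omega>"
 shows "interface \<Omega> Gam e \<in> sets borel" "negligible (interface \<Omega> Gam e)"
proof -
 have "(\<lambda>y. e *\<^sub>R y + e *\<^sub>R k) ` Gam \<in> sets borel" for k
  using compact_affine_image[OF compact_Gam] by (simp add: borel_compact)
 then have "(\<Union>k\<in>lattice3. (\<lambda>y. e *\<^sub>R y + e *\<^sub>R k) ` Gam) \<in> sets borel"
  by (intro sets.countable_UN'' countable_lattice) auto
 then show "interface \<Omega> Gam e \<in> sets borel"
  unfolding interface_eq[OF assms(1)] using assms(2) by auto
 have "negligible ((\<lambda>y. e *\<^sub>R y + e *\<^sub>R k) ` Gam)" for k
 proof -
  have "(\<lambda>y. e *\<^sub>R y + e *\<^sub>R k) differentiable_on Gam"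
   unfolding differentiable_on_def differentiable_def by (auto intro!: derivative_eq_intros exI)
  then show ?thesis by (intro negligible_differentiable_image_negligible negligible_Gam) auto
 qed
 then have "negligible (\<Union>((\<lambda>k. (\<lambda>y. e *\<^sub>R y + e *\<^sub>R k) ` Gam) ` lattice3))"
  by (intro negligible_countable_Union countable_image countable_lattice) auto
 then show "negligible (interface \<Omega> Gam e)"
  unfolding interface_eq[OF assms(1)] by (rule negligible_subset) blast
qed

text \<open>A bounded set meets of the order of \<open>e\<close> to the power -3 scaled cells, and
  each of them carries a copy of \<open>Gam\<close> whose area is scaled by
  \<open>e\<^sup>2\<close>.\<close>

lemma surf_interface_bound:
 assumes "bounded \<Omega>" "open \<Omega>"
 obtains C where "\<And>e. 0 < e ==> e \<le> 1 ==> emeasure surf (interface \<Omega> Gam e) \<le> ennreal (C / e)"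
proof -
 obtain \<F> H where F: "finite \<F>" "Gam = \<Union>\<F>" "\<And>A. A \<in> \<F> ==> compact A \<and> negligible A \<and> area_le A H" "H \<ge> 0"
  using Gam_pieces by blast
 obtain R where R: "R > 0" "\<And>x. x \<in> \<Omega> ==> norm x \<le> R" using assms(1) bounded_pos by blast
 \<comment> \<open>The number of cells along one axis is at most \<open>2 * M + 1\<close> with
   \<open>M \<le> R / e + 2\<close>. As \<open>1 \<le> 1 / e\<close>, the rounding terms are
   absorbed by the 7.\<close>
 define C where "C = (2 * R + 7) ^ 3 * (real (card \<F>) * H)"
 have "emeasure surf (interface \<Omega> Gam e) \<le> ennreal (C / e)" if e: "0 < e" "e \<le> 1" for e
 proof -
  define M where "M = nat \<lceil>R / e + 1\<rceil>"
  have Re: "R / e > 0" using R(1) e(1) by simp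
  have M: "R / e + 1 \<le> real M" "real M \<le> R / e + 2" unfolding M_def using Re by linarith+
  define \<K> where "\<K> = {k \<in> lattice3. \<forall>i. \<bar>k $ i\<bar> \<le> real M}"
  have sub: "interface \<Omega> Gam e \<subseteq> (\<Union>k\<in>\<K>. \<Union>A\<in>\<F>. (\<lambda>y. e *\<^sub>R y + e *\<^sub>R k) ` A)"
  proof
   fix x assume "x \<in> interface \<Omega> Gam e"
   then obtain k y where ky: "x \<in> \<Omega>" "k \<in> lattice3" "y \<in> Gam" "x = e *\<^sub>R y + e *\<^sub>R k"
    unfolding interface_eq[OF e(1)] by blast
   have "norm y < 1" using ky(3) sub_cell(3) norm_closure_cell closure_subset by blast
   have "e *\<^sub>R k = x - e *\<^sub>R y" using ky(4) by simp
   then have "e * norm k \<le> norm x + e * norm y" using norm_triangle_ineq4[of x "e *\<^sub>R y"] e(1) by (metis abs_of_pos norm_scaleR)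
   also have "\<dots> \<le> R + e * 1" using R(2)[OF ky(1)] \<open>norm y < 1\<close> e(1) by (intro add_mono mult_left_mono) auto
   finally have "norm k \<le> R / e + 1" using e(1) by (simp add: field_simps)
   then have "\<bar>k $ i\<bar> \<le> real M" for i using component_le_norm_cart[of k i] M(1) by linarith
   then have "k \<in> \<K>" using ky(2) by (simp add: \<K>_def)
   then show "x \<in> (\<Union>k\<in>\<K>. \<Union>A\<in>\<F>. (\<lambda>y. e *\<^sub>R y + e *\<^sub>R k) ` A)" using ky F(2) by blast
  qed
  have meas: "(\<lambda>y. e *\<^sub>R y + e *\<^sub>R k) ` A \<in> sets surf" if "A \<in> \<F>" for A k
   using compact_affine_image F(3)[OF that] by (simp add: borel_compact sets_surf)
  have fK: "finite \<K>" unfolding \<K>_def by (rule lattice_box(1))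
  have "emeasure surf (interface \<Omega> Gam e) \<le> emeasure surf (\<Union>k\<in>\<K>. \<Union>A\<in>\<F>. (\<lambda>y. e *\<^sub>R y + e *\<^sub>R k) ` A)"
   by (rule emeasure_mono[OF sub]) (use fK F(1) meas in auto)
  also have "\<dots> \<le> (\<Sum>k\<in>\<K>. emeasure surf (\<Union>A\<in>\<F>. (\<lambda>y. e *\<^sub>R y + e *\<^sub>R k) ` A))"
   by (rule emeasure_subadditive_finite[OF fK]) (use F(1) meas in auto)
  also have "\<dots> \<le> (\<Sum>k\<in>\<K>. \<Sum>A\<in>\<F>. emeasure surf ((\<lambda>y. e *\<^sub>R y + e *\<^sub>R k) ` A))"
   by (intro sum_mono emeasure_subadditive_finite[OF F(1)]) (use meas in auto)
  also have "\<dots> \<le> (\<Sum>k\<in>\<K>. \<Sum>A\<in>\<F>. ennreal (e\<^sup>2 * H))"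
   by (intro sum_mono emeasure_surf_le area_le_scale) (use F(3) e in auto)
  also have "\<dots> = ennreal (real (card \<K>) * (real (card \<F>) * (e\<^sup>2 * H)))"
   using F(4) by (simp add: ennreal_of_nat_eq_real_of_nat flip: ennreal_mult)
  also have "\<dots> \<le> ennreal (C / e)"
  proof (rule ennreal_leI)
   have "real (card \<K>) \<le> real ((2 * M + 1) ^ 3)" using lattice_box(2)[of M] unfolding \<K>_def by (rule of_nat_mono)
   also have "\<dots> = (2 * real M + 1) ^ 3" by (simp add: add.commute)
   also have "\<dots> \<le> ((2 * R + 7) / e) ^ 3"
   proof (rule power_mono)
    have "1 \<le> 1 / e" using e by (simp add: field_simps)
    then have "2 * real M + 1 \<le> 2 * (R / e) + 7 * (1 / e)" using M(2) by linarith
    then show "2 * real M + 1 \<le> (2 * R + 7) / e" by (simp add: add_divide_distrib)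
   qed simp
   finally have "real (card \<K>) * (real (card \<F>) * (e\<^sup>2 * H)) \<le> ((2 * R + 7) / e) ^ 3 * (real (card \<F>) * (e\<^sup>2 * H))"
    by (rule mult_right_mono) (use F(4) in simp)
   also have "\<dots> = C / e" using e by (simp add: C_def field_simps power2_eq_square power3_eq_cube)
   finally show "real (card \<K>) * (real (card \<F>) * (e\<^sup>2 * H)) \<le> C / e" .
  qed
  finally show ?thesis .
 qed
 then show ?thesis by (rule that)
qed

end

section \<open>Periodic Sobolev functions\<close>

text \<open>Weak derivatives of periodic functions are periodic only up to null sets, which may
  depend on the lattice vector.\<close>

definition ae_periodic :: "R3 set => (R3 => 'b) => bool" where
 "ae_periodic U h \<longleftrightarrow> (\<forall>k\<in>lattice3. AE y\<in>U in \<L>. h (y + k) = h y)"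

lemma continuous_bounded_on:
 fixes b :: "R3 => 'b::real_normed_vector"
 assumes "continuous_on UNIV b" "bounded S"
 shows "\<exists>B\<ge>0. \<forall>x\<in>S. norm (b x) \<le> B"
proof -
 have c: "compact (closure S)" using assms(2) by (simp add: compact_closure)
 obtain B where B: "\<forall>x\<in>closure S. norm (b x) \<le> B"
  using compact_imp_bounded[OF compact_continuous_image[OF continuous_on_subset[OF assms(1) subset_UNIV] c]]
  unfolding bounded_iff by blast
 then show ?thesis using closure_subset[of S] by (intro exI[of _ "max B 0"]) (auto simp: le_max_iff_disj)
qed

lemma set_integrable_mult_continuous:
 fixes f b :: "R3 => complex"
 assumes "set_integrable \<L> S f" "continuous_on UNIV b" "bounded S"
 shows "set_integrable \<L> S (\<lambda>x. f x * b x)"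
proof -
 obtain B where B: "B \<ge> 0" "\<And>x. x \<in> S ==> norm (b x) \<le> B" using continuous_bounded_on[OF assms(2,3)] by blast
 have f: "integrable \<L> (\<lambda>x. indicator S x *\<^sub>R f x)" using assms(1) by (simp add: set_integrable_def)
 have "integrable \<L> (\<lambda>x. (indicator S x *\<^sub>R f x) * b x)"
 proof (rule integrable_dominated[of _ "\<lambda>x. B * norm (indicator S x *\<^sub>R f x)"])
  show "integrable \<L> (\<lambda>x. B * norm (indicator S x *\<^sub>R f x))" using f by (intro integrable_mult_right integrable_norm)
  show "(\<lambda>x. (indicator S x *\<^sub>R f x) * b x) \<in> borel_measurable \<L>"
   using borel_measurable_integrable[OF f] continuous_lebesgue_measurable[OF assms(2)] by (rule borel_measurable_times)
  show "AE x in \<L>. norm ((indicator S x *\<^sub>R f x) * b x) \<le> norm (B * norm (indicator S x *\<^sub>R f x))"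
  proof (rule AE_I2)
   fix x show "norm ((indicator S x *\<^sub>R f x) * b x) \<le> norm (B * norm (indicator S x *\<^sub>R f x))"
    using B(2)[of x] B(1) by (cases "x \<in> S") (simp_all add: norm_mult mult.commute mult_right_mono)
  qed
 qed
 then show ?thesis by (simp add: set_integrable_def)
qed

lemma L1_loc_mult:
 assumes "L1_loc U f" "continuous_on UNIV b" shows "L1_loc U (\<lambda>x. f x * b x)"
 using assms set_integrable_mult_continuous compact_imp_bounded unfolding L1_loc_def by blast

lemma L1_loc_add: "L1_loc U f ==> L1_loc U g ==> L1_loc U (\<lambda>x. f x + g x)"
 unfolding L1_loc_def by (auto intro: set_integral_add)

lemma test_fun_mult:
 assumes "test_fun U \<phi>" "smooth b" shows "test_fun U (\<lambda>x. b x * \<phi> x)"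
proof (rule test_funI)
 show "smooth (\<lambda>x. b x * \<phi> x)" using assms by (intro smooth_mult) (auto simp: test_fun_def)
 show "compact (closure {x. \<phi> x \<noteq> 0})" "closure {x. \<phi> x \<noteq> 0} \<subseteq> U" using assms(1) by (auto simp: test_fun_def)
 show "b x * \<phi> x = 0" if "x \<notin> closure {x. \<phi> x \<noteq> 0}" for x using that closure_subset[of "{x. \<phi> x \<noteq> 0}"] by auto
qed

lemma test_fun_pd:
 assumes "test_fun U \<phi>" shows "test_fun U (pd l \<phi>)"
proof (rule test_funI)
 have s: "smooth \<phi>" using assms by (simp add: test_fun_def)
 then show "smooth (pd l \<phi>)" by (rule smooth_pd)
 show "compact (closure {x. \<phi> x \<noteq> 0})" "closure {x. \<phi> x \<noteq> 0} \<subseteq> U" using assms by (auto simp: test_fun_def)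
 show "pd l \<phi> x = 0" if "x \<notin> closure {x. \<phi> x \<noteq> 0}" for x
 proof -
  have "pd l \<phi> x = pd l (\<lambda>_. 0 :: complex) x"
  proof (rule pd_cong_open[of "- closure {x. \<phi> x \<noteq> 0}"])
   show "\<phi> y = 0" if "y \<in> - closure {x. \<phi> x \<noteq> 0}" for y using that closure_subset[of "{x. \<phi> x \<noteq> 0}"] by auto
  qed (use that in \<open>auto simp: smooth_const\<close>)
  also have "\<dots> = 0" using pd_eq[OF has_derivative_const] by blast
  finally show ?thesis .
 qed
qed

text \<open>The factor \<open>b\<close> is moved onto the test function, where the classical product
  rule holds.\<close>

lemma has_weak_pd_mult:
 assumes w: "has_weak_pd U l f g" and b: "smooth b"
 shows "has_weak_pd U l (\<lambda>x. f x * b x) (\<lambda>x. g x * b x + f x * pd l b x)"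
proof -
 have L: "L1_loc U f" "L1_loc U g" using w by (auto simp: has_weak_pd_def)
 have c: "continuous_on UNIV b" "continuous_on UNIV (pd l b)" using b by (auto intro: smooth_continuous smooth_pd)
 note L' = L1_loc_mult[OF L(1) c(1)] L1_loc_add[OF L1_loc_mult[OF L(2) c(1)] L1_loc_mult[OF L(1) c(2)]]
 have "(LINT x:U|\<L>. f x * b x * pd l \<phi> x) = - (LINT x:U|\<L>. (g x * b x + f x * pd l b x) * \<phi> x)"
  if \<phi>: "test_fun U \<phi>" for \<phi>
 proof -
  have s\<phi>: "smooth \<phi>" using \<phi> by (simp add: test_fun_def)
  have t: "test_fun U (\<lambda>x. b x * \<phi> x)" by (rule test_fun_mult[OF \<phi> b])
  have i1: "set_integrable \<L> U (\<lambda>x. f x * pd l (\<lambda>x. b x * \<phi> x) x)"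
   by (rule test_fun_integrable[OF L(1) test_fun_pd[OF t]])
  have i2: "set_integrable \<L> U (\<lambda>x. f x * (pd l b x * \<phi> x))"
   by (rule test_fun_integrable[OF L(1) test_fun_mult[OF \<phi> smooth_pd[OF b]]])
  have i3: "set_integrable \<L> U (\<lambda>x. g x * (b x * \<phi> x))"
   by (rule test_fun_integrable[OF L(2) t])
  have 0: "f x * b x * pd l \<phi> x = f x * pd l (\<lambda>x. b x * \<phi> x) x - f x * (pd l b x * \<phi> x)" for x
   unfolding pd_mult[OF b s\<phi>] by (simp add: algebra_simps)
  have "(LINT x:U|\<L>. f x * b x * pd l \<phi> x) = (LINT x:U|\<L>. f x * pd l (\<lambda>x. b x * \<phi> x) x) - (LINT x:U|\<L>. f x * (pd l b x * \<phi> x))"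
   unfolding 0 by (rule set_integral_diff(2)[OF i1 i2])
  also have "\<dots> = - (LINT x:U|\<L>. g x * (b x * \<phi> x)) - (LINT x:U|\<L>. f x * (pd l b x * \<phi> x))"
   using has_weak_pdD[OF w t] by simp
  also have "\<dots> = - (LINT x:U|\<L>. g x * (b x * \<phi> x) + f x * (pd l b x * \<phi> x))"
   using set_integral_add(2)[OF i3 i2] by simp
  finally show ?thesis by (simp add: algebra_simps)
 qed
 then show ?thesis using L' unfolding has_weak_pd_def pd_def[symmetric] by blast
qed

lemma has_weak_pd_shift:
 assumes w: "has_weak_pd U l f g" and U: "\<And>y. y + k \<in> U \<longleftrightarrow> y \<in> U"
 shows "has_weak_pd U l (\<lambda>y. f (y + k)) (\<lambda>y. g (y + k))"
proof -
 have U': "y - k \<in> U \<longleftrightarrow> y \<in> U" for y using U[of "y - k"] by simp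
 have ind: "indicator U (y + k) = (indicator U y :: real)" for y using U[of y] by (simp add: indicator_def)
 have L: "L1_loc U (\<lambda>y. h (y + k))" if "L1_loc U h" for h
  unfolding L1_loc_def
 proof (intro allI impI)
  fix K assume K: "compact K \<and> K \<subseteq> U"
  have "compact ((\<lambda>y. y + k) ` K)" using K by (intro compact_continuous_image continuous_intros) auto
  moreover have "(\<lambda>y. y + k) ` K \<subseteq> U" using K U by auto
  ultimately have "integrable \<L> (\<lambda>y. indicator ((\<lambda>y. y + k) ` K) y *\<^sub>R h y)" by (rule L1_loc_restrict[OF that])
  from integrable_shift[OF this, of k] have "integrable \<L> (\<lambda>y. indicator ((\<lambda>y. y + k) ` K) (y + k) *\<^sub>R h (y + k))" .
  moreover have "indicator ((\<lambda>y. y + k) ` K) (y + k) = (indicator K y :: real)" for y by (auto simp: indicator_def)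
  ultimately show "set_integrable \<L> K (\<lambda>y. h (y + k))" by (simp add: set_integrable_def)
 qed
 have sh: "(LINT y:U|\<L>. h (y + k)) = (LINT y:U|\<L>. h y)" for h :: "R3 => complex"
  using integral_shift[of "\<lambda>y. indicator U y *\<^sub>R h y" k] by (simp add: set_lebesgue_integral_def ind)
 have "(LINT y:U|\<L>. f (y + k) * pd l \<phi> y) = - (LINT y:U|\<L>. g (y + k) * \<phi> y)" if \<phi>: "test_fun U \<phi>" for \<phi>
 proof -
  define \<psi> where "\<psi> = (\<lambda>y. \<phi> (1 *\<^sub>R y + - k))"
  have s: "smooth \<phi>" using \<phi> by (simp add: test_fun_def)
  let ?K = "closure {x. \<phi> x \<noteq> 0}"
  have t: "test_fun U \<psi>"
  proof (rule test_funI)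
   show "smooth \<psi>" unfolding \<psi>_def by (rule smooth_affine[OF s])
   show "compact ((\<lambda>y. y + k) ` ?K)" using \<phi> by (intro compact_continuous_image continuous_intros) (auto simp: test_fun_def)
   show "(\<lambda>y. y + k) ` ?K \<subseteq> U" using \<phi> U by (auto simp: test_fun_def)
   fix x assume "x \<notin> (\<lambda>y. y + k) ` ?K"
   then have "x - k \<notin> ?K" using image_eqI[of x "\<lambda>y. y + k" "x - k" ?K] by fastforce
   then show "\<psi> x = 0" using closure_subset[of "{x. \<phi> x \<noteq> 0}"] by (auto simp: \<psi>_def)
  qed
  have "(LINT y:U|\<L>. f (y + k) * pd l \<phi> y) = (LINT y:U|\<L>. f (y + k) * pd l \<psi> (y + k))"
   using pd_affine[OF s, of l 1 "- k"] by (simp add: \<psi>_def)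
  also have "\<dots> = (LINT y:U|\<L>. f y * pd l \<psi> y)" by (rule sh)
  also have "\<dots> = - (LINT y:U|\<L>. g y * \<psi> y)" by (rule has_weak_pdD[OF w t])
  also have "(LINT y:U|\<L>. g y * \<psi> y) = (LINT y:U|\<L>. g (y + k) * \<psi> (y + k))" by (rule sh[symmetric])
  finally show ?thesis by (simp add: \<psi>_def)
 qed
 then show ?thesis using w L unfolding has_weak_pd_def pd_def[symmetric] by blast
qed

section \<open>Square integrable functions on bounded sets\<close>

lemma L2_integrable:
 fixes f :: "R3 => complex"
 assumes "L2 \<L> S f" "bounded S" "S \<in> sets \<L>"
 shows "set_integrable \<L> S f"
proof -
 have fin: "emeasure \<L> S < \<infinity>"
  using bounded_set_imp_lmeasurable[OF assms(2,3)] by (simp add: fmeasurable_def del: emeasure_completion)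
 have i: "integrable \<L> (\<lambda>x. indicator S x * (norm (f x))\<^sup>2)"
  and m: "(\<lambda>x. indicator S x *\<^sub>R f x) \<in> borel_measurable \<L>"
  using assms(1) by (auto simp: L2_defs)
 have "integrable \<L> (\<lambda>x. indicator S x + indicator S x * (norm (f x))\<^sup>2 :: real)"
  using fin assms(3) i by (intro Bochner_Integration.integrable_add) (auto simp: integrable_indicator_iff)
 then have "integrable \<L> (\<lambda>x. indicator S x *\<^sub>R f x)"
 proof (rule integrable_dominated[OF _ m], intro AE_I2)
  fix x
  have "norm (f x) \<le> 1 + (norm (f x))\<^sup>2"
   using zero_le_power2[of "norm (f x) - 1"] norm_ge_zero[of "f x"] unfolding power2_diff one_power2 mult_1_right
   by (simp only: power2_eq_square)
  then show "norm (indicator S x *\<^sub>R f x) \<le> norm (indicator S x + indicator S x * (norm (f x))\<^sup>2 :: real)"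
   by (cases "x \<in> S") auto
 qed
 then show ?thesis by (simp add: set_integrable_def)
qed

lemma L2_mult_bounded:
 fixes f b :: "R3 => complex"
 assumes "L2 \<L> S f" "continuous_on UNIV b" "bounded S"
 shows "L2 \<L> S (\<lambda>x. f x * b x)"
proof -
 obtain B where B: "B \<ge> 0" "\<And>x. x \<in> S ==> norm (b x) \<le> B" using continuous_bounded_on[OF assms(2,3)] by blast
 have i: "integrable \<L> (\<lambda>x. indicator S x * (norm (f x))\<^sup>2)"
  and m: "(\<lambda>x. indicator S x *\<^sub>R f x) \<in> borel_measurable \<L>"
  using assms(1) by (auto simp: L2_defs)
 have m': "(\<lambda>x. (indicator S x *\<^sub>R f x) * b x) \<in> borel_measurable \<L>"
  using m continuous_lebesgue_measurable[OF assms(2)] by (rule borel_measurable_times)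
 then have "(\<lambda>x. (norm ((indicator S x *\<^sub>R f x) * b x))\<^sup>2) \<in> borel_measurable \<L>" by measurable
 moreover have eq: "(norm ((indicator S x *\<^sub>R f x) * b x))\<^sup>2 = indicator S x * (norm (f x * b x))\<^sup>2" for x
  by (cases "x \<in> S") auto
 ultimately have m2: "(\<lambda>x. indicator S x * (norm (f x * b x))\<^sup>2) \<in> borel_measurable \<L>" by simp
 have "integrable \<L> (\<lambda>x. indicator S x * (norm (f x * b x))\<^sup>2)"
 proof (rule integrable_dominated[of _ "\<lambda>x. B\<^sup>2 * (indicator S x * (norm (f x))\<^sup>2)"])
  show "integrable \<L> (\<lambda>x. B\<^sup>2 * (indicator S x * (norm (f x))\<^sup>2))" using i by simp
  show "AE x in \<L>. norm (indicator S x * (norm (f x * b x))\<^sup>2) \<le> norm (B\<^sup>2 * (indicator S x * (norm (f x))\<^sup>2))"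
  proof (rule AE_I2)
   fix x
   have "x \<in> S ==> (norm (b x))\<^sup>2 \<le> B\<^sup>2" using B by (intro power_mono) auto
   then show "norm (indicator S x * (norm (f x * b x))\<^sup>2) \<le> norm (B\<^sup>2 * (indicator S x * (norm (f x))\<^sup>2))"
    by (cases "x \<in> S") (auto simp: norm_mult power_mult_distrib mult.commute mult_right_mono)
  qed
 qed (rule m2)
 then show ?thesis using m' by (simp add: L2_defs mult.assoc)
qed

lemma L2_add:
 fixes f g :: "'a => complex"
 assumes "L2 M S f" "L2 M S g"
 shows "L2 M S (\<lambda>x. f x + g x)"
proof -
 have i: "integrable M (\<lambda>x. indicator S x * (norm (f x))\<^sup>2)" "integrable M (\<lambda>x. indicator S x * (norm (g x))\<^sup>2)"
  and m: "(\<lambda>x. indicator S x *\<^sub>R f x) \<in> borel_measurable M" "(\<lambda>x. indicator S x *\<^sub>R g x) \<in> borel_measurable M"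
  using assms by (auto simp: L2_defs)
 have m': "(\<lambda>x. indicator S x *\<^sub>R (f x + g x)) \<in> borel_measurable M"
  unfolding scaleR_add_right using m by (rule borel_measurable_add)
 then have "(\<lambda>x. (norm (indicator S x *\<^sub>R (f x + g x)))\<^sup>2) \<in> borel_measurable M" by measurable
 moreover have "(norm (indicator S x *\<^sub>R (f x + g x)))\<^sup>2 = indicator S x * (norm (f x + g x))\<^sup>2" for x
  by (cases "x \<in> S") auto
 ultimately have m2: "(\<lambda>x. indicator S x * (norm (f x + g x))\<^sup>2) \<in> borel_measurable M" by simp
 have "integrable M (\<lambda>x. indicator S x * (norm (f x + g x))\<^sup>2)"
 proof (rule integrable_dominated[of _ "\<lambda>x. 2 * (indicator S x * (norm (f x))\<^sup>2) + 2 * (indicator S x * (norm (g x))\<^sup>2)"])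
  show "integrable M (\<lambda>x. 2 * (indicator S x * (norm (f x))\<^sup>2) + 2 * (indicator S x * (norm (g x))\<^sup>2))"
   using i by (intro Bochner_Integration.integrable_add integrable_mult_right)
  show "AE x in M. norm (indicator S x * (norm (f x + g x))\<^sup>2) \<le> norm (2 * (indicator S x * (norm (f x))\<^sup>2) + 2 * (indicator S x * (norm (g x))\<^sup>2))"
  proof (rule AE_I2)
   fix x
   have "(norm (f x + g x))\<^sup>2 \<le> (norm (f x) + norm (g x))\<^sup>2" by (rule power_mono[OF norm_triangle_ineq]) simp
   also have "\<dots> \<le> 2 * (norm (f x))\<^sup>2 + 2 * (norm (g x))\<^sup>2"
    using zero_le_power2[of "norm (f x) - norm (g x)"] by (simp add: power2_eq_square algebra_simps)
   finally show "norm (indicator S x * (norm (f x + g x))\<^sup>2) \<le> norm (2 * (indicator S x * (norm (f x))\<^sup>2) + 2 * (indicator S x * (norm (g x))\<^sup>2))"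
    by (cases "x \<in> S") auto
  qed
 qed (rule m2)
 then show ?thesis using m' by (simp add: L2_defs)
qed

lemma L2_diff:
 fixes f g :: "'a => complex"
 assumes "L2 M S f" "L2 M S g" shows "L2 M S (\<lambda>x. f x - g x)"
proof -
 have "L2 M S (\<lambda>x. - g x)"
  using assms(2) borel_measurable_uminus[of "\<lambda>x. indicator S x *\<^sub>R g x" M] by (simp add: L2_defs)
 from L2_add[OF assms(1) this] show ?thesis by simp
qed

lemma L2_product:
 fixes f g :: "'a => complex"
 assumes "L2 M S f" "L2 M S g"
 shows "set_integrable M S (\<lambda>x. f x * g x)"
proof -
 have i: "integrable M (\<lambda>x. indicator S x * (norm (f x))\<^sup>2)" "integrable M (\<lambda>x. indicator S x * (norm (g x))\<^sup>2)"
  and m: "(\<lambda>x. indicator S x *\<^sub>R f x) \<in> borel_measurable M" "(\<lambda>x. indicator S x *\<^sub>R g x) \<in> borel_measurable M"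
  using assms by (auto simp: L2_defs)
 have eq: "(indicator S x *\<^sub>R f x) * (indicator S x *\<^sub>R g x) = indicator S x *\<^sub>R (f x * g x)" for x by (cases "x \<in> S") auto
 have m': "(\<lambda>x. indicator S x *\<^sub>R (f x * g x)) \<in> borel_measurable M"
  using borel_measurable_times[OF m] by (simp only: eq)
 have "integrable M (\<lambda>x. indicator S x *\<^sub>R (f x * g x))"
 proof (rule integrable_dominated[OF _ m'])
  show "integrable M (\<lambda>x. indicator S x * (norm (f x))\<^sup>2 + indicator S x * (norm (g x))\<^sup>2)"
   using i by (rule Bochner_Integration.integrable_add)
  show "AE x in M. norm (indicator S x *\<^sub>R (f x * g x)) \<le> norm (indicator S x * (norm (f x))\<^sup>2 + indicator S x * (norm (g x))\<^sup>2)"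
  proof (rule AE_I2)
   fix x
   have "norm (f x) * norm (g x) \<le> (norm (f x))\<^sup>2 + (norm (g x))\<^sup>2"
    using zero_le_power2[of "norm (f x) - norm (g x)"] zero_le_power2[of "norm (f x)"] zero_le_power2[of "norm (g x)"]
    mult_nonneg_nonneg[OF norm_ge_zero[of "f x"] norm_ge_zero[of "g x"]] unfolding power2_diff by linarith
   then show "norm (indicator S x *\<^sub>R (f x * g x)) \<le> norm (indicator S x * (norm (f x))\<^sup>2 + indicator S x * (norm (g x))\<^sup>2)"
    by (cases "x \<in> S") (auto simp: norm_mult)
  qed
 qed
 then show ?thesis by (simp add: set_integrable_def)
qed

text \<open>Weak derivatives live on the periodic extension \<open>U\<close>, integrals on its part
  \<open>Y\<close> in the open cell. The solid and the fluid are the two instances.\<close>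

locale periodic_domain =
 fixes Y U :: "R3 set"
 assumes openU: "open U" and Ucell: "\<And>y. y \<in> cell ==> y \<in> U \<longleftrightarrow> y \<in> Y" and Ysub: "Y \<subseteq> cell" and openY: "open Y"
  and Uper: "\<And>y k. k \<in> lattice3 ==> y + k \<in> U \<longleftrightarrow> y \<in> U"
begin

lemma YU: "Y \<subseteq> U" using Ucell Ysub by blast

lemma boundedY: "bounded Y" using Ysub bounded_cell bounded_subset by blast

lemma setsY: "Y \<in> sets \<L>" using openY by auto

text \<open>Translating the pair by a lattice vector gives another weak derivative of the same
  function, and weak derivatives are unique.\<close>

lemma weak_pd_ae_periodic:
 assumes "periodic v" "has_weak_pd U l v h" shows "ae_periodic U h"
 unfolding ae_periodic_def
proof
 fix k assume k: "k \<in> lattice3"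
 have "has_weak_pd U l (\<lambda>y. v (y + k)) (\<lambda>y. h (y + k))"
  by (rule has_weak_pd_shift[OF assms(2)]) (rule Uper[OF k])
 moreover have "(\<lambda>y. v (y + k)) = v" using assms(1) k by (auto simp: periodic_def)
 ultimately show "AE y\<in>U in \<L>. h (y + k) = h y"
  using weak_pd_unique[OF openU _ assms(2)] by simp
qed

text \<open>Up to a null set, a ball intersected with \<open>U\<close> is covered by finitely many
  translates of \<open>Y\<close>, on each of which \<open>h\<close> is a translate of its values on
  \<open>Y\<close>.\<close>

lemma periodic_set_integrable:
 fixes h :: "R3 => 'b::euclidean_space"
 assumes h: "ae_periodic U h" and i: "set_integrable \<L> Y h"
 shows "integrable \<L> (\<lambda>y. indicator (U \<inter> cball 0 R) y *\<^sub>R h y)"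
proof -
 have Gi: "integrable \<L> (\<lambda>y. indicator Y (y - k) *\<^sub>R h (y - k))" for k
  using integrable_shift[of "\<lambda>y. indicator Y y *\<^sub>R h y" "- k"] i by (simp add: set_integrable_def)
 have "integrable \<L> (\<lambda>y. indicator (cball 0 R) y *\<^sub>R (\<Sum>k\<in>lat (R + 1). indicator Y (y - k) *\<^sub>R h (y - k)))"
  by (intro integrable_mult_indicator Bochner_Integration.integrable_sum Gi) simp
 moreover have "AE y in \<L>. \<forall>k\<in>lat (R + 1). y \<in> U --> h (y - k) = h y"
 proof (intro AE_finite_allI finite_lat)
  fix k assume "k \<in> lat (R + 1)"
  then have "- k \<in> lattice3" by (simp add: lat_def lattice_minus)
  then show "AE y\<in>U in \<L>. h (y - k) = h y" using h unfolding ae_periodic_def by fastforce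
 qed
 then have "AE y in \<L>. indicator (U \<inter> cball 0 R) y *\<^sub>R h y = indicator (cball 0 R) y *\<^sub>R (\<Sum>k\<in>lat (R + 1). indicator Y (y - k) *\<^sub>R h (y - k))"
  using AE_in_cells
 proof eventually_elim
  case (elim y)
  then obtain k where k: "k \<in> lattice3" "y - k \<in> cell" by blast
  show ?case
  proof (cases "norm y \<le> R")
   case True
   moreover have "norm (y - k) < 1" using k(2) norm_closure_cell closure_subset by blast
   ultimately have "norm k \<le> R + 1" using norm_triangle_ineq4[of y "y - k"] by simp
   then have kl: "k \<in> lat (R + 1)" using k by (simp add: lat_def)
   have "indicator Y (y - j) *\<^sub>R h (y - j) = (if j = k then indicator U y *\<^sub>R h y else 0)" if "j \<in> lat (R + 1)" for j
   proof (cases "j = k")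
    case True
    have "y - k \<in> Y \<longleftrightarrow> y \<in> U" using Ucell[OF k(2)] Uper[OF lattice_minus[OF k(1)], of y] by simp
    then show ?thesis using True elim(1) that by (auto simp: indicator_def)
   next
    case False
    have "y - j \<notin> cell"
    proof
     assume c: "y - j \<in> cell"
     then have "(y - j) - (k - j) \<in> closure cell" using k(2) closure_subset[of cell] by auto
     moreover have "k - j \<in> lattice3" using k(1) that by (simp add: lattice_diff lat_def)
     ultimately have "k - j = 0" using cell_translate[OF c] by blast
     with False show False by simp
    qed
    then have "y - j \<notin> Y" using Ysub by blast
    then show ?thesis using False by simp
   qed
   then have "(\<Sum>j\<in>lat (R + 1). indicator Y (y - j) *\<^sub>R h (y - j)) = (\<Sum>j\<in>lat (R + 1). if j = k then indicator U y *\<^sub>R h y else 0)"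
    by (rule sum.cong[OF refl])
   also have "\<dots> = indicator U y *\<^sub>R h y" using kl finite_lat by simp
   finally show ?thesis using True by (simp add: indicator_def)
  qed simp
 qed
 ultimately show ?thesis by (rule integrable_AE)
qed

lemma periodic_L2:
 fixes h :: "R3 => complex"
 assumes h: "ae_periodic U h" and i: "L2 \<L> Y h"
 shows "integrable \<L> (\<lambda>y. indicator (U \<inter> cball 0 R) y *\<^sub>R h y)"
  "integrable \<L> (\<lambda>y. (norm (indicator (U \<inter> cball 0 R) y *\<^sub>R h y))\<^sup>2)"
proof -
 define g where "g = (\<lambda>y. indicator (U \<inter> cball 0 R) y *\<^sub>R h y)"
 show "integrable \<L> (\<lambda>y. indicator (U \<inter> cball 0 R) y *\<^sub>R h y)"
  by (rule periodic_set_integrable[OF h L2_integrable[OF i boundedY setsY]])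
 have "ae_periodic U (\<lambda>y. (norm (h y))\<^sup>2)"
  unfolding ae_periodic_def
 proof
  fix k assume "k \<in> lattice3"
  then have "AE y\<in>U in \<L>. h (y + k) = h y" using h by (simp add: ae_periodic_def)
  then show "AE y\<in>U in \<L>. (norm (h (y + k)))\<^sup>2 = (norm (h y))\<^sup>2" by eventually_elim simp
 qed
 moreover have "set_integrable \<L> Y (\<lambda>y. (norm (h y))\<^sup>2)" using i by (simp add: L2_def)
 ultimately have "integrable \<L> (\<lambda>y. indicator (U \<inter> cball 0 R) y *\<^sub>R (norm (h y))\<^sup>2)" by (rule periodic_set_integrable)
 moreover have "indicator (U \<inter> cball 0 R) y *\<^sub>R (norm (h y))\<^sup>2 = (norm (g y))\<^sup>2" for y
  by (cases "y \<in> U \<inter> cball 0 R") (auto simp: g_def)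
 ultimately show "integrable \<L> (\<lambda>y. (norm (indicator (U \<inter> cball 0 R) y *\<^sub>R h y))\<^sup>2)" by (simp add: g_def)
qed

text \<open>The derivatives are carried along as explicit functions, so that product rules yield
  formulas rather than unspecified representatives.\<close>

definition H1data :: "(R3 => complex) => (3 => R3 => complex) => bool" where
 "H1data v h \<longleftrightarrow> periodic v \<and> L2 \<L> Y v \<and> (\<forall>j. has_weak_pd U j v (h j) \<and> L2 \<L> Y (h j))"

lemma H1data_mult:
 assumes "H1data v h" "smooth b" "periodic b"
 shows "H1data (\<lambda>y. v y * b y) (\<lambda>j y. h j y * b y + v y * pd j b y)"
proof -
 have c: "continuous_on UNIV b" "continuous_on UNIV (pd j b)" for j using assms(2) by (auto intro: smooth_continuous smooth_pd)
 show ?thesis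
  using assms unfolding H1data_def
  by (auto intro!: has_weak_pd_mult L2_add L2_mult_bounded boundedY c simp: periodic_def)
qed

text \<open>Unfolding in reverse: the translates of the compactly supported factor are summed into
  its periodisation while \<open>h\<close> stays the same in every cell. It converts statements on
  \<open>U\<close> into statements on the cell.\<close>

lemma integral_U_Y:
 fixes h :: "R3 => complex"
 assumes h: "ae_periodic U h" and f: "\<And>y. norm y > R ==> f y = 0" "smooth f"
  and i: "integrable \<L> (\<lambda>y. indicator U y *\<^sub>R h y * of_real (f y))"
 shows "(LINT y:U|\<L>. h y * of_real (f y)) = (LINT y:Y|\<L>. h y * of_real (periodize f y))"
proof -
 have "(LINT y|\<L>. indicator U y *\<^sub>R h y * complex_of_real (f y)) = (LINT y:cell|\<L>. indicator U y *\<^sub>R h y * (\<Sum>k\<in>lat (R + 1). complex_of_real (f (y + k))))"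
 proof (rule integral_periodic_mult[OF _ _ i])
  fix k assume k: "k \<in> lattice3"
  then have "AE y\<in>U in \<L>. h (y + k) = h y" using h by (simp add: ae_periodic_def)
  then show "AE y in \<L>. indicator U (y + k) *\<^sub>R h (y + k) = indicator U y *\<^sub>R h y"
   by eventually_elim (use Uper[OF k] in \<open>auto simp: indicator_def\<close>)
 qed (use f in auto)
 also have "\<dots> = (LINT y:Y|\<L>. h y * of_real (periodize f y))"
  unfolding set_lebesgue_integral_def
 proof (rule Bochner_Integration.integral_cong[OF refl])
  fix y
  show "indicator cell y *\<^sub>R (indicator U y *\<^sub>R h y * (\<Sum>k\<in>lat (R + 1). complex_of_real (f (y + k)))) = indicator Y y *\<^sub>R (h y * of_real (periodize f y))"
  proof (cases "y \<in> cell")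
   case True
   then have "norm y \<le> 1" using norm_closure_cell closure_subset by (meson less_imp_le subsetD)
   then have "periodize f y = (\<Sum>k\<in>lat (R + 1). f (y + k))" by (intro periodize_eq[OF f(1)]) auto
   then show ?thesis using True Ucell[OF True] by (simp add: indicator_def)
  next
   case False
   then have "y \<notin> Y" using Ysub by blast
   then show ?thesis using False by simp
  qed
 qed
 finally show ?thesis by (simp add: set_lebesgue_integral_def)
qed

end

section \<open>Density of smooth functions up to a graph boundary\<close>

text \<open>Mollifying with a ball of radius \<open>c\<close> centred at \<open>y - p\<close> uses only values in \<open>U\<close>; near a graph, \<open>p\<close> is a
small multiple of the direction of the graph.\<close>

definition shrinkable :: "R3 set => R3 => real => bool" where
 "shrinkable U x \<rho> \<longleftrightarrow> (\<forall>\<tau>>0. \<exists>p c. norm p < \<tau> \<and> 0 < c \<and> c \<le> \<tau> \<and> (\<forall>y\<in>ball x \<rho> \<inter> U. ball (y - p) c \<subseteq> U))"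

text \<open>Inside the domain no shift is required, and away from its closure the condition is void.
  At the boundary, subtracting \<open>p\<close> moves a point down below the graph, and uniform
  continuity of the graph function fixes how small the averaging ball must be.\<close>

lemma graph_shrinkable:
 assumes U: "open U" and g: "graph_boundary (Ck 1) U"
 shows "\<exists>\<rho>>0. shrinkable U x \<rho>"
proof -
 consider "x \<in> U" | "x \<notin> closure U" | "x \<in> frontier U"
  using U by (auto simp: frontier_def interior_open)
 then show ?thesis
 proof cases
  case 1
  then obtain e where e: "e > 0" "ball x e \<subseteq> U" using U open_contains_ball by blast
  have "shrinkable U x (e / 2)" unfolding shrinkable_def
  proof (intro allI impI)
   fix \<tau> :: real assume \<tau>: "\<tau> > 0"
   have "ball (y - 0) (min \<tau> (e / 2)) \<subseteq> U" if "y \<in> ball x (e / 2) \<inter> U" for y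
   proof
    fix z assume "z \<in> ball (y - 0) (min \<tau> (e / 2))"
    then have "dist x z < e" using that dist_triangle[of x z y] by auto
    then show "z \<in> U" using e(2) by auto
   qed
   then show "\<exists>p c. norm p < \<tau> \<and> 0 < c \<and> c \<le> \<tau> \<and> (\<forall>y\<in>ball x (e / 2) \<inter> U. ball (y - p) c \<subseteq> U)"
    using \<tau> e by (intro exI[of _ 0] exI[of _ "min \<tau> (e / 2)"]) auto
  qed
  then show ?thesis using e by (intro exI[of _ "e / 2"]) auto
 next
  case 2
  then have "x \<in> - closure U" "open (- closure U)" by auto
  then obtain e where e: "e > 0" "ball x e \<subseteq> - closure U"
   using open_contains_ball by blast
  then have "ball x e \<inter> U = {}" using closure_subset by blast
  then have "shrinkable U x e" unfolding shrinkable_def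
   by (intro allI impI exI[of _ "0::R3"], rule_tac x = \<tau> in exI) simp
  then show ?thesis using e by blast
 next
  case 3
  from bspec[OF g[unfolded graph_boundary_def] this]
  obtain T :: "R3 => R3" and g :: "real \<times> real => real" and r where
   T: "orthogonal_transformation T" and g: "Ck 1 g" and r: "r > 0"
   and gr': "\<forall>y\<in>ball x r. y \<in> U \<longleftrightarrow> T (y - x) $ 3 < g (T (y - x) $ 1, T (y - x) $ 2)"
   by (elim exE conjE) (rule that)
  note gr = bspec[OF gr']
  have lin: "linear T" and iso: "norm (T v) = norm v" for v using T by (auto simp: orthogonal_transformation)
  have "surj T" using orthogonal_transformation_bij[OF T] by (simp add: bij_is_surj)
  then obtain n where n: "T n = axis 3 1" by (metis surjD)
  have nn: "norm n = 1" using iso[of n] by (simp add: n)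
  have "continuous_on UNIV g" by (rule Ck_continuous[OF g])
  then have "uniformly_continuous_on (cbox (- r, - r) (r, r)) g"
   by (rule compact_uniformly_continuous[OF continuous_on_subset[OF _ subset_UNIV] compact_cbox])
  then have uc: "\<exists>d>0. \<forall>p\<in>cbox (- r, - r) (r, r). \<forall>q\<in>cbox (- r, - r) (r, r). dist q p < d --> \<bar>g q - g p\<bar> < e" if "e > 0" for e
   using that unfolding uniformly_continuous_on_def dist_real_def by blast
  have "shrinkable U x (r / 2)" unfolding shrinkable_def
  proof (intro allI impI)
   fix \<tau> :: real assume \<tau>: "\<tau> > 0"
   \<comment> \<open>The bound \<open>r / 8\<close> keeps the displaced ball within the chart:
     \<open>r / 2 + r / 8 + r / 8 < r\<close>.\<close>
   define t where "t = min (\<tau> / 2) (r / 8)"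
   have t: "t > 0" "t < \<tau>" "t \<le> r / 8" using \<tau> r by (auto simp: t_def)
   obtain d where d: "d > 0" "\<And>p q. p \<in> cbox (- r, - r) (r, r) ==> q \<in> cbox (- r, - r) (r, r) ==> dist q p < d ==> \<bar>g q - g p\<bar> < t / 2"
    using uc[of "t / 2"] t(1) by (metis half_gt_zero)
   \<comment> \<open>Two points of the ball have horizontal coordinates closer than
     \<open>d\<close>, so \<open>g\<close> changes by less than \<open>t / 2\<close>; and of the
     vertical drop \<open>t\<close> at least \<open>t / 2\<close> remains.\<close>
   define c where "c = min (d / 2) (t / 2)"
   have c: "c > 0" "c \<le> t / 2" "2 * c \<le> d" using d t by (auto simp: c_def)
   have "ball (y - t *\<^sub>R n) c \<subseteq> U" if y: "y \<in> ball x (r / 2) \<inter> U" for y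
   proof
    fix z assume z: "z \<in> ball (y - t *\<^sub>R n) c"
    define w where "w = z - (y - t *\<^sub>R n)"
    have w: "norm w < c" using z by (simp add: w_def dist_norm norm_minus_commute)
    have zx: "z - x = (y - x) - t *\<^sub>R n + w" by (simp add: w_def)
    have "norm (z - x) \<le> norm (y - x) + norm (t *\<^sub>R n) + norm w"
     unfolding zx by (meson norm_triangle_mono norm_triangle_ineq4 order_refl)
    also have "\<dots> < r / 2 + r / 8 + r / 8" using y w c t nn by (simp add: dist_norm norm_minus_commute)
    finally have zr: "norm (z - x) < r" using r by linarith
    have yr: "norm (y - x) < r" using y r by (auto simp: dist_norm norm_minus_commute)
    have Tz: "T (z - x) = T (y - x) - t *\<^sub>R axis 3 1 + T w"
     unfolding zx linear_add[OF lin] linear_diff[OF lin] linear_scale[OF lin] n ..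
    have comp: "T (z - x) $ 1 = T (y - x) $ 1 + T w $ 1" "T (z - x) $ 2 = T (y - x) $ 2 + T w $ 2"
     "T (z - x) $ 3 = T (y - x) $ 3 - t + T w $ 3"
     unfolding Tz by (simp_all add: axis_def)
    have Tw: "\<bar>T w $ i\<bar> < c" for i using component_le_norm_cart[of "T w" i] iso[of w] w by linarith
    have inb: "(T v $ 1, T v $ 2) \<in> cbox (- r, - r) (r, r)" if "norm v < r" for v
     using component_le_norm_cart[of "T v" 1] component_le_norm_cart[of "T v" 2] iso[of v] that by (auto simp: cbox_Pair_eq)
    have "dist (T (y - x) $ 1, T (y - x) $ 2) (T (z - x) $ 1, T (z - x) $ 2) \<le> \<bar>T w $ 1\<bar> + \<bar>T w $ 2\<bar>"
     unfolding dist_norm comp using norm_Pair_le[of "- T w $ 1" "- T w $ 2"] by simp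
    also have "\<dots> < d" using Tw[of 1] Tw[of 2] c(3) by linarith
    finally have "\<bar>g (T (y - x) $ 1, T (y - x) $ 2) - g (T (z - x) $ 1, T (z - x) $ 2)\<bar> < t / 2"
     by (intro d(2) inb zr yr)
    moreover have "T (y - x) $ 3 < g (T (y - x) $ 1, T (y - x) $ 2)"
     using gr[of y] y yr by (auto simp: dist_norm norm_minus_commute)
    ultimately have "T (z - x) $ 3 < g (T (z - x) $ 1, T (z - x) $ 2)"
     using comp(3) Tw[of 3] c(2) by linarith
    then show "z \<in> U" using gr[of z] zr by (simp add: dist_norm norm_minus_commute)
   qed
   then show "\<exists>p c. norm p < \<tau> \<and> 0 < c \<and> c \<le> \<tau> \<and> (\<forall>y\<in>ball x (r / 2) \<inter> U. ball (y - p) c \<subseteq> U)"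
    using t c nn by (intro exI[of _ "t *\<^sub>R n"] exI[of _ c]) auto
  qed
  then show ?thesis using r by (intro exI[of _ "r / 2"]) auto
 qed
qed

lemma pd_bump_swap: "- pd l (bump r (y - p)) z = pd l (bump r (z + p)) y"
 unfolding pd_bump by (simp add: algebra_simps inner_commute)

lemma pd_bump_bounded:
 assumes "r > 0" obtains B where "\<And>q z. \<bar>pd l (bump r q) z\<bar> \<le> B"
proof -
 have c: "continuous_on UNIV (\<lambda>z. complex_of_real (pd l (bump r 0) z))"
  by (intro smooth_continuous smooth_of_real smooth_pd smooth_bump)
 have "complex_of_real (pd l (bump r 0) x) = 0" if "norm x > r" for x
  using pd_bump_0[OF assms, of x 0] that by simp
 from smooth_bounded[OF c this] obtain B where B: "\<And>x. norm (complex_of_real (pd l (bump r 0) x)) \<le> B" by metis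
 have "pd l (bump r q) z = pd l (bump r 0) (z - q)" for q z
  using pd_bump_shift[of l r 0 z "- q"] by simp
 then show ?thesis using B that by (metis norm_of_real)
qed

lemma borel_pd_bump: "(\<lambda>(y, z). complex_of_real (pd l (bump r (y + p)) z)) \<in> borel_measurable borel"
proof -
 have "continuous_on UNIV (expinv 2)" by (rule smooth_continuous[OF smooth_expinv])
 then have "continuous_on UNIV (\<lambda>x. expinv 2 (r\<^sup>2 - (snd x - (fst x + p)) \<bullet> (snd x - (fst x + p))))"
  by (rule continuous_on_compose2) (auto intro!: continuous_intros)
 then have "continuous_on UNIV (\<lambda>x. complex_of_real (pd l (bump r (fst x + p)) (snd x)))"
  unfolding pd_bump by (intro continuous_intros) auto
 then show ?thesis by (auto simp: case_prod_unfold intro!: borel_measurable_continuous_onI)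
qed

lemma integral_indicator_eq: "(LINT y:S|M. f y) = (LINT y|M. indicator S y *\<^sub>R f y)"
 by (simp add: set_lebesgue_integral_def)

context periodic_domain
begin

text \<open>By \<open>T0\<close> the field is orthogonal to gradients of bumps centred anywhere,
  including those that do not vanish on the boundary of \<open>U\<close>. Mollifying the gradient of
  \<open>v * b\<close> with a shift into the domain gives an integral over such gradients, hence
  zero pairing; the limit is the claim. The strict inclusion of the support radius
  \<open>\<rho>'\<close> in \<open>\<rho>\<close> leaves room for the shift.\<close>

lemma local_density:
 assumes sg: "\<And>j. ae_periodic U (\<sigma> j)" "\<And>j. L2 \<L> Y (\<sigma> j)"
  and T0: "\<And>m q. (\<Sigma> j. LINT y:U|\<L>. \<sigma> j y * of_real (pd j (bump (inverse (real (Suc m))) q) y)) = 0"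
  and sh: "shrinkable U x \<rho>" and b: "smooth b" "\<And>y. \<rho>' < dist y x ==> b y = 0" "0 < \<rho>'" "\<rho>' < \<rho>"
  and v: "H1data v h"
 shows "(\<Sigma> j. LINT y:U|\<L>. \<sigma> j y * (h j y * of_real (b y) + v y * of_real (pd j b y))) = 0"
proof -
 let ?b = "\<lambda>y. complex_of_real (b y)"
 have sb: "smooth ?b" by (rule smooth_of_real[OF b(1)])
 have pdb: "pd j ?b y = of_real (pd j b y)" for j y by (rule pd_of_real[OF b(1)])
 have pdb0: "pd j b y = 0" if "\<rho>' < dist y x" for j y
 proof -
  have "pd j b y = pd j (\<lambda>_. 0 :: real) y"
  proof (rule pd_cong_open[of "- cball x \<rho>'"])
   show "open (- cball x \<rho>')" by (rule open_Compl[OF closed_cball])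
  qed (use that b(2) in \<open>auto simp: smooth_const not_le dist_commute\<close>)
  also have "\<dots> = 0" using pd_eq[OF has_derivative_const] by blast
  finally show ?thesis .
 qed
 \<comment> \<open>The margin 2 accounts for one shift and one radius, each at most 1, so every
   kernel that meets the support of \<open>b\<close> lives in \<open>cball 0 R\<close>.\<close>
 define R where "R = norm x + \<rho> + 2"
 define B where "B = U \<inter> cball 0 R"
 define f where "f = (\<lambda>y. indicator B y *\<^sub>R v y * ?b y)"
 define g where "g = (\<lambda>j y. indicator B y *\<^sub>R (h j y * ?b y + v y * of_real (pd j b y)))"
 define s where "s = (\<lambda>j y. indicator B y *\<^sub>R \<sigma> j y)"
 have near: "y \<in> cball 0 R" if "dist y x \<le> \<rho> + 2" for y
  using that norm_triangle_sub[of y x] by (simp add: R_def dist_norm)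
 have vp: "periodic v" "L2 \<L> Y v" and hw: "has_weak_pd U j v (h j)" and hL: "L2 \<L> Y (h j)" for j
  using v by (auto simp: H1data_def)
 have vper: "ae_periodic U v" using vp(1) by (simp add: ae_periodic_def periodic_def)
 have hper: "ae_periodic U (h j)" for j by (rule weak_pd_ae_periodic[OF vp(1) hw])
 have "L2 \<L> (cball 0 R) f'" if "integrable \<L> f'" "integrable \<L> (\<lambda>y. (norm (f' y))\<^sup>2)" for f' :: "R3 => complex"
 proof -
  have "integrable \<L> (\<lambda>y. indicator (cball 0 R) y *\<^sub>R (norm (f' y))\<^sup>2)"
   by (rule integrable_mult_indicator[OF _ that(2)]) simp
  moreover have "(\<lambda>y. indicator (cball 0 R) y *\<^sub>R f' y) \<in> borel_measurable \<L>"
   using integrable_mult_indicator[OF _ that(1), of "cball 0 R"] by auto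
  ultimately show ?thesis by (simp add: L2_defs)
 qed
 note L2B = this
 have L2h: "L2 \<L> (cball 0 R) (\<lambda>y. indicator B y *\<^sub>R h' y)" if "ae_periodic U h'" "L2 \<L> Y h'" for h' :: "R3 => complex"
  unfolding B_def by (rule L2B[OF periodic_L2[OF that]])
 have restr: "integrable \<L> h'" "integrable \<L> (\<lambda>y. (norm (h' y))\<^sup>2)"
  if "L2 \<L> (cball 0 R) h'" "\<And>y. y \<notin> cball 0 R ==> h' y = 0" for h' :: "R3 => complex"
 proof -
  have "indicator (cball 0 R) y *\<^sub>R h' y = h' y" "indicator (cball 0 R) y *\<^sub>R (norm (h' y))\<^sup>2 = (norm (h' y))\<^sup>2" for y
   using that(2)[of y] by (auto simp: indicator_def)
  note e = this
  have "set_integrable \<L> (cball 0 R) h'" by (rule L2_integrable[OF that(1) bounded_cball]) simp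
  then show "integrable \<L> h'" unfolding set_integrable_def e .
  have "set_integrable \<L> (cball 0 R) (\<lambda>y. (norm (h' y))\<^sup>2)" using that(1) by (simp add: L2_def)
  then show "integrable \<L> (\<lambda>y. (norm (h' y))\<^sup>2)" unfolding set_integrable_def e .
 qed
 have cb: "continuous_on UNIV ?b" "continuous_on UNIV (\<lambda>y. complex_of_real (pd j b y))" for j
  using smooth_continuous[OF sb] smooth_continuous[OF smooth_of_real[OF smooth_pd[OF b(1)]]] by auto
 have fL: "L2 \<L> (cball 0 R) f"
  unfolding f_def by (rule L2_mult_bounded[OF L2h[OF vper vp(2)] cb(1) bounded_cball])
 have gL: "L2 \<L> (cball 0 R) (g j)" for j
 proof -
  have "L2 \<L> (cball 0 R) (\<lambda>y. indicator B y *\<^sub>R h j y * ?b y + indicator B y *\<^sub>R v y * of_real (pd j b y))"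
   by (intro L2_add L2_mult_bounded L2h vper vp(2) hper hL cb bounded_cball)
  then show ?thesis by (simp add: g_def scaleR_add_right)
 qed
 have out: "f y = 0" "g j y = 0" "s j y = 0" if "y \<notin> cball 0 R" for y j
  using that by (auto simp: f_def g_def s_def B_def)
 have fI: "integrable \<L> f" by (rule restr(1)[OF fL]) (rule out)
 have gI: "integrable \<L> (g j)" "integrable \<L> (\<lambda>y. (norm (g j y))\<^sup>2)" for j by (rule restr[OF gL out(2)]; assumption)+
 have sI: "integrable \<L> (s j)" "integrable \<L> (\<lambda>y. (norm (s j y))\<^sup>2)" for j
  using restr[OF L2h[OF sg(1,2)[of j]], folded s_def] out(3)[of _ j] by (simp_all add: s_def)
 have w: "has_weak_pd U j (\<lambda>y. v y * ?b y) (\<lambda>y. h j y * ?b y + v y * of_real (pd j b y))" for j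
  using has_weak_pd_mult[OF hw sb, of j] by (simp add: pdb)
 have fU: "indicator U y *\<^sub>R (v y * ?b y) = f y" for y
  using b(2)[of y] near[of y] b(3,4) by (cases "\<rho>' < dist y x") (auto simp: f_def B_def indicator_def)
 have gU: "indicator U y *\<^sub>R (h j y * ?b y + v y * of_real (pd j b y)) = g j y" for y j
  using b(2)[of y] pdb0[of y j] near[of y] b(3,4) by (cases "\<rho>' < dist y x") (auto simp: g_def B_def indicator_def)
 \<comment> \<open>Shift plus radius, at most \<open>2 * \<delta>\<close>, must fit into the gap
   between the support of \<open>b\<close> and the ball on which shrinking is possible.\<close>
 define \<delta> where "\<delta> = min 1 ((\<rho> - \<rho>') / 2)"
 have \<delta>: "\<delta> > 0" "\<delta> \<le> 1" "2 * \<delta> \<le> \<rho> - \<rho>'" using b(4) by (auto simp: \<delta>_def min_def)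
 have "\<exists>p m. norm p < \<delta> / real (Suc n) \<and> inverse (real (Suc m)) \<le> \<delta> / real (Suc n) \<and> (\<forall>y\<in>ball x \<rho> \<inter> U. cball (y - p) (inverse (real (Suc m))) \<subseteq> U)" for n
 proof -
  have "\<delta> / real (Suc n) > 0" using \<delta> by simp
  then obtain p c where pc: "norm p < \<delta> / real (Suc n)" "0 < c" "c \<le> \<delta> / real (Suc n)" "\<And>y. y \<in> ball x \<rho> \<inter> U ==> ball (y - p) c \<subseteq> U"
   using sh unfolding shrinkable_def by blast
  obtain m where m: "inverse (real (Suc m)) < c" using reals_Archimedean[OF pc(2)] by blast
  then have "cball (y - p) (inverse (real (Suc m))) \<subseteq> ball (y - p) c" for y by auto
  then have "\<forall>y\<in>ball x \<rho> \<inter> U. cball (y - p) (inverse (real (Suc m))) \<subseteq> U" using pc(4) by blast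
  then show ?thesis using pc(1,3) m by (intro exI[of _ p] exI[of _ m] conjI) linarith+
 qed
 then obtain p m where pm: "\<And>n. norm (p n) < \<delta> / real (Suc n)" "\<And>n. inverse (real (Suc (m n))) \<le> \<delta> / real (Suc n)"
  "\<And>n y. y \<in> ball x \<rho> \<inter> U ==> cball (y - p n) (inverse (real (Suc (m n)))) \<subseteq> U" by metis
 define r where "r = (\<lambda>n. inverse (real (Suc (m n))))"
 have r: "r n > 0" for n by (simp add: r_def)
 have dl: "(\<lambda>n. \<delta> / real (Suc n)) \<longlonglongrightarrow> 0"
  using tendsto_mult_left[OF LIMSEQ_inverse_real_of_nat, of \<delta>] by (simp add: divide_inverse)
 have r0: "r \<longlonglongrightarrow> 0"
  by (rule tendsto_sandwich[OF _ _ tendsto_const dl]) (use pm(2) in \<open>auto simp: r_def intro!: always_eventually\<close>)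
 have p0: "p \<longlonglongrightarrow> 0"
  by (rule tendsto_norm_zero_cancel, rule tendsto_sandwich[OF _ _ tendsto_const dl]) (use pm(1) less_imp_le in \<open>auto intro!: always_eventually\<close>)
 have small: "norm (p n) < \<delta>" "r n \<le> \<delta>" for n
 proof -
  have "\<delta> / real (Suc n) \<le> \<delta>" using \<delta>(1) by (simp add: field_simps)
  then show "norm (p n) < \<delta>" "r n \<le> \<delta>" using pm(1,2)[of n] unfolding r_def by linarith+
 qed
 \<comment> \<open>The kernel centred at \<open>y - p n\<close> is supported in \<open>U\<close>, so
   the weak derivative can be moved onto it. By symmetry of the kernel its
   \<open>z\<close>-derivative is minus the \<open>y\<close>-derivative of the bump centred at
   \<open>z + p n\<close>.\<close>
 have moll_id: "moll (r n) (p n) (g j) y = (LINT z|\<L>. f z * of_real (pd j (bump (r n) (z + p n)) y))" if y: "y \<in> U" for n j y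
 proof (cases "y \<in> ball x \<rho>")
  case True
  have t: "test_fun U (\<lambda>z. of_real (bump (r n) (y - p n) z))"
   by (rule test_fun_bump[OF r]) (use pm(3)[of y n] True y in \<open>simp add: r_def\<close>)
  have "(LINT z:U|\<L>. v z * ?b z * of_real (pd j (bump (r n) (y - p n)) z)) = - (LINT z:U|\<L>. (h j z * ?b z + v z * of_real (pd j b z)) * of_real (bump (r n) (y - p n) z))"
   using has_weak_pdD[OF w t] by (simp only: pd_of_real[OF smooth_bump])
  moreover have "(LINT z:U|\<L>. v z * ?b z * of_real (pd j (bump (r n) (y - p n)) z)) = (LINT z|\<L>. f z * of_real (pd j (bump (r n) (y - p n)) z))"
   unfolding integral_indicator_eq fU[symmetric] by (simp add: mult.assoc)
  moreover have "(LINT z:U|\<L>. (h j z * ?b z + v z * of_real (pd j b z)) * of_real (bump (r n) (y - p n) z)) = moll (r n) (p n) (g j) y"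
   unfolding integral_indicator_eq moll_def gU[symmetric] by simp
  ultimately have "moll (r n) (p n) (g j) y = - (LINT z|\<L>. f z * of_real (pd j (bump (r n) (y - p n)) z))" by simp
  also have "\<dots> = (LINT z|\<L>. f z * of_real (- pd j (bump (r n) (y - p n)) z))" by simp
  finally show ?thesis unfolding pd_bump_swap .
 next
  case False
  \<comment> \<open>Outside \<open>ball x \<rho>\<close> the kernel does not reach the support of
    \<open>b\<close>, and both sides are 0.\<close>
  have far: "r n \<le> dist z (y - p n)" if "dist z x \<le> \<rho>'" for z
  proof -
   have "dist y x \<le> dist y (y - p n) + dist (y - p n) z + dist z x" by (meson add_mono_thms_linordered_semiring(3) dist_triangle order_trans)
   then show ?thesis using False that small[of n] \<delta>(3) by (simp add: dist_commute dist_norm)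
  qed
  have z1: "g j z * of_real (bump (r n) (y - p n) z) = 0" for z
  proof (cases "dist z x \<le> \<rho>'")
   case True
   then show ?thesis using far[OF True] bump_0_iff[OF r[of n], of "y - p n" z] by simp
  qed (use b(2)[of z] pdb0[of z j] in \<open>simp add: g_def\<close>)
  have z2: "f z * of_real (pd j (bump (r n) (z + p n)) y) = 0" for z
  proof (cases "dist z x \<le> \<rho>'")
   case True
   have "dist y (z + p n) = dist z (y - p n)" by (simp add: dist_norm norm_minus_commute algebra_simps)
   then show ?thesis using far[OF True] pd_bump_0[OF r[of n], of y "z + p n" j] by simp
  qed (use b(2)[of z] in \<open>simp add: f_def\<close>)
  show ?thesis by (simp only: moll_def z1 z2 integral_zero)
 qed
 have zero: "(\<Sigma> j. (LINT y|\<L>. s j y * moll (r n) (p n) (g j) y) / mass (r n)) = 0" for n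
 proof -
  have inner: "integrable \<L> (\<lambda>y. s j y * of_real (pd j (bump (r n) (z + p n)) y))" for j z
  proof -
   obtain B where "\<And>q z. \<bar>pd j (bump (r n) q) z\<bar> \<le> B" using pd_bump_bounded[OF r] by metis
   then show ?thesis
    by (intro integrable_mult_bounded[OF sI(1), of _ B] continuous_lebesgue_measurable smooth_continuous smooth_of_real smooth_pd smooth_bump) auto
  qed
  have e: "(LINT y|\<L>. s j y * moll (r n) (p n) (g j) y) = (LINT z|\<L>. f z * (LINT y|\<L>. s j y * of_real (pd j (bump (r n) (z + p n)) y)))"
   and ei: "integrable \<L> (\<lambda>z. f z * (LINT y|\<L>. s j y * of_real (pd j (bump (r n) (z + p n)) y)))" for j
  proof -
   have 1: "s j y * moll (r n) (p n) (g j) y = s j y * (LINT z|\<L>. f z * of_real (pd j (bump (r n) (z + p n)) y))" for y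
    using moll_id[of y n j] by (cases "y \<in> U") (auto simp: s_def B_def)
   obtain B where B: "\<And>q z. norm (complex_of_real (pd j (bump (r n) q) z)) \<le> B" using pd_bump_bounded[OF r] by (metis norm_of_real)
   note K = kernel_Fubini[OF fI sI(1) borel_pd_bump B]
   show "(LINT y|\<L>. s j y * moll (r n) (p n) (g j) y) = (LINT z|\<L>. f z * (LINT y|\<L>. s j y * of_real (pd j (bump (r n) (z + p n)) y)))"
    unfolding 1 by (rule K(2)[symmetric])
   show "integrable \<L> (\<lambda>z. f z * (LINT y|\<L>. s j y * of_real (pd j (bump (r n) (z + p n)) y)))" by (rule K(1))
  qed
  \<comment> \<open>For fixed \<open>z\<close> the inner sum pairs \<open>\<sigma>\<close> with the
    gradient of one bump, which is the situation of \<open>T0\<close>.\<close>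
  have z3: "f z * (\<Sigma> j. LINT y|\<L>. s j y * of_real (pd j (bump (r n) (z + p n)) y)) = 0" for z
  proof (cases "dist z x \<le> \<rho>'")
   case True
   have "s j y * of_real (pd j (bump (r n) (z + p n)) y) = indicator U y *\<^sub>R (\<sigma> j y * of_real (pd j (bump (r n) (z + p n)) y))" for j y
   proof (cases "y \<in> cball 0 R")
    case True
    then show ?thesis by (simp add: s_def B_def indicator_def)
   next
    case False
    have "r n \<le> dist y (z + p n)"
    proof (rule ccontr)
     assume "\<not> r n \<le> dist y (z + p n)"
     moreover have "dist y x \<le> dist y (z + p n) + dist (z + p n) z + dist z x" by (meson add_mono_thms_linordered_semiring(3) dist_triangle order_trans)
     ultimately have "dist y x \<le> \<rho> + 2"
      using \<open>dist z x \<le> \<rho>'\<close> small[of n] \<delta>(2) b(4) by (simp add: dist_norm)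
     then show False using near False by blast
    qed
    then show ?thesis using pd_bump_0[OF r] by simp
   qed
   then have "(\<Sigma> j. LINT y|\<L>. s j y * of_real (pd j (bump (r n) (z + p n)) y)) = 0"
    using T0[where m = "m n" and q = "z + p n"] by (simp add: integral_indicator_eq r_def)
   then show ?thesis by simp
  qed (use b(2)[of z] in \<open>simp add: f_def\<close>)
  have "(\<Sigma> j. LINT y|\<L>. s j y * moll (r n) (p n) (g j) y) = 0"
   unfolding e Bochner_Integration.integral_sum[OF ei, symmetric] sum_distrib_left[symmetric] z3 by simp
  then show ?thesis by (simp flip: sum_divide_distrib)
 qed
 have "(\<lambda>n. \<Sigma> j. (LINT y|\<L>. s j y * moll (r n) (p n) (g j) y) / mass (r n)) \<longlonglongrightarrow> (\<Sigma> j. LINT y|\<L>. s j y * g j y)"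
  by (intro tendsto_sum moll_L2[OF r r0 p0 sI _ gI, of R]) (use out(3) in \<open>simp add: dist_norm\<close>)
 then have "(\<Sigma> j. LINT y|\<L>. s j y * g j y) = 0"
  unfolding zero by (simp add: LIMSEQ_const_iff)
 moreover have "s j y * g j y = indicator U y *\<^sub>R (\<sigma> j y * (h j y * ?b y + v y * of_real (pd j b y)))" for j y
 proof -
  have "s j y * g j y = \<sigma> j y * g j y" by (simp add: s_def g_def indicator_def)
  also have "\<dots> = indicator U y *\<^sub>R (\<sigma> j y * (h j y * ?b y + v y * of_real (pd j b y)))"
   unfolding gU[symmetric] by simp
  finally show ?thesis .
 qed
 ultimately show ?thesis by (simp add: integral_indicator_eq)
qed

end

lemma periodize_pd:
 assumes f: "smooth f" and R: "\<And>y. norm y > R ==> f y = 0" "\<And>y. norm y > R ==> pd l f y = 0"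
 shows "periodize (pd l f) y = pd l (periodize f) y"
proof -
 have "norm y < norm y + 1" by simp
 from smooth_periodize(2)[OF f R(1) this order_refl] periodize_eq[where f = "pd l f" and y = y and M = "norm y + 1", OF R(2) _ order_refl]
 show ?thesis by simp
qed

lemma pd_bump_outside: "r > 0 ==> norm z > r + norm q ==> pd l (bump r q) z = 0"
 using norm_triangle_ineq2[of z q] by (intro pd_bump_0) (auto simp: dist_norm)

context periodic_domain
begin

text \<open>The pairing depends continuously on the centre by dominated convergence, so a dense set
  of centres determines it; the periodised bump on \<open>Y\<close> and the bump on \<open>U\<close>
  give the same pairing by unfolding.\<close>

lemma kernel_orthogonality:
 fixes \<sigma> :: "3 => R3 => complex"
 assumes sg: "\<And>j. ae_periodic U (\<sigma> j)" "\<And>j. L2 \<L> Y (\<sigma> j)"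
  and r: "r > 0" and D: "closure D = UNIV"
  and z: "\<And>q. q \<in> D ==> (\<Sigma> j. LINT y:Y|\<L>. \<sigma> j y * of_real (pd j (periodize (bump r q)) y)) = 0"
 shows "(\<Sigma> j. LINT y:U|\<L>. \<sigma> j y * of_real (pd j (bump r q) y)) = 0"
proof -
 define I where "I = (\<lambda>q. \<Sigma> j. LINT y:U|\<L>. \<sigma> j y * of_real (pd j (bump r q) y))"
 define s where "s = (\<lambda>R j y. indicator (U \<inter> cball 0 R) y *\<^sub>R \<sigma> j y)"
 have s: "integrable \<L> (s R j)" for R j
  unfolding s_def by (rule periodic_L2(1)[OF sg])
 have eq: "indicator U y *\<^sub>R \<sigma> j y * of_real (pd j (bump r q) y) = s R j y * of_real (pd j (bump r q) y)"
  if "r + norm q \<le> R" for q j y R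
  using pd_bump_outside[OF r, of q y j] that by (cases "y \<in> cball 0 R") (auto simp: s_def indicator_def)
 have cont: "continuous_on UNIV (\<lambda>y. complex_of_real (pd j (bump r q) y))" for j q
  by (intro smooth_continuous smooth_of_real smooth_pd smooth_bump)
 have int: "integrable \<L> (\<lambda>y. s R j y * of_real (pd j (bump r q) y))" for R j q
 proof -
  obtain B where B: "\<And>q z. norm (complex_of_real (pd j (bump r q) z)) \<le> B" using pd_bump_bounded[OF r] by (metis norm_of_real)
  show ?thesis by (rule integrable_mult_bounded[OF s continuous_lebesgue_measurable[OF cont] B])
 qed
 have I0: "I q = 0" if "q \<in> D" for q
 proof -
  have "(LINT y:U|\<L>. \<sigma> j y * of_real (pd j (bump r q) y)) = (LINT y:Y|\<L>. \<sigma> j y * of_real (pd j (periodize (bump r q)) y))" for j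
  proof -
   have "integrable \<L> (\<lambda>y. indicator U y *\<^sub>R \<sigma> j y * of_real (pd j (bump r q) y))"
    unfolding eq[OF order_refl] by (rule int)
   from integral_U_Y[OF sg(1) pd_bump_outside[OF r] smooth_pd[OF smooth_bump] this]
   show ?thesis
    using periodize_pd[OF smooth_bump bump_outside[OF r] pd_bump_outside[OF r]] by simp
  qed
  then show ?thesis unfolding I_def using z[OF that] by simp
 qed
 obtain Q where Q: "\<And>n. Q n \<in> D" "Q \<longlonglongrightarrow> q" using D closure_sequential[of q D] by blast
 have "bounded (range Q)" using Q(2) by (rule convergent_imp_bounded)
 then obtain C where C: "\<And>n. norm (Q n) \<le> C" by (auto simp: bounded_iff)
 define R where "R = max (r + C) (r + norm q)"
 have RQ: "r + norm (Q n) \<le> R" "r + norm q \<le> R" for n using C[of n] by (auto simp: R_def)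
 have Is: "I q' = (\<Sigma> j. LINT y|\<L>. s R j y * of_real (pd j (bump r q') y))" if "r + norm q' \<le> R" for q'
  unfolding I_def set_lebesgue_integral_def eq[OF that, symmetric] by simp
 have "(\<lambda>n. I (Q n)) \<longlonglongrightarrow> I q"
  unfolding Is[OF RQ(1)] Is[OF RQ(2)]
 proof (intro tendsto_sum)
  fix j
  obtain B where B: "\<And>q z. norm (complex_of_real (pd j (bump r q) z)) \<le> B" using pd_bump_bounded[OF r] by (metis norm_of_real)
  show "(\<lambda>n. LINT y|\<L>. s R j y * of_real (pd j (bump r (Q n)) y)) \<longlonglongrightarrow> (LINT y|\<L>. s R j y * of_real (pd j (bump r q) y))"
  proof (rule integral_dominated_convergence)
   show "integrable \<L> (\<lambda>y. norm (s R j y) * B)" using s by simp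
   show "(\<lambda>y. s R j y * of_real (pd j (bump r q) y)) \<in> borel_measurable \<L>"
     "(\<lambda>y. s R j y * of_real (pd j (bump r (Q n)) y)) \<in> borel_measurable \<L>" for n
    using int by (blast intro: borel_measurable_integrable)+
   show "AE y in \<L>. (\<lambda>n. s R j y * of_real (pd j (bump r (Q n)) y)) \<longlonglongrightarrow> s R j y * of_real (pd j (bump r q) y)"
   proof (intro AE_I2 tendsto_mult tendsto_const)
    fix y
    have "continuous_on UNIV (\<lambda>z. complex_of_real (pd j (bump r 0) z))" by (rule cont)
    then have "isCont (\<lambda>z. complex_of_real (pd j (bump r 0) z)) (y - q)" by (simp add: continuous_on_eq_continuous_at)
    then have "(\<lambda>n. complex_of_real (pd j (bump r 0) (y - Q n))) \<longlonglongrightarrow> complex_of_real (pd j (bump r 0) (y - q))"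
     by (rule isCont_tendsto_compose) (intro tendsto_diff tendsto_const Q(2))
    moreover have "pd j (bump r 0) (y - q) = pd j (bump r q) y" for q
     using pd_bump_shift[of j r 0 y "- q"] by simp
    ultimately show "(\<lambda>n. complex_of_real (pd j (bump r (Q n)) y)) \<longlonglongrightarrow> complex_of_real (pd j (bump r q) y)" by simp
   qed
   show "AE y in \<L>. norm (s R j y * of_real (pd j (bump r (Q n)) y)) \<le> norm (s R j y) * B" for n
    using B by (auto simp: norm_mult intro!: AE_I2 mult_left_mono)
  qed
 qed
 moreover have "I (Q n) = 0" for n using I0 Q(1) by blast
 ultimately have "I q = 0" by (simp add: LIMSEQ_const_iff)
 then show ?thesis by (simp add: I_def)
qed

text \<open>The closed cell is covered by finitely many balls in which \<open>local_density\<close>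
  applies. The periodised cut-offs of these balls add up to a positive smooth \<open>b\<close>;
  writing \<open>v\<close> as the sum of the products of \<open>v / b\<close> with the cut-offs
  localises the claim periodically.\<close>

lemma global_density:
 fixes \<sigma> :: "3 => R3 => complex"
 assumes gb: "graph_boundary (Ck 1) U"
  and sg: "\<And>j. ae_periodic U (\<sigma> j)" "\<And>j. L2 \<L> Y (\<sigma> j)"
  and D: "closure D = UNIV"
  and z: "\<And>m q. q \<in> D ==> (\<Sigma> j. LINT y:Y|\<L>. \<sigma> j y * of_real (pd j (periodize (bump (inverse (real (Suc m))) q)) y)) = 0"
  and v: "H1data v h"
 shows "(\<Sigma> j. LINT y:Y|\<L>. \<sigma> j y * h j y) = 0"
proof -
 have T0: "(\<Sigma> j. LINT y:U|\<L>. \<sigma> j y * of_real (pd j (bump (inverse (real (Suc m))) q) y)) = 0" for m q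
  by (rule kernel_orthogonality[OF sg _ D z]) auto
 obtain \<rho> where \<rho>: "\<And>x. \<rho> x > 0" "\<And>x. shrinkable U x (\<rho> x)" using graph_shrinkable[OF openU gb] by metis
 have "compact (closure cell)" using bounded_cell by (simp add: compact_closure)
 moreover have "closure cell \<subseteq> (\<Union>x\<in>closure cell. ball x (\<rho> x / 2))" using \<rho>(1) by force
 ultimately obtain N where N: "N \<subseteq> closure cell" "finite N" "closure cell \<subseteq> (\<Union>x\<in>N. ball x (\<rho> x / 2))"
  by (rule compactE_image[OF _ open_ball])
 define \<beta> where "\<beta> = (\<lambda>x. bump (\<rho> x / 2) x)"
 have \<rho>2: "\<rho> x / 2 > 0" for x using \<rho>(1)[of x] by simp
 have \<beta>s: "smooth (\<beta> x)" for x unfolding \<beta>_def by (rule smooth_bump)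
 define R where "R = (\<lambda>x. \<rho> x / 2 + norm x)"
 have \<beta>0: "\<beta> x y = 0" "pd j (\<beta> x) y = 0" if "norm y > R x" for x y j
  using that bump_outside[OF \<rho>2] pd_bump_outside[OF \<rho>2] by (auto simp: \<beta>_def R_def)
 define b where "b = (\<lambda>y. \<Sum>x\<in>N. periodize (\<beta> x) y)"
 have ps: "smooth (periodize (\<beta> x))" for x by (rule smooth_periodize(1)[OF \<beta>s \<beta>0(1)])
 have bs: "smooth b" unfolding b_def by (rule smooth_sum[OF N(2)]) (rule ps)
 have bper: "periodic b" unfolding b_def periodic_def
  using periodic_periodize unfolding periodic_def by (simp cong: sum.cong)
 have nonneg: "periodize (\<beta> x) y \<ge> 0" for x y
  unfolding periodize_def by (rule sum_nonneg) (simp add: \<beta>_def bump_nonneg)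
 have bpos: "b y > 0" for y
 proof -
  define w where "w = y - nearest y"
  have "w \<in> closure cell" unfolding w_def by (rule nearest_closure_cell)
  then obtain x where x: "x \<in> N" "w \<in> ball x (\<rho> x / 2)" using N(3) by blast
  have "- nearest y \<in> lattice3" by (rule lattice_minus[OF nearest_lattice])
  from bper[unfolded periodic_def, rule_format, OF this, of y] have "b w = b y" by (simp add: w_def)
  have "0 < \<beta> x w" unfolding \<beta>_def using bump_pos_iff[OF \<rho>2] x(2) by (simp add: dist_commute)
  also have "\<beta> x w \<le> periodize (\<beta> x) w"
  proof -
   have "norm w \<le> norm w" by simp
   have e: "periodize (\<beta> x) w = (\<Sum>k\<in>lat (R x + norm w). \<beta> x (w + k))" by (rule periodize_eq[OF \<beta>0(1)]) auto
   have "R x + norm w \<ge> 0" using \<rho>2[of x] by (simp add: R_def)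
   then have "0 \<in> lat (R x + norm w)" by (simp add: lat_def lattice_0)
   then have "\<beta> x (w + 0) \<le> (\<Sum>k\<in>lat (R x + norm w). \<beta> x (w + k))"
    by (intro member_le_sum[of 0 _ "\<lambda>k. \<beta> x (w + k)"] finite_lat) (auto simp: \<beta>_def bump_nonneg)
   then show ?thesis using e by simp
  qed
  also have "\<dots> \<le> b w" unfolding b_def by (intro member_le_sum x(1) N(2) nonneg)
  finally show ?thesis using \<open>b w = b y\<close> by simp
 qed
 \<comment> \<open>Dividing \<open>v\<close> once by the sum of the cut-offs replaces a normalised
   partition of unity.\<close>
 define c where "c = (\<lambda>y. inverse (b y))"
 have b0: "b y \<noteq> 0" for y using bpos[of y] by simp
 have cs: "smooth c" unfolding c_def by (rule smooth_inverse[OF bs b0])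
 have cper: "periodic (\<lambda>y. complex_of_real (c y))" using bper by (simp add: periodic_def c_def)
 define v' where "v' = (\<lambda>y. v y * of_real (c y))"
 define h' where "h' = (\<lambda>j y. h j y * of_real (c y) + v y * of_real (pd j c y))"
 have v': "H1data v' h'"
  using H1data_mult[OF v smooth_of_real[OF cs] cper] by (simp add: v'_def h'_def pd_of_real[OF cs])
 have w': "has_weak_pd U j v' (h' j)" and v'L: "L2 \<L> Y v'" and h'L: "L2 \<L> Y (h' j)" and v'p: "periodic v'" for j
  using v' by (auto simp: H1data_def)
 have ap: "ae_periodic U v'" "ae_periodic U (h' j)" for j
  using v'p weak_pd_ae_periodic[OF v'p w'] by (auto simp: ae_periodic_def periodic_def)
 have aps: "ae_periodic U (\<lambda>y. f y * g y)" if "ae_periodic U f" "ae_periodic U g" for f g :: "R3 => complex"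
  unfolding ae_periodic_def
 proof
  fix k assume k: "k \<in> lattice3"
  have "AE y\<in>U in \<L>. f (y + k) = f y" "AE y\<in>U in \<L>. g (y + k) = g y"
   using that k by (auto simp: ae_periodic_def)
  then show "AE y\<in>U in \<L>. f (y + k) * g (y + k) = f y * g y" by eventually_elim simp
 qed
 have prodY: "set_integrable \<L> Y (\<lambda>y. f y * g y * of_real (t y))"
  if "L2 \<L> Y f" "L2 \<L> Y g" "continuous_on UNIV t" for f g :: "R3 => complex" and t :: "R3 => real"
  by (rule set_integrable_mult_continuous[OF L2_product[OF that(1,2)] _ boundedY]) (intro continuous_intros that(3))
 have prodU: "integrable \<L> (\<lambda>y. indicator U y *\<^sub>R (f y * g y) * of_real (t y))"
  if "L2 \<L> Y f" "L2 \<L> Y g" "ae_periodic U f" "ae_periodic U g" "continuous_on UNIV t" and t0: "\<And>y. norm y > R' ==> t y = 0" for f g :: "R3 => complex" and R' and t :: "R3 => real"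
 proof -
  have 1: "integrable \<L> (\<lambda>y. indicator (U \<inter> cball 0 R') y *\<^sub>R (f y * g y))"
   by (rule periodic_set_integrable[OF aps[OF that(3,4)] L2_product[OF that(1,2)]])
  have 2: "continuous_on UNIV (\<lambda>y. complex_of_real (t y))" by (intro continuous_intros that(5))
  obtain B where B: "\<And>y. norm (complex_of_real (t y)) \<le> B"
   using smooth_bounded[OF 2, of R'] t0 by (metis of_real_0)
  have "integrable \<L> (\<lambda>y. indicator (U \<inter> cball 0 R') y *\<^sub>R (f y * g y) * of_real (t y))"
   by (rule integrable_mult_bounded[OF 1 continuous_lebesgue_measurable[OF 2] B])
  moreover have e: "indicator (U \<inter> cball 0 R') y *\<^sub>R (f y * g y) * of_real (t y) = indicator U y *\<^sub>R (f y * g y) * of_real (t y)" for y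
   using t0[of y] by (cases "norm y \<le> R'") (auto simp: indicator_def)
  ultimately show ?thesis by (simp only: e)
 qed
 have cpd: "continuous_on UNIV (periodize (\<beta> x))" "continuous_on UNIV (pd j (periodize (\<beta> x)))" "continuous_on UNIV (\<beta> x)" "continuous_on UNIV (pd j (\<beta> x))" for x j
  using ps \<beta>s by (auto intro: smooth_continuous smooth_pd)
 have part: "(\<Sigma> j. LINT y:Y|\<L>. \<sigma> j y * (h' j y * of_real (periodize (\<beta> x) y) + v' y * of_real (pd j (periodize (\<beta> x)) y))) = 0" for x
 proof -
  have "(LINT y:U|\<L>. \<sigma> j y * (h' j y * of_real (\<beta> x y) + v' y * of_real (pd j (\<beta> x) y)))
   = (LINT y:Y|\<L>. \<sigma> j y * (h' j y * of_real (periodize (\<beta> x) y) + v' y * of_real (pd j (periodize (\<beta> x)) y)))" for j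
  proof -
   have I1: "integrable \<L> (\<lambda>y. indicator U y *\<^sub>R (\<sigma> j y * h' j y) * of_real (\<beta> x y))"
    by (rule prodU[OF sg(2) h'L sg(1) ap(2) cpd(3) \<beta>0(1)])
   have I2: "integrable \<L> (\<lambda>y. indicator U y *\<^sub>R (\<sigma> j y * v' y) * of_real (pd j (\<beta> x) y))"
    by (rule prodU[OF sg(2) v'L sg(1) ap(1) cpd(4) \<beta>0(2)])
   have U1: "set_integrable \<L> U (\<lambda>y. \<sigma> j y * h' j y * of_real (\<beta> x y))" using I1 by (simp add: set_integrable_def)
   have U2: "set_integrable \<L> U (\<lambda>y. \<sigma> j y * v' y * of_real (pd j (\<beta> x) y))" using I2 by (simp add: set_integrable_def)
   have "(LINT y:U|\<L>. \<sigma> j y * (h' j y * of_real (\<beta> x y) + v' y * of_real (pd j (\<beta> x) y)))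
    = (LINT y:U|\<L>. \<sigma> j y * h' j y * of_real (\<beta> x y)) + (LINT y:U|\<L>. \<sigma> j y * v' y * of_real (pd j (\<beta> x) y))"
    using set_integral_add(2)[OF U1 U2] by (simp add: distrib_left mult.assoc)
   also have "(LINT y:U|\<L>. \<sigma> j y * h' j y * of_real (\<beta> x y)) = (LINT y:Y|\<L>. \<sigma> j y * h' j y * of_real (periodize (\<beta> x) y))"
    by (rule integral_U_Y[OF aps[OF sg(1) ap(2)] \<beta>0(1) \<beta>s I1])
   also have "(LINT y:U|\<L>. \<sigma> j y * v' y * of_real (pd j (\<beta> x) y)) = (LINT y:Y|\<L>. \<sigma> j y * v' y * of_real (periodize (pd j (\<beta> x)) y))"
    by (rule integral_U_Y[OF aps[OF sg(1) ap(1)] \<beta>0(2) smooth_pd[OF \<beta>s] I2])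
   also have "periodize (pd j (\<beta> x)) = pd j (periodize (\<beta> x))"
    by (rule ext) (rule periodize_pd[OF \<beta>s \<beta>0])
   also have "(LINT y:Y|\<L>. \<sigma> j y * h' j y * of_real (periodize (\<beta> x) y)) + (LINT y:Y|\<L>. \<sigma> j y * v' y * of_real (pd j (periodize (\<beta> x)) y))
    = (LINT y:Y|\<L>. \<sigma> j y * (h' j y * of_real (periodize (\<beta> x) y) + v' y * of_real (pd j (periodize (\<beta> x)) y)))"
    using set_integral_add(2)[OF prodY[OF sg(2) h'L cpd(1)] prodY[OF sg(2) v'L cpd(2)], of j j x j j x] by (simp add: distrib_left mult.assoc)
   finally show ?thesis .
  qed
  moreover have "(\<Sigma> j. LINT y:U|\<L>. \<sigma> j y * (h' j y * of_real (\<beta> x y) + v' y * of_real (pd j (\<beta> x) y))) = 0"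
   by (rule local_density[OF sg T0 \<rho>(2)[of x] \<beta>s _ \<rho>2[of x] _ v'])
    (use \<rho>2[of x] \<rho>(1)[of x] in \<open>auto simp: \<beta>_def bump_0_iff\<close>)
  ultimately show ?thesis by simp
 qed
 have "(\<Sum>x\<in>N. h' j y * of_real (periodize (\<beta> x) y) + v' y * of_real (pd j (periodize (\<beta> x)) y)) = h j y" for j y
 proof -
  have pb: "pd j b y = (\<Sum>x\<in>N. pd j (periodize (\<beta> x)) y)" unfolding b_def by (rule pd_sum[OF N(2)]) (rule ps)
  have "(\<Sum>x\<in>N. h' j y * of_real (periodize (\<beta> x) y) + v' y * of_real (pd j (periodize (\<beta> x)) y)) = h' j y * of_real (b y) + v' y * of_real (pd j b y)"
   unfolding pb by (simp add: b_def sum.distrib sum_distrib_left)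
  also have "pd j c y = - (inverse (b y) * pd j b y * inverse (b y))" for j
   unfolding c_def by (rule pd_inverse[OF bs b0])
  then have "h' j y * of_real (b y) + v' y * of_real (pd j b y) = h j y"
   using b0[of y] by (simp add: h'_def v'_def c_def[symmetric]) (simp add: c_def field_simps)
  finally show ?thesis .
 qed
 then have e: "\<sigma> j y * h j y = (\<Sum>x\<in>N. \<sigma> j y * (h' j y * of_real (periodize (\<beta> x) y) + v' y * of_real (pd j (periodize (\<beta> x)) y)))" for j y
  by (simp flip: sum_distrib_left)
 have intY: "set_integrable \<L> Y (\<lambda>y. \<sigma> j y * (h' j y * of_real (periodize (\<beta> x) y) + v' y * of_real (pd j (periodize (\<beta> x)) y)))" for j x
  using set_integral_add(1)[OF prodY[OF sg(2) h'L cpd(1)] prodY[OF sg(2) v'L cpd(2)], of j j x j j x] by (simp add: distrib_left mult.assoc)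
 have "(\<Sigma> j. LINT y:Y|\<L>. \<sigma> j y * h j y) = (\<Sigma> j. \<Sum>x\<in>N. LINT y:Y|\<L>. \<sigma> j y * (h' j y * of_real (periodize (\<beta> x) y) + v' y * of_real (pd j (periodize (\<beta> x)) y)))"
 proof (rule sum.cong[OF refl])
  fix j
  show "(LINT y:Y|\<L>. \<sigma> j y * h j y) = (\<Sum>x\<in>N. LINT y:Y|\<L>. \<sigma> j y * (h' j y * of_real (periodize (\<beta> x) y) + v' y * of_real (pd j (periodize (\<beta> x)) y)))"
   unfolding e set_lebesgue_integral_def scaleR_sum_right
   by (rule Bochner_Integration.integral_sum) (use intY in \<open>simp add: set_integrable_def\<close>)
 qed
 also have "\<dots> = (\<Sum>x\<in>N. \<Sigma> j. LINT y:Y|\<L>. \<sigma> j y * (h' j y * of_real (periodize (\<beta> x) y) + v' y * of_real (pd j (periodize (\<beta> x)) y)))"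
  by (rule sum.swap)
 also have "\<dots> = 0" by (simp add: part)
 finally show ?thesis .
qed

section \<open>Rigidity\<close>

text \<open>Vanishing strain makes the derivative of each \<open>g i j\<close> zero as a
  distribution, so the gradient is a constant matrix on the connected set and \<open>d\<close> is
  affine almost everywhere. The unit lattice translations then force the matrix to be 0.\<close>

lemma rigid_displacement:
 assumes conn: "connected U" and ne: "Y \<noteq> {}"
  and d: "\<And>i. periodic (d i)" "\<And>i j. has_weak_pd U j (d i) (g i j)"
  and sym: "\<And>i j. AE y\<in>U in \<L>. g i j y + g j i y = 0"
 shows "\<exists>c. AE y\<in>U in \<L>. d i y = c"
proof -
 have L: "L1_loc U (g i j)" "L1_loc U (d i)" for i j using d(2)[of j i] by (auto simp: has_weak_pd_def)
 have g0: "(LINT y:U|\<L>. g i j y * of_real (pd k (bump r q) y)) = 0" if r: "r > 0" "cball q r \<subseteq> U" for i j k r q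
 proof -
  define D where "D = (\<lambda>i j k. LINT y:U|\<L>. d i y * of_real (pd j (pd k (bump r q)) y))"
  have Dg: "D i j k = - (LINT y:U|\<L>. g i j y * of_real (pd k (bump r q) y))" for i j k
   using has_weak_pdD[OF d(2) test_fun_pd_bump[OF r, of k], of i j]
   by (simp add: D_def pd_of_real[OF smooth_pd[OF smooth_bump]])
  have Dsym: "D i j k = D i k j" for i j k unfolding D_def pd_pd_bump_symmetric[of j k] ..
  have Danti: "D i j k = - D j i k" for i j k
  proof -
   have "(LINT y:U|\<L>. g i j y * of_real (pd k (bump r q) y)) + (LINT y:U|\<L>. g j i y * of_real (pd k (bump r q) y))
    = (LINT y:U|\<L>. (g i j y + g j i y) * of_real (pd k (bump r q) y))"
    using set_integral_add(2)[OF test_fun_integrable[OF L(1) test_fun_pd_bump[OF r, of k]] test_fun_integrable[OF L(1) test_fun_pd_bump[OF r, of k]], of i j j i]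
    by (simp add: distrib_right)
   also have "\<dots> = (LINT y:U|\<L>. 0)"
    by (rule set_integral_AE_eq) (use sym[of i j] in \<open>eventually_elim, simp\<close>)
   finally show ?thesis unfolding Dg by (simp add: add_eq_0_iff)
  qed
  \<comment> \<open>An array symmetric in its last two indices and antisymmetric in its first two
    vanishes: six alternating exchanges return to the start with the opposite sign.\<close>
  have "D i j k = - D i j k"
  proof -
   have "D i j k = - D j i k" by (rule Danti)
   also have "\<dots> = - D j k i" using Dsym by simp
   also have "\<dots> = D k j i" using Danti[of j k i] by simp
   also have "\<dots> = D k i j" by (rule Dsym)
   also have "\<dots> = - D i k j" by (rule Danti)
   also have "\<dots> = - D i j k" using Dsym by simp
   finally show ?thesis .
  qed
  then have "D i j k = 0" by (simp add: eq_neg_iff_add_eq_0)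
  then show ?thesis using Dg[of i j k] by simp
 qed
 have "\<exists>A. AE y\<in>U in \<L>. g i j y = A" for i j
  by (rule zero_gradient_constant[OF openU conn L(1) g0])
 then obtain A where A: "\<And>i j. AE y\<in>U in \<L>. g i j y = A i j" by metis
 define a where "a = (\<lambda>i y. d i y - (\<Sigma> j. A i j * of_real (y $ j)))"
 have la: "continuous_on UNIV (\<lambda>y :: R3. \<Sigma> j. A i j * of_real (y $ j))" for i by (intro continuous_intros)
 have lin_loc: "L1_loc U (\<lambda>y. \<Sigma> j. A i j * of_real (y $ j))" for i
  unfolding L1_loc_def set_integrable_def
 proof (intro allI impI)
  fix K assume K: "compact K \<and> K \<subseteq> U"
  have "integrable lborel (\<lambda>x. indicator K x *\<^sub>R (\<Sigma> j. A i j * complex_of_real (x $ j)))"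
   by (rule borel_integrable_compact[OF _ continuous_on_subset[OF la]]) (use K in auto)
  then show "integrable \<L> (\<lambda>x. indicator K x *\<^sub>R (\<Sigma> j. A i j * complex_of_real (x $ j)))"
   by (subst integrable_completion) (auto dest: borel_measurable_integrable)
 qed
 have aconst: "\<exists>c. AE y\<in>U in \<L>. a i y = c" for i
 proof (rule zero_gradient_constant[OF openU conn])
  show "L1_loc U (a i)" unfolding a_def by (rule L1_loc_diff[OF L(2) lin_loc])
  fix r q l assume r: "r > (0::real)" "cball q r \<subseteq> U"
  let ?\<phi> = "\<lambda>y. complex_of_real (bump r q y)"
  have t: "test_fun U ?\<phi>" "test_fun U (\<lambda>y. complex_of_real (pd l (bump r q) y))"
   by (rule test_fun_bump[OF r], rule test_fun_pd_bump[OF r])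
  have d1: "(LINT y:U|\<L>. d i y * of_real (pd l (bump r q) y)) = - (LINT y:U|\<L>. g i l y * ?\<phi> y)"
   using has_weak_pdD[OF d(2) t(1), of i l] by (simp add: pd_of_real[OF smooth_bump])
  have d2: "(LINT y:U|\<L>. g i l y * ?\<phi> y) = (LINT y:U|\<L>. A i l * ?\<phi> y)"
   by (rule set_integral_AE_eq) (use A[of i l] in \<open>eventually_elim, simp\<close>)
  have Uind: "indicator U y *\<^sub>R (w * complex_of_real (bump r q y)) = w * complex_of_real (bump r q y)"
   "indicator U y *\<^sub>R (w * complex_of_real (pd l (bump r q) y)) = w * complex_of_real (pd l (bump r q) y)" for y w
   using bump_zero[OF r, of y] pd_bump_zero[OF r, of y l] by (auto simp: indicator_def)
  let ?L = "\<lambda>y :: R3. \<Sigma> j. A i j * of_real (y $ j)"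
  have sL: "smooth ?L"
  proof (rule smooth_sum)
   fix j
   have "smooth (\<lambda>y::R3. complex_of_real (y $ j))"
    by (rule smooth_of_real[OF smooth_bounded_linear[OF bounded_linear_vec_nth]])
   then show "smooth (\<lambda>y::R3. A i j * complex_of_real (y $ j))" by (rule smooth_mult[OF smooth_const])
  qed simp
  have pL: "pd l ?L y = A i l" for y
  proof -
   have "(?L has_derivative (\<lambda>h. \<Sigma> j. A i j * of_real (h $ j))) (at y)"
    by (auto intro!: derivative_eq_intros bounded_linear.has_derivative[OF bounded_linear_vec_nth])
   from pd_eq[OF this, of l] have "pd l ?L y = (\<Sigma> j. A i j * of_real ((axis l 1 :: R3) $ j))" .
   also have "\<dots> = (\<Sigma> j. if j = l then A i j else 0)" by (rule sum.cong) (auto simp: axis_def)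
   finally show ?thesis by simp
  qed
  have z: "(LINT y|\<L>. pd l (\<lambda>y. ?L y * ?\<phi> y) y) = 0"
   by (rule integral_pd_zero[where R = "r + norm q"]) (use smooth_mult[OF sL smooth_of_real[OF smooth_bump]] bump_outside[OF r(1)] in auto)
  have pp: "pd l (\<lambda>y. ?L y * ?\<phi> y) y = ?L y * of_real (pd l (bump r q) y) + A i l * ?\<phi> y" for y
   by (simp only: pd_mult[OF sL smooth_of_real[OF smooth_bump]] pL pd_of_real[OF smooth_bump])
  have I1: "integrable \<L> (\<lambda>y. ?L y * of_real (pd l (bump r q) y))"
   using test_fun_integrable[OF lin_loc t(2), of i] unfolding set_integrable_def Uind .
  have I2: "integrable \<L> (\<lambda>y. A i l * ?\<phi> y)"
   using integrable_bump[OF r(1)] by (intro integrable_mult_right) simp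
  have d3: "(LINT y|\<L>. ?L y * of_real (pd l (bump r q) y)) = - (LINT y|\<L>. A i l * ?\<phi> y)"
   using z unfolding pp Bochner_Integration.integral_add[OF I1 I2] by (simp add: eq_neg_iff_add_eq_0)
  have "(LINT y:U|\<L>. a i y * of_real (pd l (bump r q) y)) = (LINT y:U|\<L>. d i y * of_real (pd l (bump r q) y)) - (LINT y:U|\<L>. ?L y * of_real (pd l (bump r q) y))"
   using set_integral_diff(2)[OF test_fun_integrable[OF L(2) t(2)] test_fun_integrable[OF lin_loc t(2)], of i i] by (simp add: a_def left_diff_distrib)
  also have "(LINT y:U|\<L>. ?L y * of_real (pd l (bump r q) y)) = - (LINT y:U|\<L>. A i l * ?\<phi> y)"
   by (simp only: set_lebesgue_integral_def Uind d3)
  finally have "(LINT y:U|\<L>. a i y * of_real (pd l (bump r q) y)) = 0" unfolding d1 d2 by simp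
  then show "(LINT y:U|\<L>. a i y * of_real (pd l (bump r q) y)) = 0" .
 qed
 then obtain c where c: "\<And>i. AE y\<in>U in \<L>. a i y = c i" by metis
 have A0: "A i k = 0" for i k
 proof -
  \<comment> \<open>Comparing the affine remainder at \<open>y\<close> and at
    \<open>y + axis k 1\<close>, where \<open>d i\<close> takes the same value, isolates the entry
    \<open>A i k\<close>.\<close>
  have 1: "AE y\<in>U in \<L>. a i (y + axis k 1) = c i"
   using AE_shift[OF c[of i], of "axis k 1"] by eventually_elim (use Uper[OF lattice_axis] in simp)
  have "AE y\<in>U in \<L>. a i (y + axis k 1) = a i y" using 1 c[of i] by eventually_elim simp
  from AE_ball_nonempty[OF this openU] obtain y where "a i (y + axis k 1) = a i y" using ne YU by blast
  moreover have "d i (y + axis k 1) = d i y" using d(1)[of i] lattice_axis[of k] by (simp add: periodic_def)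
  ultimately have "(\<Sigma> j. A i j * of_real ((y + axis k 1) $ j)) = (\<Sigma> j. A i j * of_real (y $ j))" by (simp add: a_def)
  then have "(\<Sigma> j. A i j * of_real ((axis k 1 :: R3) $ j)) = 0" by (simp add: distrib_left sum.distrib)
  moreover have "(\<Sigma> j. A i j * of_real ((axis k 1 :: R3) $ j)) = (\<Sigma> j. if j = k then A i j else 0)"
   by (rule sum.cong) (auto simp: axis_def)
  ultimately show ?thesis by simp
 qed
 have "AE y\<in>U in \<L>. d i y = c i" using c[of i] by (simp add: a_def A0)
 then show ?thesis by blast
qed

end

section \<open>The Laplace transform of the force\<close>

lemma exp_integrable:
 assumes "a > 0" shows "integrable \<L> (\<lambda>t::real. indicator {0<..} t * exp (- a * t))"
proof -
 have "(\<lambda>x. exp (- a * x)) absolutely_integrable_on {0..}"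
  using integrable_on_exp_minus_to_infinity[OF assms, of 0]
  by (intro nonnegative_absolutely_integrable_1) auto
 then have "(\<lambda>x. exp (- a * x)) absolutely_integrable_on {0<..}"
  by (rule set_integrable_subset) auto
 then show ?thesis by (simp add: set_integrable_def)
qed

lemma Cauchy_Schwarz_integral:
 fixes u v :: "'a => real"
 assumes u: "integrable M (\<lambda>x. (u x)\<^sup>2)" and v: "integrable M (\<lambda>x. (v x)\<^sup>2)" and uv: "integrable M (\<lambda>x. u x * v x)"
 shows "(LINT x|M. u x * v x)\<^sup>2 \<le> (LINT x|M. (u x)\<^sup>2) * (LINT x|M. (v x)\<^sup>2)"
proof -
 define A B I where "A = (LINT x|M. (u x)\<^sup>2)" and "B = (LINT x|M. (v x)\<^sup>2)" and "I = (LINT x|M. u x * v x)"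
 have A: "A \<ge> 0" unfolding A_def by simp
 have *: "2 * s * I \<le> s\<^sup>2 * A + B" for s
 proof -
  have "0 \<le> (LINT x|M. (s * u x - v x)\<^sup>2)" by simp
  also have "\<dots> = (LINT x|M. s\<^sup>2 * (u x)\<^sup>2 - 2 * s * (u x * v x) + (v x)\<^sup>2)"
   by (rule Bochner_Integration.integral_cong[OF refl]) (simp add: power2_eq_square algebra_simps)
  also have "\<dots> = s\<^sup>2 * A - 2 * s * I + B"
   unfolding A_def B_def I_def using u v uv by simp
  finally show ?thesis by simp
 qed
 show ?thesis
 proof (cases "A = 0")
  case True
  then have "AE x in M. (u x)\<^sup>2 = 0"
   unfolding A_def using integral_nonneg_eq_0_iff_AE[OF u] by simp
  then have "AE x in M. u x * v x = 0" by eventually_elim simp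
  then have "I = 0" unfolding I_def by (rule integral_eq_zero_AE)
  then show ?thesis using True unfolding A_def B_def I_def by simp
 next
  case False
  then have "A > 0" using A by simp
  have "2 * (I / A) * I \<le> (I / A)\<^sup>2 * A + B" by (rule *)
  then have "I\<^sup>2 \<le> A * B" using \<open>A > 0\<close> by (simp add: field_simps power2_eq_square)
  then show ?thesis unfolding A_def B_def I_def .
 qed
qed

lemma mult_le_sum_squares:
 fixes x y :: real
 assumes "0 \<le> x" "0 \<le> y" shows "x * y \<le> x\<^sup>2 + y\<^sup>2"
 using sum_squares_bound[of x y] mult_nonneg_nonneg[OF assms] by linarith

lemma product_integrable:
 fixes u :: "'a::euclidean_space => real" and v :: "'b::euclidean_space => real"
 assumes "integrable lborel u" "integrable lborel v"
 shows "integrable \<L> (\<lambda>z. u (fst z) * v (snd z))"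
proof -
 have [measurable]: "u \<in> borel_measurable borel" "v \<in> borel_measurable borel" using assms by auto
 have "integrable (lborel \<Otimes>\<^sub>M lborel) (\<lambda>(y, z). u y * v z)"
 proof (rule lborel_pair.Fubini_integrable)
  show "(\<lambda>(y, z). u y * v z) \<in> borel_measurable (lborel \<Otimes>\<^sub>M lborel)" by measurable
  show "integrable lborel (\<lambda>x. LINT y|lborel. norm (case (x, y) of (y, z) => u y * v z))"
   using assms by (simp add: abs_mult)
  show "AE x in lborel. integrable lborel (\<lambda>y. case (x, y) of (y, z) => u y * v z)"
   using assms by simp
 qed
 then have "integrable lborel (\<lambda>z. u (fst z) * v (snd z))" by (simp add: lborel_prod case_prod_unfold)
 then show ?thesis by (subst integrable_completion) (auto dest: borel_measurable_integrable)
qed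

text \<open>As \<open>2 * r > m\<close>, the growth bound makes \<open>exp (- r t) * \<phi>\<close>
  square integrable over all positive times. The remaining factor decays like
  \<open>exp (- (Re lam - r) t)\<close> and is square integrable in time, so Cauchy-Schwarz bounds
  the transform pointwise in \<open>x\<close>.\<close>

lemma laplace_scalar:
 fixes \<phi> :: "real => R3 => complex"
 assumes \<Omega>: "open \<Omega>" "bounded \<Omega>"
  and L: "\<And>s t. 0 < s ==> s \<le> t ==> L2 \<L> ({s..t} \<times> \<Omega>) (\<lambda>(t, x). \<phi> t x)"
  and bd: "AE t in \<L>. t > 0 --> (LINT x:\<Omega>|\<L>. (norm (\<phi> t x))\<^sup>2) \<le> K * exp (m * t)" and K: "K > 0"
  and r: "Re lam > r" "2 * r > m"
 shows "AE x\<in>\<Omega> in \<L>. set_integrable \<L> {0<..} (\<lambda>t. exp (- lam * of_real t) * \<phi> t x)"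
  "L2 \<L> \<Omega> (\<lambda>x. LINT t:{0<..}|\<L>. exp (- lam * of_real t) * \<phi> t x)"
proof -
 \<comment> \<open>Square integrability is given on time intervals bounded away from 0 only. These
   slabs exhaust the half line, the growth bound controls their integrals uniformly, and monotone
   convergence passes to the whole.\<close>
 define S where "S = (\<lambda>n. {inverse (real (Suc n))..real (Suc n)} \<times> \<Omega>)"
 define F where "F = (\<lambda>z. indicator ({0<..} \<times> \<Omega>) z *\<^sub>R (exp (- of_real (r * fst z)) * \<phi> (fst z) (snd z)))"
 define Fn where "Fn = (\<lambda>n z. indicator (S n) z *\<^sub>R (exp (- of_real (r * fst z)) * \<phi> (fst z) (snd z)))"
 have LS: "L2 \<L> (S n) (\<lambda>z. \<phi> (fst z) (snd z))" for n
  unfolding S_def using L[of "inverse (real (Suc n))" "real (Suc n)"]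
  by (simp add: case_prod_unfold field_simps)
 have ce: "continuous_on UNIV (\<lambda>z :: real \<times> R3. exp (- complex_of_real (r * fst z)))" by (intro continuous_intros)
 have Fnm: "Fn n \<in> borel_measurable \<L>" for n
 proof -
  have "(\<lambda>z. indicator (S n) z *\<^sub>R \<phi> (fst z) (snd z)) \<in> borel_measurable \<L>"
   using LS[of n] by (simp add: L2_def set_borel_measurable_def)
  from borel_measurable_times[OF continuous_lebesgue_measurable[OF ce] this]
  show ?thesis unfolding Fn_def by simp
 qed
 have FnF: "\<exists>N. \<forall>n\<ge>N. Fn n z = F z" for z
 proof (cases "fst z > 0")
  case True
  obtain N1 where N1: "inverse (real (Suc N1)) < fst z" using reals_Archimedean[OF True] by blast
  obtain N2 where N2: "fst z \<le> real N2" using real_arch_simple by blast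
  have "Fn n z = F z" if "n \<ge> max N1 N2" for n
  proof -
   have "inverse (real (Suc n)) \<le> inverse (real (Suc N1))" using that by (intro le_imp_inverse_le) auto
   then have "inverse (real (Suc n)) \<le> fst z" using N1 by linarith
   moreover have "fst z \<le> real (Suc n)" using N2 that by linarith
   ultimately have "z \<in> S n \<longleftrightarrow> z \<in> {0<..} \<times> \<Omega>" using True unfolding S_def mem_Times_iff atLeastAtMost_iff greaterThan_iff by blast
   then show ?thesis by (simp add: Fn_def F_def indicator_def)
  qed
  then show ?thesis by blast
 next
  case False
  have "z \<notin> S n" for n
  proof
   assume "z \<in> S n"
   then have "inverse (real (Suc n)) \<le> fst z" by (auto simp: S_def mem_Times_iff)
   moreover have "inverse (real (Suc n)) > 0" by simp
   ultimately show False using False by linarith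
  qed
  moreover have "z \<notin> {0<..} \<times> \<Omega>" using False by (auto simp: mem_Times_iff)
  ultimately show ?thesis by (simp add: Fn_def F_def)
 qed
 then have FnF': "(\<lambda>n. Fn n z) \<longlonglongrightarrow> F z" for z
  using tendsto_eventually by (metis (mono_tags, lifting) eventually_sequentially)
 have Fm: "F \<in> borel_measurable \<L>"
  by (rule borel_measurable_LIMSEQ_metric[OF Fnm FnF'])
 define G where "G = (\<lambda>n z. (norm (Fn n z))\<^sup>2)"
 have Gi: "integrable \<L> (G n)" for n
 proof -
  obtain B where B: "B \<ge> 0" "\<And>z. z \<in> S n ==> norm (exp (- complex_of_real (r * fst z))) \<le> B"
  proof -
   have b: "bounded (S n)" unfolding S_def by (intro bounded_Times \<Omega>(2)) simp
   have "compact (closure (S n))" using b by (simp add: compact_closure)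
   from compact_imp_bounded[OF compact_continuous_image[OF continuous_on_subset[OF ce subset_UNIV] this]]
   obtain B where "\<forall>z\<in>closure (S n). norm (exp (- complex_of_real (r * fst z))) \<le> B" unfolding bounded_iff by blast
   then show ?thesis using closure_subset[of "S n"] by (intro that[of "max B 0"]) (auto simp: le_max_iff_disj)
  qed
  have i: "integrable \<L> (\<lambda>z. B\<^sup>2 * (indicator (S n) z * (norm (\<phi> (fst z) (snd z)))\<^sup>2))"
   using LS[of n] by (intro integrable_mult_right) (simp add: L2_def set_integrable_def)
  show ?thesis
  proof (rule integrable_dominated[OF i])
   show "G n \<in> borel_measurable \<L>" unfolding G_def using Fnm[of n] by measurable
   show "AE z in \<L>. norm (G n z) \<le> norm (B\<^sup>2 * (indicator (S n) z * (norm (\<phi> (fst z) (snd z)))\<^sup>2))"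
   proof (rule AE_I2)
    fix z
    have "z \<in> S n ==> (norm (exp (- complex_of_real (r * fst z))))\<^sup>2 \<le> B\<^sup>2" using B by (intro power_mono) auto
    then show "norm (G n z) \<le> norm (B\<^sup>2 * (indicator (S n) z * (norm (\<phi> (fst z) (snd z)))\<^sup>2))"
     by (cases "z \<in> S n") (auto simp: G_def Fn_def norm_mult power_mult_distrib mult_right_mono simp del: norm_exp_eq_Re)
   qed
  qed
 qed
 define C where "C = (LINT t|\<L>. indicator {0<..} t * (K * exp (- (2 * r - m) * t)))"
 have Ci: "integrable \<L> (\<lambda>t. indicator {0<..} t * (K * exp (- (2 * r - m) * t)))"
  using integrable_mult_right[OF exp_integrable[of "2 * r - m"], of K] r(2) by (simp add: mult_ac)
 have GC: "(LINT z|\<L>. G n z) \<le> C" for n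
 proof -
  have Gc: "integrable \<L> (\<lambda>z. complex_of_real (G n z))" using Gi by simp
  have "complex_of_real (LINT z|\<L>. G n z) = (LINT t|\<L>. LINT x|\<L>. complex_of_real (G n (t, x)))"
   using lebesgue_slices(3)[OF Gc] by simp
  then have e: "(LINT z|\<L>. G n z) = (LINT t|\<L>. LINT x|\<L>. G n (t, x))"
   by (simp only: integral_complex_of_real of_real_eq_iff)
  have i: "integrable \<L> (\<lambda>t. LINT x|\<L>. G n (t, x))"
   using integrable_Re[OF lebesgue_slices(2)[OF Gc]] by simp
  show ?thesis unfolding e C_def
  proof (rule integral_mono_AE[OF i Ci])
   show "AE t in \<L>. (LINT x|\<L>. G n (t, x)) \<le> indicator {0<..} t * (K * exp (- (2 * r - m) * t))"
    using bd
   proof eventually_elim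
    case (elim t)
    show ?case
    proof (cases "t \<in> {inverse (real (Suc n))..real (Suc n)}")
     case True
     moreover have "inverse (real (Suc n)) > 0" by simp
     ultimately have t: "t > 0" by (auto simp del: inverse_positive_iff_positive)
     have "G n (t, x) = exp (- (2 * r * t)) * (indicator \<Omega> x *\<^sub>R (norm (\<phi> t x))\<^sup>2)" for x
      using True by (cases "x \<in> \<Omega>") (auto simp: G_def Fn_def S_def norm_mult power_mult_distrib norm_exp_eq_Re power2_eq_square mult_ac simp flip: exp_add)
     then have "(LINT x|\<L>. G n (t, x)) = exp (- (2 * r * t)) * (LINT x:\<Omega>|\<L>. (norm (\<phi> t x))\<^sup>2)"
      by (simp add: set_lebesgue_integral_def)
     also have "\<dots> \<le> exp (- (2 * r * t)) * (K * exp (m * t))"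
      by (rule mult_left_mono) (use elim t in auto)
     also have "\<dots> = K * exp (- (2 * r - m) * t)" by (simp add: exp_add[symmetric] algebra_simps)
     finally show ?thesis using t by simp
    next
     case False
     then have "G n (t, x) = 0" for x by (auto simp: G_def Fn_def S_def)
     then show ?thesis using K by simp
    qed
   qed
  qed
 qed
 have F2: "integrable \<L> (\<lambda>z. (norm (F z))\<^sup>2)"
 proof -
  have mono: "G n z \<le> G (Suc n) z" for n z
  proof (cases "z \<in> S n")
   case True
   have "inverse (real (Suc (Suc n))) \<le> inverse (real (Suc n))" by (intro le_imp_inverse_le) auto
   moreover have "inverse (real (Suc n)) \<le> fst z" "fst z \<le> real (Suc n)" "snd z \<in> \<Omega>"
    using True unfolding S_def mem_Times_iff atLeastAtMost_iff by blast+
   ultimately have "z \<in> S (Suc n)" unfolding S_def mem_Times_iff atLeastAtMost_iff by linarith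
   then show ?thesis using True by (simp add: G_def Fn_def)
  qed (simp add: G_def Fn_def)
  have inc: "incseq (\<lambda>n. LINT z|\<L>. G n z)"
   by (intro incseq_SucI integral_mono Gi mono)
  obtain L where "(\<lambda>n. LINT z|\<L>. G n z) \<longlonglongrightarrow> L"
   using incseq_convergent[OF inc, of C] GC by blast
  moreover have "AE z in \<L>. mono (\<lambda>n. G n z)" by (intro AE_I2) (metis incseq_SucI mono)
  moreover have "AE z in \<L>. (\<lambda>n. G n z) \<longlonglongrightarrow> (norm (F z))\<^sup>2"
   unfolding G_def by (intro AE_I2 tendsto_power tendsto_norm FnF')
  moreover have "(\<lambda>z. (norm (F z))\<^sup>2) \<in> borel_measurable \<L>" using Fm by measurable
  ultimately show ?thesis using integrable_monotone_convergence[of \<L> G "\<lambda>z. (norm (F z))\<^sup>2" L] Gi by blast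
 qed
 define b where "b = Re lam - r"
 have b: "b > 0" using r by (simp add: b_def)
 define e where "e = (\<lambda>t. indicator {0<..} t * exp (- (2 * b) * t))"
 have ei: "integrable \<L> e" unfolding e_def by (rule exp_integrable) (use b in simp)
 have em: "e \<in> borel_measurable borel" unfolding e_def by measurable
 have ei': "integrable lborel e" using ei em by (simp add: integrable_completion)
 have \<Omega>i: "integrable lborel (indicator \<Omega> :: R3 => real)"
  using \<Omega> emeasure_bounded_finite[OF \<Omega>(2)] by (simp add: integrable_indicator_iff less_top)
 have ep: "integrable \<L> (\<lambda>z. e (fst z) * indicator \<Omega> (snd z))"
  by (rule product_integrable[OF ei' \<Omega>i])
 define P where "P = (\<lambda>z. exp (- (lam - of_real r) * of_real (fst z)) * F z)"
 have Pm: "P \<in> borel_measurable \<L>"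
 proof -
  have "continuous_on UNIV (\<lambda>z :: real \<times> R3. exp (- (lam - of_real r) * of_real (fst z)))" by (intro continuous_intros)
  from borel_measurable_times[OF continuous_lebesgue_measurable[OF this] Fm] show ?thesis unfolding P_def .
 qed
 have Pn: "norm (P z) \<le> sqrt (e (fst z)) * norm (F z)" and Pn2: "norm (P z) \<le> e (fst z) * indicator \<Omega> (snd z) + (norm (F z))\<^sup>2" for z
 proof -
  have 1: "norm (P z) = exp (- b * fst z) * norm (F z)"
   by (simp add: P_def norm_mult norm_exp_eq_Re b_def)
  have s: "(exp (- b * fst z))\<^sup>2 = exp (- (2 * b) * fst z)" by (simp add: power2_eq_square flip: exp_add)
  show "norm (P z) \<le> sqrt (e (fst z)) * norm (F z)"
  proof (cases "fst z > 0")
   case True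
   then have "sqrt (e (fst z)) = exp (- b * fst z)" unfolding e_def s[symmetric] by simp
   then show ?thesis by (simp add: 1)
  next
   case False
   then have "F z = 0" by (auto simp: F_def indicator_def mem_Times_iff)
   then show ?thesis by (simp add: 1)
  qed
  show "norm (P z) \<le> e (fst z) * indicator \<Omega> (snd z) + (norm (F z))\<^sup>2"
  proof (cases "z \<in> {0<..} \<times> \<Omega>")
   case True
   then have "e (fst z) * indicator \<Omega> (snd z) = (exp (- b * fst z))\<^sup>2" unfolding s by (auto simp: e_def mem_Times_iff)
   moreover have "exp (- b * fst z) * norm (F z) \<le> (exp (- b * fst z))\<^sup>2 + (norm (F z))\<^sup>2"
    by (rule mult_le_sum_squares) auto
   ultimately show ?thesis by (simp add: 1)
  next
   case False
   then have "F z = 0" by (simp add: F_def)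
   then show ?thesis by (simp add: 1 e_def)
  qed
 qed
 have Pi: "integrable \<L> P"
  by (rule integrable_dominated[OF Bochner_Integration.integrable_add[OF ep F2] Pm])
   (use Pn2 in \<open>auto intro!: AE_I2 order_trans[OF _ abs_ge_self]\<close>)
 have Pe: "P (t, x) = indicator \<Omega> x *\<^sub>R indicator {0<..} t *\<^sub>R (exp (- lam * of_real t) * \<phi> t x)" for t x
 proof -
  have "exp (- (lam - of_real r) * of_real t) * exp (- complex_of_real (r * t)) = exp (- lam * of_real t)"
   by (simp add: exp_add[symmetric] algebra_simps)
  then show ?thesis
   by (cases "t \<in> {0<..} \<and> x \<in> \<Omega>") (auto simp: P_def F_def mult.assoc[symmetric])
 qed
 note sw = lebesgue_slices[OF integrable_swap[OF Pi], simplified]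
 have ae1: "AE x in \<L>. integrable \<L> (\<lambda>t. P (t, x))" using sw(1) .
 show "AE x\<in>\<Omega> in \<L>. set_integrable \<L> {0<..} (\<lambda>t. exp (- lam * of_real t) * \<phi> t x)"
  using ae1
 proof eventually_elim
  case (elim x)
  show ?case
  proof
   assume "x \<in> \<Omega>"
   then have "indicator {0<..} t *\<^sub>R (exp (- lam * of_real t) * \<phi> t x) = P (t, x)" for t by (simp add: Pe)
   then show "set_integrable \<L> {0<..} (\<lambda>t. exp (- lam * of_real t) * \<phi> t x)"
    unfolding set_integrable_def using elim by (simp only:)
  qed
 qed
 define fh where "fh = (\<lambda>x. LINT t:{0<..}|\<L>. exp (- lam * of_real t) * \<phi> t x)"
 have fe: "indicator \<Omega> x *\<^sub>R fh x = (LINT t|\<L>. P (t, x))" for x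
  by (cases "x \<in> \<Omega>") (simp_all add: fh_def Pe set_lebesgue_integral_def)
 have F2c: "integrable \<L> (\<lambda>z. complex_of_real ((norm (F z))\<^sup>2))" using F2 by (simp only: complex_of_real_integrable_eq)
 note sF = lebesgue_slices[OF integrable_swap[OF F2c], simplified]
 have ae2: "AE x in \<L>. integrable \<L> (\<lambda>t. (norm (F (t, x)))\<^sup>2)"
  using sF(1)
 proof eventually_elim
  case (elim x)
  from integrable_Re[OF elim] show ?case by simp
 qed
 have i2: "integrable \<L> (\<lambda>x. LINT t|\<L>. (norm (F (t, x)))\<^sup>2)"
 proof -
  have "(LINT t|\<L>. complex_of_real ((norm (F (t, x)))\<^sup>2)) = complex_of_real (LINT t|\<L>. (norm (F (t, x)))\<^sup>2)" for x
   by (rule integral_complex_of_real)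
  then show ?thesis using integrable_Re[OF sF(2)] by (simp flip: of_real_power)
 qed
 have fm: "(\<lambda>x. indicator \<Omega> x *\<^sub>R fh x) \<in> borel_measurable \<L>" using sw(2) unfolding fe by auto
 have fm2: "(\<lambda>x. (norm (indicator \<Omega> x *\<^sub>R fh x))\<^sup>2) \<in> borel_measurable \<L>" using fm by measurable
 have "integrable \<L> (\<lambda>x. (norm (indicator \<Omega> x *\<^sub>R fh x))\<^sup>2)"
 proof (rule integrable_dominated[OF integrable_mult_right[OF i2, of "LINT t|\<L>. e t"] fm2])
  show "AE x in \<L>. norm ((norm (indicator \<Omega> x *\<^sub>R fh x))\<^sup>2) \<le> norm ((LINT t|\<L>. e t) * (LINT t|\<L>. (norm (F (t, x)))\<^sup>2))"
   using ae1 ae2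
  proof eventually_elim
   case (elim x)
   have e0: "e t \<ge> 0" for t by (simp add: e_def)
   have se: "(sqrt (e t))\<^sup>2 = e t" for t using e0 by simp
   have mF: "(\<lambda>t. norm (F (t, x))) \<in> borel_measurable \<L>"
   proof -
    have [measurable]: "(\<lambda>t. (norm (F (t, x)))\<^sup>2) \<in> borel_measurable \<L>" using elim(2) by (rule borel_measurable_integrable)
    have "(\<lambda>t. sqrt ((norm (F (t, x)))\<^sup>2)) \<in> borel_measurable \<L>" by measurable
    then show ?thesis by simp
   qed
   have uv: "integrable \<L> (\<lambda>t. sqrt (e t) * norm (F (t, x)))"
   proof (rule integrable_dominated[OF Bochner_Integration.integrable_add[OF ei elim(2)]])
    show "(\<lambda>t. sqrt (e t) * norm (F (t, x))) \<in> borel_measurable \<L>"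
    proof -
     have [measurable]: "e \<in> borel_measurable \<L>" using ei by (rule borel_measurable_integrable)
     show ?thesis using mF by measurable
    qed
    show "AE t in \<L>. norm (sqrt (e t) * norm (F (t, x))) \<le> norm (e t + (norm (F (t, x)))\<^sup>2)"
    proof (rule AE_I2)
     fix t
     have "sqrt (e t) * norm (F (t, x)) \<le> (sqrt (e t))\<^sup>2 + (norm (F (t, x)))\<^sup>2"
      by (rule mult_le_sum_squares) (use e0 in auto)
     then show "norm (sqrt (e t) * norm (F (t, x))) \<le> norm (e t + (norm (F (t, x)))\<^sup>2)" using e0[of t] by (simp add: abs_mult)
    qed
   qed
   have "norm (LINT t|\<L>. P (t, x)) \<le> (LINT t|\<L>. sqrt (e t) * norm (F (t, x)))"
    by (rule norm_integral_le[OF uv]) (use Pn[of "(_, x)"] in simp)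
   then have "(norm (LINT t|\<L>. P (t, x)))\<^sup>2 \<le> (LINT t|\<L>. sqrt (e t) * norm (F (t, x)))\<^sup>2" by (rule power_mono) simp
   also have "\<dots> \<le> (LINT t|\<L>. (sqrt (e t))\<^sup>2) * (LINT t|\<L>. (norm (F (t, x)))\<^sup>2)"
    by (rule Cauchy_Schwarz_integral[OF _ elim(2) uv]) (use ei se in simp)
   finally show ?case unfolding fe se by (simp add: e0)
  qed
 qed
 moreover have "(norm (indicator \<Omega> x *\<^sub>R fh x))\<^sup>2 = indicator \<Omega> x *\<^sub>R (norm (fh x))\<^sup>2" for x by (cases "x \<in> \<Omega>") auto
 ultimately have "L2 \<L> \<Omega> fh" using fm by (simp add: L2_defs)
 then show "L2 \<L> \<Omega> (\<lambda>x. LINT t:{0<..}|\<L>. exp (- lam * of_real t) * \<phi> t x)" by (simp add: fh_def)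
qed

section \<open>Test functions with a jump\<close>

text \<open>Expanding both symmetrised factors gives four sums, which coincide after exchanging
  summation indices within the first or the second pair of \<open>a\<close>.\<close>

lemma tensor_symmetrize:
 fixes a :: "3 => 3 => 3 => 3 => real" and A B :: "3 => 3 => complex"
 assumes a: "\<And>i j k l. a i j k l = a j i k l \<and> a i j k l = a i j l k"
 shows "(\<Sigma> i j k l. of_real (a i j k l) * ((A k l + A l k) / 2) * ((B i j + B j i) / 2))
  = (\<Sigma> i j k l. of_real (a i j k l) * A k l * B i j)"
proof -
 let ?S = "\<lambda>f. \<Sum>i\<in>(UNIV::3 set). \<Sum>j\<in>(UNIV::3 set). \<Sum>k\<in>(UNIV::3 set). \<Sum>l\<in>(UNIV::3 set). (f i j k l :: complex)"
 have s1: "?S (\<lambda>i j k l. f i j k l) = ?S (\<lambda>i j k l. f j i k l)" for f by (rule sum.swap)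
 have s2: "?S (\<lambda>i j k l. f i j k l) = ?S (\<lambda>i j k l. f i j l k)" for f
  by (rule sum.cong[OF refl], rule sum.cong[OF refl], rule sum.swap)
 let ?X = "?S (\<lambda>i j k l. of_real (a i j k l) * A k l * B i j)"
 have aij: "a j i k l = a i j k l" and akl: "a i j l k = a i j k l" for i j k l using a by metis+
 have e1: "?S (\<lambda>i j k l. of_real (a i j k l) * A l k * B i j) = ?X"
  by (subst s2) (simp only: akl)
 have e2: "?S (\<lambda>i j k l. of_real (a i j k l) * A k l * B j i) = ?X"
  by (subst s1) (simp only: aij)
 have e3: "?S (\<lambda>i j k l. of_real (a i j k l) * A l k * B j i) = ?X"
  by (subst s1, subst s2) (simp only: aij akl)
 have "?S (\<lambda>i j k l. of_real (a i j k l) * ((A k l + A l k) / 2) * ((B i j + B j i) / 2))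
  = ?S (\<lambda>i j k l. (of_real (a i j k l) * A k l * B i j + of_real (a i j k l) * A l k * B i j
    + of_real (a i j k l) * A k l * B j i + of_real (a i j k l) * A l k * B j i) / 4)"
  by (intro sum.cong refl) (simp add: field_simps)
 also have "\<dots> = (?X + ?X + ?X + ?X) / 4"
  unfolding sum_divide_distrib[symmetric] sum.distrib e1 e2 e3 ..
 finally show ?thesis by simp
qed

text \<open>Real ellipticity is applied to real and imaginary parts separately; their cross terms
  cancel by the symmetry between the two index pairs.\<close>

lemma tensor_nonneg:
 fixes a :: "3 => 3 => 3 => 3 => real"
 assumes a: "elasticity_tensor a"
 obtains c where "c > 0" "\<And>\<xi> :: 3 => 3 => complex. (\<And>i j. \<xi> i j = \<xi> j i) ==> \<exists>t\<ge>c * (\<Sigma> i j. (norm (\<xi> i j))\<^sup>2).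
  (\<Sigma> i j k l. of_real (a i j k l) * \<xi> k l * cnj (\<xi> i j)) = of_real t"
proof -
 from a[unfolded elasticity_tensor_def, THEN conjunct2] obtain c where c: "c > 0"
  and pos': "\<forall>\<xi> :: 3 => 3 => real. (\<forall>i j. \<xi> i j = \<xi> j i) -->
    (\<Sigma> i j k l. a i j k l * \<xi> k l * \<xi> i j) \<ge> c * (\<Sigma> i j. \<xi> i j * \<xi> i j)"
  by (elim exE conjE) (rule that)
 note pos = pos'[rule_format]
 have maj: "\<And>i j k l. a i j k l = a k l i j" using a[unfolded elasticity_tensor_def, THEN conjunct1] by blast
 have "\<exists>t\<ge>c * (\<Sigma> i j. (norm (\<xi> i j))\<^sup>2).
  (\<Sigma> i j k l. of_real (a i j k l) * \<xi> k l * cnj (\<xi> i j)) = of_real t"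
  if \<xi>: "\<And>i j. \<xi> i j = \<xi> j i" for \<xi> :: "3 => 3 => complex"
 proof -
  let ?Q = "\<lambda>f g. \<Sigma> i j k l. a i j k l * f k l * (g i j :: real)"
  let ?R = "\<lambda>i j. Re (\<xi> i j)" and ?I = "\<lambda>i j. Im (\<xi> i j)"
  have sw: "?Q f g = ?Q g f" for f g
  proof -
   have "?Q f g = (\<Sigma> k l i j. a i j k l * f k l * g i j)"
   proof -
    have "?Q f g = (\<Sigma> i k j l. a i j k l * f k l * g i j)"
     by (rule sum.cong[OF refl], rule sum.swap)
    also have "\<dots> = (\<Sigma> k i j l. a i j k l * f k l * g i j)" by (rule sum.swap)
    also have "\<dots> = (\<Sigma> k i l j. a i j k l * f k l * g i j)"
     by (rule sum.cong[OF refl], rule sum.cong[OF refl], rule sum.swap)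
    also have "\<dots> = (\<Sigma> k l i j. a i j k l * f k l * g i j)"
     by (rule sum.cong[OF refl], rule sum.swap)
    finally show ?thesis .
   qed
   also have "\<dots> = ?Q g f"
   proof (intro sum.cong refl)
    fix k l i j :: 3
    show "a i j k l * f k l * g i j = a k l i j * g i j * f k l" using maj[of i j k l] by simp
   qed
   finally show ?thesis .
  qed
  have re: "Re (\<Sigma> i j k l. of_real (a i j k l) * \<xi> k l * cnj (\<xi> i j)) = ?Q ?R ?R + ?Q ?I ?I"
   by (simp add: sum.distrib[symmetric] algebra_simps)
  have im: "Im (\<Sigma> i j k l. of_real (a i j k l) * \<xi> k l * cnj (\<xi> i j)) = ?Q ?I ?R - ?Q ?R ?I"
   by (simp add: sum_subtractf[symmetric] algebra_simps)
  have "c * (\<Sigma> i j. (norm (\<xi> i j))\<^sup>2) = c * (\<Sigma> i j. ?R i j * ?R i j) + c * (\<Sigma> i j. ?I i j * ?I i j)"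
   by (simp only: cmod_power2 power2_eq_square[symmetric] sum.distrib distrib_left)
  also have "\<dots> \<le> ?Q ?R ?R + ?Q ?I ?I"
  proof (rule add_mono)
   show "c * (\<Sigma> i j. ?R i j * ?R i j) \<le> ?Q ?R ?R" by (rule pos[of ?R]) (metis \<xi>)
   show "c * (\<Sigma> i j. ?I i j * ?I i j) \<le> ?Q ?I ?I" by (rule pos[of ?I]) (metis \<xi>)
  qed
  finally have "c * (\<Sigma> i j. (norm (\<xi> i j))\<^sup>2) \<le> ?Q ?R ?R + ?Q ?I ?I" .
  moreover have "(\<Sigma> i j k l. of_real (a i j k l) * \<xi> k l * cnj (\<xi> i j)) = of_real (?Q ?R ?R + ?Q ?I ?I)"
   unfolding complex_eq_iff re im using sw[of ?I ?R] by simp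
  ultimately show ?thesis by blast
 qed
 with c show ?thesis by (rule that)
qed

text \<open>The support of \<open>t\<close> is a compact part of the open set
  \<open>W \<union> W'\<close>, so \<open>t\<close> vanishes near every point outside it, and
  cutting along the interface creates no discontinuity.\<close>

lemma glue_smooth:
 fixes t b :: "R3 => complex"
 assumes W: "open W" "open W'" "W \<inter> W' = {}" and t: "test_fun (W \<union> W') t" and b: "smooth b"
 shows "smooth (\<lambda>x. if x \<in> W then b x * t x else 0)"
proof (rule smooth_local)
 fix x
 let ?K = "closure {x. t x \<noteq> 0}"
 have K: "?K \<subseteq> W \<union> W'" "smooth t" using t by (auto simp: test_fun_def)
 have t0: "t y = 0" if "y \<notin> ?K" for y using that closure_subset[of "{x. t x \<noteq> 0}"] by auto
 consider "x \<in> W" | "x \<in> W'" | "x \<notin> ?K" using K(1) by blast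
 then show "\<exists>V g. open V \<and> x \<in> V \<and> smooth g \<and> (\<forall>y\<in>V. (if y \<in> W then b y * t y else 0) = g y)"
 proof cases
  case 1
  then show ?thesis using W(1) smooth_mult[OF b K(2)] by (intro exI[of _ W] exI[of _ "\<lambda>x. b x * t x"]) simp
 next
  case 2
  have "y \<notin> W" if "y \<in> W'" for y using W(3) that by blast
  then show ?thesis using W(2) 2 smooth_const[of 0] by (intro exI[of _ W'] exI[of _ "\<lambda>x. 0"]) simp
 next
  case 3
  have "open (- ?K)" by (intro open_Compl closed_closure)
  moreover have "(if y \<in> W then b y * t y else 0) = 0" if "y \<in> - ?K" for y
  proof -
   have "t y = 0" by (rule t0) (use that in blast)
   then show ?thesis by simp
  qed
  ultimately show ?thesis using 3 smooth_const[of "0 :: complex"] by blast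
 qed
qed

lemma test_fun_bounded_support:
 assumes "test_fun U t" obtains R where "\<And>x. norm x > R ==> t x = (0::complex)"
proof -
 have "bounded (closure {x. t x \<noteq> 0})" using assms by (auto simp: test_fun_def compact_imp_bounded)
 then obtain R where R: "\<forall>x\<in>closure {x. t x \<noteq> 0}. norm x \<le> R" unfolding bounded_iff by blast
 have "t x = 0" if "norm x > R" for x
 proof (rule ccontr)
  assume "t x \<noteq> 0"
  then have "x \<in> closure {x. t x \<noteq> 0}" using closure_subset[of "{x. t x \<noteq> 0}"] by blast
  with R that show False by force
 qed
 then show ?thesis by (rule that)
qed

lemma L1_loc_bounded_indicator:
 fixes F :: "R3 => complex"
 assumes "open W" "continuous_on UNIV F"
 shows "L1_loc U (\<lambda>x. if x \<in> W then F x else 0)"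
 unfolding L1_loc_def
proof (intro allI impI)
 fix K assume K: "compact K \<and> K \<subseteq> U"
 have "integrable lborel (\<lambda>x. indicator K x *\<^sub>R F x)"
  by (rule borel_integrable_compact[OF _ continuous_on_subset[OF assms(2)]]) (use K in auto)
 then have "integrable \<L> (\<lambda>x. indicator K x *\<^sub>R F x)"
  by (subst integrable_completion) (auto dest: borel_measurable_integrable)
 then have "integrable \<L> (\<lambda>x. indicator W x *\<^sub>R (indicator K x *\<^sub>R F x))"
  by (rule integrable_mult_indicator[rotated]) (use assms(1) in auto)
 moreover have "indicator W x *\<^sub>R (indicator K x *\<^sub>R F x) = indicator K x *\<^sub>R (if x \<in> W then F x else 0)" for x by auto
 ultimately show "set_integrable \<L> K (\<lambda>x. if x \<in> W then F x else 0)" by (simp add: set_integrable_def)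
qed

text \<open>The interface does not belong to the open set, so a jump there leaves no trace in the
  weak derivative: the product with a test function is globally smooth and its derivative has
  integral 0.\<close>

lemma has_weak_pd_piece:
 fixes F :: "R3 => complex"
 assumes W: "open W" "open W'" "W \<inter> W' = {}" and F: "smooth F"
 shows "has_weak_pd (W \<union> W') l (\<lambda>x. if x \<in> W then F x else 0) (\<lambda>x. if x \<in> W then pd l F x else 0)"
proof -
 have "(LINT x:W \<union> W'|\<L>. (if x \<in> W then F x else 0) * pd l t x) = - (LINT x:W \<union> W'|\<L>. (if x \<in> W then pd l F x else 0) * t x)"
  if t: "test_fun (W \<union> W') t" for t
 proof -
  have st: "smooth t" using t by (simp add: test_fun_def)
  define k where "k = (\<lambda>x. if x \<in> W then F x * t x else 0)"
  define k1 where "k1 = (\<lambda>x. if x \<in> W then F x * pd l t x else 0)"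
  define k2 where "k2 = (\<lambda>x. if x \<in> W then pd l F x * t x else 0)"
  have sk: "smooth k" "smooth k1" "smooth k2" unfolding k_def k1_def k2_def
   by (intro glue_smooth[OF W] t test_fun_pd[OF t] F smooth_pd)+
  obtain R where R: "\<And>x. norm x > R ==> t x = 0" using test_fun_bounded_support[OF t] by metis
  obtain R' where R': "\<And>x. norm x > R' ==> pd l t x = 0" using test_fun_bounded_support[OF test_fun_pd[OF t]] by metis
  have i: "integrable \<L> k1" "integrable \<L> k2"
   by (rule continuous_integrable[where R = R'], rule smooth_continuous[OF sk(2)], use R' in \<open>simp add: k1_def\<close>)
    (rule continuous_integrable[where R = R], rule smooth_continuous[OF sk(3)], use R in \<open>simp add: k2_def\<close>)
  have "pd l k x = k1 x + k2 x" for x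
  proof (cases "x \<in> W")
   case True
   have "pd l k x = pd l (\<lambda>x. F x * t x) x"
    by (rule pd_cong_open[OF W(1) True]) (auto simp: k_def intro: smooth_mult F st)
   then show ?thesis using True by (simp add: pd_mult[OF F st] k1_def k2_def)
  next
   case False
   have "pd l k x = pd l (\<lambda>_. 0 :: complex) x"
   proof (cases "x \<in> W'")
    case True
    show ?thesis by (rule pd_cong_open[OF W(2) True]) (use W(3) in \<open>auto simp: k_def intro: smooth_const\<close>)
   next
    case False
    let ?K = "closure {x. t x \<noteq> 0}"
    have K: "x \<in> - ?K" using t False \<open>x \<notin> W\<close> by (auto simp: test_fun_def)
    show ?thesis
    proof (rule pd_cong_open[OF _ K])
     fix y assume "y \<in> - ?K"
     then show "k y = 0" using closure_subset[of "{x. t x \<noteq> 0}"] by (auto simp: k_def)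
    qed (auto intro: smooth_const)
   qed
   also have "\<dots> = 0" using pd_eq[OF has_derivative_const] by blast
   finally show ?thesis using False by (simp add: k1_def k2_def)
  qed
  moreover have "(LINT x|\<L>. pd l k x) = 0"
   by (rule integral_pd_zero[OF sk(1), where R = R]) (simp add: k_def R)
  ultimately have "(LINT x|\<L>. k1 x) = - (LINT x|\<L>. k2 x)"
   using i by (simp add: eq_neg_iff_add_eq_0)
  moreover have "indicator (W \<union> W') x *\<^sub>R ((if x \<in> W then F x else 0) * pd l t x) = k1 x"
   "indicator (W \<union> W') x *\<^sub>R ((if x \<in> W then pd l F x else 0) * t x) = k2 x" for x by (auto simp: k1_def k2_def)
  ultimately show ?thesis by (simp add: set_lebesgue_integral_def)
 qed
 then show ?thesis
  unfolding has_weak_pd_def pd_def[symmetric]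
  using L1_loc_bounded_indicator[OF W(1)] smooth_continuous F smooth_pd by blast
qed

lemma has_weak_pd_add:
 assumes "has_weak_pd U l f g" "has_weak_pd U l f' g'"
 shows "has_weak_pd U l (\<lambda>x. f x + f' x) (\<lambda>x. g x + g' x)"
proof -
 have L: "L1_loc U f" "L1_loc U g" "L1_loc U f'" "L1_loc U g'" using assms by (auto simp: has_weak_pd_def)
 have "(LINT x:U|\<L>. (f x + f' x) * pd l t x) = - (LINT x:U|\<L>. (g x + g' x) * t x)" if t: "test_fun U t" for t
  unfolding distrib_right
  using set_integral_add(2)[OF test_fun_integrable[OF L(1) test_fun_pd[OF t]] test_fun_integrable[OF L(3) test_fun_pd[OF t]], of l l]
   set_integral_add(2)[OF test_fun_integrable[OF L(2) t] test_fun_integrable[OF L(4) t]]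
   has_weak_pdD[OF assms(1) t] has_weak_pdD[OF assms(2) t] by simp
 then show ?thesis using L1_loc_add L unfolding has_weak_pd_def pd_def[symmetric] by blast
qed

lemma has_weak_pd_two_phase:
 fixes F G v :: "R3 => complex"
 assumes W: "open W" "open W'" "W \<inter> W' = {}" and F: "smooth F" "smooth G"
  and v: "\<And>x. x \<in> W ==> v x = F x" "\<And>x. x \<in> W' ==> v x = G x"
 shows "has_weak_pd (W \<union> W') l v (\<lambda>x. if x \<in> W then pd l F x else pd l G x)"
proof -
 have W2: "W' \<inter> W = {}" using W(3) by blast
 note 1 = has_weak_pd_piece[OF W F(1), of l]
 note 2 = has_weak_pd_piece[OF W(2,1) W2 F(2), of l]
 from has_weak_pd_add[OF 1 2[unfolded Un_commute[of W']]]
 show ?thesis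
 proof (rule has_weak_pd_AE_eq)
  show "AE x\<in>W \<union> W' in \<L>. v x = (if x \<in> W then F x else 0) + (if x \<in> W' then G x else 0)"
   using v W(3) by (intro AE_I2) auto
  show "AE x\<in>W \<union> W' in \<L>. (if x \<in> W then pd l F x else pd l G x) = (if x \<in> W then pd l F x else 0) + (if x \<in> W' then pd l G x else 0)"
   using W(3) by (intro AE_I2) auto
 qed
qed

section \<open>Fields that are smooth in each phase: Sobolev regularity and traces\<close>

lemma L2_bounded_fun:
 fixes f :: "'a => complex"
 assumes S: "S \<in> sets M" "emeasure M S < \<infinity>" and f: "f \<in> borel_measurable M" "\<And>x. x \<in> S ==> norm (f x) \<le> B"
 shows "L2 M S f"
proof -
 have m: "(\<lambda>x. indicator S x *\<^sub>R f x) \<in> borel_measurable M" using S(1) f(1) by (intro borel_measurable_scaleR) auto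
 have "(\<lambda>x. (norm (f x))\<^sup>2) \<in> borel_measurable M" using f(1) by measurable
 then have m2: "(\<lambda>x. indicator S x *\<^sub>R (norm (f x))\<^sup>2) \<in> borel_measurable M" using S(1) by (intro borel_measurable_scaleR) auto
 have "integrable M (\<lambda>x. indicator S x *\<^sub>R (norm (f x))\<^sup>2)"
 proof (rule integrable_dominated[OF _ m2])
  show "integrable M (\<lambda>x. indicator S x * (\<bar>B\<bar>)\<^sup>2)" using S by (intro integrable_mult_left) (simp add: integrable_indicator_iff)
  show "AE x in M. norm (indicator S x *\<^sub>R (norm (f x))\<^sup>2) \<le> norm (indicator S x * (\<bar>B\<bar>)\<^sup>2)"
  proof (rule AE_I2)
   fix x
   have "x \<in> S ==> (norm (f x))\<^sup>2 \<le> (\<bar>B\<bar>)\<^sup>2" using f(2)[of x] by (intro power_mono) auto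
   then show "norm (indicator S x *\<^sub>R (norm (f x))\<^sup>2) \<le> norm (indicator S x * (\<bar>B\<bar>)\<^sup>2)" by (cases "x \<in> S") auto
  qed
 qed
 then show ?thesis using m by (simp add: L2_defs)
qed

lemma emeasure_bounded_open:
 fixes S :: "'a::euclidean_space set"
 assumes "open S" "bounded S" shows "emeasure \<L> S < \<infinity>"
 using bounded_set_imp_lmeasurable[OF assms(2)] assms(1) by (simp add: fmeasurable_def del: emeasure_completion)

lemma H1_two_phase:
 fixes F G v :: "R3 => complex"
 assumes W: "open W" "open W'" "W \<inter> W' = {}" "bounded (W \<union> W')" and F: "smooth F" "smooth G"
  and v: "\<And>x. x \<in> W ==> v x = F x" "\<And>x. x \<in> W' ==> v x = G x"
 shows "H1 (W \<union> W') v"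
proof -
 have L2: "L2 \<L> (W \<union> W') (\<lambda>x. if x \<in> W then p x else q x)" if "continuous_on UNIV p" "continuous_on UNIV q" for p q :: "R3 => complex"
 proof -
  note pq = that
  obtain B1 where B1: "\<forall>x\<in>W \<union> W'. norm (p x) \<le> B1" using continuous_bounded_on[OF pq(1) W(4)] by blast
  obtain B2 where B2: "\<forall>x\<in>W \<union> W'. norm (q x) \<le> B2" using continuous_bounded_on[OF pq(2) W(4)] by blast
  show ?thesis
  proof (rule L2_bounded_fun)
   show "W \<union> W' \<in> sets \<L>" "emeasure \<L> (W \<union> W') < \<infinity>" using W emeasure_bounded_open[of "W \<union> W'"] by auto
   show "(\<lambda>x. if x \<in> W then p x else q x) \<in> borel_measurable \<L>"
    using W(1) pq by (intro measurable_If_set continuous_lebesgue_measurable) auto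
   fix x assume "x \<in> W \<union> W'"
   then have "norm (p x) \<le> B1" "norm (q x) \<le> B2" using B1 B2 by blast+
   then show "norm (if x \<in> W then p x else q x) \<le> max B1 B2" by auto
  qed
 qed
 have "L2 \<L> (W \<union> W') v"
 proof -
  have "L2 \<L> (W \<union> W') (\<lambda>x. if x \<in> W then F x else G x)" by (intro L2 smooth_continuous F)
  moreover have "indicator (W \<union> W') x *\<^sub>R (if x \<in> W then F x else G x) = indicator (W \<union> W') x *\<^sub>R v x"
   "indicator (W \<union> W') x *\<^sub>R (norm (if x \<in> W then F x else G x))\<^sup>2 = indicator (W \<union> W') x *\<^sub>R (norm (v x))\<^sup>2" for x
   using v by (auto simp: indicator_def)
  ultimately show ?thesis unfolding L2_defs by (simp only:)
 qed
 then show ?thesis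
  unfolding H1_def using has_weak_pd_two_phase[OF W(1-3) F v] L2[OF smooth_continuous[OF smooth_pd[OF F(1)]] smooth_continuous[OF smooth_pd[OF F(2)]]] by blast
qed

text \<open>The smooth \<open>F\<close> serves as a constant approximating sequence. The derivatives
  agree exactly, since the same representative is selected for functions that agree on
  \<open>U\<close>.\<close>

lemma has_trace_smooth:
 fixes F f g :: "R3 => complex"
 assumes U: "open U" "bounded U" and F: "smooth F" and f: "\<And>x. x \<in> U ==> f x = F x" and g: "\<And>x. x \<in> S ==> g x = F x"
  and L: "L2 surf S g"
 shows "has_trace U S f g"
proof -
 have h: "H1 U F" "H1 U f" using H1_two_phase[of U "{}" F F F] H1_two_phase[of U "{}" F F f] U F f by auto
 have w: "weak_pd U l f = weak_pd U l F" for l by (rule weak_pd_cong[OF f])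
 have z: "(\<integral>\<^sup>+x\<in>T. ennreal ((cmod (p x - q x))\<^sup>2) \<partial>M) = 0" if "\<And>x. x \<in> T ==> p x = q x" for p q :: "R3 => complex" and T M
 proof -
  have "ennreal ((cmod (p x - q x))\<^sup>2) * indicator T x = 0" for x using that[of x] by (cases "x \<in> T") auto
  then show ?thesis by (subst nn_integral_cong[where v = "\<lambda>_. 0"]) auto
 qed
 have "H1_tendsto U (\<lambda>n. F) f"
  unfolding H1_tendsto_def L2_tendsto_def using h z[of U F f \<L>] f z[of U "weak_pd U l F" "weak_pd U l f" \<L> for l] w by auto
 moreover have "L2_tendsto surf S (\<lambda>n. F) g"
  unfolding L2_tendsto_def using z[of S F g surf] g by simp
 ultimately show ?thesis unfolding has_trace_def using L F by (intro conjI exI[of _ "\<lambda>n. F"]) simp_all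
qed

lemma L2_vec_nth:
 fixes f :: "'a => C3"
 assumes "L2 M S f" shows "L2 M S (\<lambda>x. f x $ i)"
proof -
 have m: "(\<lambda>x. indicator S x *\<^sub>R f x) \<in> borel_measurable M" and j: "integrable M (\<lambda>x. indicator S x *\<^sub>R (norm (f x))\<^sup>2)"
  using assms by (auto simp: L2_defs)
 have c: "(\<lambda>v :: C3. v $ i) \<in> borel_measurable borel" by (intro borel_measurable_continuous_onI continuous_intros)
 have m': "(\<lambda>x. indicator S x *\<^sub>R (f x $ i)) \<in> borel_measurable M"
  using measurable_compose[OF m c] by simp
 then have "(\<lambda>x. (norm (indicator S x *\<^sub>R (f x $ i)))\<^sup>2) \<in> borel_measurable M" by measurable
 moreover have "(norm (indicator S x *\<^sub>R (f x $ i)))\<^sup>2 = indicator S x *\<^sub>R (norm (f x $ i))\<^sup>2" for x by (cases "x \<in> S") auto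
 ultimately have m2: "(\<lambda>x. indicator S x *\<^sub>R (norm (f x $ i))\<^sup>2) \<in> borel_measurable M" by simp
 have "integrable M (\<lambda>x. indicator S x *\<^sub>R (norm (f x $ i))\<^sup>2)"
  by (rule integrable_dominated[OF j m2])
   (auto intro!: AE_I2 mult_left_mono power_mono Finite_Cartesian_Product.norm_nth_le simp: abs_mult)
 with m' show ?thesis by (simp add: L2_defs)
qed

text \<open>For almost every \<open>x\<close> all components are integrable in time, so the vector
  integral exists and can be taken componentwise.\<close>

lemma laplace_L2:
 assumes \<Omega>: "open \<Omega>" "bounded \<Omega>"
  and L: "\<And>s t. 0 < s ==> s \<le> t ==> L2 \<L> ({s..t} \<times> \<Omega>) (\<lambda>(t, x). f t x)"
  and bd: "AE t in \<L>. t > 0 --> (LINT x:\<Omega>|\<L>. (norm (f t x))\<^sup>2) \<le> K * exp (m * t)" and K: "K > 0"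
  and r: "Re lam > r" "2 * r > m"
 shows "L2 \<L> \<Omega> (\<lambda>x. laplace f lam x $ i)"
proof -
 have L': "L2 \<L> ({s..t} \<times> \<Omega>) (\<lambda>(t, x). f t x $ i)" if "0 < s" "s \<le> t" for s t i
  using L2_vec_nth[OF L[OF that], of i] by (simp add: case_prod_unfold)
 define S where "S = (\<lambda>n. {inverse (real (Suc n))..real (Suc n)} \<times> \<Omega>)"
 \<comment> \<open>The bound on the norm of \<open>f t\<close> passes to a component only if the
   larger integrand is integrable, because a divergent integral counts as 0. Slicing provides
   integrability for almost every \<open>t\<close>.\<close>
 have SL: "integrable \<L> (\<lambda>z. complex_of_real (indicator (S n) z *\<^sub>R (norm (f (fst z) (snd z)))\<^sup>2))" for n
  using L[of "inverse (real (Suc n))" "real (Suc n)"]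
  unfolding complex_of_real_integrable_eq S_def L2_def set_integrable_def case_prod_unfold by (simp add: field_simps)
 have "AE t in \<L>. \<forall>n. integrable \<L> (\<lambda>x. complex_of_real (indicator (S n) (t, x) *\<^sub>R (norm (f t x))\<^sup>2))"
  using lebesgue_slices(1)[OF SL] unfolding AE_all_countable by simp
 then have bd': "AE t in \<L>. t > 0 --> (LINT x:\<Omega>|\<L>. (norm (f t x $ i))\<^sup>2) \<le> K * exp (m * t)" for i
  using bd
 proof eventually_elim
  case (elim t)
  show ?case
  proof
   assume t: "t > 0"
   obtain N1 where N1: "inverse (real (Suc N1)) < t" using reals_Archimedean[OF t] by blast
   obtain N2 where N2: "t \<le> real N2" using real_arch_simple by blast
   define n where "n = max N1 N2"
   have "inverse (real (Suc n)) \<le> inverse (real (Suc N1))" unfolding n_def by (intro le_imp_inverse_le) auto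
   then have t1: "inverse (real (Suc n)) \<le> t" using N1 by linarith
   have t2: "t \<le> real (Suc n)" using N2 unfolding n_def by linarith
   have "indicator (S n) (t, x) = (indicator \<Omega> x :: real)" for x
    using t1 t2 by (simp only: S_def indicator_def mem_Sigma_iff atLeastAtMost_iff) simp
   then have i: "integrable \<L> (\<lambda>x. indicator \<Omega> x *\<^sub>R (norm (f t x))\<^sup>2)"
    using spec[OF elim(1), of n] by (simp only: complex_of_real_integrable_eq)
   have "(LINT x:\<Omega>|\<L>. (norm (f t x $ i))\<^sup>2) \<le> (LINT x:\<Omega>|\<L>. (norm (f t x))\<^sup>2)"
    unfolding set_lebesgue_integral_def
    by (rule integral_mono'[OF i]) (auto intro!: mult_left_mono power_mono Finite_Cartesian_Product.norm_nth_le)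
   also have "\<dots> \<le> K * exp (m * t)" using elim(2) t by blast
   finally show "(LINT x:\<Omega>|\<L>. (norm (f t x $ i))\<^sup>2) \<le> K * exp (m * t)" .
  qed
 qed
 note sc = laplace_scalar[OF \<Omega> L' bd' K r]
 have "AE x in \<L>. \<forall>i. x \<in> \<Omega> --> set_integrable \<L> {0<..} (\<lambda>t. exp (- lam * of_real t) * (f t x $ i))"
  unfolding AE_all_countable
 proof
  fix i show "AE x\<in>\<Omega> in \<L>. set_integrable \<L> {0<..} (\<lambda>t. exp (- lam * of_real t) * (f t x $ i))"
   by (rule sc(1))
 qed
 then have ae: "AE x\<in>\<Omega> in \<L>. laplace f lam x $ i = (LINT t:{0<..}|\<L>. exp (- lam * of_real t) * (f t x $ i))"
 proof eventually_elim
  case (elim x)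
  show ?case
  proof
   assume x: "x \<in> \<Omega>"
   let ?g = "\<lambda>t. indicator {0<..} t *\<^sub>R (exp (- lam * of_real t) *s f t x)"
   have c: "integrable \<L> (\<lambda>t. indicator {0<..} t *\<^sub>R (exp (- lam * of_real t) * (f t x $ i)))" for i
    using elim x by (simp add: set_integrable_def)
   have bl: "bounded_linear (\<lambda>z. axis i z :: C3)" for i
   proof
    show "\<exists>B. \<forall>z. norm (axis i z :: C3) \<le> norm z * B"
     by (intro exI[of _ 1]) (simp add: norm_vec_def L2_set_def axis_def if_distrib[of norm] if_distrib[of "\<lambda>x. x\<^sup>2"] cong: if_cong)
   qed (auto simp: vec_eq_iff axis_def)
   have "integrable \<L> (\<lambda>t. \<Sigma> i. axis i (indicator {0<..} t *\<^sub>R (exp (- lam * of_real t) * (f t x $ i))) :: C3)"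
    by (intro Bochner_Integration.integrable_sum integrable_bounded_linear[OF bl] c)
   moreover have "(\<Sigma> i. axis i (indicator {0<..} t *\<^sub>R (exp (- lam * of_real t) * (f t x $ i))) :: C3) = ?g t" for t
    by (simp add: vec_eq_iff axis_def)
   ultimately have g: "integrable \<L> ?g" by simp
   have "laplace f lam x $ i = (LINT t|\<L>. ?g t $ i)"
    unfolding laplace_def set_lebesgue_integral_def
    by (rule integral_bounded_linear[OF bounded_linear_vec_nth g, symmetric])
   then show "laplace f lam x $ i = (LINT t:{0<..}|\<L>. exp (- lam * of_real t) * (f t x $ i))"
    by (simp add: set_lebesgue_integral_def)
  qed
 qed
 let ?h = "\<lambda>x. LINT t:{0<..}|\<L>. exp (- lam * of_real t) * (f t x $ i)"
 have h: "integrable \<L> (\<lambda>x. indicator \<Omega> x *\<^sub>R (norm (?h x))\<^sup>2)" "(\<lambda>x. indicator \<Omega> x *\<^sub>R ?h x) \<in> borel_measurable \<L>"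
  using sc(2)[of i] by (auto simp: L2_defs)
 have "integrable \<L> (\<lambda>x. indicator \<Omega> x *\<^sub>R (norm (laplace f lam x $ i))\<^sup>2)"
  by (rule integrable_AE[OF h(1)]) (use ae in eventually_elim, auto simp: indicator_def)
 moreover have "(\<lambda>x. indicator \<Omega> x *\<^sub>R (laplace f lam x $ i)) \<in> borel_measurable \<L>"
  by (rule borel_measurable_AE[OF h(2)]) (use ae in eventually_elim, auto simp: indicator_def)
 ultimately show ?thesis by (simp add: L2_defs)
qed

section \<open>The problem at a fixed scale\<close>

lemma cdot_axis: "cdot v (axis i (of_real c)) = v $ i * of_real c"
proof -
 have "cdot v (axis i (of_real c)) = (\<Sigma> k. if k = i then v $ k * of_real c else 0)"
  unfolding cdot_def by (intro sum.cong) (auto simp: axis_def)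
 then show ?thesis by simp
qed

lemma cdot_self: "cdot v v = of_real (\<Sigma> i. (norm (v $ i))\<^sup>2)"
 by (simp add: cdot_def complex_norm_square del: of_real_power)

lemma sum_if_row:
 fixes X :: "3 => 3 => complex"
 shows "(\<Sigma> p q. if p = i then X p q else 0) = (\<Sigma> q. X i q)"
proof -
 have "(\<Sigma> p q. if p = i then X p q else 0) = (\<Sigma> p. if p = i then \<Sigma> q. X p q else 0)"
  by (intro sum.cong) auto
 then show ?thesis by simp
qed

lemma symmetric_contraction:
 fixes s :: "3 => 3 => complex"
 assumes s: "\<And>p q. s p q = s q p"
 shows "(\<Sigma> p q. s p q * (((if p = i then d q else 0) + (if q = i then d p else 0)) / 2)) = (\<Sigma> q. s i q * d q)"
proof -
 have "(\<Sigma> p q. s p q * (((if p = i then d q else 0) + (if q = i then d p else 0)) / 2))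
  = (\<Sigma> p q. (if p = i then s p q * d q / 2 else 0) + (if q = i then s q p * d p / 2 else 0))"
  using s by (intro sum.cong refl) (auto simp: field_simps)
 also have "\<dots> = (\<Sigma> q. s i q * d q / 2) + (\<Sigma> q p. if q = i then s q p * d p / 2 else 0)"
 proof -
  have "(\<Sigma> p q. if q = i then s q p * d p / 2 else 0) = (\<Sigma> q p. if q = i then s q p * d p / 2 else 0)"
   by (rule sum.swap)
  then show ?thesis by (simp only: sum.distrib) (simp only: sum_if_row)
 qed
 also have "\<dots> = (\<Sigma> q. s i q * d q / 2) + (\<Sigma> q. s i q * d q / 2)" by (simp only: sum_if_row)
 also have "\<dots> = (\<Sigma> q. s i q * d q)" by (simp flip: sum_divide_distrib)
 finally show ?thesis .
qed

lemma set_integral_of_real_nonneg: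
 fixes f :: "'a => complex"
 assumes "\<And>x. \<exists>t\<ge>0. f x = of_real t"
 shows "\<exists>t\<ge>0. (LINT x:A|M. f x) = of_real t"
proof -
 obtain t where t: "\<And>x. t x \<ge> 0" "\<And>x. f x = of_real (t x)" using assms by metis
 have "(LINT x:A|M. f x) = (LINT x|M. complex_of_real (indicator A x * t x))"
  unfolding set_lebesgue_integral_def by (simp add: t(2) scaleR_conv_of_real)
 also have "\<dots> = of_real (LINT x|M. indicator A x * t x)" by (rule integral_complex_of_real)
 finally show ?thesis using t(1) by (intro exI[of _ "LINT x|M. indicator A x * t x"]) auto
qed

text \<open>The squared trace is at most three times the sum of the squared diagonal entries; this
  is where the bound -2/3 on the ratio of the viscosities enters.\<close>

lemma div_strain_nonneg:
 fixes s :: "3 => 3 => complex"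
 assumes "\<mu> > 0" "\<eta> / \<mu> > - 2 / 3"
 shows "\<exists>t\<ge>0. of_real \<eta> * (\<Sigma> i. s i i) * cnj (\<Sigma> i. s i i) + 2 * of_real \<mu> * (\<Sigma> i j. s i j * cnj (s i j)) = of_real t"
proof -
 let ?D = "(norm (\<Sigma> i. s i i))\<^sup>2" and ?Q = "\<Sigma> i j. (norm (s i j))\<^sup>2"
 let ?q = "\<Sigma> i. (norm (s i i))\<^sup>2"
 have "?D \<le> (\<Sigma> i. norm (s i i))\<^sup>2" by (intro power_mono norm_sum) auto
 also have "\<dots> \<le> 3 * ?q" using sum_squared_le_sum_of_squares[of "\<lambda>i. norm (s i i)" "UNIV :: 3 set"] by simp
 finally have D: "?D \<le> 3 * ?q" .
 have q: "?q \<le> ?Q" by (intro sum_mono member_le_sum[of _ UNIV "\<lambda>j. (norm (s _ j))\<^sup>2"]) auto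
 have \<eta>: "3 * \<eta> \<ge> - 2 * \<mu>" using assms by (simp add: field_simps)
 have "0 \<le> \<eta> * ?D + 2 * \<mu> * ?Q"
 proof (cases "\<eta> \<ge> 0")
  case True
  then show ?thesis using assms(1) by (intro add_nonneg_nonneg mult_nonneg_nonneg sum_nonneg) auto
 next
  case False
  have "- (2 * \<mu> * ?Q) \<le> - (2 * \<mu>) * ?q" using q assms(1) by simp
  also have "\<dots> \<le> 3 * \<eta> * ?q" using \<eta> by (intro mult_right_mono sum_nonneg) auto
  also have "\<dots> = \<eta> * (3 * ?q)" by simp
  also have "\<dots> \<le> \<eta> * ?D" using D False by (intro mult_left_mono_neg) auto
  finally show ?thesis by linarith
 qed
 moreover have "of_real \<eta> * (\<Sigma> i. s i i) * cnj (\<Sigma> i. s i i) = of_real (\<eta> * ?D)"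
  by (simp only: of_real_mult complex_norm_square mult.assoc)
 moreover have "(\<Sigma> i j. s i j * cnj (s i j)) = of_real ?Q"
  by (simp only: of_real_sum complex_norm_square)
 ultimately show ?thesis by (intro exI[of _ "\<eta> * ?D + 2 * \<mu> * ?Q"]) simp
qed

text \<open>The square of \<open>lam\<close> may have negative real part. After multiplication by
  the conjugate, all three coefficients have a sign as soon as \<open>Re lam > 0\<close>.\<close>

lemma Re_cnj_mult_quadratic:
 assumes "X = lam\<^sup>2 * of_real P + of_real Q + lam * of_real R"
 shows "Re (cnj lam * X) = Re lam * (norm lam)\<^sup>2 * P + Re lam * Q + (norm lam)\<^sup>2 * R"
 unfolding assms cmod_power2 by (simp add: power2_eq_square algebra_simps)

text \<open>A single fixed scale. Periodicity is forgotten; what is kept are open disjoint phases, a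
  null remainder and an interface of finite surface measure.\<close>

locale two_phase =
 fixes \<Omega> Us Uf S :: "R3 set"
 assumes opens: "open \<Omega>" "open Us" "open Uf" and bounded: "bounded \<Omega>"
  and disj: "Us \<inter> Uf = {}" and sub: "Us \<subseteq> \<Omega>" "Uf \<subseteq> \<Omega>" "S \<subseteq> \<Omega>"
  and cover: "negligible (\<Omega> - (Us \<union> Uf))"
  and S: "S \<in> sets surf" "emeasure surf S < \<infinity>"
begin

text \<open>\<open>eps_solution\<close> hides the jump behind an existential quantifier. It is named
  here so that the energy bound and the tested identity concern the same function
  \<open>J\<close>.\<close>

definition weak_sol where
 "weak_sol a \<mu> \<eta> \<rho>s \<rho>f \<gamma> \<alpha> e (lam :: complex) F u J \<longleftrightarrow>
  u \<in> V_space \<Omega> Us Uf \<and> has_jump Us Uf S u J \<and>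
   (\<forall>w\<in>V_space \<Omega> Us Uf. \<forall>Jw. has_jump Us Uf S w Jw -->
    (LINT x:\<Omega>|\<L>. cdot (F x) (w x)) =
     lam\<^sup>2 * (LINT x:Us|\<L>. of_real \<rho>s * cdot (u x) (w x)) +
     lam\<^sup>2 * (LINT x:Uf|\<L>. of_real \<rho>f * cdot (u x) (w x)) +
     c_form Us Uf a \<gamma> u w +
     lam * of_real (e\<^sup>2) * b_form Us Uf \<eta> \<mu> u w +
     lam * of_real e * (LINT x:S|surf. of_real \<alpha> * cdot (J x) (Jw x)))"

lemma eps_solution_iff: "eps_solution \<Omega> Us Uf S a \<mu> \<eta> \<rho>s \<rho>f \<gamma> \<alpha> e lam F u \<longleftrightarrow> (\<exists>J. weak_sol a \<mu> \<eta> \<rho>s \<rho>f \<gamma> \<alpha> e lam F u J)"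
 unfolding eps_solution_def weak_sol_def by blast

definition field :: "3 => (R3 => real) => (R3 => real) => R3 => C3" where
 "field i Fs Ff x = axis i (of_real (if x \<in> Us then Fs x else Ff x))"

definition comp :: "3 => (R3 => real) => 3 => R3 => complex" where
 "comp i F k x = of_real ((if k = i then 1 else 0) * F x)"

lemma smooth_comp: "smooth F ==> smooth (comp i F k)"
 unfolding comp_def[abs_def] by (rule smooth_of_real[OF smooth_mult[OF smooth_const]])

lemma pd_comp: "smooth F ==> pd j (comp i F k) x = (if k = i then of_real (pd j F x) else 0)"
 unfolding comp_def[abs_def]
 by (subst pd_of_real, rule smooth_mult[OF smooth_const], assumption)
  (use pd_linear[OF bounded_linear_mult_right, of F j "if k = i then 1 else 0" x] in auto)

lemma field_comp: "x \<in> Us ==> field i Fs Ff x $ k = comp i Fs k x" "x \<in> Uf ==> field i Fs Ff x $ k = comp i Ff k x"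
 using disj by (auto simp: field_def comp_def axis_def)

lemma surf_measurable: "continuous_on UNIV (g :: R3 => complex) ==> g \<in> borel_measurable surf"
 using borel_measurable_continuous_onI measurable_cong_sets[OF sets_surf refl] by blast

lemma boundedU: "bounded Us" "bounded Uf" "bounded (Uf \<union> Us)" "bounded S"
 using bounded bounded_subset sub by (auto intro: bounded_subset[OF bounded])

text \<open>Compact support in the open set gives zero traces on its boundary, and smoothness up to
  the interface from each side gives both traces by restriction. The two profiles are independent,
  which is what lets a test field live in one phase alone.\<close>

lemma field_V_space:
 assumes F: "smooth Fs" "smooth Ff" and K: "compact K" "K \<subseteq> \<Omega>" "\<And>x. x \<notin> K ==> Fs x = 0 \<and> Ff x = 0"
 shows "field i Fs Ff \<in> V_space \<Omega> Us Uf" "has_jump Us Uf S (field i Fs Ff) (\<lambda>x. axis i (of_real (Ff x - Fs x)))"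
proof -
 have d: "Uf \<inter> Us = {}" using disj by blast
 have s: "smooth (comp i Fs k)" "smooth (comp i Ff k)" for k using F smooth_comp by blast+
 have fr: "x \<in> frontier \<Omega> ==> x \<notin> K" for x using K(2) opens(1) by (auto simp: frontier_def interior_open)
 have z: "x \<in> frontier \<Omega> ==> 0 = comp i Fs k x" "x \<in> frontier \<Omega> ==> 0 = comp i Ff k x" for x k using fr[of x] K(3)[of x] by (auto simp: comp_def)
 have l0: "L2 surf T (\<lambda>_. 0 :: complex)" for T by (simp add: L2_defs)
 show "field i Fs Ff \<in> V_space \<Omega> Us Uf"
  unfolding V_space_def mem_Collect_eq
 proof (intro allI conjI)
  fix k
  show "H1 (Uf \<union> Us) (\<lambda>x. field i Fs Ff x $ k)"
   by (rule H1_two_phase[OF opens(3,2) d boundedU(3) s(2) s(1)]) (rule field_comp, assumption)+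
  show "has_trace Us (frontier \<Omega> \<inter> closure Us) (\<lambda>x. field i Fs Ff x $ k) (\<lambda>_. 0)"
   by (rule has_trace_smooth[OF opens(2) boundedU(1) s(1)[of k]]) (use field_comp z l0 in auto)
  show "has_trace Uf (frontier \<Omega> \<inter> closure Uf) (\<lambda>x. field i Fs Ff x $ k) (\<lambda>_. 0)"
   by (rule has_trace_smooth[OF opens(3) boundedU(2) s(2)[of k]]) (use field_comp z l0 in auto)
 qed
 have l: "L2 surf S (comp i G k)" if "smooth G" for G k
 proof -
  have c: "continuous_on UNIV (comp i G k)" using smooth_continuous[OF smooth_comp[OF that]] .
  obtain B where "\<forall>x\<in>S. norm (comp i G k x) \<le> B" using continuous_bounded_on[OF c boundedU(4)] by blast
  then show ?thesis by (intro L2_bounded_fun[OF S surf_measurable[OF c]]) blast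
 qed
 show "has_jump Us Uf S (field i Fs Ff) (\<lambda>x. axis i (of_real (Ff x - Fs x)))"
  unfolding has_jump_def
 proof (intro exI conjI allI ballI)
  fix k
  show "has_trace Uf S (\<lambda>x. field i Fs Ff x $ k) (\<lambda>x. (\<chi> k. comp i Ff k x) $ k)"
   by (rule has_trace_smooth[OF opens(3) boundedU(2) s(2)[of k]]) (use field_comp l[OF F(2)] in auto)
  show "has_trace Us S (\<lambda>x. field i Fs Ff x $ k) (\<lambda>x. (\<chi> k. comp i Fs k x) $ k)"
   by (rule has_trace_smooth[OF opens(2) boundedU(1) s(1)[of k]]) (use field_comp l[OF F(1)] in auto)
 next
  fix x
  show "axis i (of_real (Ff x - Fs x)) = (\<chi> k. comp i Ff k x) - (\<chi> k. comp i Fs k x)"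
   by (auto simp: vec_eq_iff comp_def axis_def)
 qed
qed

lemma pdv_field:
 assumes F: "smooth Fs" "smooth Ff"
 shows "AE x\<in>Uf \<union> Us in \<L>. (\<forall>k j. pdv (Uf \<union> Us) (field i Fs Ff) k j x =
  (if k = i then of_real (if x \<in> Us then pd j Fs x else pd j Ff x) else 0))"
proof -
 have d: "Uf \<inter> Us = {}" using disj by blast
 have "AE x\<in>Uf \<union> Us in \<L>. pdv (Uf \<union> Us) (field i Fs Ff) k j x =
  (if k = i then of_real (if x \<in> Us then pd j Fs x else pd j Ff x) else 0)" for k j
 proof -
  have "has_weak_pd (Uf \<union> Us) j (\<lambda>x. field i Fs Ff x $ k) (\<lambda>x. if x \<in> Uf then pd j (comp i Ff k) x else pd j (comp i Fs k) x)"
   by (rule has_weak_pd_two_phase[OF opens(3,2) d smooth_comp[OF F(2)] smooth_comp[OF F(1)]]) (rule field_comp, assumption)+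
  from weak_pd_AE[OF open_Un[OF opens(3,2)] this] show ?thesis
   unfolding pdv_def by eventually_elim (use disj in \<open>auto simp: pd_comp F\<close>)
 qed
 then have "AE x in \<L>. \<forall>k. \<forall>j. x \<in> Uf \<union> Us --> pdv (Uf \<union> Us) (field i Fs Ff) k j x =
  (if k = i then of_real (if x \<in> Us then pd j Fs x else pd j Ff x) else 0)"
  unfolding AE_all_countable by blast
 then show ?thesis by eventually_elim blast
qed

text \<open>With one nonzero component the strain products reduce to gradients: the tensor
  symmetries undo the symmetrisation in the solid, and the symmetric viscous strain contracts to its
  row \<open>i\<close> in the fluid.\<close>

lemma tested_identity:
 assumes sol: "weak_sol a \<mu> \<eta> \<rho>s \<rho>f \<gamma> \<alpha> e lam F u J" and a: "elasticity_tensor a"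
  and sm: "smooth Fs" "smooth Ff" and K: "compact K" "K \<subseteq> \<Omega>" "\<And>x. x \<notin> K ==> Fs x = 0 \<and> Ff x = 0"
 shows "(LINT x:\<Omega>|\<L>. F x $ i * of_real (if x \<in> Us then Fs x else Ff x)) =
  lam\<^sup>2 * (LINT x:Us|\<L>. of_real \<rho>s * (u x $ i * of_real (Fs x))) +
  lam\<^sup>2 * (LINT x:Uf|\<L>. of_real \<rho>f * (u x $ i * of_real (Ff x))) +
  ((LINT x:Us|\<L>. (\<Sigma> j k l. of_real (a i j k l) * pdv (Uf \<union> Us) u k l x * of_real (pd j Fs x))) +
  (LINT x:Uf|\<L>. of_real \<gamma> * dvg (Uf \<union> Us) u x * of_real (pd i Ff x))) +
  lam * of_real (e\<^sup>2) * (LINT x:Uf|\<L>. of_real \<eta> * dvg (Uf \<union> Us) u x * of_real (pd i Ff x) +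
   of_real \<mu> * (\<Sigma> q. (pdv (Uf \<union> Us) u i q x + pdv (Uf \<union> Us) u q i x) * of_real (pd q Ff x))) +
  lam * of_real e * (LINT x:S|surf. of_real \<alpha> * (J x $ i * of_real (Ff x - Fs x)))"
proof -
 let ?w = "field i Fs Ff" and ?U = "Uf \<union> Us"
 note V = field_V_space[OF sm K, of i]
 have ex: "\<And>i j k l. a i j k l = a j i k l \<and> a i j k l = a i j l k" using a unfolding elasticity_tensor_def by blast
 have w1: "x \<in> Us ==> cdot v (?w x) = v $ i * of_real (Fs x)" "x \<in> Uf ==> cdot v (?w x) = v $ i * of_real (Ff x)" for v x
  using disj unfolding field_def by (subst cdot_axis, auto)+
 have m1: "(LINT x:Us|\<L>. of_real \<rho>s * cdot (u x) (?w x)) = (LINT x:Us|\<L>. of_real \<rho>s * (u x $ i * of_real (Fs x)))"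
  by (rule set_integral_AE_eq) (simp add: w1)
 have m2: "(LINT x:Uf|\<L>. of_real \<rho>f * cdot (u x) (?w x)) = (LINT x:Uf|\<L>. of_real \<rho>f * (u x $ i * of_real (Ff x)))"
  by (rule set_integral_AE_eq) (simp add: w1)
 note pw = pdv_field[OF sm, of i]
 have c1: "(LINT x:Us|\<L>. (\<Sigma> i j k l. of_real (a i j k l) *
    strain ?U u k l x * cnj (strain ?U ?w i j x))) =
  (LINT x:Us|\<L>. (\<Sigma> j k l. of_real (a i j k l) * pdv ?U u k l x * of_real (pd j Fs x)))"
 proof (rule set_integral_AE_eq, use pw in eventually_elim, rule impI)
  fix x assume "x \<in> ?U --> (\<forall>k j. pdv ?U ?w k j x = (if k = i then of_real (if x \<in> Us then pd j Fs x else pd j Ff x) else 0))" "x \<in> Us"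
  then have p: "pdv ?U ?w k j x = (if k = i then of_real (pd j Fs x) else 0)" for k j by auto
  have "(\<Sigma> i j k l. of_real (a i j k l) * strain ?U u k l x * cnj (strain ?U ?w i j x))
   = (\<Sigma> i j k l. of_real (a i j k l) * pdv ?U u k l x * cnj (pdv ?U ?w i j x))"
   using tensor_symmetrize[OF ex, where A = "\<lambda>k l. pdv ?U u k l x" and B = "\<lambda>i j. cnj (pdv ?U ?w i j x)"] by (simp add: strain_def)
  also have "\<dots> = (\<Sigma> p j. if p = i then (\<Sigma> k l. of_real (a p j k l) * pdv ?U u k l x * of_real (pd j Fs x)) else 0)"
   by (intro sum.cong refl) (simp add: p)
  finally show "(\<Sigma> i j k l. of_real (a i j k l) * strain ?U u k l x * cnj (strain ?U ?w i j x))
   = (\<Sigma> j k l. of_real (a i j k l) * pdv ?U u k l x * of_real (pd j Fs x))"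
   by (simp only: sum_if_row)
 qed
 have pf: "AE x\<in>Uf in \<L>. (\<forall>k j. pdv ?U ?w k j x = (if k = i then of_real (pd j Ff x) else 0))"
  using pw by eventually_elim (use disj in auto)
 have dv: "AE x\<in>Uf in \<L>. dvg ?U ?w x = of_real (pd i Ff x)"
  using pf by eventually_elim (auto simp: dvg_def)
 have c2: "(LINT x:Uf|\<L>. of_real \<gamma> * dvg ?U u x * cnj (dvg ?U ?w x)) = (LINT x:Uf|\<L>. of_real \<gamma> * dvg ?U u x * of_real (pd i Ff x))"
  by (rule set_integral_AE_eq, use dv in eventually_elim) auto
 have b: "b_form Us Uf \<eta> \<mu> u ?w = (LINT x:Uf|\<L>. of_real \<eta> * dvg ?U u x * of_real (pd i Ff x) +
   of_real \<mu> * (\<Sigma> q. (pdv ?U u i q x + pdv ?U u q i x) * of_real (pd q Ff x)))"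
  unfolding b_form_def
 proof (rule set_integral_AE_eq, use pf dv in eventually_elim, rule impI)
  fix x assume "x \<in> Uf --> (\<forall>k j. pdv ?U ?w k j x = (if k = i then of_real (pd j Ff x) else 0))" "x \<in> Uf --> dvg ?U ?w x = of_real (pd i Ff x)" "x \<in> Uf"
  then have p: "pdv ?U ?w k j x = (if k = i then of_real (pd j Ff x) else 0)" and d: "dvg ?U ?w x = of_real (pd i Ff x)" for k j by auto
  have "(\<Sigma> p q. strain ?U u p q x * cnj (strain ?U ?w p q x))
   = (\<Sigma> p q. strain ?U u p q x * (((if p = i then of_real (pd q Ff x) else 0) + (if q = i then of_real (pd p Ff x) else 0)) / 2))"
   by (intro sum.cong refl) (simp add: strain_def p)
  also have "\<dots> = (\<Sigma> q. strain ?U u i q x * of_real (pd q Ff x))"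
   by (rule symmetric_contraction) (simp add: strain_def add.commute)
  finally have "2 * of_real \<mu> * (\<Sigma> p q. strain ?U u p q x * cnj (strain ?U ?w p q x))
   = 2 * of_real \<mu> * (\<Sigma> q. strain ?U u i q x * of_real (pd q Ff x))" by (simp only:)
  also have "\<dots> = of_real \<mu> * (\<Sigma> q. (pdv ?U u i q x + pdv ?U u q i x) * of_real (pd q Ff x))"
   unfolding sum_distrib_left by (intro sum.cong refl) (simp add: strain_def)
  finally have "2 * of_real \<mu> * (\<Sigma> p q. strain ?U u p q x * cnj (strain ?U ?w p q x))
   = of_real \<mu> * (\<Sigma> q. (pdv ?U u i q x + pdv ?U u q i x) * of_real (pd q Ff x))" .
  then show "of_real \<eta> * dvg ?U u x * cnj (dvg ?U ?w x) + 2 * of_real \<mu> * (\<Sigma> i j. strain ?U u i j x * cnj (strain ?U ?w i j x))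
   = of_real \<eta> * dvg ?U u x * of_real (pd i Ff x) + of_real \<mu> * (\<Sigma> q. (pdv ?U u i q x + pdv ?U u q i x) * of_real (pd q Ff x))"
   by (simp add: d)
 qed
 have "(LINT x:\<Omega>|\<L>. cdot (F x) (?w x)) =
     lam\<^sup>2 * (LINT x:Us|\<L>. of_real \<rho>s * cdot (u x) (?w x)) +
     lam\<^sup>2 * (LINT x:Uf|\<L>. of_real \<rho>f * cdot (u x) (?w x)) +
     c_form Us Uf a \<gamma> u ?w +
     lam * of_real (e\<^sup>2) * b_form Us Uf \<eta> \<mu> u ?w +
     lam * of_real e * (LINT x:S|surf. of_real \<alpha> * cdot (J x) (axis i (of_real (Ff x - Fs x))))"
  using sol V unfolding weak_sol_def by blast
 then show ?thesis
  unfolding m1 m2 c_form_def c1 c2 b unfolding field_def cdot_axis .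
qed

lemma jump_L2:
 assumes "has_jump Us Uf S w J" shows "L2 surf S (\<lambda>x. J x $ i)"
proof -
 obtain gf gs where g: "\<And>i. L2 surf S (\<lambda>x. gf x $ i)" "\<And>i. L2 surf S (\<lambda>x. gs x $ i)" "\<And>x. x \<in> S ==> J x = gf x - gs x"
  using assms unfolding has_jump_def has_trace_def by blast
 have L: "L2 surf S (\<lambda>x. gf x $ i - gs x $ i)" by (rule L2_diff[OF g(1,2)])
 have e: "indicator S x *\<^sub>R (J x $ i) = indicator S x *\<^sub>R (gf x $ i - gs x $ i)"
  "indicator S x *\<^sub>R (norm (J x $ i))\<^sup>2 = indicator S x *\<^sub>R (norm (gf x $ i - gs x $ i))\<^sup>2" for x
  using g(3)[of x] by (cases "x \<in> S"; simp)+
 show ?thesis using L unfolding L2_defs e .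
qed

section \<open>Control of the jump on the interface\<close>

definition energy :: "(R3 => C3) => real" where
 "energy J = (LINT x:S|surf. (\<Sigma> i. (norm (J x $ i))\<^sup>2))"

lemma energy_integrable:
 assumes "has_jump Us Uf S w J" shows "integrable surf (\<lambda>x. indicator S x *\<^sub>R (\<Sigma> i. (norm (J x $ i))\<^sup>2))"
proof -
 have "integrable surf (\<lambda>x. \<Sigma> i. indicator S x *\<^sub>R (norm (J x $ i))\<^sup>2)"
  using jump_L2[OF assms] by (intro Bochner_Integration.integrable_sum) (simp add: L2_def set_integrable_def)
 then show ?thesis by (simp only: scaleR_sum_right)
qed

lemma surface_term:
 assumes J: "has_jump Us Uf S w J" and e: "e > 0" and \<alpha>: "\<alpha> > 0" and G: "\<And>x. x \<in> S ==> \<bar>G x\<bar> \<le> e * M"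
 shows "norm (LINT x:S|surf. of_real \<alpha> * (J x $ i * of_real (G x))) \<le> \<alpha> * (e * energy J + e * M\<^sup>2 * measure surf S)"
proof -
 let ?g = "\<lambda>x. \<alpha> * (e * (indicator S x *\<^sub>R (\<Sigma> i. (norm (J x $ i))\<^sup>2)) + e * M\<^sup>2 * indicator S x)"
 note i1 = energy_integrable[OF J]
 have i2: "integrable surf (indicator S :: R3 => real)" using S by (simp add: integrable_indicator_iff)
 have i: "integrable surf ?g"
  by (intro integrable_mult_right Bochner_Integration.integrable_add i1 i2)
 have "norm (indicator S x *\<^sub>R (of_real \<alpha> * (J x $ i * of_real (G x)))) \<le> ?g x" for x
 proof (cases "x \<in> S")
  case True
  have "norm (J x $ i) * \<bar>G x\<bar> \<le> norm (J x $ i) * (e * M)" by (rule mult_left_mono[OF G[OF True]]) simp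
  also have "\<dots> = e * (norm (J x $ i) * M)" by simp
  also have "\<dots> \<le> e * ((norm (J x $ i))\<^sup>2 + M\<^sup>2)"
   using e mult_le_sum_squares[of "norm (J x $ i)" "\<bar>M\<bar>"] abs_ge_self[of M]
   by (intro mult_left_mono) (auto intro: order_trans[OF mult_left_mono[OF abs_ge_self]])
  also have "\<dots> \<le> e * ((\<Sigma> i. (norm (J x $ i))\<^sup>2) + M\<^sup>2)"
   using e member_le_sum[of i UNIV "\<lambda>i. (norm (J x $ i))\<^sup>2"] by (intro mult_left_mono add_right_mono) auto
  finally have "norm (J x $ i) * \<bar>G x\<bar> \<le> e * (\<Sigma> i. (norm (J x $ i))\<^sup>2) + e * M\<^sup>2" by (simp only: distrib_left)
  from mult_left_mono[OF this, of \<alpha>] \<alpha> show ?thesis using True by (simp add: norm_mult)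
 qed simp
 then have "norm (LINT x:S|surf. of_real \<alpha> * (J x $ i * of_real (G x))) \<le> integral\<^sup>L surf ?g"
  unfolding set_lebesgue_integral_def by (rule norm_integral_le[OF i])
 also have "\<dots> = \<alpha> * (e * energy J + e * M\<^sup>2 * measure surf S)"
 proof -
  have "integral\<^sup>L surf ?g = \<alpha> * (e * integral\<^sup>L surf (\<lambda>x. indicator S x *\<^sub>R (\<Sigma> i. (norm (J x $ i))\<^sup>2)) + e * M\<^sup>2 * integral\<^sup>L surf (indicator S))"
   using i1 i2 by (subst integral_mult_right_zero, subst Bochner_Integration.integral_add) (auto intro!: integrable_mult_right)
  then show ?thesis using S sets.sets_into_space[OF S(1)] by (simp add: energy_def set_lebesgue_integral_def Int_absorb2)
 qed
 finally show ?thesis .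
qed

text \<open>Test with the solution itself and take the real part after multiplying by the conjugate
  of \<open>lam\<close>. The elastic, pressure, viscous and jump terms are nonnegative, and the
  force is absorbed by the inertia. The resulting bound on \<open>e * energy J\<close> does not
  involve \<open>e\<close>.\<close>

lemma energy_estimate:
 assumes sol: "weak_sol a \<mu> \<eta> \<rho>s \<rho>f \<gamma> \<alpha> e lam F u J" and a: "elasticity_tensor a" and e: "e > 0"
  and co: "\<mu> > 0" "\<eta> / \<mu> > - 2 / 3" "\<rho>s > 0" "\<rho>f > 0" "\<gamma> \<ge> 0" "\<alpha> > 0" and lam: "Re lam > 0"
  and F: "\<And>i. L2 \<L> \<Omega> (\<lambda>x. F x $ i)"
 shows "(norm lam)\<^sup>2 * (\<alpha> * (e * energy J)) \<le> norm lam * ((LINT x:\<Omega>|\<L>. (\<Sigma> i. (norm (F x $ i))\<^sup>2)) / (4 * (Re lam * norm lam * min \<rho>s \<rho>f)))"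
proof -
 let ?U = "Uf \<union> Us"
 define \<rho> where "\<rho> = min \<rho>s \<rho>f"
 \<comment> \<open>The weight in Young's inequality for which \<open>norm lam * \<theta>\<close>
   equals \<open>Re lam * (norm lam)\<^sup>2 * \<rho>\<close>, so that the inertia cancels the
   solution exactly.\<close>
 define \<theta> where "\<theta> = Re lam * norm lam * \<rho>"
 have \<rho>: "\<rho> > 0" "\<rho> \<le> \<rho>s" "\<rho> \<le> \<rho>f" using co by (auto simp: \<rho>_def)
 have l0: "norm lam > 0" using lam by auto
 have \<theta>: "\<theta> > 0" unfolding \<theta>_def using \<rho> lam l0 by simp
 define N where "N = (LINT x:\<Omega>|\<L>. (\<Sigma> i. (norm (F x $ i))\<^sup>2))"
 define X where "X = (LINT x:\<Omega>|\<L>. cdot (F x) (u x))"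
 define H where "H = (\<lambda>x. \<Sigma> i. (norm (u x $ i))\<^sup>2)"
 define Gs where "Gs = (LINT x:Us|\<L>. H x)"
 define Gf where "Gf = (LINT x:Uf|\<L>. H x)"
 have V: "u \<in> V_space \<Omega> Us Uf" and J: "has_jump Us Uf S u J" using sol by (auto simp: weak_sol_def)
 have eq: "X = lam\<^sup>2 * (LINT x:Us|\<L>. of_real \<rho>s * cdot (u x) (u x)) +
     lam\<^sup>2 * (LINT x:Uf|\<L>. of_real \<rho>f * cdot (u x) (u x)) +
     c_form Us Uf a \<gamma> u u + lam * of_real (e\<^sup>2) * b_form Us Uf \<eta> \<mu> u u +
     lam * of_real e * (LINT x:S|surf. of_real \<alpha> * cdot (J x) (J x))"
  using sol V J unfolding weak_sol_def X_def by blast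
 have re: "(LINT x:A|M. of_real c * cdot (g x) (g x)) = of_real (c * (LINT x:A|M. (\<Sigma> i. (norm (g x $ i))\<^sup>2)))"
  for A :: "R3 set" and M c and g :: "R3 => C3"
 proof -
  have "(LINT x:A|M. of_real c * cdot (g x) (g x)) = (LINT x|M. complex_of_real (c * (indicator A x *\<^sub>R (\<Sigma> i. (norm (g x $ i))\<^sup>2))))"
   unfolding set_lebesgue_integral_def cdot_self scaleR_conv_of_real of_real_mult by (simp add: mult_ac)
  also have "\<dots> = of_real (LINT x|M. c * (indicator A x *\<^sub>R (\<Sigma> i. (norm (g x $ i))\<^sup>2)))" by (rule integral_complex_of_real)
  finally show ?thesis by (simp only: integral_mult_right_zero set_lebesgue_integral_def)
 qed
 obtain t0 where t0: "t0 > 0" and tn: "\<And>\<xi> :: 3 => 3 => complex. (\<And>i j. \<xi> i j = \<xi> j i) ==> \<exists>t\<ge>t0 * (\<Sigma> i j. (norm (\<xi> i j))\<^sup>2).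
  (\<Sigma> i j k l. of_real (a i j k l) * \<xi> k l * cnj (\<xi> i j)) = of_real t"
  using tensor_nonneg[OF a] by blast
 have "\<exists>t\<ge>0. (LINT x:Us|\<L>. (\<Sigma> i j k l. of_real (a i j k l) *
    strain ?U u k l x * cnj (strain ?U u i j x))) = of_real t"
 proof (rule set_integral_of_real_nonneg)
  fix x
  have "strain ?U u i j x = strain ?U u j i x" for i j by (simp add: strain_def add.commute)
  from tn[of "\<lambda>i j. strain ?U u i j x", OF this] obtain t where t: "t \<ge> t0 * (\<Sigma> i j. (norm (strain ?U u i j x))\<^sup>2)"
   "(\<Sigma> i j k l. of_real (a i j k l) * strain ?U u k l x * cnj (strain ?U u i j x)) = of_real t" by blast
  have "0 \<le> t0 * (\<Sigma> i j. (norm (strain ?U u i j x))\<^sup>2)" using t0 by (intro mult_nonneg_nonneg sum_nonneg) auto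
  then show "\<exists>t\<ge>0. (\<Sigma> i j k l. of_real (a i j k l) * strain ?U u k l x * cnj (strain ?U u i j x)) = of_real t"
   using t by (intro exI[of _ t]) linarith
 qed
 then obtain C1 where C1: "C1 \<ge> 0" "(LINT x:Us|\<L>. (\<Sigma> i j k l. of_real (a i j k l) *
    strain ?U u k l x * cnj (strain ?U u i j x))) = of_real C1" by blast
 have "\<exists>t\<ge>0. (LINT x:Uf|\<L>. of_real \<gamma> * dvg ?U u x * cnj (dvg ?U u x)) = of_real t"
 proof (rule set_integral_of_real_nonneg)
  fix x
  have "of_real \<gamma> * dvg ?U u x * cnj (dvg ?U u x) = of_real (\<gamma> * (norm (dvg ?U u x))\<^sup>2)"
   by (simp only: of_real_mult complex_norm_square mult.assoc)
  then show "\<exists>t\<ge>0. of_real \<gamma> * dvg ?U u x * cnj (dvg ?U u x) = of_real t" using co(5) by (metis mult_nonneg_nonneg zero_le_power2)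
 qed
 then obtain C2 where C2: "C2 \<ge> 0" "(LINT x:Uf|\<L>. of_real \<gamma> * dvg ?U u x * cnj (dvg ?U u x)) = of_real C2" by blast
 have "\<exists>t\<ge>0. b_form Us Uf \<eta> \<mu> u u = of_real t"
  unfolding b_form_def
 proof (rule set_integral_of_real_nonneg)
  fix x
  have "dvg ?U u x = (\<Sigma> i. strain ?U u i i x)" by (simp add: dvg_def strain_def)
  then show "\<exists>t\<ge>0. of_real \<eta> * dvg ?U u x * cnj (dvg ?U u x) + 2 * of_real \<mu> * (\<Sigma> i j. strain ?U u i j x * cnj (strain ?U u i j x)) = of_real t"
   using div_strain_nonneg[OF co(1,2), of "\<lambda>i j. strain ?U u i j x"] by (simp only:)
 qed
 then obtain D where D: "D \<ge> 0" "b_form Us Uf \<eta> \<mu> u u = of_real D" by blast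
 have "X = lam\<^sup>2 * of_real (\<rho>s * Gs + \<rho>f * Gf) + of_real (C1 + C2) + lam * of_real (e\<^sup>2 * D + e * (\<alpha> * energy J))"
  unfolding eq re c_form_def C1 C2 D energy_def Gs_def Gf_def H_def by (simp add: algebra_simps)
 from Re_cnj_mult_quadratic[OF this]
 have R: "Re (cnj lam * X) = Re lam * (norm lam)\<^sup>2 * (\<rho>s * Gs + \<rho>f * Gf) + Re lam * (C1 + C2) + (norm lam)\<^sup>2 * (e\<^sup>2 * D + e * (\<alpha> * energy J))" .
 have G0: "Gs \<ge> 0" "Gf \<ge> 0" unfolding Gs_def Gf_def set_lebesgue_integral_def H_def by (auto intro!: Bochner_Integration.integral_nonneg mult_nonneg_nonneg sum_nonneg)
 have "integrable \<L> (\<lambda>x. \<Sigma> i. indicator ?U x *\<^sub>R (norm (u x $ i))\<^sup>2)"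
  using V by (intro Bochner_Integration.integrable_sum) (auto simp: V_space_def H1_def L2_def set_integrable_def)
 then have Hi: "set_integrable \<L> ?U H" unfolding H_def set_integrable_def by (simp only: scaleR_sum_right)
 have HU: "(LINT x:?U|\<L>. H x) = Gf + Gs"
  unfolding Gs_def Gf_def using disj opens
  by (intro set_integral_Un set_integrable_subset[OF Hi]) auto
 have "integrable \<L> (\<lambda>x. \<Sigma> i. indicator \<Omega> x *\<^sub>R (norm (F x $ i))\<^sup>2)"
  using F by (intro Bochner_Integration.integrable_sum) (auto simp: L2_def set_integrable_def)
 then have Fi: "integrable \<L> (\<lambda>x. indicator \<Omega> x *\<^sub>R (\<Sigma> i. (norm (F x $ i))\<^sup>2))" by (simp only: scaleR_sum_right)
 have ae: "AE x\<in>\<Omega> in \<L>. x \<in> ?U"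
  by (rule AE_I'[of "\<Omega> - (Us \<union> Uf)"]) (use cover in \<open>auto simp: negligible_iff_null_sets\<close>)
 \<comment> \<open>The solution is known to be square integrable on the two phases; what is left of
   \<open>\<Omega>\<close> is a null set.\<close>
 have X2: "X = (LINT x|\<L>. indicator ?U x *\<^sub>R cdot (F x) (u x))"
  unfolding X_def set_lebesgue_integral_def
  by (rule integral_AE, use ae in eventually_elim) (use sub in \<open>auto simp: indicator_def\<close>)
 have XN: "norm X \<le> N / (4 * \<theta>) + \<theta> * (Gs + Gf)"
 proof -
  let ?g = "\<lambda>x. (1 / (4 * \<theta>)) * (indicator \<Omega> x *\<^sub>R (\<Sigma> i. (norm (F x $ i))\<^sup>2)) + \<theta> * (indicator ?U x *\<^sub>R H x)"
  have gi: "integrable \<L> ?g"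
   using Fi Hi unfolding set_integrable_def by (intro Bochner_Integration.integrable_add integrable_mult_right)
  have "norm (indicator ?U x *\<^sub>R cdot (F x) (u x)) \<le> ?g x" for x
  proof (cases "x \<in> ?U")
   case True
   have "norm (cdot (F x) (u x)) \<le> (\<Sigma> i. norm (F x $ i) * norm (u x $ i))"
    unfolding cdot_def by (rule order_trans[OF norm_sum]) (simp add: norm_mult)
   also have "\<dots> \<le> (\<Sigma> i. (1 / (4 * \<theta>)) * (norm (F x $ i))\<^sup>2 + \<theta> * (norm (u x $ i))\<^sup>2)"
   proof (rule sum_mono)
    fix i
    have "0 \<le> (norm (F x $ i) - 2 * \<theta> * norm (u x $ i))\<^sup>2 / (4 * \<theta>)" using \<theta> by simp
    also have "\<dots> = (1 / (4 * \<theta>)) * (norm (F x $ i))\<^sup>2 + \<theta> * (norm (u x $ i))\<^sup>2 - norm (F x $ i) * norm (u x $ i)"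
     using \<theta> by (simp add: power2_eq_square field_simps)
    finally show "norm (F x $ i) * norm (u x $ i) \<le> (1 / (4 * \<theta>)) * (norm (F x $ i))\<^sup>2 + \<theta> * (norm (u x $ i))\<^sup>2" by linarith
   qed
   also have "\<dots> = (1 / (4 * \<theta>)) * (\<Sigma> i. (norm (F x $ i))\<^sup>2) + \<theta> * H x"
    unfolding H_def by (simp only: sum.distrib sum_distrib_left)
   moreover have "x \<in> \<Omega>" using True sub by blast
   ultimately show ?thesis using True by simp
  next
   case False
   then show ?thesis using \<theta> by (simp add: sum_nonneg)
  qed
  then have "norm X \<le> integral\<^sup>L \<L> ?g" unfolding X2 by (rule norm_integral_le[OF gi])
  also have "\<dots> = (1 / (4 * \<theta>)) * N + \<theta> * (Gf + Gs)"
   unfolding HU[symmetric] N_def set_lebesgue_integral_def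
   using Fi Hi unfolding set_integrable_def
   by (subst Bochner_Integration.integral_add) (simp_all only: integral_mult_right_zero integrable_mult_right)
  finally show ?thesis by (simp add: add.commute)
 qed
 have "(norm lam)\<^sup>2 * (\<alpha> * (e * energy J)) \<le> (norm lam)\<^sup>2 * (e\<^sup>2 * D + e * (\<alpha> * energy J))"
  using D(1) e by (intro mult_left_mono) (auto simp: algebra_simps)
 also have "\<dots> \<le> Re (cnj lam * X) - Re lam * (norm lam)\<^sup>2 * (\<rho>s * Gs + \<rho>f * Gf)"
  using R mult_nonneg_nonneg[of "Re lam" "C1 + C2"] lam C1 C2 by linarith
 also have "\<dots> \<le> norm lam * norm X - Re lam * (norm lam)\<^sup>2 * (\<rho> * (Gs + Gf))"
 proof -
  have "Re (cnj lam * X) \<le> norm lam * norm X" using complex_Re_le_cmod[of "cnj lam * X"] by (simp add: norm_mult)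
  moreover have "\<rho> * (Gs + Gf) \<le> \<rho>s * Gs + \<rho>f * Gf"
   using \<rho> G0 by (simp only: distrib_left) (intro add_mono mult_right_mono; simp)
  then have "Re lam * (norm lam)\<^sup>2 * (\<rho> * (Gs + Gf)) \<le> Re lam * (norm lam)\<^sup>2 * (\<rho>s * Gs + \<rho>f * Gf)"
   using lam by (intro mult_left_mono) auto
  ultimately show ?thesis by linarith
 qed
 also have "\<dots> \<le> norm lam * (N / (4 * \<theta>) + \<theta> * (Gs + Gf)) - Re lam * (norm lam)\<^sup>2 * (\<rho> * (Gs + Gf))"
  using mult_left_mono[OF XN, of "norm lam"] by simp
 also have "\<dots> = norm lam * (N / (4 * \<theta>))" unfolding \<theta>_def by (simp add: algebra_simps power2_eq_square)
 finally show ?thesis unfolding N_def \<theta>_def \<rho>_def .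
qed

lemma pdv_integrable:
 assumes "u \<in> V_space \<Omega> Us Uf" shows "set_integrable \<L> (Uf \<union> Us) (pdv (Uf \<union> Us) u k l)"
proof -
 obtain g where g: "has_weak_pd (Uf \<union> Us) l (\<lambda>x. u x $ k) g" "L2 \<L> (Uf \<union> Us) g"
  using assms unfolding V_space_def H1_def by blast
 have o: "open (Uf \<union> Us)" using opens by blast
 have "set_integrable \<L> (Uf \<union> Us) g"
  by (rule L2_integrable[OF g(2) boundedU(3)]) (use o in auto)
 from set_integrable_AE_eq[OF this weak_pd_AE[OF o g(1)]] show ?thesis unfolding pdv_def .
qed

end

section \<open>Passage to the limit\<close>

lemma set_integral_sum':
 fixes f :: "'i => R3 => complex"
 assumes "\<And>i. set_integrable M A (f i)"
 shows "set_integrable M A (\<lambda>x. \<Sum>i\<in>I. f i x)" "(LINT x:A|M. \<Sum>i\<in>I. f i x) = (\<Sum>i\<in>I. LINT x:A|M. f i x)"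
proof -
 have i: "integrable M (\<lambda>x. indicator A x *\<^sub>R f i x)" for i using assms[of i] by (simp add: set_integrable_def)
 show "set_integrable M A (\<lambda>x. \<Sum>i\<in>I. f i x)"
  unfolding set_integrable_def scaleR_sum_right using i by (rule Bochner_Integration.integrable_sum)
 show "(LINT x:A|M. \<Sum>i\<in>I. f i x) = (\<Sum>i\<in>I. LINT x:A|M. f i x)"
  unfolding set_lebesgue_integral_def scaleR_sum_right using i by (rule Bochner_Integration.integral_sum)
qed

lemma periodic_bounded:
 fixes \<theta> :: "R3 => real"
 assumes "continuous_on UNIV \<theta>" "periodic \<theta>" obtains B where "B \<ge> 0" "\<And>y. \<bar>\<theta> y\<bar> \<le> B"
proof -
 obtain B where B: "B \<ge> 0" "\<forall>y\<in>closure cell. norm (\<theta> y) \<le> B"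
  using continuous_bounded_on[OF assms(1), of "closure cell"] bounded_closure[OF bounded_cell] by blast
 have "\<bar>\<theta> y\<bar> \<le> B" for y
 proof -
  have "\<theta> (y + - nearest y) = \<theta> y"
   using assms(2) lattice_minus[OF nearest_lattice[of y]] unfolding periodic_def by blast
  moreover have "y + - nearest y \<in> closure cell" using nearest_closure_cell[of y] by simp
  ultimately show ?thesis using B(2) by (metis real_norm_def)
 qed
 with B(1) show ?thesis by (rule that)
qed

lemma pd_zero: "pd l (\<lambda>x. 0 :: real) x = 0"
 using pd_eq[OF has_derivative_const] by blast

definition osc :: "real => (R3 => real) => (R3 => real) => R3 => real" where
 "osc e \<theta> \<phi> x = e * (\<phi> x * \<theta> ((1 / e) *\<^sub>R x))"

lemma smooth_osc: "smooth \<theta> ==> smooth \<phi> ==> smooth (osc e \<theta> \<phi>)"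
 unfolding osc_def[abs_def]
 using smooth_mult[OF smooth_const smooth_mult[OF _ smooth_affine[of \<theta> "1 / e" 0]], of \<phi> e] by simp

lemma pd_osc:
 assumes s: "smooth \<theta>" "smooth \<phi>" and e: "e > 0"
 shows "pd j (osc e \<theta> \<phi>) x = e * (pd j \<phi> x * \<theta> ((1 / e) *\<^sub>R x)) + \<phi> x * pd j \<theta> ((1 / e) *\<^sub>R x)"
proof -
 have c: "smooth (\<lambda>x. \<theta> ((1 / e) *\<^sub>R x))" using smooth_affine[OF s(1), of "1 / e" 0] by simp
 have "pd j (osc e \<theta> \<phi>) x = e * pd j (\<lambda>x. \<phi> x * \<theta> ((1 / e) *\<^sub>R x)) x"
  unfolding osc_def[abs_def] by (rule pd_linear[OF bounded_linear_mult_right smooth_mult[OF s(2) c]])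
 also have "\<dots> = e * (\<phi> x * ((1 / e) * pd j \<theta> ((1 / e) *\<^sub>R x)) + pd j \<phi> x * \<theta> ((1 / e) *\<^sub>R x))"
  using pd_affine[OF s(1), of j "1 / e" 0 x] by (simp add: pd_mult[OF s(2) c])
 also have "\<dots> = e * (pd j \<phi> x * \<theta> ((1 / e) *\<^sub>R x)) + \<phi> x * pd j \<theta> ((1 / e) *\<^sub>R x)"
  using e by (simp add: distrib_left)
 finally show ?thesis .
qed

context cell_geom begin

lemma phase_iff: "e > 0 ==> x \<in> phase \<Omega> Y e \<longleftrightarrow> x \<in> \<Omega> \<and> (1 / e) *\<^sub>R x \<in> per_ext Y"
 unfolding phase_def by (auto simp: image_iff intro!: bexI[of _ "(1 / e) *\<^sub>R x"])

lemma two_phase_phases: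
 assumes e: "0 < e" "e \<le> 1" and \<Omega>: "open \<Omega>" "bounded \<Omega>"
 shows "two_phase \<Omega> (phase \<Omega> Ys e) (phase \<Omega> Yf e) (interface \<Omega> Gam e)"
proof
 show "open \<Omega>" "bounded \<Omega>" by fact+
 show "open (phase \<Omega> Ys e)" "open (phase \<Omega> Yf e)"
  unfolding phase_def using open_per e(1) \<Omega>(1) by (auto intro!: open_Int open_scaling)
 show "phase \<Omega> Ys e \<inter> phase \<Omega> Yf e = {}" using per_disjoint by (auto simp: phase_iff[OF e(1)])
 show "phase \<Omega> Ys e \<subseteq> \<Omega>" "phase \<Omega> Yf e \<subseteq> \<Omega>" "interface \<Omega> Gam e \<subseteq> \<Omega>" by (auto simp: phase_def interface_def)
 have "\<Omega> - (phase \<Omega> Ys e \<union> phase \<Omega> Yf e) \<subseteq> interface \<Omega> Gam e"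
 proof
  fix x assume "x \<in> \<Omega> - (phase \<Omega> Ys e \<union> phase \<Omega> Yf e)"
  then show "x \<in> interface \<Omega> Gam e"
   using per_cover[of "(1 / e) *\<^sub>R x"] by (auto simp: phase_iff[OF e(1)] interface_def)
 qed
 then show "negligible (\<Omega> - (phase \<Omega> Ys e \<union> phase \<Omega> Yf e))"
  using interface_sets(2)[OF e(1) \<Omega>(1)] negligible_subset by blast
 show "interface \<Omega> Gam e \<in> sets surf" using interface_sets(1)[OF e(1) \<Omega>(1)] by (simp add: sets_surf)
 obtain C where "emeasure surf (interface \<Omega> Gam e) \<le> ennreal (C / e)"
  using surf_interface_bound[OF \<Omega>(2,1)] e by metis
 then show "emeasure surf (interface \<Omega> Gam e) < \<infinity>" by (rule order.strict_trans1) simp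
qed

text \<open>The two-scale limits of the displacement and of its scaled gradient are over all of
  \<open>\<Omega>\<close>. A discontinuous periodic multiplier restricts them to one phase.\<close>

lemma L2p_cutoff:
 fixes \<theta> :: "R3 => real"
 assumes c: "continuous_on UNIV \<theta>" "periodic \<theta>" and Y: "open (per_ext Y)"
 shows "L2p cell (\<lambda>y. if y \<in> per_ext Y then of_real (\<theta> y) else 0)" (is "L2p cell ?f")
  "L2p cell (\<lambda>y. of_real (\<theta> y))"
proof -
 obtain B where B: "\<And>y. \<bar>\<theta> y\<bar> \<le> B" using periodic_bounded[OF c] by blast
 have m: "(\<lambda>y. complex_of_real (\<theta> y)) \<in> borel_measurable \<L>"
  using continuous_lebesgue_measurable[OF continuous_on_of_real[OF c(1)]] .
 have o: "cell \<in> sets \<L>" using open_cell by auto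
 have s: "L2 \<L> cell ?f"
  by (rule L2_bounded_fun[OF o emeasure_bounded_open[OF open_cell bounded_cell], of _ "\<bar>B\<bar>"])
   (use m Y B order_trans[OF B abs_ge_self] in \<open>auto intro!: measurable_If_set\<close>)
 show "L2p cell ?f" using s c(2) by (auto simp: L2p_def periodic_def per_ext_shift)
 have "L2 \<L> cell (\<lambda>y. complex_of_real (\<theta> y))"
  by (rule L2_bounded_fun[OF o emeasure_bounded_open[OF open_cell bounded_cell] m, of B]) (use B in auto)
 then show "L2p cell (\<lambda>y. of_real (\<theta> y))" using c(2) by (auto simp: L2p_def periodic_def)
qed

end

text \<open>The two-scale limits are kept as abstract functionals: \<open>L0\<close> and
  \<open>L1\<close> occur only multiplied by null sequences, and the integral forms of
  \<open>Ls\<close> and \<open>Lp\<close> are inserted in the final proof.\<close>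

locale homogenization = cell_geom +
 fixes \<Omega> :: "R3 set" and a :: "3 => 3 => 3 => 3 => real" and \<mu> \<eta> \<rho>s \<rho>f \<gamma> \<alpha> :: real and lam :: complex
  and F :: "R3 => C3" and eps :: "nat => real" and uh :: "nat => R3 => C3"
  and L0 :: "3 => (R3 => complex) => (R3 => complex) => complex"
  and L1 Ls :: "3 => 3 => (R3 => complex) => (R3 => complex) => complex"
  and Lp :: "(R3 => complex) => (R3 => complex) => complex"
  and Us Uf S :: "nat => R3 set"
 defines Us: "Us \<equiv> \<lambda>n. phase \<Omega> Ys (eps n)" and Uf: "Uf \<equiv> \<lambda>n. phase \<Omega> Yf (eps n)" and S: "S \<equiv> \<lambda>n. interface \<Omega> Gam (eps n)"
 assumes \<Omega>: "open \<Omega>" "bounded \<Omega>" and eps: "\<And>n. eps n > 0" "eps \<longlonglongrightarrow> 0"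
  and tensor: "elasticity_tensor a"
  and coefficients: "\<mu> > 0" "\<eta> / \<mu> > - 2 / 3" "\<rho>s > 0" "\<rho>f > 0" "\<gamma> \<ge> 0" "\<alpha> > 0"
  and lam: "Re lam > 0" and F: "\<And>i. L2 \<L> \<Omega> (\<lambda>x. F x $ i)"
  and solution: "\<And>n. eps_solution \<Omega> (Us n) (Uf n) (S n) a \<mu> \<eta> \<rho>s \<rho>f \<gamma> \<alpha> (eps n) lam F (uh n)"
  and two_scale_u:
   "\<And>\<psi> \<phi> k. L2p cell \<psi> ==> continuous_on (closure \<Omega>) \<phi> ==>
    (\<lambda>n. LINT x:\<Omega>|\<L>. uh n x $ k * \<psi> ((1 / eps n) *\<^sub>R x) * \<phi> x) \<longlonglongrightarrow> L0 k \<psi> \<phi>"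
  and two_scale_grad:
   "\<And>\<psi> \<phi> k l. L2p cell \<psi> ==> continuous_on (closure \<Omega>) \<phi> ==>
    (\<lambda>n. LINT x:\<Omega>|\<L>. of_real (eps n) * pdv (Uf n \<union> Us n) (uh n) k l x
        * \<psi> ((1 / eps n) *\<^sub>R x) * \<phi> x) \<longlonglongrightarrow> L1 k l \<psi> \<phi>"
  and two_scale_solid:
   "\<And>\<psi> \<phi> k l. L2p cell \<psi> ==> continuous_on (closure \<Omega>) \<phi> ==>
    (\<lambda>n. LINT x:Us n|\<L>. pdv (Uf n \<union> Us n) (uh n) k l x
        * \<psi> ((1 / eps n) *\<^sub>R x) * \<phi> x) \<longlonglongrightarrow> Ls k l \<psi> \<phi>"
  and two_scale_pressure:
   "\<And>\<psi> \<phi>. L2p cell \<psi> ==> continuous_on (closure \<Omega>) \<phi> ==>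
    (\<lambda>n. LINT x:Uf n|\<L>. (- of_real \<gamma> * dvg (Uf n \<union> Us n) (uh n) x)
        * \<psi> ((1 / eps n) *\<^sub>R x) * \<phi> x) \<longlonglongrightarrow> Lp \<psi> \<phi>"
begin

lemma eps_le_1: "\<forall>\<^sub>F n in sequentially. eps n \<le> 1"
 using order_tendstoD(2)[OF eps(2) zero_less_one] by eventually_elim simp

lemma two_phase_eps: "eps n \<le> 1 ==> two_phase \<Omega> (Us n) (Uf n) (S n)"
 unfolding Us Uf S by (rule two_phase_phases[OF eps(1) _ \<Omega>])

lemma jumps: "\<exists>J. \<forall>n. eps n \<le> 1 --> two_phase.weak_sol \<Omega> (Us n) (Uf n) (S n) a \<mu> \<eta> \<rho>s \<rho>f \<gamma> \<alpha> (eps n) lam F (uh n) (J n)"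
proof (rule choice, rule allI)
 fix n
 show "\<exists>J. eps n \<le> 1 --> two_phase.weak_sol \<Omega> (Us n) (Uf n) (S n) a \<mu> \<eta> \<rho>s \<rho>f \<gamma> \<alpha> (eps n) lam F (uh n) J"
 proof (cases "eps n \<le> 1")
  case True
  then show ?thesis using solution[of n] unfolding two_phase.eps_solution_iff[OF two_phase_eps[OF True]] by blast
 qed blast
qed

text \<open>One jump is fixed per index. The restriction \<open>eps n \<le> 1\<close> comes from the
  area bound and holds eventually.\<close>

definition J where "J = (SOME J. \<forall>n. eps n \<le> 1 --> two_phase.weak_sol \<Omega> (Us n) (Uf n) (S n) a \<mu> \<eta> \<rho>s \<rho>f \<gamma> \<alpha> (eps n) lam F (uh n) (J n))"

lemma J: "eps n \<le> 1 ==> two_phase.weak_sol \<Omega> (Us n) (Uf n) (S n) a \<mu> \<eta> \<rho>s \<rho>f \<gamma> \<alpha> (eps n) lam F (uh n) (J n)"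
 using someI_ex[OF jumps] unfolding J_def by blast

text \<open>By Young's inequality the surface integral is bounded by \<open>eps n\<close> times the
  jump energy plus \<open>eps n\<close> times the area, both of which stay bounded. The coefficient
  \<open>eps n\<close> in front then gives the limit.\<close>

lemma surface_limit:
 assumes G: "\<And>n x. eps n \<le> 1 ==> \<bar>G n x\<bar> \<le> eps n * M"
 shows "(\<lambda>n. lam * of_real (eps n) * (LINT x:S n|surf. of_real \<alpha> * (J n x $ i * of_real (G n x)))) \<longlonglongrightarrow> 0"
proof -
 have Sn: "S n = interface \<Omega> Gam (eps n)" for n unfolding S ..
 define N where "N = norm lam * ((LINT x:\<Omega>|\<L>. (\<Sigma> i. (norm (F x $ i))\<^sup>2)) / (4 * (Re lam * norm lam * min \<rho>s \<rho>f)))"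
 have l0: "norm lam > 0" using lam by auto
 define C1 where "C1 = N / ((norm lam)\<^sup>2 * \<alpha>)"
 obtain C where C: "\<And>e. 0 < e ==> e \<le> 1 ==> emeasure surf (interface \<Omega> Gam e) \<le> ennreal (C / e)"
  using surf_interface_bound[OF \<Omega>(2,1)] by blast
 define C2 where "C2 = max C 0"
 have "\<forall>\<^sub>F n in sequentially. norm (lam * of_real (eps n) * (LINT x:S n|surf. of_real \<alpha> * (J n x $ i * of_real (G n x)))) \<le> eps n * (norm lam * (\<alpha> * (C1 + M\<^sup>2 * C2)))"
  using eps_le_1
 proof eventually_elim
  case (elim n)
  interpret two_phase \<Omega> "Us n" "Uf n" "S n" by (rule two_phase_eps[OF elim])
  let ?e = "eps n"
  note sol = J[OF elim]
  have hj: "has_jump (Us n) (Uf n) (S n) (uh n) (J n)" using sol by (simp add: weak_sol_def)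
  have "(norm lam)\<^sup>2 * (\<alpha> * (?e * energy (J n))) \<le> N"
   unfolding N_def by (rule energy_estimate[OF sol tensor eps(1) coefficients lam F])
  then have 1: "?e * energy (J n) \<le> C1"
   unfolding C1_def using l0 coefficients(6) by (simp add: field_simps)
  have "emeasure surf (S n) \<le> ennreal (C2 / ?e)"
  proof (rule order_trans)
   show "emeasure surf (S n) \<le> ennreal (C / ?e)" unfolding Sn by (rule C[OF eps(1) elim])
   show "ennreal (C / ?e) \<le> ennreal (C2 / ?e)"
    using eps(1)[of n] unfolding C2_def by (intro ennreal_leI divide_right_mono) auto
  qed
  then have "measure surf (S n) \<le> C2 / ?e"
   unfolding measure_def using eps(1)[of n] by (intro enn2real_leI) (auto simp: C2_def)
  then have 2: "?e * measure surf (S n) \<le> C2" using eps(1)[of n] by (simp add: field_simps)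
  have "norm (LINT x:S n|surf. of_real \<alpha> * (J n x $ i * of_real (G n x))) \<le> \<alpha> * (?e * energy (J n) + ?e * M\<^sup>2 * measure surf (S n))"
   by (rule surface_term[OF hj eps(1) coefficients(6) G[OF elim]])
  also have "\<dots> = \<alpha> * (?e * energy (J n) + M\<^sup>2 * (?e * measure surf (S n)))" by (simp add: mult_ac)
  also have "\<dots> \<le> \<alpha> * (C1 + M\<^sup>2 * C2)"
   using coefficients(6) 1 2 by (intro mult_left_mono add_mono) auto
  finally have "norm lam * ?e * norm (LINT x:S n|surf. of_real \<alpha> * (J n x $ i * of_real (G n x))) \<le> norm lam * ?e * (\<alpha> * (C1 + M\<^sup>2 * C2))"
   using eps(1)[of n] by (intro mult_left_mono) auto
  then show ?case using eps(1)[of n] by (simp add: norm_mult mult_ac)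
 qed
 moreover have "(\<lambda>n. eps n * (norm lam * (\<alpha> * (C1 + M\<^sup>2 * C2)))) \<longlonglongrightarrow> 0" using tendsto_mult_left_zero[OF eps(2)] .
 ultimately show ?thesis by (rule Lim_null_comparison)
qed

lemma force_limit:
 assumes h: "\<And>n x. norm (h n x) \<le> eps n * M"
 shows "(\<lambda>n. LINT x:\<Omega>|\<L>. F x $ i * h n x) \<longlonglongrightarrow> 0"
proof -
 have Fi: "integrable \<L> (\<lambda>x. norm (indicator \<Omega> x *\<^sub>R (F x $ i)))"
  using L2_integrable[OF F \<Omega>(2)] \<Omega>(1) by (intro integrable_norm) (auto simp: set_integrable_def)
 have "norm (LINT x:\<Omega>|\<L>. F x $ i * h n x) \<le> eps n * (M * (LINT x|\<L>. norm (indicator \<Omega> x *\<^sub>R (F x $ i))))" for n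
 proof -
  have "norm (LINT x:\<Omega>|\<L>. F x $ i * h n x) \<le> (LINT x|\<L>. (eps n * M) * norm (indicator \<Omega> x *\<^sub>R (F x $ i)))"
   unfolding set_lebesgue_integral_def
  proof (rule norm_integral_le[OF integrable_mult_right[OF Fi]])
   fix x
   have "norm (h n x) * norm (F x $ i) \<le> (eps n * M) * norm (F x $ i)" by (rule mult_right_mono[OF h]) simp
   then show "norm (indicator \<Omega> x *\<^sub>R (F x $ i * h n x)) \<le> eps n * M * norm (indicator \<Omega> x *\<^sub>R (F x $ i))"
    by (cases "x \<in> \<Omega>") (auto simp: norm_mult mult.commute)
  qed
  then show ?thesis by (simp only: integral_mult_right_zero mult.assoc)
 qed
 then show ?thesis
  by (intro Lim_null_comparison[OF always_eventually[OF allI] tendsto_mult_left_zero[OF eps(2)]])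
qed

text \<open>Separates the slow derivative, which keeps the factor \<open>e\<close>, from the fast
  one, which survives in the limit. Integrability of \<open>g\<close> is required to split the
  integral.\<close>

lemma split_osc:
 fixes g :: "R3 => complex"
 assumes "set_integrable \<L> A g" "bounded A" "smooth \<theta>" "smooth \<phi>" "e > 0"
 shows "set_integrable \<L> A (\<lambda>x. g x * of_real (pd j (osc e \<theta> \<phi>) x))"
  "(LINT x:A|\<L>. g x * of_real (pd j (osc e \<theta> \<phi>) x)) =
   of_real e * (LINT x:A|\<L>. g x * of_real (\<theta> ((1 / e) *\<^sub>R x)) * of_real (pd j \<phi> x)) +
   (LINT x:A|\<L>. g x * of_real (pd j \<theta> ((1 / e) *\<^sub>R x)) * of_real (\<phi> x))"
proof -
 have ci: "set_integrable \<L> A (\<lambda>x. g x * of_real (b x))" if "continuous_on UNIV b" for b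
  by (rule set_integrable_mult_continuous[OF assms(1) continuous_on_of_real[OF that] assms(2)])
 show "set_integrable \<L> A (\<lambda>x. g x * of_real (pd j (osc e \<theta> \<phi>) x))"
  by (intro ci smooth_continuous smooth_pd smooth_osc assms)
 have c2: "continuous_on UNIV (\<lambda>x. f ((1 / e) *\<^sub>R x))" if "smooth f" for f :: "R3 => real"
  using smooth_continuous[OF smooth_affine[OF that, of "1 / e" 0]] by simp
 have i1: "set_integrable \<L> A (\<lambda>x. g x * of_real (\<theta> ((1 / e) *\<^sub>R x) * pd j \<phi> x))"
  by (intro ci continuous_on_mult c2 smooth_continuous smooth_pd assms)
 have i2: "set_integrable \<L> A (\<lambda>x. g x * of_real (pd j \<theta> ((1 / e) *\<^sub>R x) * \<phi> x))"
  by (intro ci continuous_on_mult c2 smooth_continuous smooth_pd assms)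
 have "(LINT x:A|\<L>. g x * of_real (pd j (osc e \<theta> \<phi>) x)) =
  (LINT x:A|\<L>. of_real e * (g x * of_real (\<theta> ((1 / e) *\<^sub>R x) * pd j \<phi> x)) + g x * of_real (pd j \<theta> ((1 / e) *\<^sub>R x) * \<phi> x))"
  by (simp add: pd_osc[OF assms(3-5)] algebra_simps)
 also have "\<dots> = of_real e * (LINT x:A|\<L>. g x * of_real (\<theta> ((1 / e) *\<^sub>R x) * pd j \<phi> x)) + (LINT x:A|\<L>. g x * of_real (pd j \<theta> ((1 / e) *\<^sub>R x) * \<phi> x))"
  using i1 i2 by (subst set_integral_add(2)) auto
 finally show "(LINT x:A|\<L>. g x * of_real (pd j (osc e \<theta> \<phi>) x)) =
   of_real e * (LINT x:A|\<L>. g x * of_real (\<theta> ((1 / e) *\<^sub>R x)) * of_real (pd j \<phi> x)) +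
   (LINT x:A|\<L>. g x * of_real (pd j \<theta> ((1 / e) *\<^sub>R x)) * of_real (\<phi> x))"
  by (simp only: of_real_mult mult.assoc)
qed

lemma phase_integral:
 "(LINT x:phase \<Omega> Y (eps n)|\<L>. g x * of_real (\<theta> ((1 / eps n) *\<^sub>R x)) * of_real (\<phi> x)) =
 (LINT x:\<Omega>|\<L>. g x * (if (1 / eps n) *\<^sub>R x \<in> per_ext Y then of_real (\<theta> ((1 / eps n) *\<^sub>R x)) else 0) * of_real (\<phi> x :: real))" for g :: "R3 => complex"
 unfolding set_lebesgue_integral_def
 by (rule Bochner_Integration.integral_cong[OF refl]) (auto simp: phase_iff[OF eps(1)] indicator_def)

context
 fixes \<theta> \<phi> :: "R3 => real" and K :: "R3 set"
 assumes sm: "smooth \<theta>" "smooth \<phi>" and per: "periodic \<theta>"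
  and K: "compact K" "K \<subseteq> \<Omega>" "\<And>x. x \<notin> K ==> \<phi> x = 0"
begin

lemma osc_bounded: "\<exists>M. \<forall>e>0. \<forall>x. \<bar>osc e \<theta> \<phi> x\<bar> \<le> e * M"
proof -
 obtain B where B: "B \<ge> 0" "\<And>y. \<bar>\<theta> y\<bar> \<le> B" using periodic_bounded[OF smooth_continuous[OF sm(1)] per] by blast
 obtain B' where B': "B' \<ge> 0" "\<forall>x\<in>K. norm (\<phi> x) \<le> B'"
  using continuous_bounded_on[OF smooth_continuous[OF sm(2)] compact_imp_bounded[OF K(1)]] by blast
 have "\<bar>osc e \<theta> \<phi> x\<bar> \<le> e * (B' * B)" if "e > 0" for e x
 proof -
  have "\<bar>\<phi> x\<bar> \<le> B'" using B' K(3)[of x] by (cases "x \<in> K") auto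
  then have "\<bar>\<phi> x\<bar> * \<bar>\<theta> ((1 / e) *\<^sub>R x)\<bar> \<le> B' * B" using B by (intro mult_mono) auto
  then show ?thesis using that by (simp add: osc_def abs_mult)
 qed
 then show ?thesis by blast
qed

lemma osc_support: "x \<notin> K ==> osc e \<theta> \<phi> x = 0" by (simp add: osc_def K)

lemma chi_L2p:
 assumes "open (per_ext Y)"
 shows "L2p cell (\<lambda>y. if y \<in> per_ext Y then of_real (\<theta> y) else 0)" "L2p cell (\<lambda>y. if y \<in> per_ext Y then of_real (pd j \<theta> y) else 0)"
  "L2p cell (\<lambda>y. of_real (\<theta> y))" "L2p cell (\<lambda>y. of_real (pd j \<theta> y))"
 using L2p_cutoff[OF smooth_continuous[OF sm(1)] per assms]
  L2p_cutoff[OF smooth_continuous[OF smooth_pd[OF sm(1)]] periodic_pd[OF sm(1) per] assms] by blast+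

lemma phi_cont: "continuous_on (closure \<Omega>) (\<lambda>x. complex_of_real (\<phi> x))" "continuous_on (closure \<Omega>) (\<lambda>x. complex_of_real (pd j \<phi> x))"
 using smooth_continuous[OF sm(2)] smooth_continuous[OF smooth_pd[OF sm(2)]]
 by (auto intro!: continuous_on_of_real intro: continuous_on_subset)

lemma eps_tendsto_complex: "(\<lambda>n. complex_of_real (eps n)) \<longlonglongrightarrow> 0"
 using tendsto_of_real[OF eps(2), where 'a = complex] by simp

lemma inertia_limit:
 assumes "open (per_ext Y)"
 shows "(\<lambda>n. lam\<^sup>2 * (LINT x:phase \<Omega> Y (eps n)|\<L>. of_real c * (uh n x $ i * of_real (osc (eps n) \<theta> \<phi> x)))) \<longlonglongrightarrow> 0"
proof -
 let ?I = "\<lambda>n. LINT x:\<Omega>|\<L>. uh n x $ i * (if (1 / eps n) *\<^sub>R x \<in> per_ext Y then of_real (\<theta> ((1 / eps n) *\<^sub>R x)) else 0) * of_real (\<phi> x)"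
 have "lam\<^sup>2 * (LINT x:phase \<Omega> Y (eps n)|\<L>. of_real c * (uh n x $ i * of_real (osc (eps n) \<theta> \<phi> x))) = of_real (eps n) * (lam\<^sup>2 * of_real c * ?I n)" for n
 proof -
  have "of_real c * (uh n x $ i * of_real (osc (eps n) \<theta> \<phi> x)) = (of_real c * of_real (eps n)) * (uh n x $ i * of_real (\<theta> ((1 / eps n) *\<^sub>R x)) * of_real (\<phi> x))" for x
   by (simp add: osc_def mult_ac)
  then have "(LINT x:phase \<Omega> Y (eps n)|\<L>. of_real c * (uh n x $ i * of_real (osc (eps n) \<theta> \<phi> x))) = (of_real c * of_real (eps n)) * ?I n"
   using phase_integral[of Y n "\<lambda>x. uh n x $ i" \<theta> \<phi>] by (simp only: set_integral_mult_right)
  then show ?thesis by (simp only: mult_ac)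
 qed
 moreover have "(\<lambda>n. of_real (eps n) * (lam\<^sup>2 * of_real c * ?I n)) \<longlonglongrightarrow> 0 * (lam\<^sup>2 * of_real c * L0 i (\<lambda>y. if y \<in> per_ext Y then of_real (\<theta> y) else 0) (\<lambda>x. of_real (\<phi> x)))"
  by (intro tendsto_mult eps_tendsto_complex tendsto_const two_scale_u chi_L2p(1)[OF assms] phi_cont)
 ultimately show ?thesis by (simp only: mult_zero_left)
qed

text \<open>The test field has profile \<open>osc\<close> in component \<open>i\<close> of the solid
  and 0 in the fluid, so all fluid terms drop out exactly. The same sequence of elastic integrals
  tends to the two-scale expression and, by the tested identity, to 0.\<close>

lemma solid_limit: "(\<Sigma> j k l. of_real (a i j k l) * Ls k l (\<lambda>y. of_real (pd j \<theta> y)) (\<lambda>x. of_real (\<phi> x))) = 0"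
proof -
 let ?T = "\<lambda>n j k l. LINT x:Us n|\<L>. pdv (Uf n \<union> Us n) (uh n) k l x * of_real (pd j (osc (eps n) \<theta> \<phi>) x)"
 have T: "(\<lambda>n. ?T n j k l) \<longlonglongrightarrow> Ls k l (\<lambda>y. of_real (pd j \<theta> y)) (\<lambda>x. of_real (\<phi> x))" for j k l
 proof -
  have "(\<lambda>n. of_real (eps n) * (LINT x:Us n|\<L>. pdv (Uf n \<union> Us n) (uh n) k l x * of_real (\<theta> ((1 / eps n) *\<^sub>R x)) * of_real (pd j \<phi> x)) +
    (LINT x:Us n|\<L>. pdv (Uf n \<union> Us n) (uh n) k l x * of_real (pd j \<theta> ((1 / eps n) *\<^sub>R x)) * of_real (\<phi> x)))
   \<longlonglongrightarrow> 0 * Ls k l (\<lambda>y. of_real (\<theta> y)) (\<lambda>x. of_real (pd j \<phi> x)) + Ls k l (\<lambda>y. of_real (pd j \<theta> y)) (\<lambda>x. of_real (\<phi> x))"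
   by (intro tendsto_add tendsto_mult eps_tendsto_complex two_scale_solid chi_L2p[OF open_per(1)] phi_cont)
  moreover have "\<forall>\<^sub>F n in sequentially. of_real (eps n) * (LINT x:Us n|\<L>. pdv (Uf n \<union> Us n) (uh n) k l x * of_real (\<theta> ((1 / eps n) *\<^sub>R x)) * of_real (pd j \<phi> x)) +
    (LINT x:Us n|\<L>. pdv (Uf n \<union> Us n) (uh n) k l x * of_real (pd j \<theta> ((1 / eps n) *\<^sub>R x)) * of_real (\<phi> x)) = ?T n j k l"
   using eps_le_1
  proof eventually_elim
   case (elim n)
   interpret two_phase \<Omega> "Us n" "Uf n" "S n" by (rule two_phase_eps[OF elim])
   have V: "uh n \<in> V_space \<Omega> (Us n) (Uf n)" using J[OF elim] by (simp add: weak_sol_def)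
   have "set_integrable \<L> (Us n) (pdv (Uf n \<union> Us n) (uh n) k l)"
    by (rule set_integrable_subset[OF pdv_integrable[OF V]]) (use opens in auto)
   from split_osc(2)[OF this boundedU(1) sm eps(1)] show ?case by (rule sym)
  qed
  ultimately show ?thesis by (simp add: Lim_transform_eventually)
 qed
 have "(\<lambda>n. \<Sigma> j k l. of_real (a i j k l) * ?T n j k l)
  \<longlonglongrightarrow> (\<Sigma> j k l. of_real (a i j k l) * Ls k l (\<lambda>y. of_real (pd j \<theta> y)) (\<lambda>x. of_real (\<phi> x)))"
  by (intro tendsto_sum tendsto_mult tendsto_const T)
 moreover have "(\<lambda>n. \<Sigma> j k l. of_real (a i j k l) * ?T n j k l) \<longlonglongrightarrow> 0"
 proof -
  obtain M where M: "\<And>e x. e > 0 ==> \<bar>osc e \<theta> \<phi> x\<bar> \<le> e * M" using osc_bounded by blast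
  have M0: "0 \<le> eps n * M" for n using M[OF eps(1)[of n], of 0] by linarith
  let ?f = "\<lambda>n. LINT x:\<Omega>|\<L>. F x $ i * of_real (if x \<in> Us n then osc (eps n) \<theta> \<phi> x else 0)"
  let ?u = "\<lambda>n. lam\<^sup>2 * (LINT x:Us n|\<L>. of_real \<rho>s * (uh n x $ i * of_real (osc (eps n) \<theta> \<phi> x)))"
  let ?s = "\<lambda>n. lam * of_real (eps n) * (LINT x:S n|surf. of_real \<alpha> * (J n x $ i * of_real (0 - osc (eps n) \<theta> \<phi> x)))"
  have "?f \<longlonglongrightarrow> 0" by (rule force_limit[of _ M]) (use M[OF eps(1)] M0 in auto)
  moreover have "?u \<longlonglongrightarrow> 0" unfolding Us by (rule inertia_limit[OF open_per(1)])
  moreover have "?s \<longlonglongrightarrow> 0" by (rule surface_limit[of _ M]) (use M[OF eps(1)] in auto)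
  ultimately have "(\<lambda>n. ?f n - ?u n - ?s n) \<longlonglongrightarrow> 0 - 0 - 0" by (intro tendsto_diff)
  moreover have "\<forall>\<^sub>F n in sequentially. ?f n - ?u n - ?s n = (\<Sigma> j k l. of_real (a i j k l) * ?T n j k l)"
   using eps_le_1
  proof eventually_elim
   case (elim n)
   interpret two_phase \<Omega> "Us n" "Uf n" "S n" by (rule two_phase_eps[OF elim])
   note sol = J[OF elim]
   let ?o = "osc (eps n) \<theta> \<phi>"
   have V: "uh n \<in> V_space \<Omega> (Us n) (Uf n)" using sol by (simp add: weak_sol_def)
   have "set_integrable \<L> (Us n) (pdv (Uf n \<union> Us n) (uh n) k l)" for k l
    by (rule set_integrable_subset[OF pdv_integrable[OF V]]) (use opens in auto)
   from split_osc(1)[OF this boundedU(1) sm eps(1)]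
   have i: "set_integrable \<L> (Us n) (\<lambda>x. of_real (a i j k l) * pdv (Uf n \<union> Us n) (uh n) k l x * of_real (pd j ?o x))" for j k l
    unfolding mult.assoc by (intro set_integrable_mult_right)
   have "(LINT x:Us n|\<L>. (\<Sigma> j k l. of_real (a i j k l) * pdv (Uf n \<union> Us n) (uh n) k l x * of_real (pd j ?o x)))
    = (\<Sigma> j k l. LINT x:Us n|\<L>. of_real (a i j k l) * pdv (Uf n \<union> Us n) (uh n) k l x * of_real (pd j ?o x))"
    by (simp only: set_integral_sum'(2)[OF set_integral_sum'(1)[OF set_integral_sum'(1)[OF i]]] set_integral_sum'(2)[OF set_integral_sum'(1)[OF i]] set_integral_sum'(2)[OF i])
   also have "\<dots> = (\<Sigma> j k l. of_real (a i j k l) * ?T n j k l)"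
    by (simp only: mult.assoc set_integral_mult_right)
   finally have a: "(LINT x:Us n|\<L>. (\<Sigma> j k l. of_real (a i j k l) * pdv (Uf n \<union> Us n) (uh n) k l x * of_real (pd j ?o x)))
    = (\<Sigma> j k l. of_real (a i j k l) * ?T n j k l)" .
   have 0: "(LINT x:Uf n|\<L>. of_real \<rho>f * (uh n x $ i * of_real 0)) = 0"
    "(LINT x:Uf n|\<L>. of_real \<gamma> * dvg (Uf n \<union> Us n) (uh n) x * of_real (pd i (\<lambda>x. 0) x)) = 0"
    "(LINT x:Uf n|\<L>. of_real \<eta> * dvg (Uf n \<union> Us n) (uh n) x * of_real (pd i (\<lambda>x. 0) x) +
     of_real \<mu> * (\<Sigma> q. (pdv (Uf n \<union> Us n) (uh n) i q x + pdv (Uf n \<union> Us n) (uh n) q i x) * of_real (pd q (\<lambda>x. 0) x))) = 0"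
    by (simp_all add: pd_zero)
   have k: "\<And>x. x \<notin> K ==> ?o x = 0 \<and> (0::real) = 0" using osc_support by blast
   have "?f n = ?u n + lam\<^sup>2 * 0 + ((\<Sigma> j k l. of_real (a i j k l) * ?T n j k l) + 0) + lam * of_real ((eps n)\<^sup>2) * 0 + ?s n"
    using tested_identity[OF sol tensor smooth_osc[OF sm] smooth_const[of 0] K(1,2) k, of i]
    unfolding 0 a .
   then show ?case by simp
  qed
  ultimately show ?thesis by (simp add: Lim_transform_eventually)
 qed
 ultimately show ?thesis by (rule LIMSEQ_unique)
qed

text \<open>Now the profile is \<open>osc\<close> in the fluid and 0 in the solid. Besides force,
  inertia and surface term there is the viscous term; it vanishes because one factor
  \<open>eps n\<close> is spent on the gradient of the solution and one remains.\<close>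

lemma fluid_limit: "Lp (\<lambda>y. of_real (pd i \<theta> y)) (\<lambda>x. of_real (\<phi> x)) = 0"
proof -
 let ?D = "\<lambda>n p q. pdv (Uf n \<union> Us n) (uh n) p q"
 let ?T = "\<lambda>n p q r. LINT x:Uf n|\<L>. ?D n p q x * of_real (pd r (osc (eps n) \<theta> \<phi>) x)"
 let ?P = "\<lambda>n. LINT x:Uf n|\<L>. (- of_real \<gamma> * dvg (Uf n \<union> Us n) (uh n) x) * of_real (pd i (osc (eps n) \<theta> \<phi>) x)"
 have Di: "set_integrable \<L> (Uf n) (?D n p q)" if "eps n \<le> 1" for n p q
 proof -
  interpret two_phase \<Omega> "Us n" "Uf n" "S n" by (rule two_phase_eps[OF that])
  have V: "uh n \<in> V_space \<Omega> (Us n) (Uf n)" using J[OF that] by (simp add: weak_sol_def)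
  show ?thesis by (rule set_integrable_subset[OF pdv_integrable[OF V]]) (use opens in auto)
 qed
 have bd: "bounded (Uf n)" for n unfolding Uf phase_def using \<Omega>(2) by (rule bounded_subset) blast
 have dvi: "set_integrable \<L> (Uf n) (\<lambda>x. - of_real \<gamma> * dvg (Uf n \<union> Us n) (uh n) x)" if "eps n \<le> 1" for n
  unfolding dvg_def by (intro set_integrable_mult_right set_integral_sum'(1) Di that)
 have P: "?P \<longlonglongrightarrow> Lp (\<lambda>y. of_real (pd i \<theta> y)) (\<lambda>x. of_real (\<phi> x))"
 proof -
  let ?p = "\<lambda>n x. - of_real \<gamma> * dvg (Uf n \<union> Us n) (uh n) x"
  have "(\<lambda>n. of_real (eps n) * (LINT x:Uf n|\<L>. ?p n x * of_real (\<theta> ((1 / eps n) *\<^sub>R x)) * of_real (pd i \<phi> x)) +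
    (LINT x:Uf n|\<L>. ?p n x * of_real (pd i \<theta> ((1 / eps n) *\<^sub>R x)) * of_real (\<phi> x)))
   \<longlonglongrightarrow> 0 * Lp (\<lambda>y. of_real (\<theta> y)) (\<lambda>x. of_real (pd i \<phi> x)) + Lp (\<lambda>y. of_real (pd i \<theta> y)) (\<lambda>x. of_real (\<phi> x))"
   by (intro tendsto_add tendsto_mult eps_tendsto_complex two_scale_pressure chi_L2p[OF open_per(1)] phi_cont)
  moreover have "\<forall>\<^sub>F n in sequentially. of_real (eps n) * (LINT x:Uf n|\<L>. ?p n x * of_real (\<theta> ((1 / eps n) *\<^sub>R x)) * of_real (pd i \<phi> x)) +
    (LINT x:Uf n|\<L>. ?p n x * of_real (pd i \<theta> ((1 / eps n) *\<^sub>R x)) * of_real (\<phi> x)) = ?P n"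
   using eps_le_1 by eventually_elim (rule split_osc(2)[OF dvi bd sm eps(1), symmetric])
  ultimately show ?thesis by (simp add: Lim_transform_eventually)
 qed
 have T: "(\<lambda>n. of_real ((eps n)\<^sup>2) * ?T n p q r) \<longlonglongrightarrow> 0" for p q r
 proof -
  let ?c = "\<lambda>f y. if y \<in> per_ext Yf then complex_of_real (f y) else 0"
  let ?A = "\<lambda>n. LINT x:\<Omega>|\<L>. of_real (eps n) * ?D n p q x * ?c \<theta> ((1 / eps n) *\<^sub>R x) * of_real (pd r \<phi> x)"
  let ?B = "\<lambda>n. LINT x:\<Omega>|\<L>. of_real (eps n) * ?D n p q x * ?c (pd r \<theta>) ((1 / eps n) *\<^sub>R x) * of_real (\<phi> x)"
  have "(\<lambda>n. of_real (eps n) * (of_real (eps n) * ?A n + ?B n)) \<longlonglongrightarrow> 0 * (0 * L1 p q (?c \<theta>) (\<lambda>x. of_real (pd r \<phi> x)) + L1 p q (?c (pd r \<theta>)) (\<lambda>x. of_real (\<phi> x)))"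
   by (intro tendsto_add tendsto_mult eps_tendsto_complex two_scale_grad chi_L2p[OF open_per(2)] phi_cont)
  moreover have "\<forall>\<^sub>F n in sequentially. of_real (eps n) * (of_real (eps n) * ?A n + ?B n) = of_real ((eps n)\<^sup>2) * ?T n p q r"
   using eps_le_1
  proof eventually_elim
   case (elim n)
   have A: "?A n = of_real (eps n) * (LINT x:Uf n|\<L>. ?D n p q x * of_real (\<theta> ((1 / eps n) *\<^sub>R x)) * of_real (pd r \<phi> x))"
    using phase_integral[of Yf n "?D n p q" \<theta> "pd r \<phi>"] by (simp only: mult.assoc set_integral_mult_right Uf)
   have B: "?B n = of_real (eps n) * (LINT x:Uf n|\<L>. ?D n p q x * of_real (pd r \<theta> ((1 / eps n) *\<^sub>R x)) * of_real (\<phi> x))"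
    using phase_integral[of Yf n "?D n p q" "pd r \<theta>" \<phi>] by (simp only: mult.assoc set_integral_mult_right Uf)
   show ?case
    unfolding A B split_osc(2)[OF Di[OF elim] bd sm eps(1)] by (simp add: power2_eq_square algebra_simps)
  qed
  ultimately show ?thesis by (simp add: Lim_transform_eventually)
 qed
 have "?P \<longlonglongrightarrow> 0"
 proof -
  obtain M where M: "\<And>e x. e > 0 ==> \<bar>osc e \<theta> \<phi> x\<bar> \<le> e * M" using osc_bounded by blast
  have M0: "0 \<le> eps n * M" for n using M[OF eps(1)[of n], of 0] by linarith
  let ?f = "\<lambda>n. LINT x:\<Omega>|\<L>. F x $ i * of_real (if x \<in> Us n then 0 else osc (eps n) \<theta> \<phi> x)"
  let ?u = "\<lambda>n. lam\<^sup>2 * (LINT x:Uf n|\<L>. of_real \<rho>f * (uh n x $ i * of_real (osc (eps n) \<theta> \<phi> x)))"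
  let ?s = "\<lambda>n. lam * of_real (eps n) * (LINT x:S n|surf. of_real \<alpha> * (J n x $ i * of_real (osc (eps n) \<theta> \<phi> x - 0)))"
  let ?b = "\<lambda>n. of_real \<eta> * (\<Sigma> p. of_real ((eps n)\<^sup>2) * ?T n p p i) + of_real \<mu> * (\<Sigma> q. of_real ((eps n)\<^sup>2) * ?T n i q q + of_real ((eps n)\<^sup>2) * ?T n q i q)"
  have 1: "?f \<longlonglongrightarrow> 0" by (rule force_limit[of _ M]) (use M[OF eps(1)] M0 in auto)
  have 2: "?u \<longlonglongrightarrow> 0" unfolding Uf by (rule inertia_limit[OF open_per(2)])
  have 3: "?s \<longlonglongrightarrow> 0" by (rule surface_limit[of _ M]) (use M[OF eps(1)] in auto)
  have 4: "?b \<longlonglongrightarrow> of_real \<eta> * (\<Sum>p\<in>(UNIV::3 set). 0) + of_real \<mu> * (\<Sum>q\<in>(UNIV::3 set). 0 + 0)"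
   by (intro tendsto_add tendsto_mult tendsto_const tendsto_sum T)
  have "(\<lambda>n. ?u n + lam * ?b n + ?s n - ?f n) \<longlonglongrightarrow> 0 + lam * (of_real \<eta> * (\<Sum>p\<in>(UNIV::3 set). 0) + of_real \<mu> * (\<Sum>q\<in>(UNIV::3 set). 0 + 0)) + 0 - 0"
   by (rule tendsto_diff[OF tendsto_add[OF tendsto_add[OF 2 tendsto_mult[OF tendsto_const 4]] 3] 1])
  moreover have "\<forall>\<^sub>F n in sequentially. ?u n + lam * ?b n + ?s n - ?f n = ?P n"
   using eps_le_1
  proof eventually_elim
   case (elim n)
   interpret two_phase \<Omega> "Us n" "Uf n" "S n" by (rule two_phase_eps[OF elim])
   note sol = J[OF elim]
   let ?o = "osc (eps n) \<theta> \<phi>"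
   have i: "set_integrable \<L> (Uf n) (\<lambda>x. ?D n p q x * of_real (pd r ?o x))" for p q r
    by (rule split_osc(1)[OF Di[OF elim] bd sm eps(1)])
   have "(LINT x:Uf n|\<L>. of_real \<eta> * dvg (Uf n \<union> Us n) (uh n) x * of_real (pd i ?o x) +
     of_real \<mu> * (\<Sigma> q. (?D n i q x + ?D n q i x) * of_real (pd q ?o x)))
    = (LINT x:Uf n|\<L>. of_real \<eta> * (\<Sigma> p. ?D n p p x * of_real (pd i ?o x)) +
     of_real \<mu> * (\<Sigma> q. ?D n i q x * of_real (pd q ?o x) + ?D n q i x * of_real (pd q ?o x)))"
    by (simp only: dvg_def sum_distrib_right mult.assoc distrib_right)
   also have "\<dots> = of_real \<eta> * (\<Sigma> p. ?T n p p i) + of_real \<mu> * (\<Sigma> q. ?T n i q q + ?T n q i q)"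
    by (subst set_integral_add(2), (intro set_integrable_mult_right set_integral_sum'(1) set_integral_add(1) i)+)
     (simp only: set_integral_mult_right set_integral_sum'(2)[OF i] set_integral_sum'(2)[OF set_integral_add(1)[OF i i]] set_integral_add(2)[OF i i])
   finally have b: "of_real ((eps n)\<^sup>2) * (LINT x:Uf n|\<L>. of_real \<eta> * dvg (Uf n \<union> Us n) (uh n) x * of_real (pd i ?o x) +
     of_real \<mu> * (\<Sigma> q. (?D n i q x + ?D n q i x) * of_real (pd q ?o x))) = ?b n"
    by (simp only: sum_distrib_left distrib_left mult.left_commute)
   have p: "(LINT x:Uf n|\<L>. of_real \<gamma> * dvg (Uf n \<union> Us n) (uh n) x * of_real (pd i ?o x)) = - ?P n"
    unfolding mult_minus_left set_lebesgue_integral_def scaleR_minus_right Bochner_Integration.integral_minus by simp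
   have 0: "(LINT x:Us n|\<L>. of_real \<rho>s * (uh n x $ i * of_real 0)) = 0"
    "(LINT x:Us n|\<L>. (\<Sigma> j k l. of_real (a i j k l) * ?D n k l x * of_real (pd j (\<lambda>x. 0) x))) = 0"
    by (simp_all add: pd_zero)
   have k: "\<And>x. x \<notin> K ==> (0::real) = 0 \<and> ?o x = 0" using osc_support by blast
   have "?f n = lam\<^sup>2 * 0 + ?u n + (0 + - ?P n) + lam * of_real ((eps n)\<^sup>2) * (LINT x:Uf n|\<L>. of_real \<eta> * dvg (Uf n \<union> Us n) (uh n) x * of_real (pd i ?o x) +
     of_real \<mu> * (\<Sigma> q. (?D n i q x + ?D n q i x) * of_real (pd q ?o x))) + ?s n"
    using tested_identity[OF sol tensor smooth_const[of 0] smooth_osc[OF sm] K(1,2) k, of i]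
    unfolding 0 p .
   then have "?f n = ?u n - ?P n + lam * ?b n + ?s n" unfolding b[symmetric] by (simp add: mult.assoc)
   then show ?case by simp
  qed
  ultimately show ?thesis by (simp add: Lim_transform_eventually)
 qed
 from LIMSEQ_unique[OF P this] show ?thesis .
qed

end

end

section \<open>The local problem\<close>

lemma L2_times_bounded:
 fixes f b :: "'a => complex"
 assumes "L2 M S f" "S \<in> sets M" "emeasure M S < \<infinity>" "b \<in> borel_measurable M" "\<And>x. x \<in> S ==> norm (b x) \<le> B"
 shows "set_integrable M S (\<lambda>x. f x * b x)"
 by (rule L2_product[OF assms(1) L2_bounded_fun[OF assms(2-5)]])

lemma slices:
 fixes G :: "R3 => R3 => complex" and \<theta> :: "R3 => real"
 assumes \<Omega>: "open \<Omega>" "bounded \<Omega>" and Y: "open Y" "bounded Y"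
  and G: "L2 \<L> (\<Omega> \<times> Y) (\<lambda>(x, y). G x y)" and c: "continuous_on UNIV \<theta>"
 shows "AE x\<in>\<Omega> in \<L>. set_integrable \<L> Y (\<lambda>y. G x y * of_real (\<theta> y))"
  "set_integrable \<L> \<Omega> (\<lambda>x. LINT y:Y|\<L>. G x y * of_real (\<theta> y))"
proof -
 obtain B where B: "\<forall>y\<in>Y. norm (\<theta> y) \<le> B" using continuous_bounded_on[OF c Y(2)] by blast
 have o: "open (\<Omega> \<times> Y)" "bounded (\<Omega> \<times> Y)" using \<Omega> Y by (auto intro: open_Times bounded_Times)
 have "continuous_on UNIV (\<lambda>z :: R3 \<times> R3. complex_of_real (\<theta> (snd z)))"
  using continuous_on_compose2[OF c continuous_on_snd[OF continuous_on_id]] by (intro continuous_on_of_real) auto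
 note m = continuous_lebesgue_measurable[OF this]
 have "set_integrable \<L> (\<Omega> \<times> Y) (\<lambda>z. (case z of (x, y) => G x y) * of_real (\<theta> (snd z)))"
  by (rule L2_times_bounded[OF G _ emeasure_bounded_open[OF o] m]) (use o B in auto)
 then have F: "integrable \<L> (\<lambda>z. indicator (\<Omega> \<times> Y) z *\<^sub>R (G (fst z) (snd z) * of_real (\<theta> (snd z))))"
  by (simp add: set_integrable_def case_prod_unfold)
 have e: "indicator (\<Omega> \<times> Y) (x, y) *\<^sub>R (G x y * of_real (\<theta> y)) = indicator \<Omega> x *\<^sub>R indicator Y y *\<^sub>R (G x y * of_real (\<theta> y))" for x y
  by (simp add: indicator_def)
 note s = lebesgue_slices[OF F, unfolded fst_conv snd_conv e]
 show "AE x\<in>\<Omega> in \<L>. set_integrable \<L> Y (\<lambda>y. G x y * of_real (\<theta> y))"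
  using s(1) by eventually_elim (auto simp: set_integrable_def)
 show "set_integrable \<L> \<Omega> (\<lambda>x. LINT y:Y|\<L>. G x y * of_real (\<theta> y))"
  using s(2) unfolding set_integrable_def set_lebesgue_integral_def by (simp only: integral_scaleR_right)
qed

lemma integrable_L1_loc:
 assumes "set_integrable \<L> U f" shows "L1_loc U f"
 unfolding L1_loc_def by (intro allI impI set_integrable_subset[OF assms]) (auto intro: fmeasurableD lmeasurable_compact)

lemma has_weak_pd_cnj:
 assumes w: "has_weak_pd U l f g" shows "has_weak_pd U l (\<lambda>x. cnj (f x)) (\<lambda>x. cnj (g x))"
proof -
 have i: "L1_loc U (\<lambda>x. cnj (p x))" if "L1_loc U p" for p
  unfolding L1_loc_def
 proof (intro allI impI)
  fix K assume "compact K \<and> K \<subseteq> U"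
  then have "integrable \<L> (\<lambda>x. indicator K x *\<^sub>R p x)" using that by (simp add: L1_loc_def set_integrable_def)
  from integrable_bounded_linear[OF bounded_linear_cnj this] show "set_integrable \<L> K (\<lambda>x. cnj (p x))"
   by (simp add: set_integrable_def)
 qed
 have c: "(LINT x:U|\<L>. cnj (p x)) = cnj (LINT x:U|\<L>. p x)" for p
  unfolding set_lebesgue_integral_def using Bochner_Integration.integral_cnj[of \<L> "\<lambda>x. indicator U x *\<^sub>R p x"] by simp
 have "(LINT x:U|\<L>. cnj (f x) * pd l t x) = - (LINT x:U|\<L>. cnj (g x) * t x)" if t: "test_fun U t" for t
 proof -
  have s: "smooth t" using t by (simp add: test_fun_def)
  have t': "test_fun U (\<lambda>x. cnj (t x))"
   using t smooth_linear[OF bounded_linear_cnj s] by (simp add: test_fun_def)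
  have "(LINT x:U|\<L>. cnj (f x) * pd l t x) = cnj (LINT x:U|\<L>. f x * pd l (\<lambda>x. cnj (t x)) x)"
   unfolding c[symmetric] by (simp add: pd_linear[OF bounded_linear_cnj s])
  also have "\<dots> = - (LINT x:U|\<L>. cnj (g x) * t x)"
   unfolding has_weak_pdD[OF w t'] using c[of "\<lambda>x. g x * cnj (t x)"] by simp
  finally show ?thesis .
 qed
 then show ?thesis using w i unfolding has_weak_pd_def pd_def[symmetric] by blast
qed

lemma L2_cnj: "L2 M S f ==> L2 M S (\<lambda>x. cnj (f x))"
proof -
 assume "L2 M S f"
 then have m: "(\<lambda>x. indicator S x *\<^sub>R f x) \<in> borel_measurable M" and i: "integrable M (\<lambda>x. indicator S x *\<^sub>R (norm (f x))\<^sup>2)"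
  by (auto simp: L2_defs)
 have "cnj \<in> borel_measurable borel" by (intro borel_measurable_continuous_onI linear_continuous_on bounded_linear_cnj)
 from measurable_compose[OF m this] show ?thesis using i by (simp add: L2_defs)
qed

lemma L2_AE_eq:
 fixes f g :: "R3 => complex"
 assumes g: "L2 \<L> S g" and e: "AE x\<in>S in \<L>. f x = g x" shows "L2 \<L> S f"
proof -
 have m: "(\<lambda>x. indicator S x *\<^sub>R g x) \<in> borel_measurable \<L>" and i: "integrable \<L> (\<lambda>x. indicator S x *\<^sub>R (norm (g x))\<^sup>2)"
  using g by (auto simp: L2_defs)
 have "(\<lambda>x. indicator S x *\<^sub>R f x) \<in> borel_measurable \<L>"
  by (rule borel_measurable_AE[OF m]) (use e in eventually_elim, auto simp: indicator_def)
 moreover have "integrable \<L> (\<lambda>x. indicator S x *\<^sub>R (norm (f x))\<^sup>2)"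
  by (rule integrable_AE[OF i]) (use e in eventually_elim, auto simp: indicator_def)
 ultimately show ?thesis by (simp add: L2_defs)
qed

lemma L2_0: "L2 M S (\<lambda>_. 0 :: complex)"
 by (simp add: L2_defs)

lemma L2_smooth:
 fixes f :: "R3 => real"
 assumes Y: "open Y" "bounded Y" and f: "smooth f" shows "L2 \<L> Y (\<lambda>y. complex_of_real (f y))"
proof -
 have c: "continuous_on UNIV (\<lambda>y. complex_of_real (f y))" by (intro continuous_on_of_real smooth_continuous f)
 obtain B where "\<forall>y\<in>Y. norm (complex_of_real (f y)) \<le> B" using continuous_bounded_on[OF c Y(2)] by blast
 then show ?thesis
  using Y(1) by (intro L2_bounded_fun[OF _ emeasure_bounded_open[OF Y] continuous_lebesgue_measurable[OF c]]) auto
qed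

lemma L2_sum:
 fixes f :: "'i => R3 => complex"
 assumes "finite I" "\<And>i. L2 \<L> S (f i)" shows "L2 \<L> S (\<lambda>x. \<Sum>i\<in>I. f i x)"
 using assms(1) by induction (simp_all add: L2_0 L2_add assms(2))

lemma has_weak_pd_smooth:
 assumes "open U" "smooth f" shows "has_weak_pd U l f (pd l f)"
 using has_weak_pd_two_phase[of U "{}" f f f l] assms by simp

lemma has_weak_pd_diff:
 assumes "has_weak_pd U l f g" "has_weak_pd U l f' g'"
 shows "has_weak_pd U l (\<lambda>x. f x - f' x) (\<lambda>x. g x - g' x)"
proof -
 have "pd l (\<lambda>_. - 1 :: complex) x = 0" for x using pd_eq[OF has_derivative_const] by blast
 then show ?thesis using has_weak_pd_add[OF assms(1) has_weak_pd_mult[OF assms(2) smooth_const[of "- 1"]]] by simp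
qed

lemma sum4_swap:
 fixes X :: "3 => 3 => 3 => 3 => complex"
 shows "(\<Sigma> i j k l. X i j k l) = (\<Sigma> k l i j. X i j k l)"
proof -
 have "(\<Sigma> i j k l. X i j k l) = (\<Sigma> i k j l. X i j k l)"
  by (rule sum.cong[OF refl], rule sum.swap)
 also have "\<dots> = (\<Sigma> k i j l. X i j k l)" by (rule sum.swap)
 also have "\<dots> = (\<Sigma> k i l j. X i j k l)"
  by (rule sum.cong[OF refl], rule sum.cong[OF refl], rule sum.swap)
 also have "\<dots> = (\<Sigma> k l i j. X i j k l)"
  by (rule sum.cong[OF refl], rule sum.swap)
 finally show ?thesis .
qed

text \<open>Radii restricted to reciprocals of integers, so that with centres in a countable dense
  set the family of cell test functions is countable.\<close>

definition pbump :: "nat => R3 => R3 => real" where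
 "pbump m q = periodize (bump (inverse (real (Suc m))) q)"

lemma periodize_bump: "r > 0 ==> smooth (periodize (bump r q))"
 by (rule smooth_periodize(1)[OF smooth_bump, of "r + norm q"]) (rule bump_outside)

lemma smooth_pbump: "smooth (pbump m q)" and periodic_pbump: "periodic (pbump m q)"
 unfolding pbump_def by (rule periodize_bump, simp) (rule periodic_periodize)

context periodic_domain begin

text \<open>Countably many translates of \<open>Y\<close> exhaust \<open>U\<close> up to a null set,
  so the exceptional sets of all translations can be united.\<close>

lemma AE_periodic_zero:
 assumes h: "ae_periodic U h" and z: "AE y\<in>Y in \<L>. h y = (0 :: complex)"
 shows "AE y\<in>U in \<L>. h y = 0"
proof -
 have "AE y in \<L>. \<forall>k\<in>lattice3. (y \<in> U --> h (y + - k) = h y) \<and> (y + - k \<in> Y --> h (y + - k) = 0)"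
  unfolding AE_ball_countable[OF countable_lattice]
 proof
  fix k assume "k \<in> lattice3"
  then have "- k \<in> lattice3" by (rule lattice_minus)
  then have "AE y\<in>U in \<L>. h (y + - k) = h y" using h unfolding ae_periodic_def by blast
  then show "AE y in \<L>. (y \<in> U --> h (y + - k) = h y) \<and> (y + - k \<in> Y --> h (y + - k) = 0)"
   using AE_shift[OF z, of "- k"] by eventually_elim blast
 qed
 then show ?thesis using AE_in_cells
 proof eventually_elim
  case (elim y)
  show ?case
  proof
   assume "y \<in> U"
   obtain k where k: "k \<in> lattice3" "y - k \<in> cell" using elim(2) by blast
   have "y + - k \<in> U" using \<open>y \<in> U\<close> Uper[OF lattice_minus[OF k(1)], of y] by simp
   then have "y + - k \<in> Y" using k(2) Ucell[of "y - k"] by simp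
   then show "h y = 0" using elim(1) k(1) \<open>y \<in> U\<close> by force
  qed
 qed
qed

lemma H1p_deriv:
 assumes "H1p Y f" "per_ext Y = U"
 shows "has_weak_pd U l f (weak_pd U l f)" "L2 \<L> Y (weak_pd U l f)" "ae_periodic U (weak_pd U l f)"
proof -
 obtain g where g: "has_weak_pd U l f g" "L2 \<L> Y g" using assms by (auto simp: H1p_def)
 show w: "has_weak_pd U l f (weak_pd U l f)" by (rule weak_pd_works[OF g(1)])
 have "AE y\<in>Y in \<L>. weak_pd U l f y = g y"
  using weak_pd_AE[OF openU g(1)] by eventually_elim (use YU in blast)
 from L2_AE_eq[OF g(2) this] show "L2 \<L> Y (weak_pd U l f)" .
 show "ae_periodic U (weak_pd U l f)" using weak_pd_ae_periodic[OF _ w] assms(1) by (simp add: H1p_def L2p_def)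
qed

end

context cell_geom begin

lemma domain_s: "periodic_domain Ys (per_ext Ys)" and domain_f: "periodic_domain Yf (per_ext Yf)"
 by (unfold_locales; use open_per open_Y sub_cell per_ext_cell per_ext_shift in blast)+

lemma boundaries: "graph_boundary (Ck 1) (per_ext Ys)" "graph_boundary (Ck 1) (per_ext Yf)"
 and connected_s: "connected (per_ext Ys)" and pos_s: "emeasure \<L> Ys > 0"
 using geometry by (auto simp: cell_geometry_def)

lemma Ys_nonempty: "Ys \<noteq> {}" using pos_s by auto

lemma pressure_zero:
 assumes p: "L2p Yf p" and D: "closure D = UNIV"
  and z: "\<And>m q l. q \<in> D ==> (LINT y:Yf|\<L>. p y * of_real (pd l (pbump m q) y)) = 0"
 shows "AE y\<in>Yf in \<L>. p y = 0"
proof -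
 interpret periodic_domain Yf "per_ext Yf" by (rule domain_f)
 have pp: "periodic p" "L2 \<L> Yf p" using p by (auto simp: L2p_def)
 have i: "set_integrable \<L> Yf p" by (rule L2_integrable[OF pp(2) boundedY setsY])
 \<comment> \<open>The hypothesis covers countably many bumps, whereas the gradient criterion needs
   every radius and centre. A periodised bump is itself a periodic Sobolev function, so
   \<open>global_density\<close> closes the gap.\<close>
 have all: "(LINT y:Yf|\<L>. p y * of_real (pd l (periodize (bump r q)) y)) = 0" if r: "r > 0" for r q l
 proof -
  \<comment> \<open>A vector field with a single nonzero component turns the divergence pairing into
    one partial derivative.\<close>
  let ?s = "\<lambda>j y. if j = l then p y else 0"
  let ?v = "\<lambda>y. complex_of_real (periodize (bump r q) y)" and ?h = "\<lambda>j y. complex_of_real (pd j (periodize (bump r q)) y)"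
  have sm: "smooth (periodize (bump r q))" by (rule periodize_bump[OF r])
  have sum: "(\<Sigma> j. LINT y:Yf|\<L>. ?s j y * g j y) = (LINT y:Yf|\<L>. p y * g l y)" for g
  proof -
   have "(LINT y:Yf|\<L>. ?s j y * g j y) = (if j = l then (LINT y:Yf|\<L>. p y * g l y) else 0)" for j by auto
   then show ?thesis by simp
  qed
  have "(\<Sigma> j. LINT y:Yf|\<L>. ?s j y * ?h j y) = 0"
  proof (rule global_density[OF boundaries(2) _ _ D])
   show "ae_periodic (per_ext Yf) (?s j)" for j using pp(1) by (auto simp: ae_periodic_def periodic_def)
   show "L2 \<L> Yf (?s j)" for j using pp(2) L2_0[of \<L> Yf] by (cases "j = l") simp_all
   show "(\<Sigma> j. LINT y:Yf|\<L>. ?s j y * of_real (pd j (periodize (bump (inverse (real (Suc m))) q)) y)) = 0" if "q \<in> D" for m q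
    unfolding sum using z[OF that, of l m] by (simp only: pbump_def)
   show "H1data ?v ?h"
    unfolding H1data_def
   proof (intro conjI allI)
    show "periodic ?v" using periodic_periodize[of "bump r q"] by (simp add: periodic_def)
    show "L2 \<L> Yf ?v" "L2 \<L> Yf (?h j)" for j by (intro L2_smooth openY boundedY sm smooth_pd)+
    show "has_weak_pd (per_ext Yf) j ?v (?h j)" for j
    proof -
     have "pd j ?v = ?h j" by (rule ext) (rule pd_of_real[OF sm])
     then show ?thesis using has_weak_pd_smooth[OF openU smooth_of_real[OF sm], of j] by simp
    qed
   qed
  qed
  then show ?thesis unfolding sum .
 qed
 define f where "f = (\<lambda>y. if y \<in> Yf then p y else 0)"
 have fi: "integrable \<L> f"
 proof -
  have "f = (\<lambda>y. indicator Yf y *\<^sub>R p y)" by (auto simp: f_def fun_eq_iff)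
  then show ?thesis using i by (simp add: set_integrable_def)
 qed
 have "set_integrable \<L> cell f"
  unfolding set_integrable_def by (rule integrable_mult_indicator[OF _ fi]) (use open_cell in auto)
 then have "\<exists>k. AE y\<in>cell in \<L>. f y = k"
 proof (rule zero_gradient_constant[OF open_cell convex_connected[OF convex_cell] integrable_L1_loc])
  \<comment> \<open>A bump supported in the open cell agrees there with its periodisation, so
    testing in the cell is testing with periodic functions.\<close>
  fix r q l assume r: "r > (0::real)" "cball q r \<subseteq> cell"
  have b: "pd l (periodize (bump r q)) y = pd l (bump r q) y" if "y \<in> cell" for y
  proof (rule pd_cong_open[OF open_cell that _ smooth_bump])
   show "periodize (bump r q) y = bump r q y" if "y \<in> cell" for y
    by (rule periodize_cell[OF _ that]) (rule bump_zero[OF r])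
  qed
  have "indicator cell y *\<^sub>R (f y * of_real (pd l (bump r q) y)) = indicator Yf y *\<^sub>R (p y * of_real (pd l (periodize (bump r q)) y))" for y
   using sub_cell(2) b[of y] by (cases "y \<in> Yf") (auto simp: f_def)
  then have "(LINT y:cell|\<L>. f y * of_real (pd l (bump r q) y)) = (LINT y:Yf|\<L>. p y * of_real (pd l (periodize (bump r q)) y))"
   by (simp only: set_lebesgue_integral_def)
  then show "(LINT y:cell|\<L>. f y * of_real (pd l (bump r q) y)) = 0" using all[OF r(1)] by simp
 qed
 then obtain k where k: "AE y\<in>cell in \<L>. f y = k" by blast
 have "AE y\<in>Ys in \<L>. f y = k" using k by eventually_elim (use sub_cell(1) in blast)
 from AE_ball_nonempty[OF this open_Y(1) Ys_nonempty] have "k = 0" using disj(1) by (auto simp: f_def split: if_splits)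
 from k show ?thesis by eventually_elim (use sub_cell(2) \<open>k = 0\<close> in \<open>auto simp: f_def\<close>)
qed

text \<open>The stress \<open>\<sigma> i\<close> is orthogonal to gradients of the countable family,
  hence by \<open>global_density\<close> to gradients of all periodic Sobolev functions; expanding
  the stress gives the weak equation. The 0 in the conclusion is the pressure.\<close>

lemma stress_local_solution:
 fixes d :: "3 => 3 => complex"
 assumes v: "H1p_mod Ys v" and G: "\<And>k l. has_weak_pd (per_ext Ys) l (\<lambda>y. v y $ k) (G k l)" and D: "closure D = UNIV"
  and z: "\<And>m q i. q \<in> D ==> (\<Sigma> j k l. of_real (a i j k l) *
   (LINT y:Ys|\<L>. (d k l + G k l y) * of_real (pd j (pbump m q) y))) = 0"
 shows "local_solution Ys a d 0 v"
proof -
 interpret periodic_domain Ys "per_ext Ys" by (rule domain_s)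
 have fin: "emeasure \<L> Ys < \<infinity>" by (rule emeasure_bounded_open[OF openY boundedY])
 have H: "H1p Ys (\<lambda>y. v y $ k)" for k using v by (auto simp: H1p_mod_def H1p_vec_def)
 have GY: "AE y\<in>Ys in \<L>. pdv (per_ext Ys) v k l y = G k l y" for k l
  unfolding pdv_def using weak_pd_AE[OF openU G[of l k]] by eventually_elim (use YU in blast)
 have LG: "L2 \<L> Ys (G k l)" for k l
  by (rule L2_AE_eq[OF H1p_deriv(2)[OF H[of k] refl, of l]]) (use GY[of k l] in \<open>eventually_elim, auto simp: pdv_def\<close>)
 have PG: "ae_periodic (per_ext Ys) (G k l)" for k l
  using weak_pd_ae_periodic[OF _ G[of l k]] H[of k] by (simp add: H1p_def L2p_def)
 have Lc: "L2 \<L> Ys (\<lambda>_. c :: complex)" for c by (rule L2_bounded_fun[OF setsY fin, of _ "norm c"]) auto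
 define \<sigma> where "\<sigma> = (\<lambda>i j y. \<Sigma> k l. (d k l + G k l y) * of_real (a i j k l))"
 have Ls: "L2 \<L> Ys (\<sigma> i j)" for i j
  unfolding \<sigma>_def by (intro L2_sum finite L2_mult_bounded[OF L2_add[OF Lc LG] continuous_on_const boundedY])
 have Ps: "ae_periodic (per_ext Ys) (\<sigma> i j)" for i j
  unfolding ae_periodic_def
 proof
  fix t assume t: "t \<in> lattice3"
  have "AE y in \<L>. \<forall>k. \<forall>l. y \<in> per_ext Ys --> G k l (y + t) = G k l y"
   unfolding AE_all_countable using PG t by (auto simp: ae_periodic_def)
  then show "AE y\<in>per_ext Ys in \<L>. \<sigma> i j (y + t) = \<sigma> i j y"
   by eventually_elim (simp add: \<sigma>_def)
 qed
 have sd: "(LINT y:Ys|\<L>. \<sigma> i j y * g y) = (\<Sigma> k l. of_real (a i j k l) * (LINT y:Ys|\<L>. (d k l + G k l y) * g y))"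
  if g: "L2 \<L> Ys g" for i j g
 proof -
  have I: "set_integrable \<L> Ys (\<lambda>y. of_real (a i j k l) * ((d k l + G k l y) * g y))" for k l
   by (intro set_integrable_mult_right L2_product[OF L2_add[OF Lc LG] g])
  have "\<sigma> i j y * g y = (\<Sigma> k l. of_real (a i j k l) * ((d k l + G k l y) * g y))" for y
   unfolding \<sigma>_def sum_distrib_right by (intro sum.cong refl) (simp only: mult_ac)
  then show ?thesis
   by (simp only: set_integral_sum'(2)[OF set_integral_sum'(1)[OF I]] set_integral_sum'(2)[OF I] set_integral_mult_right)
 qed
 have "q_form Ys a v w = - (\<Sigma> k l. d k l * (LINT y:Ys|\<L>. (\<Sigma> i j. 
   of_real (a i j k l) * cnj (pdv (per_ext Ys) w i j y))))" if w: "H1p_mod Ys w" for w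
 proof -
  \<comment> \<open>\<open>q_form\<close> is conjugate linear in \<open>w\<close> while the density
    statement is bilinear, so it is applied to the conjugate components.\<close>
  let ?h = "\<lambda>i j y. cnj (pdv (per_ext Ys) w i j y)"
  have Hw: "H1p Ys (\<lambda>y. w y $ i)" for i using w by (auto simp: H1p_mod_def H1p_vec_def)
  have Lh: "L2 \<L> Ys (?h i j)" for i j unfolding pdv_def by (intro L2_cnj H1p_deriv(2)[OF Hw refl])
  have Dh: "H1data (\<lambda>y. cnj (w y $ i)) (?h i)" for i
   unfolding H1data_def
  proof (intro conjI allI)
   show "periodic (\<lambda>y. cnj (w y $ i))" "L2 \<L> Ys (\<lambda>y. cnj (w y $ i))" using Hw[of i] by (auto simp: H1p_def L2p_def periodic_def intro: L2_cnj)
   show "L2 \<L> Ys (?h i j)" for j by (rule Lh)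
   show "has_weak_pd (per_ext Ys) j (\<lambda>y. cnj (w y $ i)) (?h i j)" for j
    unfolding pdv_def by (intro has_weak_pd_cnj H1p_deriv(1)[OF Hw refl])
  qed
  have Lr: "L2 \<L> Ys (\<lambda>y. complex_of_real (pd j (pbump m q) y))" for j m q
   by (intro L2_smooth openY boundedY smooth_pd smooth_pbump)
  have orth: "(\<Sigma> j. LINT y:Ys|\<L>. \<sigma> i j y * ?h i j y) = 0" for i
  proof (rule global_density[OF boundaries(1) Ps Ls D _ Dh])
   show "(\<Sigma> j. LINT y:Ys|\<L>. \<sigma> i j y * of_real (pd j (periodize (bump (inverse (real (Suc m))) q)) y)) = 0" if "q \<in> D" for m q
    using z[OF that, of i m] unfolding pbump_def[symmetric] sd[OF Lr] .
  qed
  define W where "W = (\<lambda>i j. LINT y:Ys|\<L>. ?h i j y)"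
  define Q where "Q = (\<lambda>i j k l. LINT y:Ys|\<L>. G k l y * ?h i j y)"
  have Wi: "set_integrable \<L> Ys (?h i j)" for i j by (rule L2_integrable[OF Lh boundedY setsY])
  have Qi: "set_integrable \<L> Ys (\<lambda>y. G k l y * ?h i j y)" for i j k l by (rule L2_product[OF LG Lh])
  have "(LINT y:Ys|\<L>. (d k l + G k l y) * ?h i j y) = d k l * W i j + Q i j k l" for i j k l
   unfolding distrib_right W_def Q_def using Wi Qi by (subst set_integral_add(2)) (auto intro: set_integrable_mult_right)
  then have "(\<Sigma> j k l. of_real (a i j k l) * (d k l * W i j + Q i j k l)) = 0" for i
   using orth[of i] unfolding sd[OF Lh] by simp
  then have "(\<Sigma> i j k l. of_real (a i j k l) * (d k l * W i j + Q i j k l)) = 0" by simp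
  then have s: "(\<Sigma> i j k l. of_real (a i j k l) * Q i j k l)
   = - (\<Sigma> i j k l. of_real (a i j k l) * (d k l * W i j))"
   unfolding distrib_left sum.distrib by (simp add: add_eq_0_iff)
  have "q_form Ys a v w = (LINT y:Ys|\<L>. (\<Sigma> i j k l. of_real (a i j k l) * (G k l y * ?h i j y)))"
   unfolding q_form_def
  proof (rule set_integral_AE_eq)
   have "AE y in \<L>. \<forall>k. \<forall>l. y \<in> Ys --> pdv (per_ext Ys) v k l y = G k l y" unfolding AE_all_countable using GY by blast
   then show "AE y\<in>Ys in \<L>. (\<Sigma> i j k l. of_real (a i j k l) * pdv (per_ext Ys) v k l y * ?h i j y)
    = (\<Sigma> i j k l. of_real (a i j k l) * (G k l y * ?h i j y))"
    by eventually_elim (simp add: mult.assoc)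
  qed
  also have "\<dots> = (\<Sigma> i j k l. of_real (a i j k l) * Q i j k l)"
  proof -
   have I: "set_integrable \<L> Ys (\<lambda>y. of_real (a i j k l) * (G k l y * ?h i j y))" for i j k l
    by (intro set_integrable_mult_right Qi)
   note I1 = set_integral_sum'(1)[OF I] note I2 = set_integral_sum'(1)[OF I1] note I3 = set_integral_sum'(1)[OF I2]
   show ?thesis unfolding Q_def
    by (simp only: set_integral_sum'(2)[OF I3] set_integral_sum'(2)[OF I2] set_integral_sum'(2)[OF I1] set_integral_sum'(2)[OF I] set_integral_mult_right)
  qed
  also have "\<dots> = - (\<Sigma> k l i j. of_real (a i j k l) * (d k l * W i j))"
   unfolding s by (rule arg_cong[where f = uminus], rule sum4_swap)
  also have "\<dots> = - (\<Sigma> k l. d k l * (LINT y:Ys|\<L>. (\<Sigma> i j. of_real (a i j k l) * ?h i j y)))"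
  proof -
   have I: "set_integrable \<L> Ys (\<lambda>y. of_real (a i j k l) * ?h i j y)" for i j k l
    by (intro set_integrable_mult_right Wi)
   note I1 = set_integral_sum'(1)[OF I]
   have "(LINT y:Ys|\<L>. (\<Sigma> i j. of_real (a i j k l) * ?h i j y)) = (\<Sigma> i j. of_real (a i j k l) * W i j)" for k l
    unfolding W_def by (simp only: set_integral_sum'(2)[OF I1] set_integral_sum'(2)[OF I] set_integral_mult_right)
   then show ?thesis by (simp only: sum_distrib_left mult.left_commute)
  qed
  finally show ?thesis .
 qed
 then show ?thesis unfolding local_solution_def using v by simp
qed

text \<open>Symmetrisation within each index pair replaces gradients by strains, and the symmetry
  between the pairs interchanges the roles of the two fields. Conjugation commutes with weak
  derivatives almost everywhere.\<close>

lemma q_form_strain: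
 assumes a: "elasticity_tensor a" and v: "H1p_vec Ys v" and w: "H1p_vec Ys w"
 shows "q_form Ys a v w = (LINT y:Ys|\<L>. (\<Sigma> i j k l. of_real (a i j k l) *
        strain (per_ext Ys) v i j y * strain (per_ext Ys) (cnj_field w) k l y))"
 unfolding q_form_def
proof (rule set_integral_AE_eq)
 interpret periodic_domain Ys "per_ext Ys" by (rule domain_s)
 let ?U = "per_ext Ys"
 have ex: "\<And>i j k l. a i j k l = a j i k l \<and> a i j k l = a i j l k" and maj: "\<And>i j k l. a i j k l = a k l i j"
  using a unfolding elasticity_tensor_def by blast+
 have "AE y\<in>?U in \<L>. pdv ?U (cnj_field w) i j y = cnj (pdv ?U w i j y)" for i j
  unfolding pdv_def cnj_field_def vec_lambda_beta
  by (rule weak_pd_AE[OF openU has_weak_pd_cnj[OF H1p_deriv(1)[OF _ refl]]]) (use w in \<open>simp add: H1p_vec_def\<close>)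
 then have "AE y in \<L>. \<forall>i. \<forall>j. y \<in> ?U --> pdv ?U (cnj_field w) i j y = cnj (pdv ?U w i j y)"
  unfolding AE_all_countable by blast
 then show "AE y\<in>Ys in \<L>. (\<Sigma> i j k l. of_real (a i j k l) * pdv ?U v k l y * cnj (pdv ?U w i j y))
  = (\<Sigma> i j k l. of_real (a i j k l) * strain ?U v i j y * strain ?U (cnj_field w) k l y)"
 proof eventually_elim
  case (elim y)
  show ?case
  proof
   assume "y \<in> Ys"
   then have c: "pdv ?U (cnj_field w) i j y = cnj (pdv ?U w i j y)" for i j using elim YU by blast
   have "(\<Sigma> i j k l. of_real (a i j k l) * pdv ?U v k l y * cnj (pdv ?U w i j y))
    = (\<Sigma> i j k l. of_real (a i j k l) * strain ?U v k l y * strain ?U (cnj_field w) i j y)"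
    unfolding strain_def c by (rule tensor_symmetrize[OF ex, symmetric])
   also have "\<dots> = (\<Sigma> k l i j. of_real (a i j k l) * strain ?U v k l y * strain ?U (cnj_field w) i j y)"
    by (rule sum4_swap)
   also have "\<dots> = (\<Sigma> i j k l. of_real (a i j k l) * strain ?U v i j y * strain ?U (cnj_field w) k l y)"
   proof (intro sum.cong refl)
    fix k l i j :: 3
    show "of_real (a i j k l) * strain ?U v k l y * strain ?U (cnj_field w) i j y = of_real (a k l i j) * strain ?U v k l y * strain ?U (cnj_field w) i j y"
     using maj[of i j k l] by simp
   qed
   finally show "(\<Sigma> i j k l. of_real (a i j k l) * pdv ?U v k l y * cnj (pdv ?U w i j y))
    = (\<Sigma> i j k l. of_real (a i j k l) * strain ?U v i j y * strain ?U (cnj_field w) k l y)" .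
  qed
 qed
qed

text \<open>The difference of two solutions is an admissible test field. Subtracting the two
  equations for it gives zero elastic energy, and coercivity of the tensor on symmetric matrices
  removes the strain.\<close>

lemma local_solution_unique:
 assumes a: "elasticity_tensor a" and v: "local_solution Ys a d p v" and w: "local_solution Ys a d p w"
 shows "AE y\<in>Ys in \<L>. v y = w y"
proof -
 interpret periodic_domain Ys "per_ext Ys" by (rule domain_s)
 let ?U = "per_ext Ys"
 define z where "z = (\<lambda>y. v y - w y)"
 have H: "H1p Ys (\<lambda>y. v y $ k)" "H1p Ys (\<lambda>y. w y $ k)" for k using v w by (auto simp: local_solution_def H1p_mod_def H1p_vec_def)
 have dz: "has_weak_pd ?U l (\<lambda>y. z y $ k) (\<lambda>y. pdv ?U v k l y - pdv ?U w k l y)" for k l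
  unfolding z_def pdv_def using has_weak_pd_diff[OF H1p_deriv(1)[OF H(1) refl] H1p_deriv(1)[OF H(2) refl]] by simp
 have Lz: "L2 \<L> Ys (\<lambda>y. pdv ?U v k l y - pdv ?U w k l y)" for k l
  unfolding pdv_def by (rule L2_diff[OF H1p_deriv(2)[OF H(1) refl] H1p_deriv(2)[OF H(2) refl]])
 have L: "L2 \<L> Ys (\<lambda>y. v y $ k)" "L2 \<L> Ys (\<lambda>y. w y $ k)" for k using H by (auto simp: H1p_def L2p_def)
 have zk: "L2 \<L> Ys (\<lambda>y. z y $ k)" for k using L2_diff[OF L] by (simp add: z_def)
 have Hz: "H1p Ys (\<lambda>y. z y $ k)" for k
  unfolding H1p_def L2p_def
 proof (intro conjI allI)
  show "periodic (\<lambda>y. z y $ k)" using H[of k] by (auto simp: H1p_def L2p_def periodic_def z_def)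
 qed (use zk dz Lz in blast)+
 have mean: "(LINT y:Ys|\<L>. z y $ k) = 0" for k
  using v w L2_integrable[OF L(1) boundedY setsY] L2_integrable[OF L(2) boundedY setsY]
  by (simp add: z_def local_solution_def H1p_mod_def set_integral_diff(2))
 then have Mz: "H1p_mod Ys z" unfolding H1p_mod_def H1p_vec_def using Hz by blast
 have q: "q_form Ys a v z = q_form Ys a w z" 
  using v[unfolded local_solution_def, THEN conjunct2, rule_format, OF Mz] w[unfolded local_solution_def, THEN conjunct2, rule_format, OF Mz]
  by (rule trans[OF _ sym])
 have ex: "\<And>i j k l. a i j k l = a j i k l \<and> a i j k l = a i j l k" using a unfolding elasticity_tensor_def by blast
 have LZ: "L2 \<L> Ys (pdv ?U z k l)" for k l unfolding pdv_def by (rule H1p_deriv(2)[OF Hz refl])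
 have Lv: "L2 \<L> Ys (pdv ?U v k l)" "L2 \<L> Ys (pdv ?U w k l)" for k l unfolding pdv_def by (rule H1p_deriv(2)[OF H(1) refl], rule H1p_deriv(2)[OF H(2) refl])
 have I: "set_integrable \<L> Ys (\<lambda>y. \<Sigma> i j k l. of_real (a i j k l) * b k l y * cnj (pdv ?U z i j y))"
  if "\<And>k l. L2 \<L> Ys (b k l)" for b
  unfolding mult.assoc by (intro set_integral_sum'(1) set_integrable_mult_right L2_product[OF that L2_cnj[OF LZ]])
 let ?E = "\<lambda>y. \<Sigma> i j k l. of_real (a i j k l) * pdv ?U z k l y * cnj (pdv ?U z i j y)"
 have "AE y\<in>?U in \<L>. pdv ?U z k l y = pdv ?U v k l y - pdv ?U w k l y" for k l
  unfolding pdv_def[of _ z] by (rule weak_pd_AE[OF openU dz])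
 then have dae: "AE y in \<L>. \<forall>k. \<forall>l. y \<in> ?U --> pdv ?U z k l y = pdv ?U v k l y - pdv ?U w k l y"
  unfolding AE_all_countable by blast
 have "(LINT y:Ys|\<L>. ?E y) = q_form Ys a v z - q_form Ys a w z"
  unfolding q_form_def set_integral_diff(2)[OF I[OF Lv(1)] I[OF Lv(2)], symmetric]
 proof (rule set_integral_AE_eq, use dae in eventually_elim, rule impI)
  fix y assume "\<forall>k l. y \<in> ?U --> pdv ?U z k l y = pdv ?U v k l y - pdv ?U w k l y" "y \<in> Ys"
  then have e: "pdv ?U z k l y = pdv ?U v k l y - pdv ?U w k l y" for k l using YU by blast
  have "?E y = (\<Sigma> i j k l. of_real (a i j k l) * pdv ?U v k l y * cnj (pdv ?U z i j y) - of_real (a i j k l) * pdv ?U w k l y * cnj (pdv ?U z i j y))"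
   by (intro sum.cong refl) (subst e, simp only: left_diff_distrib right_diff_distrib)
  then show "?E y = (\<Sigma> i j k l. of_real (a i j k l) * pdv ?U v k l y * cnj (pdv ?U z i j y)) -
   (\<Sigma> i j k l. of_real (a i j k l) * pdv ?U w k l y * cnj (pdv ?U z i j y))"
   by (simp only: sum_subtractf)
 qed
 then have E0: "(LINT y:Ys|\<L>. ?E y) = 0" using q by simp
 obtain t0 where t0: "t0 > 0" and tn: "\<And>\<xi> :: 3 => 3 => complex. (\<And>i j. \<xi> i j = \<xi> j i) ==> \<exists>t\<ge>t0 * (\<Sigma> i j. (norm (\<xi> i j))\<^sup>2).
  (\<Sigma> i j k l. of_real (a i j k l) * \<xi> k l * cnj (\<xi> i j)) = of_real t"
  using tensor_nonneg[OF a] by blast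
 have Et: "\<exists>t\<ge>t0 * (\<Sigma> i j. (norm (strain ?U z i j y))\<^sup>2). ?E y = of_real t" for y
 proof -
  have s: "strain ?U z i j y = strain ?U z j i y" for i j by (simp add: strain_def add.commute)
  have e: "(\<Sigma> i j k l. of_real (a i j k l) * strain ?U z k l y * cnj (strain ?U z i j y)) = ?E y"
   using tensor_symmetrize[OF ex, where A = "\<lambda>k l. pdv ?U z k l y" and B = "\<lambda>i j. cnj (pdv ?U z i j y)"] by (simp add: strain_def)
  show ?thesis using tn[of "\<lambda>i j. strain ?U z i j y", OF s] unfolding e .
 qed
 define t where "t = (\<lambda>y. Re (?E y))"
 have t: "t y \<ge> t0 * (\<Sigma> i j. (norm (strain ?U z i j y))\<^sup>2)" "?E y = of_real (t y)" for y
 proof -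
  obtain s where s: "s \<ge> t0 * (\<Sigma> i j. (norm (strain ?U z i j y))\<^sup>2)" "?E y = of_real s" using Et[of y] by blast
  have "t y = s" unfolding t_def s(2) by simp
  then show "t y \<ge> t0 * (\<Sigma> i j. (norm (strain ?U z i j y))\<^sup>2)" "?E y = of_real (t y)" using s by (simp_all only:)
 qed
 have tpos: "t y \<ge> 0" for y
 proof -
  have "0 \<le> t0 * (\<Sigma> i j. (norm (strain ?U z i j y))\<^sup>2)" using t0 by (intro mult_nonneg_nonneg sum_nonneg) auto
  then show ?thesis using t(1)[of y] by linarith
 qed
 have ti: "integrable \<L> (\<lambda>y. complex_of_real (indicator Ys y * t y))"
  using I[of "\<lambda>k l. pdv ?U z k l", OF LZ] unfolding t(2) set_integrable_def by (simp add: scaleR_conv_of_real)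
 have "complex_of_real (LINT y|\<L>. indicator Ys y * t y) = 0"
  using E0 unfolding t(2) set_lebesgue_integral_def by (simp add: scaleR_conv_of_real flip: of_real_mult)
 then have "(LINT y|\<L>. indicator Ys y * t y) = 0" by (simp only: of_real_eq_0_iff)
 then have "AE y in \<L>. indicator Ys y * t y = 0"
  using integral_nonneg_eq_0_iff_AE[of \<L> "\<lambda>y. indicator Ys y * t y"] ti tpos by (simp add: complex_of_real_integrable_eq del: of_real_mult)
 then have s0: "AE y\<in>Ys in \<L>. (\<forall>i j. strain ?U z i j y = 0)"
 proof eventually_elim
  case (elim y)
  show ?case
  proof
   assume "y \<in> Ys"
   then have "t0 * (\<Sigma> i j. (norm (strain ?U z i j y))\<^sup>2) \<le> 0" using elim t(1)[of y] by simp
   then have "(\<Sigma> i j. (norm (strain ?U z i j y))\<^sup>2) \<le> 0" using t0 by (simp add: mult_le_0_iff)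
   then have "(\<Sigma> i j. (norm (strain ?U z i j y))\<^sup>2) = 0" by (intro antisym sum_nonneg) auto
   then show "\<forall>i j. strain ?U z i j y = 0" by (simp add: sum_nonneg_eq_0_iff sum_nonneg)
  qed
 qed
 \<comment> \<open>The energy controls the strain inside the cell only. Rigidity is applied on the
   connected periodic extension, to which the identity is carried by periodicity of the
   derivatives.\<close>
 have sym: "AE y\<in>?U in \<L>. pdv ?U z i j y + pdv ?U z j i y = 0" for i j
 proof (rule AE_periodic_zero)
  show "AE y\<in>Ys in \<L>. pdv ?U z i j y + pdv ?U z j i y = 0"
   using s0 by eventually_elim (auto simp: strain_def)
  have "ae_periodic ?U (pdv ?U z i j)" "ae_periodic ?U (pdv ?U z j i)" unfolding pdv_def by (rule H1p_deriv(3)[OF Hz refl])+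
  then show "ae_periodic ?U (\<lambda>y. pdv ?U z i j y + pdv ?U z j i y)"
   unfolding ae_periodic_def
  proof (intro ballI)
   fix k assume "k \<in> lattice3" "\<forall>k\<in>lattice3. AE y\<in>?U in \<L>. pdv ?U z i j (y + k) = pdv ?U z i j y"
    "\<forall>k\<in>lattice3. AE y\<in>?U in \<L>. pdv ?U z j i (y + k) = pdv ?U z j i y"
   then have "AE y\<in>?U in \<L>. pdv ?U z i j (y + k) = pdv ?U z i j y" "AE y\<in>?U in \<L>. pdv ?U z j i (y + k) = pdv ?U z j i y" by blast+
   then show "AE y\<in>?U in \<L>. pdv ?U z i j (y + k) + pdv ?U z j i (y + k) = pdv ?U z i j y + pdv ?U z j i y"
    by eventually_elim simp
  qed
 qed
 have "AE y\<in>Ys in \<L>. z y $ i = 0" for i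
 proof -
  have "\<exists>c. AE y\<in>?U in \<L>. z y $ i = c"
  proof (rule rigid_displacement[OF connected_s Ys_nonempty])
   show "periodic (\<lambda>y. z y $ i)" for i using Hz[of i] by (simp add: H1p_def L2p_def)
   show "has_weak_pd ?U j (\<lambda>y. z y $ i) (pdv ?U z i j)" for i j unfolding pdv_def by (rule H1p_deriv(1)[OF Hz refl])
  qed (rule sym)
  then obtain c where c: "AE y\<in>?U in \<L>. z y $ i = c" by blast
  then have cY: "AE y\<in>Ys in \<L>. z y $ i = c" by eventually_elim (use YU in blast)
  have "(LINT y:Ys|\<L>. z y $ i) = (LINT y:Ys|\<L>. c)" by (rule set_integral_AE_eq[OF cY])
  also have "\<dots> = measure \<L> Ys *\<^sub>R c"
   using setsY emeasure_bounded_open[OF openY boundedY] by (simp add: set_lebesgue_integral_def integrable_indicator_iff)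
  finally have "measure \<L> Ys *\<^sub>R c = 0" using mean[of i] by simp
  moreover have "measure \<L> Ys > 0"
   using pos_s emeasure_bounded_open[OF openY boundedY] unfolding measure_def by (simp add: enn2real_positive_iff)
  ultimately have "c = 0" by simp
  with cY show ?thesis by simp
 qed
 then have "AE y in \<L>. \<forall>i. y \<in> Ys --> z y $ i = 0" unfolding AE_all_countable by blast
 then show ?thesis by eventually_elim (auto simp: z_def vec_eq_iff)
qed

end

theorem theorem7p1:
  fixes Ys Yf Gam \<Omega> :: "R3 set"
    and a :: "3 \<Rightarrow> 3 \<Rightarrow> 3 \<Rightarrow> 3 \<Rightarrow> real"
    and \<mu> \<eta> \<rho>s \<rho>f c0 \<gamma> \<alpha> K m r lam0 :: real
    and lam :: complex
    and f :: "real \<Rightarrow> R3 \<Rightarrow> C3"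
    and eps :: "nat \<Rightarrow> real"
    and uh :: "nat \<Rightarrow> R3 \<Rightarrow> C3"
    and u :: "R3 \<Rightarrow> C3"
    and w0 u1 ur :: "R3 \<Rightarrow> R3 \<Rightarrow> C3"
    and p0 :: "R3 \<Rightarrow> R3 \<Rightarrow> complex"
    and Us Uf S :: "nat \<Rightarrow> R3 set"
  assumes geometry: "cell_geometry Ys Yf Gam"
    and Omega: "open \<Omega>" "bounded \<Omega>" "graph_boundary smooth \<Omega>"
    and eps: "\<And>n. eps n > 0" "eps \<longlonglongrightarrow> 0"
    and Us: "\<And>n. Us n = phase \<Omega> Ys (eps n)" "\<And>n. connected (Us n)"
    and Uf: "\<And>n. Uf n = phase \<Omega> Yf (eps n)"
    and S: "\<And>n. S n = interface \<Omega> Gam (eps n)"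
    and tensor: "elasticity_tensor a"
    and coefficients: "\<mu> > 0" "\<eta> / \<mu> > - 2 / 3" "\<rho>s > 0" "\<rho>f > 0" "c0 > 0"
      "\<gamma> = c0\<^sup>2 * \<rho>f" "\<alpha> > 0"
    and force: "\<And>s t. 0 < s \<Longrightarrow> s \<le> t \<Longrightarrow> L2 lebesgue ({s..t} \<times> \<Omega>) (\<lambda>(t, x). f t x)"
      "K > 0"
      "AE t in lebesgue. t > 0 \<longrightarrow> (LINT x:\<Omega>|lebesgue. (norm (f t x))\<^sup>2) \<le> K * exp (m * t)"
    and lam: "Re lam \<ge> lam0" "lam0 > r" "r > max 0 (m / 2)"
    and solution: "\<And>n. eps_solution \<Omega> (Us n) (Uf n) (S n) a \<mu> \<eta> \<rho>s \<rho>f \<gamma> \<alpha> (eps n) lam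
                          (laplace f lam) (uh n)"
    and limit_spaces:
      "\<And>k. L2_H1p \<Omega> (Ys \<union> Yf) (\<lambda>x y. w0 x y $ k)"
      "\<And>k. H10 \<Omega> (\<lambda>x. u x $ k)"
      "\<And>k. L2_H1p \<Omega> Ys (\<lambda>x y. u1 x y $ k)"
      "AE x in lebesgue. x \<in> \<Omega> \<longrightarrow> H1p_mod Ys (u1 x)"
      "L2_L2p \<Omega> Yf p0"
    and decomposition:
      "AE x in lebesgue. x \<in> \<Omega> \<longrightarrow>
         (AE y in lebesgue. y \<in> per_ext (Ys \<union> Yf) \<longrightarrow> w0 x y = u x + ur x y)"
      "AE x in lebesgue. x \<in> \<Omega> \<longrightarrow> (AE y in lebesgue. y \<in> Ys \<longrightarrow> ur x y = 0)"
      "AE x in lebesgue. x \<in> \<Omega> \<longrightarrow>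
         (AE y in lebesgue. y \<in> Ys \<union> Yf \<longrightarrow> dvg (per_ext (Ys \<union> Yf)) (ur x) y = 0)"
    and two_scale_u:
      "\<And>\<psi> \<phi> k. L2p cell \<psi> \<Longrightarrow> continuous_on (closure \<Omega>) \<phi> \<Longrightarrow>
         (\<lambda>n. LINT x:\<Omega>|lebesgue. uh n x $ k * \<psi> ((1 / eps n) *\<^sub>R x) * \<phi> x)
           \<longlonglongrightarrow> (LINT x:\<Omega>|lebesgue. LINT y:cell|lebesgue. w0 x y $ k * \<psi> y * \<phi> x)"
    and two_scale_grad:
      "\<And>\<psi> \<phi> k l. L2p cell \<psi> \<Longrightarrow> continuous_on (closure \<Omega>) \<phi> \<Longrightarrow>
         (\<lambda>n. LINT x:\<Omega>|lebesgue. of_real (eps n) * pdv (Uf n \<union> Us n) (uh n) k l x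
                * \<psi> ((1 / eps n) *\<^sub>R x) * \<phi> x)
           \<longlonglongrightarrow> (LINT x:\<Omega>|lebesgue. LINT y:cell|lebesgue.
                  pdv (per_ext (Ys \<union> Yf)) (w0 x) k l y * \<psi> y * \<phi> x)"
    and two_scale_solid:
      "\<And>\<psi> \<phi> k l. L2p cell \<psi> \<Longrightarrow> continuous_on (closure \<Omega>) \<phi> \<Longrightarrow>
         (\<lambda>n. LINT x:Us n|lebesgue. pdv (Uf n \<union> Us n) (uh n) k l x
                * \<psi> ((1 / eps n) *\<^sub>R x) * \<phi> x)
           \<longlonglongrightarrow> (LINT x:\<Omega>|lebesgue. LINT y:Ys|lebesgue.
                  (pdv \<Omega> u k l x + pdv (per_ext Ys) (u1 x) k l y) * \<psi> y * \<phi> x)"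
    and two_scale_pressure:
      "\<And>\<psi> \<phi>. L2p cell \<psi> \<Longrightarrow> continuous_on (closure \<Omega>) \<phi> \<Longrightarrow>
         (\<lambda>n. LINT x:Uf n|lebesgue. (- of_real \<gamma> * dvg (Uf n \<union> Us n) (uh n) x)
                * \<psi> ((1 / eps n) *\<^sub>R x) * \<phi> x)
           \<longlonglongrightarrow> (LINT x:\<Omega>|lebesgue. LINT y:Yf|lebesgue. p0 x y * \<psi> y * \<phi> x)"
  shows "(\<exists>P :: R3 \<Rightarrow> complex. L2 lebesgue \<Omega> P \<and>
            (AE x in lebesgue. x \<in> \<Omega> \<longrightarrow> (AE y in lebesgue. y \<in> Yf \<longrightarrow> p0 x y = P x)) \<and>
            (AE x in lebesgue. x \<in> \<Omega> \<longrightarrow>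
               local_solution Ys a (\<lambda>k l. pdv \<Omega> u k l x) (P x) (u1 x) \<and>
               (\<forall>v. local_solution Ys a (\<lambda>k l. pdv \<Omega> u k l x) (P x) v \<longrightarrow>
                  (AE y in lebesgue. y \<in> Ys \<longrightarrow> v y = u1 x y)))) \<and>
         (\<forall>v w. H1p_vec Ys v \<longrightarrow> H1p_vec Ys w \<longrightarrow>
            q_form Ys a v w = (LINT y:Ys|lebesgue.
              (\<Sum>i\<in>UNIV. \<Sum>j\<in>UNIV. \<Sum>k\<in>UNIV. \<Sum>l\<in>UNIV. of_real (a i j k l) *
                 strain (per_ext Ys) v i j y * strain (per_ext Ys) (cnj_field w) k l y)))"
proof -
 interpret cell_geom Ys Yf Gam by unfold_locales (rule geometry)
 define L0 where "L0 = (\<lambda>k \<psi> \<phi>. LINT x:\<Omega>|\<L>. LINT y:cell|\<L>. w0 x y $ k * \<psi> y * \<phi> x)"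
 define L1 where "L1 = (\<lambda>k l \<psi> \<phi>. LINT x:\<Omega>|\<L>. LINT y:cell|\<L>. pdv (per_ext (Ys \<union> Yf)) (w0 x) k l y * \<psi> y * \<phi> x)"
 define Ls where "Ls = (\<lambda>k l \<psi> \<phi>. LINT x:\<Omega>|\<L>. LINT y:Ys|\<L>. (pdv \<Omega> u k l x + pdv (per_ext Ys) (u1 x) k l y) * \<psi> y * \<phi> x)"
 define Lp where "Lp = (\<lambda>\<psi> \<phi>. LINT x:\<Omega>|\<L>. LINT y:Yf|\<L>. p0 x y * \<psi> y * \<phi> x)"
 have hom: "homogenization Ys Yf Gam \<Omega> a \<mu> \<eta> \<rho>s \<rho>f \<gamma> \<alpha> lam (laplace f lam) eps uh L0 L1 Ls Lp"
 proof (unfold_locales, unfold L0_def L1_def Ls_def Lp_def)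
  show "\<gamma> \<ge> 0" using coefficients by simp
  show "Re lam > 0" using lam by simp
  show "L2 \<L> \<Omega> (\<lambda>x. laplace f lam x $ i)" for i
   by (rule laplace_L2[where K = K and m = m and r = r, OF Omega(1,2) force(1) force(3,2)]) (use lam in auto)
 qed (fact Omega eps tensor coefficients solution[unfolded Us(1) Uf S] two_scale_u two_scale_grad[unfolded Us(1) Uf] two_scale_solid[unfolded Us(1) Uf] two_scale_pressure[unfolded Us(1) Uf])+
 interpret Ps: periodic_domain Ys "per_ext Ys" by (rule domain_s)
 interpret Pf: periodic_domain Yf "per_ext Yf" by (rule domain_f)
 obtain D :: "R3 set" where D: "countable D" "\<And>X. open X ==> X \<noteq> {} ==> \<exists>d\<in>D. d \<in> X"
  using countable_dense_setE by blast
 have D': "closure D = UNIV"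
 proof -
  have "x \<in> closure D" for x
  proof (rule ccontr)
   assume "x \<notin> closure D"
   then obtain d where "d \<in> D" "d \<in> - closure D" using D(2)[of "- closure D"] by auto
   then show False using closure_subset by blast
  qed
  then show ?thesis by blast
 qed
 note pb = smooth_pbump smooth_pd[OF smooth_pbump] smooth_continuous[OF smooth_pd[OF smooth_pbump]]

 \<comment> \<open>For a fixed cell function the macroscopic factor ranges over bumps in
   \<open>\<Omega>\<close>, and the fundamental lemma localises the limit equation in
   \<open>x\<close>.\<close>
 have "AE x\<in>\<Omega> in \<L>. (LINT y:Yf|\<L>. p0 x y * of_real (pd i (pbump m q) y)) = 0" for m q i
 proof (rule fundamental_lemma[OF Omega(1)])
  let ?I = "\<lambda>x. LINT y:Yf|\<L>. p0 x y * of_real (pd i (pbump m q) y)"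
  show "L1_loc \<Omega> ?I"
   by (rule integrable_L1_loc, rule slices(2)[OF Omega(1,2) open_Y(2) Pf.boundedY _ pb(3)]) (use limit_spaces(5) in \<open>simp add: L2_L2p_def\<close>)
  fix r q' assume r: "r > (0::real)" "cball q' r \<subseteq> \<Omega>"
  have "Lp (\<lambda>y. of_real (pd i (pbump m q) y)) (\<lambda>x. of_real (bump r q' x)) = 0"
   by (rule homogenization.fluid_limit[OF hom pb(1) smooth_bump periodic_pbump compact_cball r(2)]) (use r(1) in \<open>auto simp: bump_0_iff dist_commute\<close>)
  then show "(LINT x:\<Omega>|\<L>. ?I x * of_real (bump r q' x)) = 0" unfolding Lp_def by simp
 qed
 then have "AE x in \<L>. \<forall>q\<in>D. \<forall>m. \<forall>i. x \<in> \<Omega> --> (LINT y:Yf|\<L>. p0 x y * of_real (pd i (pbump m q) y)) = 0"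
  unfolding AE_ball_countable[OF D(1)] AE_all_countable by blast
 moreover have "AE x\<in>\<Omega> in \<L>. L2p Yf (p0 x)" using limit_spaces(5) by (simp add: L2_L2p_def)
 ultimately have p0: "AE x\<in>\<Omega> in \<L>. (AE y\<in>Yf in \<L>. p0 x y = 0)"
 proof eventually_elim
  case (elim x)
  show ?case
  proof
   assume x: "x \<in> \<Omega>"
   show "AE y\<in>Yf in \<L>. p0 x y = 0"
    by (rule pressure_zero[OF _ D']) (use elim x in auto)
  qed
 qed

 \<comment> \<open>\<open>weak_pd\<close> selects a derivative of \<open>u1 x\<close> separately for
   each \<open>x\<close>, which gives no measurability in both variables. The jointly measurable
   derivatives provided by \<open>L2_H1p\<close> are used for integration and agree with it almost
   everywhere.\<close>
 have ex: "\<exists>G. L2 \<L> (\<Omega> \<times> Ys) (\<lambda>(x, y). G x y) \<and> (AE x\<in>\<Omega> in \<L>. has_weak_pd (per_ext Ys) l (\<lambda>y. u1 x y $ k) (G x))" for k l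
  using limit_spaces(3)[of k] unfolding L2_H1p_def by blast
 define G where "G = (\<lambda>k l. SOME G. L2 \<L> (\<Omega> \<times> Ys) (\<lambda>(x, y). G x y) \<and> (AE x\<in>\<Omega> in \<L>. has_weak_pd (per_ext Ys) l (\<lambda>y. u1 x y $ k) (G x)))"
 have G: "L2 \<L> (\<Omega> \<times> Ys) (\<lambda>(x, y). G k l x y)"
  "AE x\<in>\<Omega> in \<L>. has_weak_pd (per_ext Ys) l (\<lambda>y. u1 x y $ k) (G k l x)" for k l
  using someI_ex[OF ex[of l k]] unfolding G_def by blast+
 have Du: "set_integrable \<L> \<Omega> (pdv \<Omega> u k l)" for k l
 proof -
  have "H1 \<Omega> (\<lambda>x. u x $ k)" using limit_spaces(2)[of k] by (auto simp: H10_def H1_tendsto_def)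
  then obtain g where g: "has_weak_pd \<Omega> l (\<lambda>x. u x $ k) g" "L2 \<L> \<Omega> g" by (auto simp: H1_def)
  have "set_integrable \<L> \<Omega> g" by (rule L2_integrable[OF g(2) Omega(2)]) (use Omega(1) in auto)
  from set_integrable_AE_eq[OF this weak_pd_AE[OF Omega(1) g(1)]] show ?thesis unfolding pdv_def .
 qed
 \<comment> \<open>The same localisation for the stress. Splitting off the part with
   \<open>pdv \<Omega> u k l x\<close>, which is constant in \<open>y\<close>, shows that the
   bracket is integrable in \<open>x\<close>.\<close>
 have "AE x\<in>\<Omega> in \<L>. (\<Sigma> j k l. of_real (a i j k l) *
   (LINT y:Ys|\<L>. (pdv \<Omega> u k l x + G k l x y) * of_real (pd j (pbump m q) y))) = 0" for m q i
 proof (rule fundamental_lemma[OF Omega(1)])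
  let ?t = "\<lambda>j y. complex_of_real (pd j (pbump m q) y)"
  let ?I = "\<lambda>j k l x. LINT y:Ys|\<L>. (pdv \<Omega> u k l x + G k l x y) * ?t j y"
  have ti: "set_integrable \<L> Ys (?t j)" for j
   by (rule L2_integrable[OF L2_smooth[OF open_Y(1) Ps.boundedY pb(2)] Ps.boundedY Ps.setsY])
  have ae: "AE x\<in>\<Omega> in \<L>. ?I j k l x = pdv \<Omega> u k l x * (LINT y:Ys|\<L>. ?t j y) + (LINT y:Ys|\<L>. G k l x y * ?t j y)" for j k l
   using slices(1)[OF Omega(1,2) open_Y(1) Ps.boundedY G(1)[of k l] pb(3)[of j m q]]
  proof eventually_elim
   case (elim x)
   show ?case
    unfolding distrib_right using elim ti by (auto simp: set_integral_add(2))
  qed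
  have I: "set_integrable \<L> \<Omega> (?I j k l)" for j k l
   by (rule set_integrable_AE_eq[OF _ ae])
    (intro set_integral_add(1) set_integrable_mult_left Du slices(2)[OF Omega(1,2) open_Y(1) Ps.boundedY G(1) pb(3)])
  show "L1_loc \<Omega> (\<lambda>x. \<Sigma> j k l. of_real (a i j k l) * ?I j k l x)"
   by (intro integrable_L1_loc set_integral_sum'(1) set_integrable_mult_right I)
  fix r q' assume r: "r > (0::real)" "cball q' r \<subseteq> \<Omega>"
  let ?b = "\<lambda>x. complex_of_real (bump r q' x)"
  have Ib: "set_integrable \<L> \<Omega> (\<lambda>x. of_real (a i j k l) * (?I j k l x * ?b x))" for j k l
   by (intro set_integrable_mult_right set_integrable_mult_continuous[OF I _ Omega(2)] continuous_on_of_real smooth_continuous smooth_bump)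
  have "(\<Sigma> j k l. of_real (a i j k l) * Ls k l (?t j) ?b) = 0"
   by (rule homogenization.solid_limit[OF hom pb(1) smooth_bump periodic_pbump compact_cball r(2)]) (use r(1) in \<open>auto simp: bump_0_iff dist_commute\<close>)
  moreover have "Ls k l (?t j) ?b = (LINT x:\<Omega>|\<L>. ?I j k l x * ?b x)" for j k l
   unfolding Ls_def
  proof (rule set_integral_AE_eq, use G(2)[of l k] in eventually_elim, rule impI)
   fix x assume "x \<in> \<Omega> --> has_weak_pd (per_ext Ys) l (\<lambda>y. u1 x y $ k) (G k l x)" "x \<in> \<Omega>"
   then have pG: "AE y\<in>per_ext Ys in \<L>. pdv (per_ext Ys) (u1 x) k l y = G k l x y"
    unfolding pdv_def using weak_pd_AE[OF open_per(1)] by blast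
   have "(LINT y:Ys|\<L>. (pdv \<Omega> u k l x + pdv (per_ext Ys) (u1 x) k l y) * ?t j y * ?b x) = (LINT y:Ys|\<L>. (pdv \<Omega> u k l x + G k l x y) * ?t j y * ?b x)"
    by (rule set_integral_AE_eq, use pG in eventually_elim) (use Ps.YU in auto)
   then show "(LINT y:Ys|\<L>. (pdv \<Omega> u k l x + pdv (per_ext Ys) (u1 x) k l y) * ?t j y * ?b x) = ?I j k l x * ?b x"
    by (simp only: set_integral_mult_left)
  qed
  moreover have "(LINT x:\<Omega>|\<L>. (\<Sigma> j k l. of_real (a i j k l) * ?I j k l x) * ?b x)
   = (\<Sigma> j k l. of_real (a i j k l) * (LINT x:\<Omega>|\<L>. ?I j k l x * ?b x))"
   unfolding sum_distrib_right mult.assoc[of "of_real _"]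
   by (simp only: set_integral_sum'(2)[OF set_integral_sum'(1)[OF set_integral_sum'(1)[OF Ib]]] set_integral_sum'(2)[OF set_integral_sum'(1)[OF Ib]] set_integral_sum'(2)[OF Ib] set_integral_mult_right)
  ultimately show "(LINT x:\<Omega>|\<L>. (\<Sigma> j k l. of_real (a i j k l) * ?I j k l x) * ?b x) = 0"
   by (simp only:)
 qed
 then have "AE x in \<L>. \<forall>q\<in>D. \<forall>m. \<forall>i. x \<in> \<Omega> --> (\<Sigma> j k l. of_real (a i j k l) *
   (LINT y:Ys|\<L>. (pdv \<Omega> u k l x + G k l x y) * of_real (pd j (pbump m q) y))) = 0"
  unfolding AE_ball_countable[OF D(1)] AE_all_countable by blast
 moreover have "AE x in \<L>. \<forall>k. \<forall>l. x \<in> \<Omega> --> has_weak_pd (per_ext Ys) l (\<lambda>y. u1 x y $ k) (G k l x)"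
  unfolding AE_all_countable using G(2) by blast
 ultimately have loc: "AE x\<in>\<Omega> in \<L>. local_solution Ys a (\<lambda>k l. pdv \<Omega> u k l x) 0 (u1 x)"
  using limit_spaces(4)
 proof eventually_elim
  case (elim x)
  show ?case
  proof
   assume x: "x \<in> \<Omega>"
   have 1: "H1p_mod Ys (u1 x)" "\<And>k l. has_weak_pd (per_ext Ys) l (\<lambda>y. u1 x y $ k) (G k l x)" using elim x by blast+
   show "local_solution Ys a (\<lambda>k l. pdv \<Omega> u k l x) 0 (u1 x)"
    by (rule stress_local_solution[OF 1 D']) (use elim(1) x in blast)
  qed
 qed
 have "AE x\<in>\<Omega> in \<L>. local_solution Ys a (\<lambda>k l. pdv \<Omega> u k l x) 0 (u1 x) \<and>
   (\<forall>v. local_solution Ys a (\<lambda>k l. pdv \<Omega> u k l x) 0 v --> (AE y\<in>Ys in \<L>. v y = u1 x y))"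
  using loc by eventually_elim (use local_solution_unique[OF tensor] in blast)
 then show ?thesis
  using p0 L2_0 q_form_strain[OF tensor] by (intro conjI exI[of _ "\<lambda>_. 0"]) simp_all
qed

end
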